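(* Let $\mathcal C$ be a dg category over a field, let $\Delta$ be its diagonal bimodule, and let $G_{12}$ be a weakly product bimodule in $\mathcal C^{op}\otimes\mathcal C$. Let $G_2\in\mathcal C$ be an object such that $\Phi_{G_{12}}(F)\in \mathrm{ads}(G_2)$ for all $F\in\mathcal C$. Suppose that the generation time of $\Delta$ by $G_{12}$ is $k$ (with $k$ a finite natural number). Then the generation time of $\mathcal C$ by $G_2$ is at most $k$. In particular, $\mathrm{Rdim}(\mathcal C)\le k$.
   Context: All functors are derived. For a dg category $\mathcal C$ over a field $\mathbf k$, $\mathrm{Perf}(\mathcal C)$ is the idempotent-completed pre-triangulated closure of $\mathcal C$; we do not distinguish between $\mathcal C$ and $\mathrm{Perf}(\mathcal C)$, nor between $\mathcal C^{op}\otimes\mathcal C$ and $\mathrm{Perf}(\mathcal C^{op}\otimes\mathcal C)$, when speaking of objects (so "$F\in\mathcal C$" means $F\in \mathrm{Perf}(\mathcal C)$). An object $G$ also denotes the full subcategory on that object. Generation. For full subcategories $\mathcal G_1,\mathcal G_2$, let $\mathcal G_1*\mathcal G_2$ be the full subcategory of objects of the form $\mathrm{cone}(G_1\to G_2)$ with $G_1\in\mathcal G_1$, $G_2\in\mathcal G_2$. Let $\langle\mathcal G\rangle$ be the smallest full subcategory containing $\mathcal G$ and closed under quasi-isomorphisms, direct summands, shifts and finite direct sums. Put $\langle\mathcal G\rangle_0=0$ and $\langle\mathcal G\rangle_k=\langle\langle\mathcal G\rangle_{k-1}*\langle\mathcal G\rangle\rangle$. The generation time of a class of objects $\mathcal E$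 by $\mathcal G$ is $\min(\{k\in\mathbb N : \mathcal E\subset\langle\mathcal G\rangle_{k+1}\}\cup\{+\infty\})$, where $0\in\mathbb N$. The Rouquier dimension $\mathrm{Rdim}(\mathcal C)$ is the minimum, over all objects $G\in\mathrm{Perf}(\mathcal C)$, of the generation time of $\mathcal C$ by $G$ (and $+\infty$ if no such time is finite). Let $\mathrm{ads}(\mathcal G)$ be the smallest full subcategory containing $\mathcal G$ and closed under (possibly infinite) direct sums, direct summands and shifts; it is formed in the derived category of all $\mathcal C$-modules, which contains $\mathrm{Perf}(\mathcal C)$. Bimodules. For $K\in\mathcal C^{op}\otimes\mathcal C$ the convolution functor is $\Phi_K(F)=K\otimes_{\mathcal C}F$ (with values in $\mathcal C$-modules). The diagonal bimodule is $\Delta(F_1,F_2)=\mathrm{Hom}^\bullet(F_1,F_2)$; it satisfies $\Phi_\Delta(F)\cong F$. An object $G_{12}\in\mathcal C^{op}\otimes\mathcal C$ is a weakly product bimodule if there exists an object $G_2\in\mathcal C$ such that $\Phi_{G_{12}}(F)\in\mathrm{ads}(G_2)$ for all $F\in\mathcal C$. *)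

theory Defs
  imports Complex_Main "HOL-Library.Poly_Mapping" "HOL-Library.Extended_Nat"
begin

section \<open>Vector spaces\<close>

text \<open>
  All vector spaces over the field \<open>'k\<close> are subspaces of some \<open>'b \<Rightarrow>\<^sub>0 'k\<close>, the vector space with
  basis \<open>'b\<close>. As every vector space has a basis, this is no restriction as long as \<open>'b\<close>
  is arbitrary (for the morphism spaces of a dg category) or large enough (for dg modules).
\<close>

definition kscale :: "'k::field \<Rightarrow> ('b \<Rightarrow>\<^sub>0 'k) \<Rightarrow> ('b \<Rightarrow>\<^sub>0 'k)" where
  "kscale c = Poly_Mapping.map ((*) c)"

lemma lookup_kscale [simp]: "Poly_Mapping.lookup (kscale c v) b = c * Poly_Mapping.lookup v b"
  unfolding kscale_def by (simp add: Poly_Mapping.map.rep_eq when_def)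

global_interpretation kvec: vector_space kscale
  by unfold_locales (rule poly_mapping_eqI, simp add: lookup_add algebra_simps)+

definition linear_map_on :: "('b \<Rightarrow>\<^sub>0 'k::field) set \<Rightarrow> (('b \<Rightarrow>\<^sub>0 'k) \<Rightarrow> ('c \<Rightarrow>\<^sub>0 'k)) \<Rightarrow> bool" where
  "linear_map_on V f \<longleftrightarrow>
     (\<forall>u\<in>V. \<forall>v\<in>V. f (u + v) = f u + f v) \<and> (\<forall>c. \<forall>v\<in>V. f (kscale c v) = kscale c (f v))"

definition bilinear_map_on ::
  "('a \<Rightarrow>\<^sub>0 'k::field) set \<Rightarrow> ('b \<Rightarrow>\<^sub>0 'k) set \<Rightarrow> (('a \<Rightarrow>\<^sub>0 'k) \<Rightarrow> ('b \<Rightarrow>\<^sub>0 'k) \<Rightarrow> ('c \<Rightarrow>\<^sub>0 'k)) \<Rightarrow> bool" where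
  "bilinear_map_on U V f \<longleftrightarrow>
     (\<forall>u\<in>U. linear_map_on V (f u)) \<and> (\<forall>v\<in>V. linear_map_on U (\<lambda>u. f u v))"

definition sgn_pow :: "int \<Rightarrow> 'v::ab_group_add \<Rightarrow> 'v" where
  "sgn_pow n v = (if even n then v else - v)"


section \<open>Dg categories\<close>

text \<open>
  \<open>Hom C x y n\<close> is the degree \<open>n\<close> part of the complex of morphisms from \<open>x\<close> to \<open>y\<close>;
  \<open>Comp C x y z i j g f\<close> is the composite of \<open>g \<in> Hom C y z i\<close> after \<open>f \<in> Hom C x y j\<close>.
  Different morphism spaces may overlap as sets, so the operations are indexed by objects and
  degrees.
\<close>

record (overloaded) ('o, 'a, 'k::field) dgcat =
  Obj :: "'o set"
  Hom :: "'o \<Rightarrow> 'o \<Rightarrow> int \<Rightarrow> ('a \<Rightarrow>\<^sub>0 'k) set"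
  Diff :: "'o \<Rightarrow> 'o \<Rightarrow> int \<Rightarrow> ('a \<Rightarrow>\<^sub>0 'k) \<Rightarrow> ('a \<Rightarrow>\<^sub>0 'k)"
  Comp :: "'o \<Rightarrow> 'o \<Rightarrow> 'o \<Rightarrow> int \<Rightarrow> int \<Rightarrow> ('a \<Rightarrow>\<^sub>0 'k) \<Rightarrow> ('a \<Rightarrow>\<^sub>0 'k) \<Rightarrow> ('a \<Rightarrow>\<^sub>0 'k)"
  Ident :: "'o \<Rightarrow> ('a \<Rightarrow>\<^sub>0 'k)"

locale dg_category =
  fixes C :: "('o, 'a, 'k::field) dgcat"
  assumes hom_subspace: "\<lbrakk>x \<in> Obj C; y \<in> Obj C\<rbrakk> \<Longrightarrow> kvec.subspace (Hom C x y n)"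
    and diff_closed: "\<lbrakk>x \<in> Obj C; y \<in> Obj C; f \<in> Hom C x y n\<rbrakk> \<Longrightarrow> Diff C x y n f \<in> Hom C x y (n + 1)"
    and diff_linear: "\<lbrakk>x \<in> Obj C; y \<in> Obj C\<rbrakk> \<Longrightarrow> linear_map_on (Hom C x y n) (Diff C x y n)"
    and diff_diff: "\<lbrakk>x \<in> Obj C; y \<in> Obj C; f \<in> Hom C x y n\<rbrakk>
      \<Longrightarrow> Diff C x y (n + 1) (Diff C x y n f) = 0"
    and comp_closed: "\<lbrakk>x \<in> Obj C; y \<in> Obj C; z \<in> Obj C; g \<in> Hom C y z i; f \<in> Hom C x y j\<rbrakk>
      \<Longrightarrow> Comp C x y z i j g f \<in> Hom C x z (i + j)"
    and comp_bilinear: "\<lbrakk>x \<in> Obj C; y \<in> Obj C; z \<in> Obj C\<rbrakk>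
      \<Longrightarrow> bilinear_map_on (Hom C y z i) (Hom C x y j) (Comp C x y z i j)"
    and comp_assoc: "\<lbrakk>w \<in> Obj C; x \<in> Obj C; y \<in> Obj C; z \<in> Obj C;
        h \<in> Hom C y z i; g \<in> Hom C x y j; f \<in> Hom C w x k\<rbrakk>
      \<Longrightarrow> Comp C w x z (i + j) k (Comp C x y z i j h g) f
        = Comp C w y z i (j + k) h (Comp C w x y j k g f)"
    and ident_closed: "x \<in> Obj C \<Longrightarrow> Ident C x \<in> Hom C x x 0"
    and comp_ident_left: "\<lbrakk>x \<in> Obj C; y \<in> Obj C; f \<in> Hom C x y n\<rbrakk>
      \<Longrightarrow> Comp C x y y 0 n (Ident C y) f = f"
    and comp_ident_right: "\<lbrakk>x \<in> Obj C; y \<in> Obj C; f \<in> Hom C x y n\<rbrakk>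
      \<Longrightarrow> Comp C x x y n 0 f (Ident C x) = f"
    and diff_ident: "x \<in> Obj C \<Longrightarrow> Diff C x x 0 (Ident C x) = 0"
    and diff_comp: "\<lbrakk>x \<in> Obj C; y \<in> Obj C; z \<in> Obj C; g \<in> Hom C y z i; f \<in> Hom C x y j\<rbrakk>
      \<Longrightarrow> Diff C x z (i + j) (Comp C x y z i j g f)
        = Comp C x y z (i + 1) j (Diff C y z i g) f
          + sgn_pow i (Comp C x y z i (j + 1) g (Diff C x y j f))"

definition opposite :: "('o, 'a, 'k::field) dgcat \<Rightarrow> ('o, 'a, 'k) dgcat" where
  "opposite C = \<lparr>
     Obj = Obj C,
     Hom = (\<lambda>x y. Hom C y x),
     Diff = (\<lambda>x y. Diff C y x),
     Comp = (\<lambda>x y z i j g f. sgn_pow (i * j) (Comp C z y x j i f g)),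
     Ident = Ident C\<rparr>"

text \<open>
  The pure tensor of \<open>f\<close> of degree \<open>i\<close> and \<open>g\<close> of degree \<open>j\<close>. The degrees are part of the basis
  elements, so that the sum of the tensor products \<open>Hom C x x' i \<otimes> Hom D y y' j\<close> over
  \<open>i + j = n\<close> is direct.
\<close>

definition tens :: "int \<Rightarrow> int \<Rightarrow> ('a \<Rightarrow>\<^sub>0 'k::field) \<Rightarrow> ('b \<Rightarrow>\<^sub>0 'k) \<Rightarrow> (int \<times> int \<times> 'a \<times> 'b \<Rightarrow>\<^sub>0 'k)" where
  "tens i j f g = (\<Sum>a\<in>Poly_Mapping.keys f. \<Sum>b\<in>Poly_Mapping.keys g.
     Poly_Mapping.single (i, j, a, b) (Poly_Mapping.lookup f a * Poly_Mapping.lookup g b))"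

text \<open>
  The linear map that extends \<open>f \<otimes> g \<mapsto> \<phi> i j f g\<close> (for \<open>f \<in> U i\<close>, \<open>g \<in> V j\<close>, and \<open>\<phi> i j\<close>
  bilinear).
\<close>

definition tens_lift ::
  "(int \<Rightarrow> ('a \<Rightarrow>\<^sub>0 'k::field) set) \<Rightarrow> (int \<Rightarrow> ('b \<Rightarrow>\<^sub>0 'k) set) \<Rightarrow>
   (int \<Rightarrow> int \<Rightarrow> ('a \<Rightarrow>\<^sub>0 'k) \<Rightarrow> ('b \<Rightarrow>\<^sub>0 'k) \<Rightarrow> 'v::ab_group_add) \<Rightarrow>
   (int \<times> int \<times> 'a \<times> 'b \<Rightarrow>\<^sub>0 'k) \<Rightarrow> 'v" where
  "tens_lift U V \<phi> t = (THE w. \<exists>ts. (\<forall>(i, j, f, g)\<in>set ts. f \<in> U i \<and> g \<in> V j) \<and>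
     t = (\<Sum>(i, j, f, g)\<leftarrow>ts. tens i j f g) \<and> w = (\<Sum>(i, j, f, g)\<leftarrow>ts. \<phi> i j f g))"

definition tensor ::
  "('o, 'a, 'k::field) dgcat \<Rightarrow> ('p, 'b, 'k) dgcat \<Rightarrow> ('o \<times> 'p, int \<times> int \<times> 'a \<times> 'b, 'k) dgcat" where
  "tensor C D = \<lparr>
     Obj = Obj C \<times> Obj D,
     Hom = (\<lambda>(x, y) (x', y') n.
       kvec.span {tens i j f g | i j f g. i + j = n \<and> f \<in> Hom C x x' i \<and> g \<in> Hom D y y' j}),
     Diff = (\<lambda>(x, y) (x', y') n.
       tens_lift (Hom C x x') (Hom D y y') (\<lambda>i j f g.
         tens (i + 1) j (Diff C x x' i f) g + sgn_pow i (tens i (j + 1) f (Diff D y y' j g)))),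
     Comp = (\<lambda>(x, y) (x', y') (x'', y'') m n s t.
       tens_lift (Hom C x' x'') (Hom D y' y'') (\<lambda>i j f g.
         tens_lift (Hom C x x') (Hom D y y') (\<lambda>i' j' f' g'.
           sgn_pow (j * i') (tens (i + i') (j + j')
             (Comp C x x' x'' i i' f f') (Comp D y y' y'' j j' g g'))) t) s),
     Ident = (\<lambda>(x, y). tens 0 0 (Ident C x) (Ident D y))\<rparr>"

abbreviation enveloping :: "('o, 'a, 'k::field) dgcat \<Rightarrow> ('o \<times> 'o, int \<times> int \<times> 'a \<times> 'a, 'k) dgcat" where
  "enveloping C \<equiv> tensor (opposite C) C"


section \<open>Dg modules\<close>

text \<open>
  Modules are right modules, i.e. dg functors from the opposite of \<open>C\<close> to complexes;
  \<open>Act M x y i j m f\<close> is the product of \<open>m \<in> Car M y i\<close> and \<open>f \<in> Hom C x y j\<close>.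
\<close>

record (overloaded) ('o, 'a, 'b, 'k::field) dgmod =
  Car :: "'o \<Rightarrow> int \<Rightarrow> ('b \<Rightarrow>\<^sub>0 'k) set"
  MDiff :: "'o \<Rightarrow> int \<Rightarrow> ('b \<Rightarrow>\<^sub>0 'k) \<Rightarrow> ('b \<Rightarrow>\<^sub>0 'k)"
  Act :: "'o \<Rightarrow> 'o \<Rightarrow> int \<Rightarrow> int \<Rightarrow> ('b \<Rightarrow>\<^sub>0 'k) \<Rightarrow> ('a \<Rightarrow>\<^sub>0 'k) \<Rightarrow> ('b \<Rightarrow>\<^sub>0 'k)"

locale dg_module =
  fixes C :: "('o, 'a, 'k::field) dgcat" and M :: "('o, 'a, 'b, 'k) dgmod"
  assumes car_subspace: "x \<in> Obj C \<Longrightarrow> kvec.subspace (Car M x n)"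
    and mdiff_closed: "\<lbrakk>x \<in> Obj C; m \<in> Car M x n\<rbrakk> \<Longrightarrow> MDiff M x n m \<in> Car M x (n + 1)"
    and mdiff_linear: "x \<in> Obj C \<Longrightarrow> linear_map_on (Car M x n) (MDiff M x n)"
    and mdiff_mdiff: "\<lbrakk>x \<in> Obj C; m \<in> Car M x n\<rbrakk> \<Longrightarrow> MDiff M x (n + 1) (MDiff M x n m) = 0"
    and act_closed: "\<lbrakk>x \<in> Obj C; y \<in> Obj C; m \<in> Car M y i; f \<in> Hom C x y j\<rbrakk>
      \<Longrightarrow> Act M x y i j m f \<in> Car M x (i + j)"
    and act_bilinear: "\<lbrakk>x \<in> Obj C; y \<in> Obj C\<rbrakk>
      \<Longrightarrow> bilinear_map_on (Car M y i) (Hom C x y j) (Act M x y i j)"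
    and act_ident: "\<lbrakk>x \<in> Obj C; m \<in> Car M x n\<rbrakk> \<Longrightarrow> Act M x x n 0 m (Ident C x) = m"
    and act_act: "\<lbrakk>x \<in> Obj C; y \<in> Obj C; z \<in> Obj C;
        m \<in> Car M z i; g \<in> Hom C y z j; f \<in> Hom C x y k\<rbrakk>
      \<Longrightarrow> Act M x y (i + j) k (Act M y z i j m g) f = Act M x z i (j + k) m (Comp C x y z j k g f)"
    and mdiff_act: "\<lbrakk>x \<in> Obj C; y \<in> Obj C; m \<in> Car M y i; f \<in> Hom C x y j\<rbrakk>
      \<Longrightarrow> MDiff M x (i + j) (Act M x y i j m f)
        = Act M x y (i + 1) j (MDiff M y i m) f
          + sgn_pow i (Act M x y i (j + 1) m (Diff C x y j f))"

text \<open>Closed morphisms of degree 0.\<close>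

definition dg_morphism ::
  "('o, 'a, 'k::field) dgcat \<Rightarrow> ('o, 'a, 'b, 'k) dgmod \<Rightarrow> ('o, 'a, 'b, 'k) dgmod \<Rightarrow>
   ('o \<Rightarrow> int \<Rightarrow> ('b \<Rightarrow>\<^sub>0 'k) \<Rightarrow> ('b \<Rightarrow>\<^sub>0 'k)) \<Rightarrow> bool" where
  "dg_morphism C M N \<phi> \<longleftrightarrow> dg_module C M \<and> dg_module C N \<and>
     (\<forall>x\<in>Obj C. \<forall>n. linear_map_on (Car M x n) (\<phi> x n) \<and>
        (\<forall>m\<in>Car M x n. \<phi> x n m \<in> Car N x n \<and> \<phi> x (n + 1) (MDiff M x n m) = MDiff N x n (\<phi> x n m))) \<and>
     (\<forall>x\<in>Obj C. \<forall>y\<in>Obj C. \<forall>i j. \<forall>m\<in>Car M y i. \<forall>f\<in>Hom C x y j.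
        \<phi> x (i + j) (Act M x y i j m f) = Act N x y i j (\<phi> y i m) f)"

text \<open>
  The last two conjuncts say that the induced map in cohomology is injective and surjective.
\<close>

definition quasi_iso ::
  "('o, 'a, 'k::field) dgcat \<Rightarrow> ('o, 'a, 'b, 'k) dgmod \<Rightarrow> ('o, 'a, 'b, 'k) dgmod \<Rightarrow>
   ('o \<Rightarrow> int \<Rightarrow> ('b \<Rightarrow>\<^sub>0 'k) \<Rightarrow> ('b \<Rightarrow>\<^sub>0 'k)) \<Rightarrow> bool" where
  "quasi_iso C M N \<phi> \<longleftrightarrow> dg_morphism C M N \<phi> \<and>
     (\<forall>x\<in>Obj C. \<forall>n. \<forall>m\<in>Car M x n. MDiff M x n m = 0 \<longrightarrow>
        (\<exists>u\<in>Car N x (n - 1). \<phi> x n m = MDiff N x (n - 1) u) \<longrightarrow>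
        (\<exists>u\<in>Car M x (n - 1). m = MDiff M x (n - 1) u)) \<and>
     (\<forall>x\<in>Obj C. \<forall>n. \<forall>v\<in>Car N x n. MDiff N x n v = 0 \<longrightarrow>
        (\<exists>m\<in>Car M x n. \<exists>u\<in>Car N x (n - 1). MDiff M x n m = 0 \<and> v = \<phi> x n m + MDiff N x (n - 1) u))"

definition acyclic_module :: "('o, 'a, 'k::field) dgcat \<Rightarrow> ('o, 'a, 'b, 'k) dgmod \<Rightarrow> bool" where
  "acyclic_module C M \<longleftrightarrow> dg_module C M \<and>
     (\<forall>x\<in>Obj C. \<forall>n. \<forall>m\<in>Car M x n. MDiff M x n m = 0 \<longrightarrow> (\<exists>u\<in>Car M x (n - 1). m = MDiff M x (n - 1) u))"

definition shift :: "int \<Rightarrow> ('o, 'a, 'b, 'k::field) dgmod \<Rightarrow> ('o, 'a, 'b, 'k) dgmod" where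
  "shift p M = \<lparr>
     Car = (\<lambda>x n. Car M x (n + p)),
     MDiff = (\<lambda>x n m. sgn_pow p (MDiff M x (n + p) m)),
     Act = (\<lambda>x y i j. Act M x y (i + p) j)\<rparr>"

text \<open>
  \<open>X\<close> is (isomorphic to) the cone of \<open>\<phi> : M \<rightarrow> N\<close>, i.e. to \<open>N \<oplus> shift 1 M\<close> with the differential
  \<open>(v, m) \<mapsto> (d v + \<phi> m, - d m)\<close>; the maps \<open>\<alpha>\<close> and \<open>\<beta>\<close> are the inclusions of the summands.
\<close>

definition is_cone ::
  "('o, 'a, 'k::field) dgcat \<Rightarrow> ('o, 'a, 'b, 'k) dgmod \<Rightarrow> ('o, 'a, 'b, 'k) dgmod \<Rightarrow>
   ('o \<Rightarrow> int \<Rightarrow> ('b \<Rightarrow>\<^sub>0 'k) \<Rightarrow> ('b \<Rightarrow>\<^sub>0 'k)) \<Rightarrow> ('o, 'a, 'b, 'k) dgmod \<Rightarrow> bool" where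
  "is_cone C M N \<phi> X \<longleftrightarrow> dg_morphism C M N \<phi> \<and> (\<exists>\<alpha> \<beta>. dg_morphism C N X \<alpha> \<and>
     (\<forall>x\<in>Obj C. \<forall>n. linear_map_on (Car M x (n + 1)) (\<beta> x n) \<and>
        (\<forall>m\<in>Car M x (n + 1). \<beta> x n m \<in> Car X x n \<and>
           MDiff X x n (\<beta> x n m) = \<alpha> x (n + 1) (\<phi> x (n + 1) m) - \<beta> x (n + 1) (MDiff M x (n + 1) m)) \<and>
        (\<forall>w\<in>Car X x n. \<exists>!(v, m). v \<in> Car N x n \<and> m \<in> Car M x (n + 1) \<and> w = \<alpha> x n v + \<beta> x n m)) \<and>
     (\<forall>x\<in>Obj C. \<forall>y\<in>Obj C. \<forall>i j. \<forall>m\<in>Car M y (i + 1). \<forall>f\<in>Hom C x y j.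
        \<beta> x (i + j) (Act M x y (i + 1) j m f) = Act X x y i j (\<beta> y i m) f))"

definition is_direct_sum ::
  "('o, 'a, 'k::field) dgcat \<Rightarrow> 'i set \<Rightarrow> ('i \<Rightarrow> ('o, 'a, 'b, 'k) dgmod) \<Rightarrow> ('o, 'a, 'b, 'k) dgmod \<Rightarrow> bool" where
  "is_direct_sum C I M S \<longleftrightarrow> dg_module C S \<and> (\<exists>\<iota>. (\<forall>i\<in>I. dg_morphism C (M i) S (\<iota> i)) \<and>
     (\<forall>x\<in>Obj C. \<forall>n. \<forall>s\<in>Car S x n. \<exists>!u. finite {i. u i \<noteq> 0} \<and> {i. u i \<noteq> 0} \<subseteq> I \<and>
        (\<forall>i\<in>I. u i \<in> Car (M i) x n) \<and> s = (\<Sum>i | u i \<noteq> 0. \<iota> i x n (u i))))"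


section \<open>The derived category\<close>

text \<open>
  The objects of the derived category of \<open>C\<close> are the dg modules; isomorphism is the
  existence of a zigzag of quasi-isomorphisms.
\<close>

definition derived_iso :: "('o, 'a, 'k::field) dgcat \<Rightarrow> ('o, 'a, 'b, 'k) dgmod \<Rightarrow> ('o, 'a, 'b, 'k) dgmod \<Rightarrow> bool" where
  "derived_iso C M N \<longleftrightarrow> dg_module C M \<and> dg_module C N \<and>
     equivclp (\<lambda>M' N'. \<exists>\<phi>. quasi_iso C M' N' \<phi>) M N"

text \<open>
  \<open>X\<close> is a cone of some morphism \<open>M \<rightarrow> N\<close> of the derived category; such a morphism is
  given by a roof \<open>M \<leftarrow> P \<rightarrow> N\<close> whose left leg is a quasi-isomorphism.
\<close>

definition derived_cone ::
  "('o, 'a, 'k::field) dgcat \<Rightarrow> ('o, 'a, 'b, 'k) dgmod \<Rightarrow> ('o, 'a, 'b, 'k) dgmod \<Rightarrow> ('o, 'a, 'b, 'k) dgmod \<Rightarrow> bool" where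
  "derived_cone C M N X \<longleftrightarrow>
     (\<exists>P \<sigma> \<phi> Y. quasi_iso C P M \<sigma> \<and> is_cone C P N \<phi> Y \<and> derived_iso C Y X)"

definition derived_summand :: "('o, 'a, 'k::field) dgcat \<Rightarrow> ('o, 'a, 'b, 'k) dgmod \<Rightarrow> ('o, 'a, 'b, 'k) dgmod \<Rightarrow> bool" where
  "derived_summand C X Y \<longleftrightarrow>
     (\<exists>Z S. is_direct_sum C UNIV (\<lambda>b::bool. if b then X else Z) S \<and> derived_iso C S Y)"

text \<open>\<open>M\<close> is isomorphic to the Yoneda module of the object \<open>a\<close>, whose value at \<open>x\<close> is \<open>Hom C x a\<close>.\<close>

definition is_representable :: "('o, 'a, 'k::field) dgcat \<Rightarrow> 'o \<Rightarrow> ('o, 'a, 'b, 'k) dgmod \<Rightarrow> bool" where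
  "is_representable C a M \<longleftrightarrow> dg_module C M \<and> (\<exists>\<epsilon>.
     (\<forall>x\<in>Obj C. \<forall>n. bij_betw (\<epsilon> x n) (Hom C x a n) (Car M x n) \<and> linear_map_on (Hom C x a n) (\<epsilon> x n) \<and>
        (\<forall>h\<in>Hom C x a n. \<epsilon> x (n + 1) (Diff C x a n h) = MDiff M x n (\<epsilon> x n h))) \<and>
     (\<forall>x\<in>Obj C. \<forall>y\<in>Obj C. \<forall>i j. \<forall>h\<in>Hom C y a i. \<forall>f\<in>Hom C x y j.
        \<epsilon> x (i + j) (Comp C x y a i j h f) = Act M x y i j (\<epsilon> y i h) f))"

text \<open>
  The idempotent-completed pre-triangulated closure of \<open>C\<close>, as a subcategory of its derived category.
  The rule \<open>zero\<close> only matters when \<open>C\<close> has no objects.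
\<close>

inductive_set Perf :: "('o, 'a, 'k::field) dgcat \<Rightarrow> ('o, 'a, 'b, 'k) dgmod set"
  for C :: "('o, 'a, 'k) dgcat" where
  representable: "\<lbrakk>a \<in> Obj C; is_representable C a M\<rbrakk> \<Longrightarrow> M \<in> Perf C"
| zero: "acyclic_module C M \<Longrightarrow> M \<in> Perf C"
| iso: "\<lbrakk>M \<in> Perf C; derived_iso C M N\<rbrakk> \<Longrightarrow> N \<in> Perf C"
| shift: "M \<in> Perf C \<Longrightarrow> shift p M \<in> Perf C"
| cone: "\<lbrakk>M \<in> Perf C; N \<in> Perf C; derived_cone C M N X\<rbrakk> \<Longrightarrow> X \<in> Perf C"
| summand: "\<lbrakk>M \<in> Perf C; derived_summand C N M\<rbrakk> \<Longrightarrow> N \<in> Perf C"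

inductive_set generated :: "('o, 'a, 'k::field) dgcat \<Rightarrow> ('o, 'a, 'b, 'k) dgmod set \<Rightarrow> ('o, 'a, 'b, 'k) dgmod set"
  for C :: "('o, 'a, 'k) dgcat" and \<G> :: "('o, 'a, 'b, 'k) dgmod set" where
  base: "\<lbrakk>M \<in> \<G>; dg_module C M\<rbrakk> \<Longrightarrow> M \<in> generated C \<G>"
| iso: "\<lbrakk>M \<in> generated C \<G>; derived_iso C M N\<rbrakk> \<Longrightarrow> N \<in> generated C \<G>"
| summand: "\<lbrakk>M \<in> generated C \<G>; derived_summand C N M\<rbrakk> \<Longrightarrow> N \<in> generated C \<G>"
| shift: "M \<in> generated C \<G> \<Longrightarrow> shift p M \<in> generated C \<G>"
| sum: "\<lbrakk>\<And>i. i < n \<Longrightarrow> M i \<in> generated C \<G>; is_direct_sum C {..<n::nat} M S\<rbrakk> \<Longrightarrow> S \<in> generated C \<G>"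

text \<open>
  A direct sum of modules in \<open>'b \<Rightarrow>\<^sub>0 'k\<close> that itself embeds in \<open>'b \<Rightarrow>\<^sub>0 'k\<close> has, for infinite \<open>'b\<close>
  at least as large as the set of objects, at most as many nonzero summands as \<open>'b\<close> has elements;
  hence sums indexed by subsets of \<open>'b\<close> are all direct sums.
\<close>

inductive_set ads :: "('o, 'a, 'k::field) dgcat \<Rightarrow> ('o, 'a, 'b, 'k) dgmod set \<Rightarrow> ('o, 'a, 'b, 'k) dgmod set"
  for C :: "('o, 'a, 'k) dgcat" and \<G> :: "('o, 'a, 'b, 'k) dgmod set" where
  base: "\<lbrakk>M \<in> \<G>; dg_module C M\<rbrakk> \<Longrightarrow> M \<in> ads C \<G>"
| iso: "\<lbrakk>M \<in> ads C \<G>; derived_iso C M N\<rbrakk> \<Longrightarrow> N \<in> ads C \<G>"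
| summand: "\<lbrakk>M \<in> ads C \<G>; derived_summand C N M\<rbrakk> \<Longrightarrow> N \<in> ads C \<G>"
| shift: "M \<in> ads C \<G> \<Longrightarrow> shift p M \<in> ads C \<G>"
| sum: "\<lbrakk>\<And>i. i \<in> I \<Longrightarrow> M i \<in> ads C \<G>; is_direct_sum C (I :: 'b set) M S\<rbrakk> \<Longrightarrow> S \<in> ads C \<G>"

definition star ::
  "('o, 'a, 'k::field) dgcat \<Rightarrow> ('o, 'a, 'b, 'k) dgmod set \<Rightarrow> ('o, 'a, 'b, 'k) dgmod set \<Rightarrow> ('o, 'a, 'b, 'k) dgmod set" where
  "star C \<G>\<^sub>1 \<G>\<^sub>2 = {X. \<exists>M\<in>\<G>\<^sub>1. \<exists>N\<in>\<G>\<^sub>2. derived_cone C M N X}"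

primrec generated_in ::
  "('o, 'a, 'k::field) dgcat \<Rightarrow> ('o, 'a, 'b, 'k) dgmod set \<Rightarrow> nat \<Rightarrow> ('o, 'a, 'b, 'k) dgmod set" where
  "generated_in C \<G> 0 = {M. acyclic_module C M}"
| "generated_in C \<G> (Suc k) = generated C (star C (generated_in C \<G> k) (generated C \<G>))"

definition generation_time ::
  "('o, 'a, 'k::field) dgcat \<Rightarrow> ('o, 'a, 'b, 'k) dgmod set \<Rightarrow> ('o, 'a, 'b, 'k) dgmod set \<Rightarrow> enat" where
  "generation_time C \<E> \<G> = (INF k\<in>{k. \<E> \<subseteq> generated_in C \<G> (k + 1)}. enat k)"

text \<open>The type argument is the one in which the dg modules live.\<close>

definition Rdim :: "'b itself \<Rightarrow> ('o, 'a, 'k::field) dgcat \<Rightarrow> enat" where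
  "Rdim _ C = (INF G\<in>(Perf C :: ('o, 'a, 'b, 'k) dgmod set). generation_time C (Perf C) {G})"


section \<open>Bimodules and convolution\<close>

text \<open>
  A bimodule \<open>K\<close> is a module over the enveloping category. As modules are contravariant, \<open>Car K (y, x)\<close>
  is covariant in \<open>y\<close> and contravariant in \<open>x\<close>. The action of \<open>f \<otimes> 1\<close> makes \<open>K\<close> a left module in \<open>y\<close>:
  for \<open>f \<in> Hom C y z p\<close> and \<open>m \<in> Car K (y, x) j\<close>, the product \<open>f m\<close> lies in \<open>Car K (z, x) (p + j)\<close>.
\<close>

definition left_act ::
  "('o, 'a, 'k::field) dgcat \<Rightarrow> ('o \<times> 'o, int \<times> int \<times> 'a \<times> 'a, 'b, 'k) dgmod \<Rightarrow>
   'o \<Rightarrow> 'o \<Rightarrow> 'o \<Rightarrow> int \<Rightarrow> int \<Rightarrow> ('a \<Rightarrow>\<^sub>0 'k) \<Rightarrow> ('b \<Rightarrow>\<^sub>0 'k) \<Rightarrow> ('b \<Rightarrow>\<^sub>0 'k)" where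
  "left_act C K z y x p j f m = sgn_pow (p * j) (Act K (z, x) (y, x) j p m (tens p 0 f (Ident C x)))"

definition right_act ::
  "('o, 'a, 'k::field) dgcat \<Rightarrow> ('o \<times> 'o, int \<times> int \<times> 'a \<times> 'a, 'b, 'k) dgmod \<Rightarrow>
   'o \<Rightarrow> 'o \<Rightarrow> 'o \<Rightarrow> int \<Rightarrow> int \<Rightarrow> ('b \<Rightarrow>\<^sub>0 'k) \<Rightarrow> ('a \<Rightarrow>\<^sub>0 'k) \<Rightarrow> ('b \<Rightarrow>\<^sub>0 'k)" where
  "right_act C K y x x' j q m g = Act K (y, x') (y, x) j q m (tens 0 q (Ident C y) g)"

text \<open>
  The diagonal bimodule has \<open>Car D (y, x) = Hom C x y\<close> (up to isomorphism), acted on by composition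
  on both sides: \<open>h \<cdot> (f \<otimes> g)\<close> is \<open>f \<circ> h \<circ> g\<close> up to the Koszul sign.
\<close>

definition is_diagonal ::
  "('o, 'a, 'k::field) dgcat \<Rightarrow> ('o \<times> 'o, int \<times> int \<times> 'a \<times> 'a, 'b, 'k) dgmod \<Rightarrow> bool" where
  "is_diagonal C D \<longleftrightarrow> dg_module (enveloping C) D \<and> (\<exists>\<epsilon>.
     (\<forall>x\<in>Obj C. \<forall>y\<in>Obj C. \<forall>n.
        bij_betw (\<epsilon> y x n) (Hom C x y n) (Car D (y, x) n) \<and> linear_map_on (Hom C x y n) (\<epsilon> y x n) \<and>
        (\<forall>h\<in>Hom C x y n. \<epsilon> y x (n + 1) (Diff C x y n h) = MDiff D (y, x) n (\<epsilon> y x n h))) \<and>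
     (\<forall>x\<in>Obj C. \<forall>x'\<in>Obj C. \<forall>y\<in>Obj C. \<forall>y'\<in>Obj C. \<forall>n p q.
        \<forall>h\<in>Hom C x y n. \<forall>f\<in>Hom C y y' p. \<forall>g\<in>Hom C x' x q.
        Act D (y', x') (y, x) n (p + q) (\<epsilon> y x n h) (tens p q f g)
          = sgn_pow (p * n) (\<epsilon> y' x' (n + (p + q))
              (Comp C x' y y' p (n + q) f (Comp C x' x y n q h g)))))"

definition balanced ::
  "('o, 'a, 'k::field) dgcat \<Rightarrow> ('o, 'a, 'b, 'k) dgmod \<Rightarrow> ('o \<times> 'o, int \<times> int \<times> 'a \<times> 'a, 'b, 'k) dgmod \<Rightarrow> 'o \<Rightarrow>
   ('o \<Rightarrow> int \<Rightarrow> int \<Rightarrow> ('b \<Rightarrow>\<^sub>0 'k) \<Rightarrow> ('b \<Rightarrow>\<^sub>0 'k) \<Rightarrow> ('b \<Rightarrow>\<^sub>0 'k)) \<Rightarrow> bool" where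
  "balanced C F K x \<psi> \<longleftrightarrow>
     (\<forall>y\<in>Obj C. \<forall>i j. bilinear_map_on (Car F y i) (Car K (y, x) j) (\<psi> y i j)) \<and>
     (\<forall>y\<in>Obj C. \<forall>z\<in>Obj C. \<forall>i p j. \<forall>u\<in>Car F z i. \<forall>f\<in>Hom C y z p. \<forall>m\<in>Car K (y, x) j.
        \<psi> y (i + p) j (Act F y z i p u f) m = \<psi> z i (p + j) u (left_act C K z y x p j f m))"

text \<open>
  \<open>T\<close> is the (underived) tensor product of the right module \<open>F\<close> and the bimodule \<open>K\<close> over \<open>C\<close>:
  each \<open>Car T x\<close> is the target of a universal balanced bilinear map, sending \<open>u\<close> of degree \<open>i\<close> and
  \<open>m\<close> of degree \<open>j\<close> to \<open>u \<otimes> m = \<theta> x y i j u m\<close>.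
\<close>

definition is_tensor_over ::
  "('o, 'a, 'k::field) dgcat \<Rightarrow> ('o, 'a, 'b, 'k) dgmod \<Rightarrow> ('o \<times> 'o, int \<times> int \<times> 'a \<times> 'a, 'b, 'k) dgmod \<Rightarrow>
   ('o, 'a, 'b, 'k) dgmod \<Rightarrow> bool" where
  "is_tensor_over C F K T \<longleftrightarrow>
     dg_module C F \<and> dg_module (enveloping C) K \<and> dg_module C T \<and> (\<exists>\<theta>.
     (\<forall>x\<in>Obj C. balanced C F K x (\<theta> x)) \<and>
     (\<forall>x\<in>Obj C. \<forall>n. Car T x n = kvec.span
        {\<theta> x y i j u m | y i j u m. y \<in> Obj C \<and> i + j = n \<and> u \<in> Car F y i \<and> m \<in> Car K (y, x) j}) \<and>
     (\<forall>x\<in>Obj C. \<forall>\<psi> :: 'o \<Rightarrow> int \<Rightarrow> int \<Rightarrow> ('b \<Rightarrow>\<^sub>0 'k) \<Rightarrow> ('b \<Rightarrow>\<^sub>0 'k) \<Rightarrow> ('b \<Rightarrow>\<^sub>0 'k).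
        balanced C F K x \<psi> \<longrightarrow> (\<forall>n. \<exists>L. linear_map_on (Car T x n) L \<and>
          (\<forall>y\<in>Obj C. \<forall>i j. i + j = n \<longrightarrow> (\<forall>u\<in>Car F y i. \<forall>m\<in>Car K (y, x) j.
             L (\<theta> x y i j u m) = \<psi> y i j u m)))) \<and>
     (\<forall>x\<in>Obj C. \<forall>y\<in>Obj C. \<forall>i j. \<forall>u\<in>Car F y i. \<forall>m\<in>Car K (y, x) j.
        MDiff T x (i + j) (\<theta> x y i j u m)
          = \<theta> x y (i + 1) j (MDiff F y i u) m + sgn_pow i (\<theta> x y i (j + 1) u (MDiff K (y, x) j m))) \<and>
     (\<forall>x\<in>Obj C. \<forall>x'\<in>Obj C. \<forall>y\<in>Obj C. \<forall>i j q. \<forall>u\<in>Car F y i. \<forall>m\<in>Car K (y, x) j. \<forall>g\<in>Hom C x' x q.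
        Act T x' x (i + j) q (\<theta> x y i j u m) g = \<theta> x' y i (j + q) u (right_act C K y x x' j q m g)))"

text \<open>
  Semi-free modules: \<open>B\<close> is a basis of the underlying graded module, an element \<open>(y, i, b)\<close> being a
  generator \<open>b \<in> Car Q y i\<close>, and the differential of a generator is a combination of generators
  of smaller level.
\<close>

definition is_combination ::
  "('o, 'a, 'k::field) dgcat \<Rightarrow> ('o, 'a, 'b, 'k) dgmod \<Rightarrow> ('o \<times> int \<times> ('b \<Rightarrow>\<^sub>0 'k)) set \<Rightarrow> 'o \<Rightarrow> int \<Rightarrow>
   ('b \<Rightarrow>\<^sub>0 'k) \<Rightarrow> ('o \<times> int \<times> ('b \<Rightarrow>\<^sub>0 'k) \<Rightarrow> ('a \<Rightarrow>\<^sub>0 'k)) \<Rightarrow> bool" where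
  "is_combination C Q B x n m c \<longleftrightarrow>
     finite {\<beta>. c \<beta> \<noteq> 0} \<and> {\<beta>. c \<beta> \<noteq> 0} \<subseteq> B \<and> (\<forall>(y, i, b)\<in>B. c (y, i, b) \<in> Hom C x y (n - i)) \<and>
     m = (\<Sum>(y, i, b) | c (y, i, b) \<noteq> 0. Act Q x y i (n - i) b (c (y, i, b)))"

definition semi_free :: "('o, 'a, 'k::field) dgcat \<Rightarrow> ('o, 'a, 'b, 'k) dgmod \<Rightarrow> bool" where
  "semi_free C Q \<longleftrightarrow> dg_module C Q \<and> (\<exists>B level.
     (\<forall>(y, i, b)\<in>B. y \<in> Obj C \<and> b \<in> Car Q y i) \<and>
     (\<forall>x\<in>Obj C. \<forall>n. \<forall>m\<in>Car Q x n. \<exists>!c. is_combination C Q B x n m c) \<and>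
     (\<forall>(y, i, b)\<in>B. \<exists>c. is_combination C Q
        {\<beta>\<in>B. (level \<beta> :: nat) < level (y, i, b)} y (i + 1) (MDiff Q y i b) c))"

text \<open>
  The convolution functor on objects, i.e. the derived tensor product over \<open>C\<close>, computed by a semi-free
  resolution \<open>Q\<close> of \<open>F\<close>; it is well-defined up to isomorphism in the derived category.
\<close>

definition convolution ::
  "('o, 'a, 'k::field) dgcat \<Rightarrow> ('o \<times> 'o, int \<times> int \<times> 'a \<times> 'a, 'b, 'k) dgmod \<Rightarrow> ('o, 'a, 'b, 'k) dgmod \<Rightarrow>
   ('o, 'a, 'b, 'k) dgmod" where
  "convolution C K F =
     (SOME T. \<exists>Q \<sigma>. semi_free C Q \<and> quasi_iso C Q F \<sigma> \<and> is_tensor_over C Q K T)"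

definition weakly_product_bimodule ::
  "('o, 'a, 'k::field) dgcat \<Rightarrow> ('o \<times> 'o, int \<times> int \<times> 'a \<times> 'a, 'b, 'k) dgmod \<Rightarrow> bool" where
  "weakly_product_bimodule C K \<longleftrightarrow> K \<in> Perf (enveloping C) \<and>
     (\<exists>G\<in>Perf C. \<forall>F\<in>Perf C. convolution C K F \<in> ads C {G})"

end

theory Submission
  imports Defs "HOL-Library.Countable"
begin

text \<open>
  The convolution of \<open>F\<close> and \<open>K\<close> is the tensor product \<open>Q \<otimes> K\<close> for a semi-free resolution \<open>Q\<close> of \<open>F\<close>. In terms of
  the generators of \<open>Q\<close> it is a sum of values \<open>K (y, -)\<close> with a twisted differential, and in this form it is
  seen to preserve quasi-isomorphisms, direct sums, shifts and cones in \<open>K\<close>. So a construction of the diagonal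
  from \<open>G\<^sub>1\<^sub>2\<close> in \<open>k + 1\<close> steps yields a construction of \<open>Q \<otimes> \<Delta> \<cong> F\<close> from \<open>Q \<otimes> G\<^sub>1\<^sub>2 \<in> ads {G\<^sub>2}\<close> in as many steps.
  The infinite direct sums allowed in \<open>ads\<close> are removed by compactness: call \<open>X\<close> approximable by a class \<open>\<G>\<close> if
  every map from a perfect module to \<open>X\<close> factors through a member of \<open>\<G>\<close>. The objects of \<open>ads {G\<^sub>2}\<close> are approximable
  by \<open>generated C {G\<^sub>2}\<close>, as maps from perfect modules to direct sums factor through finite ones; if \<open>M\<close> and \<open>N\<close> are
  approximable by \<open>\<G>\<^sub>1\<close> and \<open>\<G>\<^sub>2\<close>, then a cone of \<open>M \<rightarrow> N\<close> is approximable by \<open>\<G>\<^sub>1 * \<G>\<^sub>2\<close>; and a perfect module which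
  is approximable by a class closed under direct summands is a summand of one of its members, hence in the class.
\<close>

text \<open>Morphisms of the derived category are not formed as such. They are represented by closed
  maps out of K-projective modules, up to homotopy. A factorization can nevertheless be demanded on
  the nose: the cone of an identity absorbs homotopies, and being acyclic it lies in every class of
  modules considered.

  The other obstacle is size. All modules have to live over the one basis \<open>'b\<close>, so a
  family of vectors is packed into a single vector by a bijection of \<open>'j \<times> 'b\<close>
  with \<open>'b\<close>. The injection of lists into \<open>'b\<close> provides such bijections for
  cones, for sums over the generators of a semi-free module, and for the very large set of
  generators of a resolution.

  Free modules are affected as well: the morphism spaces live over \<open>'a\<close>, not over
  \<open>'b\<close>, but the diagonal bimodule contains a copy of each of them. The semi-free
  resolution of \<open>F\<close> is therefore a twisted sum of values of the diagonal itself, an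
  instance of the construction that computes \<open>Q \<otimes> K\<close> for arbitrary
  \<open>K\<close>. One formalism thus serves both for the resolution and for the functor.\<close>

type_synonym ('b, 'k) vec = "'b \<Rightarrow>\<^sub>0 'k"

type_synonym ('o, 'b, 'k) gmap = "'o \<Rightarrow> int \<Rightarrow> ('b \<Rightarrow>\<^sub>0 'k) \<Rightarrow> ('b \<Rightarrow>\<^sub>0 'k)"

type_synonym ('o, 'a, 'b, 'k) bimod = "('o \<times> 'o, int \<times> int \<times> 'a \<times> 'a, 'b, 'k) dgmod"

section \<open>Linear maps on subspaces and signs\<close>

lemma kscale_minus1 [simp]: "kscale (-1) v = - v"
  by (rule poly_mapping_eqI) simp

context
  fixes V :: "('b, 'k::field) vec set" and f :: "('b, 'k) vec \<Rightarrow> ('c \<Rightarrow>\<^sub>0 'k)"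
  assumes lin: "linear_map_on V f"
begin

lemma lin_add: "u \<in> V \<Longrightarrow> v \<in> V \<Longrightarrow> f (u + v) = f u + f v"
  using lin by (auto simp: linear_map_on_def)

lemma lin_scale: "v \<in> V \<Longrightarrow> f (kscale c v) = kscale c (f v)"
  using lin by (auto simp: linear_map_on_def)

lemma lin_minus: "v \<in> V \<Longrightarrow> f (- v) = - f v"
  using lin_scale[of v "-1"] by simp

lemma lin_zero: "kvec.subspace V \<Longrightarrow> f 0 = 0"
  using lin_scale[of 0 0] kvec.subspace_0 by fastforce

lemma lin_diff: "kvec.subspace V \<Longrightarrow> u \<in> V \<Longrightarrow> v \<in> V \<Longrightarrow> f (u - v) = f u - f v"
  using lin_add[of u "- v"] lin_minus[of v] kvec.subspace_neg[of V v] by simp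

lemma lin_sum:
  "kvec.subspace V \<Longrightarrow> (\<And>i. i \<in> A \<Longrightarrow> g i \<in> V) \<Longrightarrow> f (sum g A) = (\<Sum>i\<in>A. f (g i))"
proof (induction A rule: infinite_finite_induct)
  case (insert a A)
  then show ?case by (simp add: lin_add kvec.subspace_sum)
qed (auto simp: lin_zero)

end

lemma linear_map_onI:
  "\<lbrakk>\<And>u v. u \<in> V \<Longrightarrow> v \<in> V \<Longrightarrow> f (u + v) = f u + f v; \<And>c v. v \<in> V \<Longrightarrow> f (kscale c v) = kscale c (f v)\<rbrakk>
    \<Longrightarrow> linear_map_on V f"
  by (simp add: linear_map_on_def)

lemma lin_cong:
  assumes "linear_map_on V f" "kvec.subspace V" "\<And>v. v \<in> V \<Longrightarrow> g v = f v"
  shows "linear_map_on V g"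
  using assms by (auto simp: linear_map_on_def kvec.subspace_add kvec.subspace_scale)

lemma lin_subset: "linear_map_on V f \<Longrightarrow> U \<subseteq> V \<Longrightarrow> linear_map_on U f"
  unfolding linear_map_on_def by blast

lemma lin_compose:
  "\<lbrakk>linear_map_on U f; linear_map_on V g; \<And>u. u \<in> U \<Longrightarrow> f u \<in> V\<rbrakk> \<Longrightarrow> linear_map_on U (\<lambda>u. g (f u))"
  by (simp add: linear_map_on_def)

lemma lin_plus:
  "linear_map_on V f \<Longrightarrow> linear_map_on V g \<Longrightarrow> linear_map_on V (\<lambda>v. f v + g v)"
  by (simp add: linear_map_on_def kvec.scale_right_distrib)

lemma lin_uminus: "linear_map_on V f \<Longrightarrow> linear_map_on V (\<lambda>v. - f v)"
  by (simp add: linear_map_on_def)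

lemma lin_const0: "linear_map_on V (\<lambda>v. 0)"
  by (simp add: linear_map_on_def)

lemma lin_id: "linear_map_on V (\<lambda>v. v)"
  by (simp add: linear_map_on_def)

lemma lin_sum_fun:
  "(\<And>i. i \<in> A \<Longrightarrow> linear_map_on V (f i)) \<Longrightarrow> linear_map_on V (\<lambda>v. \<Sum>i\<in>A. f i v)"
  by (induction A rule: infinite_finite_induct) (auto simp: lin_const0 lin_plus)

lemma sgn_pow_zero [simp]: "sgn_pow n 0 = 0"
  by (simp add: sgn_pow_def)

lemma sgn_pow_0 [simp]: "sgn_pow 0 v = v"
  by (simp add: sgn_pow_def)

lemma sgn_pow_1 [simp]: "sgn_pow 1 v = - v"
  by (simp add: sgn_pow_def)

lemma sgn_pow_sgn_pow [simp]: "sgn_pow m (sgn_pow n v) = sgn_pow (m + n) v"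
  by (simp add: sgn_pow_def)

lemma sgn_pow_minus [simp]: "sgn_pow n (- v) = - sgn_pow n v"
  by (simp add: sgn_pow_def)

lemma sgn_pow_Suc [simp]: "sgn_pow (n + 1) v = - sgn_pow n v"
  by (simp add: sgn_pow_def)

lemma sgn_pow_Pred [simp]: "sgn_pow (n - 1) v = - sgn_pow n v"
  by (simp add: sgn_pow_def)

lemma sgn_pow_add: "sgn_pow n (u + v) = sgn_pow n u + sgn_pow n v"
  by (simp add: sgn_pow_def)

lemma sgn_pow_diff: "sgn_pow n (u - v) = sgn_pow n u - sgn_pow n v"
  by (simp add: sgn_pow_def)

lemma sgn_pow_eq_0 [simp]: "sgn_pow n v = 0 \<longleftrightarrow> v = 0"
  by (simp add: sgn_pow_def)

lemma sgn_pow_scale: "sgn_pow n (kscale c v) = kscale c (sgn_pow n v)"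
  by (simp add: sgn_pow_def)

lemma sgn_pow_cong: "even (m - n) \<Longrightarrow> sgn_pow m v = sgn_pow n v"
  by (auto simp: sgn_pow_def)

lemma sgn_pow_even: "even n \<Longrightarrow> sgn_pow n v = v"
  by (simp add: sgn_pow_def)

lemma sgn_pow_in: "kvec.subspace V \<Longrightarrow> v \<in> V \<Longrightarrow> sgn_pow n v \<in> V"
  by (simp add: sgn_pow_def kvec.subspace_neg)

lemma lin_sgn_pow: "linear_map_on V f \<Longrightarrow> v \<in> V \<Longrightarrow> f (sgn_pow n v) = sgn_pow n (f v)"
  by (simp add: sgn_pow_def lin_minus)

lemma lin_sgn: "linear_map_on V f \<Longrightarrow> linear_map_on V (\<lambda>v. sgn_pow n (f v))"
  by (simp add: linear_map_on_def sgn_pow_add sgn_pow_scale)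


section \<open>Modules and their morphisms\<close>

context dg_module
begin

lemma mem_0: "x \<in> Obj C \<Longrightarrow> 0 \<in> Car M x n"
  using car_subspace kvec.subspace_0 by blast

lemma mem_add: "x \<in> Obj C \<Longrightarrow> u \<in> Car M x n \<Longrightarrow> v \<in> Car M x n \<Longrightarrow> u + v \<in> Car M x n"
  using car_subspace kvec.subspace_add by blast

lemma mem_diff: "x \<in> Obj C \<Longrightarrow> u \<in> Car M x n \<Longrightarrow> v \<in> Car M x n \<Longrightarrow> u - v \<in> Car M x n"
  using car_subspace kvec.subspace_diff by blast

lemma mem_minus: "x \<in> Obj C \<Longrightarrow> u \<in> Car M x n \<Longrightarrow> - u \<in> Car M x n"
  using car_subspace kvec.subspace_neg by blast

lemma mem_scale: "x \<in> Obj C \<Longrightarrow> u \<in> Car M x n \<Longrightarrow> kscale c u \<in> Car M x n"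
  using car_subspace kvec.subspace_scale by blast

lemma mem_sgn: "x \<in> Obj C \<Longrightarrow> u \<in> Car M x n \<Longrightarrow> sgn_pow p u \<in> Car M x n"
  using car_subspace sgn_pow_in by blast

lemma mem_sum: "x \<in> Obj C \<Longrightarrow> (\<And>i. i \<in> A \<Longrightarrow> g i \<in> Car M x n) \<Longrightarrow> sum g A \<in> Car M x n"
  using car_subspace kvec.subspace_sum by blast

lemmas mem = mem_0 mem_add mem_diff mem_minus mem_sgn mem_scale

text \<open>Degrees that are equal integers are in general different terms, so the target degree is
  a variable with an equation to be proved by arithmetic. Many rules below have this form.\<close>

lemma d_in: "x \<in> Obj C \<Longrightarrow> m \<in> Car M x n \<Longrightarrow> k = n + 1 \<Longrightarrow> MDiff M x n m \<in> Car M x k"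
  using mdiff_closed by simp

lemma act_in: "\<lbrakk>x \<in> Obj C; y \<in> Obj C; m \<in> Car M y i; f \<in> Hom C x y j; k = i + j\<rbrakk>
    \<Longrightarrow> Act M x y i j m f \<in> Car M x k"
  using act_closed by simp

lemma d_add: "x \<in> Obj C \<Longrightarrow> u \<in> Car M x n \<Longrightarrow> v \<in> Car M x n \<Longrightarrow> MDiff M x n (u + v) = MDiff M x n u + MDiff M x n v"
  using lin_add mdiff_linear by blast

lemma d_diff: "x \<in> Obj C \<Longrightarrow> u \<in> Car M x n \<Longrightarrow> v \<in> Car M x n \<Longrightarrow> MDiff M x n (u - v) = MDiff M x n u - MDiff M x n v"
  using lin_diff mdiff_linear car_subspace by blast

lemma d_minus: "x \<in> Obj C \<Longrightarrow> u \<in> Car M x n \<Longrightarrow> MDiff M x n (- u) = - MDiff M x n u"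
  using lin_minus mdiff_linear by blast

lemma d_0: "x \<in> Obj C \<Longrightarrow> MDiff M x n 0 = 0"
  using lin_zero mdiff_linear car_subspace by blast

lemma d_scale: "x \<in> Obj C \<Longrightarrow> u \<in> Car M x n \<Longrightarrow> MDiff M x n (kscale c u) = kscale c (MDiff M x n u)"
  using lin_scale mdiff_linear by blast

lemma d_sgn: "x \<in> Obj C \<Longrightarrow> u \<in> Car M x n \<Longrightarrow> MDiff M x n (sgn_pow p u) = sgn_pow p (MDiff M x n u)"
  using lin_sgn_pow mdiff_linear by blast

lemma dd: "x \<in> Obj C \<Longrightarrow> m \<in> Car M x n \<Longrightarrow> k = n + 1 \<Longrightarrow> MDiff M x k (MDiff M x n m) = 0"
  using mdiff_mdiff by simp

lemma act_linear_left:
  "\<lbrakk>x \<in> Obj C; y \<in> Obj C; f \<in> Hom C x y j\<rbrakk> \<Longrightarrow> linear_map_on (Car M y i) (\<lambda>m. Act M x y i j m f)"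
  using act_bilinear[of x y i j] by (simp add: bilinear_map_on_def)

lemma act_linear_right:
  "\<lbrakk>x \<in> Obj C; y \<in> Obj C; m \<in> Car M y i\<rbrakk> \<Longrightarrow> linear_map_on (Hom C x y j) (\<lambda>f. Act M x y i j m f)"
  using act_bilinear[of x y i j] by (simp add: bilinear_map_on_def)

lemma act_add:
  "\<lbrakk>x \<in> Obj C; y \<in> Obj C; u \<in> Car M y i; v \<in> Car M y i; f \<in> Hom C x y j\<rbrakk>
    \<Longrightarrow> Act M x y i j (u + v) f = Act M x y i j u f + Act M x y i j v f"
  using lin_add[OF act_linear_left] .

lemma act_minus:
  "\<lbrakk>x \<in> Obj C; y \<in> Obj C; u \<in> Car M y i; f \<in> Hom C x y j\<rbrakk>
    \<Longrightarrow> Act M x y i j (- u) f = - Act M x y i j u f"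
  using lin_minus[OF act_linear_left] .

lemma act_diff:
  "\<lbrakk>x \<in> Obj C; y \<in> Obj C; u \<in> Car M y i; v \<in> Car M y i; f \<in> Hom C x y j\<rbrakk>
    \<Longrightarrow> Act M x y i j (u - v) f = Act M x y i j u f - Act M x y i j v f"
  using lin_diff[OF act_linear_left car_subspace] .

lemma act_scale:
  "\<lbrakk>x \<in> Obj C; y \<in> Obj C; u \<in> Car M y i; f \<in> Hom C x y j\<rbrakk>
    \<Longrightarrow> Act M x y i j (kscale c u) f = kscale c (Act M x y i j u f)"
  using lin_scale[OF act_linear_left] .

lemma act_0:
  "\<lbrakk>x \<in> Obj C; y \<in> Obj C; f \<in> Hom C x y j\<rbrakk> \<Longrightarrow> Act M x y i j 0 f = 0"
  using lin_zero[OF act_linear_left car_subspace] .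

lemma act_sgn:
  "\<lbrakk>x \<in> Obj C; y \<in> Obj C; u \<in> Car M y i; f \<in> Hom C x y j\<rbrakk>
    \<Longrightarrow> Act M x y i j (sgn_pow p u) f = sgn_pow p (Act M x y i j u f)"
  using lin_sgn_pow[OF act_linear_left] .

lemma act_sum:
  "\<lbrakk>x \<in> Obj C; y \<in> Obj C; f \<in> Hom C x y j; \<And>a. a \<in> A \<Longrightarrow> g a \<in> Car M y i\<rbrakk>
    \<Longrightarrow> Act M x y i j (sum g A) f = (\<Sum>a\<in>A. Act M x y i j (g a) f)"
  using lin_sum[OF act_linear_left car_subspace] .

end

text \<open>Compatibility with the differential is left out on purpose: homotopies, which have
  degree -1, and the components of maps into and out of cones are of this kind.\<close>

definition graded_map ::
  "('o, 'a, 'k::field) dgcat \<Rightarrow> int \<Rightarrow> ('o, 'a, 'b, 'k) dgmod \<Rightarrow> ('o, 'a, 'b, 'k) dgmod \<Rightarrow>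
   ('o, 'b, 'k) gmap \<Rightarrow> bool" where
  "graded_map C p M N \<phi> \<longleftrightarrow>
     (\<forall>x\<in>Obj C. \<forall>n. linear_map_on (Car M x n) (\<phi> x n) \<and> (\<forall>m\<in>Car M x n. \<phi> x n m \<in> Car N x (n + p))) \<and>
     (\<forall>x\<in>Obj C. \<forall>y\<in>Obj C. \<forall>i j. \<forall>m\<in>Car M y i. \<forall>f\<in>Hom C x y j.
        \<phi> x (i + j) (Act M x y i j m f) = Act N x y (i + p) j (\<phi> y i m) f)"

lemma graded_mapI:
  assumes "\<And>x n. x \<in> Obj C \<Longrightarrow> linear_map_on (Car M x n) (\<phi> x n)"
    and "\<And>x n m. x \<in> Obj C \<Longrightarrow> m \<in> Car M x n \<Longrightarrow> \<phi> x n m \<in> Car N x (n + p)"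
    and "\<And>x y i j m f. \<lbrakk>x \<in> Obj C; y \<in> Obj C; m \<in> Car M y i; f \<in> Hom C x y j\<rbrakk>
      \<Longrightarrow> \<phi> x (i + j) (Act M x y i j m f) = Act N x y (i + p) j (\<phi> y i m) f"
  shows "graded_map C p M N \<phi>"
  using assms by (simp add: graded_map_def)

lemma mor_iff:
  "dg_morphism C M N \<phi> \<longleftrightarrow> dg_module C M \<and> dg_module C N \<and> graded_map C 0 M N \<phi> \<and>
     (\<forall>x\<in>Obj C. \<forall>n. \<forall>m\<in>Car M x n. \<phi> x (n + 1) (MDiff M x n m) = MDiff N x n (\<phi> x n m))"
  by (auto simp: dg_morphism_def graded_map_def)

lemma dg_morphismI:
  assumes "dg_module C M" "dg_module C N"
    and "\<And>x n. x \<in> Obj C \<Longrightarrow> linear_map_on (Car M x n) (\<phi> x n)"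
    and "\<And>x n m. x \<in> Obj C \<Longrightarrow> m \<in> Car M x n \<Longrightarrow> \<phi> x n m \<in> Car N x n"
    and "\<And>x n m. x \<in> Obj C \<Longrightarrow> m \<in> Car M x n \<Longrightarrow> \<phi> x (n + 1) (MDiff M x n m) = MDiff N x n (\<phi> x n m)"
    and "\<And>x y i j m f. \<lbrakk>x \<in> Obj C; y \<in> Obj C; m \<in> Car M y i; f \<in> Hom C x y j\<rbrakk>
      \<Longrightarrow> \<phi> x (i + j) (Act M x y i j m f) = Act N x y i j (\<phi> y i m) f"
  shows "dg_morphism C M N \<phi>"
  using assms by (simp add: dg_morphism_def)

context
  fixes C :: "('o, 'a, 'k::field) dgcat" and p :: int and M N :: "('o, 'a, 'b, 'k) dgmod" and \<phi>
  assumes gm: "graded_map C p M N \<phi>"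
begin

lemma gr_linear: "x \<in> Obj C \<Longrightarrow> linear_map_on (Car M x n) (\<phi> x n)"
  using gm by (simp add: graded_map_def)

lemma gr_in: "x \<in> Obj C \<Longrightarrow> m \<in> Car M x n \<Longrightarrow> k = n + p \<Longrightarrow> \<phi> x n m \<in> Car N x k"
  using gm by (simp add: graded_map_def)

lemma gr_act: "\<lbrakk>x \<in> Obj C; y \<in> Obj C; m \<in> Car M y i; f \<in> Hom C x y j; k = i + j; l = i + p\<rbrakk>
      \<Longrightarrow> \<phi> x k (Act M x y i j m f) = Act N x y l j (\<phi> y i m) f"
  using gm by (simp add: graded_map_def)

lemma gr_add: "x \<in> Obj C \<Longrightarrow> u \<in> Car M x n \<Longrightarrow> v \<in> Car M x n \<Longrightarrow> \<phi> x n (u + v) = \<phi> x n u + \<phi> x n v"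
  using lin_add gr_linear by blast

lemma gr_minus: "x \<in> Obj C \<Longrightarrow> u \<in> Car M x n \<Longrightarrow> \<phi> x n (- u) = - \<phi> x n u"
  using lin_minus gr_linear by blast

lemma gr_scale: "x \<in> Obj C \<Longrightarrow> u \<in> Car M x n \<Longrightarrow> \<phi> x n (kscale c u) = kscale c (\<phi> x n u)"
  using lin_scale gr_linear by blast

end

context
  fixes C :: "('o, 'a, 'k::field) dgcat" and M N :: "('o, 'a, 'b, 'k) dgmod" and \<phi>
  assumes mor: "dg_morphism C M N \<phi>"
begin

lemma mor_source: "dg_module C M"
  using mor by (simp add: dg_morphism_def)

lemma mor_target: "dg_module C N"
  using mor by (simp add: dg_morphism_def)

lemma mor_graded: "graded_map C 0 M N \<phi>"
  using mor by (simp add: mor_iff)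

lemma mor_linear: "x \<in> Obj C \<Longrightarrow> linear_map_on (Car M x n) (\<phi> x n)"
  using mor by (simp add: dg_morphism_def)

lemma mor_in: "x \<in> Obj C \<Longrightarrow> m \<in> Car M x n \<Longrightarrow> \<phi> x n m \<in> Car N x n"
  using mor by (simp add: dg_morphism_def)

lemma mor_d: "x \<in> Obj C \<Longrightarrow> m \<in> Car M x n \<Longrightarrow> k = n + 1 \<Longrightarrow> \<phi> x k (MDiff M x n m) = MDiff N x n (\<phi> x n m)"
  using mor by (simp add: dg_morphism_def)

lemma mor_act: "\<lbrakk>x \<in> Obj C; y \<in> Obj C; m \<in> Car M y i; f \<in> Hom C x y j; k = i + j\<rbrakk>
      \<Longrightarrow> \<phi> x k (Act M x y i j m f) = Act N x y i j (\<phi> y i m) f"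
  using mor by (simp add: dg_morphism_def)

lemma mor_add: "x \<in> Obj C \<Longrightarrow> u \<in> Car M x n \<Longrightarrow> v \<in> Car M x n \<Longrightarrow> \<phi> x n (u + v) = \<phi> x n u + \<phi> x n v"
  using lin_add mor_linear by blast

lemma mor_minus: "x \<in> Obj C \<Longrightarrow> u \<in> Car M x n \<Longrightarrow> \<phi> x n (- u) = - \<phi> x n u"
  using lin_minus mor_linear by blast

lemma mor_0: "x \<in> Obj C \<Longrightarrow> \<phi> x n 0 = 0"
  using lin_zero mor_linear dg_module.car_subspace[OF mor_source] by blast

lemma mor_diff: "x \<in> Obj C \<Longrightarrow> u \<in> Car M x n \<Longrightarrow> v \<in> Car M x n \<Longrightarrow> \<phi> x n (u - v) = \<phi> x n u - \<phi> x n v"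
  using lin_diff mor_linear dg_module.car_subspace[OF mor_source] by blast

lemma mor_scale: "x \<in> Obj C \<Longrightarrow> u \<in> Car M x n \<Longrightarrow> \<phi> x n (kscale c u) = kscale c (\<phi> x n u)"
  using lin_scale mor_linear by blast

lemma mor_sgn: "x \<in> Obj C \<Longrightarrow> u \<in> Car M x n \<Longrightarrow> \<phi> x n (sgn_pow p u) = sgn_pow p (\<phi> x n u)"
  using lin_sgn_pow mor_linear by blast

lemma mor_sum: "x \<in> Obj C \<Longrightarrow> (\<And>i. i \<in> A \<Longrightarrow> g i \<in> Car M x n) \<Longrightarrow> \<phi> x n (sum g A) = (\<Sum>i\<in>A. \<phi> x n (g i))"
  using lin_sum[OF mor_linear dg_module.car_subspace[OF mor_source]] by blast

end

lemma mor_id: "dg_module C M \<Longrightarrow> dg_morphism C M M (\<lambda>x n m. m)"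
  by (simp add: dg_morphism_def lin_id)

lemma mor_comp:
  assumes f: "dg_morphism C L M f" and g: "dg_morphism C M N g"
  shows "dg_morphism C L N (\<lambda>x n m. g x n (f x n m))"
proof (rule dg_morphismI)
  fix x n assume "x \<in> Obj C"
  then show "linear_map_on (Car L x n) (\<lambda>m. g x n (f x n m))"
    using lin_compose[OF mor_linear[OF f] mor_linear[OF g]] mor_in[OF f] by blast
qed (auto intro: mor_source[OF f] mor_target[OF g] mor_in[OF g] mor_in[OF f]
  simp: mor_d[OF f] mor_d[OF g] mor_act[OF f] mor_act[OF g] mor_in[OF f])

lemma mor_cong:
  assumes f: "dg_morphism C M N f" and eq: "\<And>x n m. x \<in> Obj C \<Longrightarrow> m \<in> Car M x n \<Longrightarrow> g x n m = f x n m"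
  shows "dg_morphism C M N g"
proof -
  interpret M: dg_module C M using mor_source[OF f] .
  show ?thesis
    by (rule dg_morphismI)
      (auto simp: mor_source[OF f] mor_target[OF f] mor_in[OF f] eq M.d_in M.act_in
        mor_d[OF f] mor_act[OF f]
        intro!: lin_cong[OF mor_linear[OF f]] M.car_subspace)
qed

lemma mor_plus:
  assumes f: "dg_morphism C M N f" and g: "dg_morphism C M N g"
  shows "dg_morphism C M N (\<lambda>x n m. f x n m + g x n m)"
proof -
  interpret M: dg_module C M using mor_source[OF f] .
  interpret N: dg_module C N using mor_target[OF f] .
  show ?thesis
    by (rule dg_morphismI)
      (auto simp: M.dg_module_axioms N.dg_module_axioms mor_in[OF f] mor_in[OF g] N.mem
        mor_d[OF f] mor_act[OF f] mor_d[OF g] mor_act[OF g] N.d_add N.act_add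
        intro!: lin_plus mor_linear[OF f] mor_linear[OF g])
qed

lemma mor_uminus:
  assumes f: "dg_morphism C M N f"
  shows "dg_morphism C M N (\<lambda>x n m. - f x n m)"
proof -
  interpret M: dg_module C M using mor_source[OF f] .
  interpret N: dg_module C N using mor_target[OF f] .
  show ?thesis
    by (rule dg_morphismI)
      (auto simp: M.dg_module_axioms N.dg_module_axioms mor_in[OF f] N.mem
        mor_d[OF f] mor_act[OF f] N.d_minus N.act_minus
        intro!: lin_uminus mor_linear[OF f])
qed

lemma mor_minus_fun:
  assumes f: "dg_morphism C M N f" and g: "dg_morphism C M N g"
  shows "dg_morphism C M N (\<lambda>x n m. f x n m - g x n m)"
  using mor_plus[OF f mor_uminus[OF g]] by simp

lemma mor_const0:
  assumes M: "dg_module C M" and N: "dg_module C N"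
  shows "dg_morphism C M N (\<lambda>x n m. 0)"
proof -
  interpret N: dg_module C N using N .
  show ?thesis
    by (rule dg_morphismI) (auto simp: M N N.mem_0 N.d_0 N.act_0 lin_const0)
qed

lemma mor_sum_fun:
  assumes "dg_module C M" "dg_module C N" "\<And>i. i \<in> A \<Longrightarrow> dg_morphism C M N (f i)"
  shows "dg_morphism C M N (\<lambda>x n m. \<Sum>i\<in>A. f i x n m)"
  using assms(3)
  by (induction A rule: infinite_finite_induct) (auto simp: mor_const0 assms(1,2) mor_plus)

text \<open>A homotopy has degree -1; as modules are right modules, it commutes with the action without a sign.\<close>

definition null_homotopic ::
  "('o, 'a, 'k::field) dgcat \<Rightarrow> ('o, 'a, 'b, 'k) dgmod \<Rightarrow> ('o, 'a, 'b, 'k) dgmod \<Rightarrow>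
   ('o, 'b, 'k) gmap \<Rightarrow> bool" where
  "null_homotopic C M N f \<longleftrightarrow> (\<exists>h. graded_map C (-1) M N h \<and> (\<forall>x\<in>Obj C. \<forall>n. \<forall>m\<in>Car M x n.
     f x n m = MDiff N x (n - 1) (h x n m) + h x (n + 1) (MDiff M x n m)))"

lemma null_homotopicI:
  assumes "graded_map C (-1) M N h"
    and "\<And>x n m. x \<in> Obj C \<Longrightarrow> m \<in> Car M x n \<Longrightarrow> f x n m = MDiff N x (n - 1) (h x n m) + h x (n + 1) (MDiff M x n m)"
  shows "null_homotopic C M N f"
  using assms by (auto simp: null_homotopic_def)

lemma gr_plus:
  assumes N: "dg_module C N" and f: "graded_map C p M N f" and g: "graded_map C p M N g"
  shows "graded_map C p M N (\<lambda>x n m. f x n m + g x n m)"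
proof -
  interpret N: dg_module C N using N .
  show ?thesis
    by (rule graded_mapI)
      (auto simp: gr_in[OF f] gr_in[OF g] N.mem N.act_add
        gr_act[OF f] gr_act[OF g]
        intro!: lin_plus gr_linear[OF f] gr_linear[OF g])
qed

lemma gr_uminus:
  assumes N: "dg_module C N" and f: "graded_map C p M N f"
  shows "graded_map C p M N (\<lambda>x n m. - f x n m)"
proof -
  interpret N: dg_module C N using N .
  show ?thesis
    by (rule graded_mapI)
      (auto simp: gr_in[OF f] N.mem N.act_minus gr_act[OF f]
        intro!: lin_uminus gr_linear[OF f])
qed

lemma gr_comp:
  assumes f: "graded_map C p L M f" and g: "graded_map C q M N g" and r: "r = p + q"
  shows "graded_map C r L N (\<lambda>x n m. g x (n + p) (f x n m))"
proof (rule graded_mapI)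
  fix x n assume "x \<in> Obj C"
  then show "linear_map_on (Car L x n) (\<lambda>m. g x (n + p) (f x n m))"
    using lin_compose[OF gr_linear[OF f] gr_linear[OF g]] gr_in[OF f] by blast
next
  fix x n m assume "x \<in> Obj C" "m \<in> Car L x n"
  then show "g x (n + p) (f x n m) \<in> Car N x (n + r)"
    by (intro gr_in[OF g] gr_in[OF f]) (auto simp: r)
next
  fix x y i j m a assume *: "x \<in> Obj C" "y \<in> Obj C" "m \<in> Car L y i" "a \<in> Hom C x y j"
  show "g x (i + j + p) (f x (i + j) (Act L x y i j m a)) = Act N x y (i + r) j (g y (i + p) (f y i m)) a"
    using * by (subst gr_act[OF f], simp_all, subst gr_act[OF g]) (auto simp: gr_in[OF f] r)
qed

lemma null_homotopic_plus:
  assumes "dg_module C N" "dg_module C M" and f: "null_homotopic C M N f" and g: "null_homotopic C M N g"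
  shows "null_homotopic C M N (\<lambda>x n m. f x n m + g x n m)"
proof -
  interpret N: dg_module C N by fact
  obtain h k where h: "graded_map C (-1) M N h" "\<And>x n m. x \<in> Obj C \<Longrightarrow> m \<in> Car M x n \<Longrightarrow> f x n m = MDiff N x (n - 1) (h x n m) + h x (n + 1) (MDiff M x n m)"
    and k: "graded_map C (-1) M N k" "\<And>x n m. x \<in> Obj C \<Longrightarrow> m \<in> Car M x n \<Longrightarrow> g x n m = MDiff N x (n - 1) (k x n m) + k x (n + 1) (MDiff M x n m)"
    using f g unfolding null_homotopic_def by metis
  show ?thesis
    by (rule null_homotopicI[OF gr_plus[OF N.dg_module_axioms h(1) k(1)]])
      (simp add: h(2) k(2) N.d_add gr_in[OF h(1)] gr_in[OF k(1)])
qed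

lemma null_homotopic_cong:
  assumes "null_homotopic C M N f" "\<And>x n m. x \<in> Obj C \<Longrightarrow> m \<in> Car M x n \<Longrightarrow> g x n m = f x n m"
  shows "null_homotopic C M N g"
  using assms unfolding null_homotopic_def by fastforce

lemma null_homotopic_post:
  assumes f: "null_homotopic C L M f" and g: "dg_morphism C M N g" and L: "dg_module C L"
  shows "null_homotopic C L N (\<lambda>x n m. g x n (f x n m))"
proof -
  interpret L: dg_module C L by fact
  interpret M: dg_module C M using mor_source[OF g] .
  obtain h where h: "graded_map C (-1) L M h" "\<And>x n m. x \<in> Obj C \<Longrightarrow> m \<in> Car L x n \<Longrightarrow> f x n m = MDiff M x (n - 1) (h x n m) + h x (n + 1) (MDiff L x n m)"
    using f unfolding null_homotopic_def by metis
  have k: "graded_map C (-1) L N (\<lambda>x n m. g x (n - 1) (h x n m))"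
    using gr_comp[OF h(1) mor_graded[OF g]] by simp
  show ?thesis
  proof (rule null_homotopicI[OF k])
    fix x n m assume *: "x \<in> Obj C" "m \<in> Car L x n"
    have "h x (n + 1) (MDiff L x n m) \<in> Car M x n" "h x n m \<in> Car M x (n - 1)"
      by (auto intro!: gr_in[OF h(1)] L.d_in *)
    then show "g x n (f x n m) = MDiff N x (n - 1) (g x (n - 1) (h x n m)) + g x (n + 1 - 1) (h x (n + 1) (MDiff L x n m))"
      by (simp add: h(2) * mor_add[OF g] M.d_in mor_d[OF g])
  qed
qed

lemma null_homotopic_pre:
  assumes f: "dg_morphism C L M f" and g: "null_homotopic C M N g"
  shows "null_homotopic C L N (\<lambda>x n m. g x n (f x n m))"
proof -
  interpret L: dg_module C L using mor_source[OF f] .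
  obtain h where h: "graded_map C (-1) M N h" "\<And>x n m. x \<in> Obj C \<Longrightarrow> m \<in> Car M x n \<Longrightarrow> g x n m = MDiff N x (n - 1) (h x n m) + h x (n + 1) (MDiff M x n m)"
    using g unfolding null_homotopic_def by metis
  have k: "graded_map C (-1) L N (\<lambda>x n m. h x n (f x n m))"
    using gr_comp[OF mor_graded[OF f] h(1)] by simp
  show ?thesis
    by (rule null_homotopicI[OF k]) (simp add: h(2) mor_in[OF f] mor_d[OF f])
qed


section \<open>Quasi-isomorphisms\<close>

lemma quasi_isoI:
  assumes "dg_morphism C M N \<phi>"
    and "\<And>x n m u. \<lbrakk>x \<in> Obj C; m \<in> Car M x n; MDiff M x n m = 0; u \<in> Car N x (n - 1); \<phi> x n m = MDiff N x (n - 1) u\<rbrakk>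
      \<Longrightarrow> \<exists>u\<in>Car M x (n - 1). m = MDiff M x (n - 1) u"
    and "\<And>x n v. \<lbrakk>x \<in> Obj C; v \<in> Car N x n; MDiff N x n v = 0\<rbrakk>
      \<Longrightarrow> \<exists>m\<in>Car M x n. \<exists>u\<in>Car N x (n - 1). MDiff M x n m = 0 \<and> v = \<phi> x n m + MDiff N x (n - 1) u"
  shows "quasi_iso C M N \<phi>"
  using assms by (auto simp: quasi_iso_def)

lemma quasi_iso_mor: "quasi_iso C M N \<phi> \<Longrightarrow> dg_morphism C M N \<phi>"
  by (simp add: quasi_iso_def)

lemma quasi_iso_inj:
  "\<lbrakk>quasi_iso C M N \<phi>; x \<in> Obj C; m \<in> Car M x n; MDiff M x n m = 0; u \<in> Car N x k; \<phi> x n m = MDiff N x k u; k = n - 1\<rbrakk>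
    \<Longrightarrow> \<exists>u\<in>Car M x (n - 1). m = MDiff M x (n - 1) u"
  unfolding quasi_iso_def by blast

lemma quasi_iso_surj:
  "\<lbrakk>quasi_iso C M N \<phi>; x \<in> Obj C; v \<in> Car N x n; MDiff N x n v = 0\<rbrakk>
    \<Longrightarrow> \<exists>m\<in>Car M x n. \<exists>u\<in>Car N x (n - 1). MDiff M x n m = 0 \<and> v = \<phi> x n m + MDiff N x (n - 1) u"
  unfolding quasi_iso_def by blast

lemma quasi_iso_bij:
  assumes f: "dg_morphism C M N \<phi>"
    and bij: "\<And>x n. x \<in> Obj C \<Longrightarrow> bij_betw (\<phi> x n) (Car M x n) (Car N x n)"
  shows "quasi_iso C M N \<phi>"
proof -
  interpret M: dg_module C M using mor_source[OF f] .
  interpret N: dg_module C N using mor_target[OF f] .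
  have inj: "u = v" if "x \<in> Obj C" "u \<in> Car M x n" "v \<in> Car M x n" "\<phi> x n u = \<phi> x n v" for x n u v
    using bij[of x n] that by (auto simp: bij_betw_def inj_on_def)
  have surj: "\<exists>u\<in>Car M x n. v = \<phi> x n u" if "x \<in> Obj C" "v \<in> Car N x n" for x n v
    using bij[of x n] that by (auto simp: bij_betw_def)
  show ?thesis
  proof (rule quasi_isoI[OF f])
    fix x n m u assume *: "x \<in> Obj C" "m \<in> Car M x n" "MDiff M x n m = 0" "u \<in> Car N x (n - 1)" "\<phi> x n m = MDiff N x (n - 1) u"
    obtain w where w: "w \<in> Car M x (n - 1)" "u = \<phi> x (n - 1) w" using surj * by blast
    have dw: "MDiff M x (n - 1) w \<in> Car M x n" using * w by (auto intro!: M.d_in)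
    have "m = MDiff M x (n - 1) w"
      by (rule inj[of x _ n]) (use * w dw in \<open>auto simp: mor_d[OF f]\<close>)
    with w show "\<exists>u\<in>Car M x (n - 1). m = MDiff M x (n - 1) u" by blast
  next
    fix x n v assume *: "x \<in> Obj C" "v \<in> Car N x n" "MDiff N x n v = 0"
    obtain m where m: "m \<in> Car M x n" "v = \<phi> x n m" using surj * by blast
    have "MDiff M x n m = 0"
      by (rule inj[of x _ "n+1"]) (use * m in \<open>auto simp: mor_d[OF f] mor_0[OF f] M.mem_0 M.d_in\<close>)
    then show "\<exists>m\<in>Car M x n. \<exists>u\<in>Car N x (n - 1). MDiff M x n m = 0 \<and> v = \<phi> x n m + MDiff N x (n - 1) u"
      using m * by (intro bexI[of _ m] bexI[of _ 0]) (auto simp: N.d_0 N.mem_0)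
  qed
qed

lemma quasi_iso_id: "dg_module C M \<Longrightarrow> quasi_iso C M M (\<lambda>x n m. m)"
  by (rule quasi_iso_bij[OF mor_id]) (auto simp: bij_betw_def)

lemma quasi_iso_comp:
  assumes f: "quasi_iso C L M f" and g: "quasi_iso C M N g"
  shows "quasi_iso C L N (\<lambda>x n m. g x n (f x n m))"
proof -
  note fm = quasi_iso_mor[OF f] and gm = quasi_iso_mor[OF g]
  interpret L: dg_module C L using mor_source[OF fm] .
  interpret M: dg_module C M using mor_source[OF gm] .
  interpret N: dg_module C N using mor_target[OF gm] .
  show ?thesis
  proof (rule quasi_isoI[OF mor_comp[OF fm gm]])
    fix x n m u assume *: "x \<in> Obj C" "m \<in> Car L x n" "MDiff L x n m = 0" "u \<in> Car N x (n - 1)" "g x n (f x n m) = MDiff N x (n - 1) u"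
    have "MDiff M x n (f x n m) = 0" using * mor_d[OF fm, of x m n] mor_0[OF fm] by simp
    from quasi_iso_inj[OF g *(1) mor_in[OF fm] this *(4,5)] *
    obtain w where "w \<in> Car M x (n - 1)" "f x n m = MDiff M x (n - 1) w" by blast
    from quasi_iso_inj[OF f *(1,2,3) this] show "\<exists>u\<in>Car L x (n - 1). m = MDiff L x (n - 1) u" by simp
  next
    fix x n v assume *: "x \<in> Obj C" "v \<in> Car N x n" "MDiff N x n v = 0"
    obtain m u where m: "m \<in> Car M x n" "u \<in> Car N x (n - 1)" "MDiff M x n m = 0" "v = g x n m + MDiff N x (n - 1) u"
      using quasi_iso_surj[OF g *] by blast
    obtain l w where l: "l \<in> Car L x n" "w \<in> Car M x (n - 1)" "MDiff L x n l = 0" "m = f x n l + MDiff M x (n - 1) w"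
      using quasi_iso_surj[OF f *(1) m(1) m(3)] by blast
    have fl: "f x n l \<in> Car M x n" "MDiff M x (n - 1) w \<in> Car M x n" "g x (n - 1) w \<in> Car N x (n - 1)"
      using * l by (auto intro!: M.d_in mor_in[OF fm] mor_in[OF gm])
    have "v = g x n (f x n l) + MDiff N x (n - 1) (g x (n - 1) w + u)"
      using * m l fl by (simp add: mor_add[OF gm] mor_d[OF gm] N.d_add)
    then show "\<exists>m\<in>Car L x n. \<exists>u\<in>Car N x (n - 1). MDiff L x n m = 0 \<and> v = g x n (f x n m) + MDiff N x (n - 1) u"
      using l m fl * by (intro bexI[of _ l] bexI[of _ "g x (n - 1) w + u"]) (auto simp: N.mem)
  qed
qed

text \<open>Two out of three, in the form which shows that a lift of a resolution along a
  quasi-isomorphism is again a resolution.\<close>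

lemma quasi_iso_cancel_left:
  assumes g: "quasi_iso C M N g" and gf: "quasi_iso C L N (\<lambda>x n m. g x n (f x n m))" and fm: "dg_morphism C L M f"
  shows "quasi_iso C L M f"
proof -
  note gm = quasi_iso_mor[OF g]
  interpret L: dg_module C L using mor_source[OF fm] .
  interpret M: dg_module C M using mor_source[OF gm] .
  interpret N: dg_module C N using mor_target[OF gm] .
  show ?thesis
  proof (rule quasi_isoI[OF fm])
    fix x n m u assume *: "x \<in> Obj C" "m \<in> Car L x n" "MDiff L x n m = 0" "u \<in> Car M x (n - 1)" "f x n m = MDiff M x (n - 1) u"
    have "g x n (f x n m) = MDiff N x (n - 1) (g x (n - 1) u)"
      using * by (simp add: mor_d[OF gm])
    then show "\<exists>u\<in>Car L x (n - 1). m = MDiff L x (n - 1) u"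
      using quasi_iso_inj[OF gf *(1-3), of "g x (n - 1) u"] * by (simp add: mor_in[OF gm])
  next
    fix x n v assume *: "x \<in> Obj C" "v \<in> Car M x n" "MDiff M x n v = 0"
    have "g x n v \<in> Car N x n" "MDiff N x n (g x n v) = 0"
      using * mor_d[OF gm, of x v n] by (auto simp: mor_in[OF gm] mor_0[OF gm])
    from quasi_iso_surj[OF gf *(1) this] obtain l u where l: "l \<in> Car L x n" "u \<in> Car N x (n - 1)" "MDiff L x n l = 0"
       "g x n v = g x n (f x n l) + MDiff N x (n - 1) u" by blast
    have fl: "f x n l \<in> Car M x n" "MDiff M x n (f x n l) = 0"
      using l * mor_d[OF fm, of x l n] by (auto simp: mor_in[OF fm] mor_0[OF fm])
    have "g x n (v - f x n l) = MDiff N x (n - 1) u" using l fl * by (simp add: mor_diff[OF gm])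
    moreover have "MDiff M x n (v - f x n l) = 0" using fl * by (simp add: M.d_diff)
    ultimately obtain w where "w \<in> Car M x (n - 1)" "v - f x n l = MDiff M x (n - 1) w"
      using quasi_iso_inj[OF g *(1) _ _ l(2)] M.mem_diff * fl by blast
    then show "\<exists>m\<in>Car L x n. \<exists>u\<in>Car M x (n - 1). MDiff L x n m = 0 \<and> v = f x n m + MDiff M x (n - 1) u"
      using l by (intro bexI[of _ l] bexI[of _ w]) (auto simp: algebra_simps)
  qed
qed

text \<open>On a cycle the two maps differ by the boundary of the value of the homotopy, so they
  agree in cohomology.\<close>

lemma quasi_iso_homotopic:
  assumes f: "quasi_iso C M N f" and gm: "dg_morphism C M N g" and h: "null_homotopic C M N (\<lambda>x n m. f x n m - g x n m)"
  shows "quasi_iso C M N g"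
proof -
  note fm = quasi_iso_mor[OF f]
  interpret M: dg_module C M using mor_source[OF gm] .
  interpret N: dg_module C N using mor_target[OF gm] .
  obtain h where h: "graded_map C (-1) M N h" "\<And>x n m. x \<in> Obj C \<Longrightarrow> m \<in> Car M x n \<Longrightarrow>
     f x n m - g x n m = MDiff N x (n - 1) (h x n m) + h x (n + 1) (MDiff M x n m)"
    using h unfolding null_homotopic_def by metis
  have h0: "h x n 0 = 0" if "x \<in> Obj C" for x n
    using lin_zero[OF gr_linear[OF h(1)] M.car_subspace] that by blast
  have hin: "h x n m \<in> Car N x (n - 1)" if "x \<in> Obj C" "m \<in> Car M x n" for x n m
    using gr_in[OF h(1) that] by simp
  have eq: "f x n m = g x n m + MDiff N x (n - 1) (h x n m)" if "x \<in> Obj C" "m \<in> Car M x n" "MDiff M x n m = 0" for x n m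
    using h(2)[OF that(1,2)] that by (simp add: h0 algebra_simps)
  show ?thesis
  proof (rule quasi_isoI[OF gm])
    fix x n m u assume *: "x \<in> Obj C" "m \<in> Car M x n" "MDiff M x n m = 0" "u \<in> Car N x (n - 1)" "g x n m = MDiff N x (n - 1) u"
    have e: "f x n m = MDiff N x (n - 1) (u + h x n m)" using eq[OF *(1-3)] * hin by (simp add: N.d_add)
    show "\<exists>u\<in>Car M x (n - 1). m = MDiff M x (n - 1) u"
      using quasi_iso_inj[OF f *(1-3) _ e] * hin by (simp add: N.mem)
  next
    fix x n v assume *: "x \<in> Obj C" "v \<in> Car N x n" "MDiff N x n v = 0"
    obtain m u where m: "m \<in> Car M x n" "u \<in> Car N x (n - 1)" "MDiff M x n m = 0" "v = f x n m + MDiff N x (n - 1) u"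
      using quasi_iso_surj[OF f *] by blast
    then have "v = g x n m + MDiff N x (n - 1) (h x n m + u)"
      using eq[of x m n] * hin by (simp add: N.d_add)
    then show "\<exists>m\<in>Car M x n. \<exists>u\<in>Car N x (n - 1). MDiff M x n m = 0 \<and> v = g x n m + MDiff N x (n - 1) u"
      using m * hin by (intro bexI[of _ m] bexI[of _ "h x n m + u"]) (auto simp: N.mem)
  qed
qed

lemma quasi_iso_acyclic:
  assumes f: "quasi_iso C M N f"
  shows "acyclic_module C M \<longleftrightarrow> acyclic_module C N"
proof -
  note fm = quasi_iso_mor[OF f]
  interpret M: dg_module C M using mor_source[OF fm] .
  interpret N: dg_module C N using mor_target[OF fm] .
  show ?thesis
  proof
    assume A: "acyclic_module C M"
    show "acyclic_module C N"
      unfolding acyclic_module_def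
    proof (intro conjI ballI allI impI N.dg_module_axioms)
      fix x n v assume *: "x \<in> Obj C" "v \<in> Car N x n" "MDiff N x n v = 0"
      obtain m u where m: "m \<in> Car M x n" "u \<in> Car N x (n - 1)" "MDiff M x n m = 0" "v = f x n m + MDiff N x (n - 1) u"
        using quasi_iso_surj[OF f *] by blast
      obtain w where w: "w \<in> Car M x (n - 1)" "m = MDiff M x (n - 1) w"
        using A m * unfolding acyclic_module_def by blast
      have "v = MDiff N x (n - 1) (f x (n - 1) w + u)"
        using w m * by (simp add: N.d_add mor_d[OF fm] mor_in[OF fm])
      then show "\<exists>u\<in>Car N x (n - 1). v = MDiff N x (n - 1) u"
        using w m * by (intro bexI[of _ "f x (n - 1) w + u"]) (auto simp: N.mem mor_in[OF fm])
    qed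
  next
    assume A: "acyclic_module C N"
    show "acyclic_module C M"
      unfolding acyclic_module_def
    proof (intro conjI ballI allI impI M.dg_module_axioms)
      fix x n m assume *: "x \<in> Obj C" "m \<in> Car M x n" "MDiff M x n m = 0"
      have "MDiff N x n (f x n m) = 0" using * mor_d[OF fm, of x m n] by (simp add: mor_0[OF fm])
      then obtain u where "u \<in> Car N x (n - 1)" "f x n m = MDiff N x (n - 1) u"
        using A * mor_in[OF fm *(1,2)] unfolding acyclic_module_def by blast
      then show "\<exists>u\<in>Car M x (n - 1). m = MDiff M x (n - 1) u"
        using quasi_iso_inj[OF f *] by blast
    qed
  qed
qed

lemma acyclic_quasi_iso:
  assumes f: "dg_morphism C M N f" and M: "acyclic_module C M" and N: "acyclic_module C N"
  shows "quasi_iso C M N f"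
proof (rule quasi_isoI[OF f])
  fix x n m u assume "x \<in> Obj C" "m \<in> Car M x n" "MDiff M x n m = 0"
  then show "\<exists>u\<in>Car M x (n - 1). m = MDiff M x (n - 1) u"
    using M unfolding acyclic_module_def by blast
next
  fix x n v assume *: "x \<in> Obj C" "v \<in> Car N x n" "MDiff N x n v = 0"
  then obtain u where "u \<in> Car N x (n - 1)" "v = MDiff N x (n - 1) u"
    using N unfolding acyclic_module_def by blast
  then show "\<exists>m\<in>Car M x n. \<exists>u\<in>Car N x (n - 1). MDiff M x n m = 0 \<and> v = f x n m + MDiff N x (n - 1) u"
    using * dg_module.mem_0[OF mor_source[OF f]] dg_module.d_0[OF mor_source[OF f]] mor_0[OF f]
    by (intro bexI[of _ 0] bexI[of _ u]) auto
qed

lemma acyclicD: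
  "\<lbrakk>acyclic_module C M; x \<in> Obj C; m \<in> Car M x n; MDiff M x n m = 0; k = n - 1\<rbrakk> \<Longrightarrow> \<exists>u\<in>Car M x k. m = MDiff M x k u"
  unfolding acyclic_module_def by blast

section \<open>Isomorphism in the derived category\<close>

lemma derived_iso_refl: "dg_module C M \<Longrightarrow> derived_iso C M M"
  by (simp add: derived_iso_def)

lemma derived_iso_sym: "derived_iso C M N \<Longrightarrow> derived_iso C N M"
  by (auto simp: derived_iso_def intro: equivclp_sym)

lemma derived_iso_trans: "derived_iso C L M \<Longrightarrow> derived_iso C M N \<Longrightarrow> derived_iso C L N"
  by (auto simp: derived_iso_def intro: equivclp_trans)

lemma derived_iso_quasi_iso: "quasi_iso C M N \<phi> \<Longrightarrow> derived_iso C M N"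
  using mor_source[OF quasi_iso_mor] mor_target[OF quasi_iso_mor]
  by (auto simp: derived_iso_def)

text \<open>A zigzag is traversed arrow by arrow, so what is transported along quasi-isomorphisms in
  both directions is an invariant of objects of the derived category.\<close>

lemma derived_iso_induct [consumes 1, case_names refl forward backward]:
  assumes "derived_iso C M N" "P M"
    and fw: "\<And>X Y \<phi>. P X \<Longrightarrow> quasi_iso C X Y \<phi> \<Longrightarrow> P Y"
    and bw: "\<And>X Y \<phi>. P Y \<Longrightarrow> quasi_iso C X Y \<phi> \<Longrightarrow> P X"
  shows "P N"
proof -
  have "equivclp (\<lambda>M' N'. \<exists>\<phi>. quasi_iso C M' N' \<phi>) M N" using assms(1) by (simp add: derived_iso_def)
  then show ?thesis
    by (induction rule: equivclp_induct) (use assms(2) fw bw in blast)+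
qed


section \<open>Families of vectors coded in one vector\<close>

text \<open>Any bijection will do; the locale \<open>coded\<close> guarantees that one exists.
  Through it a vector over \<open>'b\<close> is the same thing as a finite family of vectors over
  \<open>'b\<close> indexed by \<open>'j\<close>: \<open>push\<close> is the inclusion of a summand
  and \<open>prj\<close> the projection onto it. This keeps direct sums in the universe.\<close>

definition code :: "'j \<times> 'b \<Rightarrow> 'b" where
  "code = (SOME e. bij e)"

definition push :: "'j \<Rightarrow> ('b, 'k::field) vec \<Rightarrow> ('b, 'k) vec" where
  "push j v = (\<Sum>b\<in>Poly_Mapping.keys v. Poly_Mapping.single (code (j, b)) (Poly_Mapping.lookup v b))"

definition prj :: "'j \<Rightarrow> ('b, 'k::field) vec \<Rightarrow> ('b, 'k) vec" where
  "prj j t = Poly_Mapping.map_key (\<lambda>b. code (j, b)) t"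

locale coded =
  fixes index :: "'j itself" and basis :: "'b itself"
  assumes ex_code: "\<exists>e :: 'j \<times> 'b \<Rightarrow> 'b. bij e"
begin

lemma bij_code: "bij (code :: 'j \<times> 'b \<Rightarrow> 'b)"
  unfolding code_def using ex_code by (rule someI_ex)

lemma code_eq_iff [simp]: "code (i :: 'j, a :: 'b) = code (j, b) \<longleftrightarrow> i = j \<and> a = b"
  using bij_code by (auto simp: bij_def dest: injD)

lemma ex_code_eq: "\<exists>i a. k = (code :: 'j \<times> 'b \<Rightarrow> 'b) (i, a)"
  using bij_code by (metis bij_pointE surj_pair)

lemma lookup_prj [simp]: "Poly_Mapping.lookup (prj (j :: 'j) (t :: ('b, 'k::field) vec)) b = Poly_Mapping.lookup t (code (j, b))"
proof -
  have "inj (\<lambda>b :: 'b. code (j, b))" by (rule injI) simp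
  then show ?thesis unfolding prj_def by (simp add: map_key.rep_eq)
qed

lemma lookup_push [simp]:
  "Poly_Mapping.lookup (push (j :: 'j) (v :: ('b, 'k::field) vec)) (code (i, b)) = (if i = j then Poly_Mapping.lookup v b else 0)"
proof -
  have "Poly_Mapping.lookup (push j v) (code (i, b)) =
     (\<Sum>a\<in>Poly_Mapping.keys v. if a = b \<and> i = j then Poly_Mapping.lookup v a else 0)"
    unfolding push_def lookup_sum by (rule sum.cong) (auto simp: lookup_single when_def)
  also have "\<dots> = (if i = j then Poly_Mapping.lookup v b else 0)"
    by (cases "i = j") (auto simp: in_keys_iff)
  finally show ?thesis .
qed

lemma vec_eqI:
  fixes s t :: "('b, 'k::field) vec"
  assumes "\<And>j :: 'j. prj j s = prj j t"
  shows "s = t"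
proof (rule poly_mapping_eqI)
  fix k :: 'b
  obtain j a where "k = code (j :: 'j, a)" using ex_code_eq[of k] by blast
  then show "Poly_Mapping.lookup s k = Poly_Mapping.lookup t k"
    using assms[of j] by (metis lookup_prj)
qed

lemma prj_push: "prj (i :: 'j) (push j (v :: ('b, 'k::field) vec)) = (if i = j then v else 0)"
  by (rule poly_mapping_eqI) simp

lemma prj_push_same [simp]: "prj (j :: 'j) (push j (v :: ('b, 'k::field) vec)) = v"
  by (simp add: prj_push)

lemma prj_0 [simp]: "prj (j :: 'j) (0 :: ('b, 'k::field) vec) = 0"
  by (rule poly_mapping_eqI) simp

lemma prj_add [simp]: "prj (j :: 'j) (s + t :: ('b, 'k::field) vec) = prj j s + prj j t"
  by (rule poly_mapping_eqI) (simp add: lookup_add)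

lemma prj_minus [simp]: "prj (j :: 'j) (- t :: ('b, 'k::field) vec) = - prj j t"
  by (rule poly_mapping_eqI) simp

lemma prj_diff [simp]: "prj (j :: 'j) (s - t :: ('b, 'k::field) vec) = prj j s - prj j t"
  by (rule poly_mapping_eqI) (simp add: lookup_minus)

lemma prj_scale [simp]: "prj (j :: 'j) (kscale c t :: ('b, 'k::field) vec) = kscale c (prj j t)"
  by (rule poly_mapping_eqI) simp

lemma prj_sgn [simp]: "prj (j :: 'j) (sgn_pow p t :: ('b, 'k::field) vec) = sgn_pow p (prj j t)"
  by (simp add: sgn_pow_def)

lemma prj_sum: "prj (j :: 'j) (sum g A :: ('b, 'k::field) vec) = (\<Sum>a\<in>A. prj j (g a))"
  by (induction A rule: infinite_finite_induct) auto

lemma push_0 [simp]: "push (j :: 'j) (0 :: ('b, 'k::field) vec) = 0"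
  by (rule vec_eqI) (simp add: prj_push)

lemma push_add: "push (j :: 'j) (s + t :: ('b, 'k::field) vec) = push j s + push j t"
  by (rule vec_eqI) (simp add: prj_push)

lemma push_scale: "push (j :: 'j) (kscale c t :: ('b, 'k::field) vec) = kscale c (push j t)"
  by (rule vec_eqI) (simp add: prj_push)

lemma push_sgn: "push (j :: 'j) (sgn_pow p t :: ('b, 'k::field) vec) = sgn_pow p (push j t)"
  by (rule vec_eqI) (simp add: prj_push)

text \<open>The support of a vector is finite, so coded families form the direct sum of their
  components and not the product.\<close>

lemma finite_prj [simp]: "finite {j :: 'j. prj j (t :: ('b, 'k::field) vec) \<noteq> 0}"
proof (rule finite_subset)
  show "{j. prj j t \<noteq> 0} \<subseteq> (\<lambda>k. fst (inv (code :: 'j \<times> 'b \<Rightarrow> 'b) k)) ` Poly_Mapping.keys t"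
  proof
    fix j assume "j \<in> {j :: 'j. prj j t \<noteq> 0}"
    then obtain b where b: "Poly_Mapping.lookup (prj j t) b \<noteq> 0"
      using poly_mapping_eqI[of "prj j t" 0] by (auto simp del: lookup_prj)
    have "inv code (code (j, b)) = (j, b)"
      using bij_code by (simp add: bij_def)
    then show "j \<in> (\<lambda>k. fst (inv (code :: 'j \<times> 'b \<Rightarrow> 'b) k)) ` Poly_Mapping.keys t"
      using b by (intro image_eqI[of _ _ "code (j, b)"]) (auto simp: in_keys_iff)
  qed
qed simp

lemma sum_push_prj: "(\<Sum>j | prj j t \<noteq> 0. push (j :: 'j) (prj j (t :: ('b, 'k::field) vec))) = t"
proof (rule vec_eqI)
  fix i :: 'j
  show "prj i (\<Sum>j | prj j t \<noteq> 0. push (j :: 'j) (prj j t)) = prj i t"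
    by (simp add: prj_sum prj_push)
qed

end


section \<open>The size of the universe\<close>

text \<open>Cardinal arithmetic: multiplying an infinite cardinal by a nonzero cardinal that is at
  most as large does not change it.\<close>

lemma ex_bij_Times:
  assumes inf: "infinite (UNIV :: 'b set)" and f: "inj (f :: 'j \<Rightarrow> 'b)"
  shows "\<exists>e :: 'j \<times> 'b \<Rightarrow> 'b. bij e"
proof -
  have "ordLeq3 (card_of (UNIV :: 'j set)) (card_of (UNIV :: 'b set))"
    using f card_of_ordLeq[of "UNIV :: 'j set" "UNIV :: 'b set"] by auto
  then have "ordIso2 (card_of ((UNIV :: 'j set) \<times> (UNIV :: 'b set))) (card_of (UNIV :: 'b set))"
    using inf card_of_Times_infinite[of "UNIV :: 'b set" "UNIV :: 'j set"] by auto
  then obtain e where "bij_betw e ((UNIV :: 'j set) \<times> (UNIV :: 'b set)) (UNIV :: 'b set)"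
    using card_of_ordIso by blast
  then show ?thesis by auto
qed

lemma ex_inj_list:
  assumes inf: "infinite (UNIV :: 'b set)"
  shows "\<exists>e :: 'b list \<Rightarrow> 'b. inj e"
proof -
  obtain p :: "'b \<times> 'b \<Rightarrow> 'b" where p: "bij p"
    using ex_bij_Times[OF inf inj_on_id] by blast
  obtain q :: "nat \<Rightarrow> 'b" where q: "inj q"
    using inf infinite_countable_subset by blast
  define r where "r xs = foldr (\<lambda>x y. p (x, y)) xs (q 0)" for xs
  have r: "xs = ys" if "r xs = r ys" "length xs = length ys" for xs ys
    using that(2,1) by (induction rule: list_induct2) (use p in \<open>auto simp: r_def bij_def dest!: injD\<close>)
  \<comment> \<open>The length has to be recorded, since the iterated pairing \<open>r\<close> alone
    does not show where a list ends.\<close>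
  have "inj (\<lambda>xs. p (q (length xs), r xs))"
  proof (rule injI)
    fix xs ys assume "p (q (length xs), r xs) = p (q (length ys), r ys)"
    then have "q (length xs) = q (length ys)" "r xs = r ys"
      using p by (auto simp: bij_def dest!: injD)
    then show "xs = ys" using q r by (auto dest: injD)
  qed
  then show ?thesis by blast
qed

locale infinite_basis =
  fixes basis :: "'b itself"
  assumes infinite_basis: "infinite (UNIV :: 'b set)"

sublocale infinite_basis \<subseteq> bool: coded "TYPE(bool)" basis
proof
  obtain a b :: 'b where "a \<noteq> b"
    using infinite_basis by (metis UNIV_I ex_new_if_finite finite.emptyI finite.insertI insert_iff)
  then have "inj (\<lambda>c. if c then a else b)" by (auto intro!: injI split: if_splits)
  then show "\<exists>e :: bool \<times> 'b \<Rightarrow> 'b. bij e" using ex_bij_Times[OF infinite_basis] by blast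
qed

locale large_basis = infinite_basis basis for basis :: "'b itself" +
  fixes C :: "('o, 'a, 'k::field) dgcat"
  assumes large: "\<exists>\<iota> :: ('o \<times> 'a \<times> 'k) list \<Rightarrow> 'b. inj \<iota>"
begin

text \<open>The quadruples will be the generators of a semi-free resolution: object, degree,
  boundary and image. A vector is determined by the finite set of its pairs of a basis element and a
  nonzero coefficient, hence by a list enumerating this set.\<close>

lemma ex_inj_vector_data: "\<exists>e :: 'o \<times> int \<times> ('b, 'k) vec \<times> ('b, 'k) vec \<Rightarrow> 'b. inj e"
proof -
  obtain \<iota> :: "('o \<times> 'a \<times> 'k) list \<Rightarrow> 'b" where \<iota>: "inj \<iota>" using large by blast
  obtain l :: "'b list \<Rightarrow> 'b" where l: "inj l" using ex_inj_list[OF infinite_basis] by blast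
  obtain q :: "nat \<Rightarrow> 'b" where q: "inj q"
    using infinite_basis infinite_countable_subset by blast
  \<comment> \<open>Filling the other places with \<open>undefined\<close> extracts from
    \<open>large\<close> separate injections of the objects and of the field.\<close>
  define o' where "o' x = \<iota> [(x, undefined, undefined)]" for x
  define k' where "k' c = \<iota> [(undefined, undefined, c)]" for c
  have o': "inj o'" and k': "inj k'" using \<iota> by (auto simp: o'_def k'_def inj_def)
  have "\<exists>e :: ('b, 'k) vec \<Rightarrow> 'b list. inj e"
  proof -
    define S where "S v xs \<longleftrightarrow> set xs = (\<lambda>b. l [b, k' (Poly_Mapping.lookup v b)]) ` Poly_Mapping.keys v"
      for v :: "('b, 'k) vec" and xs
    have ex: "\<exists>xs. S v xs" for v unfolding S_def by (rule finite_list) simp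
    define e where "e v = (SOME xs. S v xs)" for v
    have S: "S v (e v)" for v unfolding e_def using ex by (rule someI_ex)
    have "inj e"
    proof (rule injI)
      fix u v :: "('b, 'k) vec" assume "e u = e v"
      then have *: "(\<lambda>b. l [b, k' (Poly_Mapping.lookup u b)]) ` Poly_Mapping.keys u
          = (\<lambda>b. l [b, k' (Poly_Mapping.lookup v b)]) ` Poly_Mapping.keys v"
        using S[of u] S[of v] by (simp add: S_def)
      have **: "Poly_Mapping.lookup u b = Poly_Mapping.lookup v b"
        if "b \<in> Poly_Mapping.keys u" "(\<lambda>b. l [b, k' (Poly_Mapping.lookup u b)]) ` Poly_Mapping.keys u
          = (\<lambda>b. l [b, k' (Poly_Mapping.lookup v b)]) ` Poly_Mapping.keys v" for u v :: "('b, 'k) vec" and b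
      proof -
        have "l [b, k' (Poly_Mapping.lookup u b)] \<in> (\<lambda>b. l [b, k' (Poly_Mapping.lookup v b)]) ` Poly_Mapping.keys v"
          unfolding that(2)[symmetric] using that(1) by blast
        then obtain c where "l [b, k' (Poly_Mapping.lookup u b)] = l [c, k' (Poly_Mapping.lookup v c)]"
          by blast
        then show ?thesis by (auto dest!: injD[OF l] injD[OF k'])
      qed
      show "u = v"
      proof (rule poly_mapping_eqI)
        fix b
        show "Poly_Mapping.lookup u b = Poly_Mapping.lookup v b"
          using **[OF _ *] **[OF _ *[symmetric]] by (metis in_keys_iff)
      qed
    qed
    then show ?thesis by blast
  qed
  then obtain e :: "('b, 'k) vec \<Rightarrow> 'b list" where e: "inj e" by blast
  have "inj (\<lambda>(x, i, u, v). l [o' x, q (to_nat (i :: int)), l (e u), l (e v)])"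
    by (auto intro!: injI dest!: injD[OF o'] injD[OF q] injD[OF l] injD[OF e])
  then show ?thesis by blast
qed

end

lemma infinite_basisI:
  assumes "\<exists>\<iota> :: ('o \<times> 'a \<times> 'k) list \<Rightarrow> 'b. inj \<iota>"
  shows "infinite (UNIV :: 'b set)"
proof
  assume fin: "finite (UNIV :: 'b set)"
  obtain \<iota> :: "('o \<times> 'a \<times> 'k) list \<Rightarrow> 'b" where "inj \<iota>" using assms by blast
  with fin have "finite (UNIV :: ('o \<times> 'a \<times> 'k) list set)"
    by (meson finite_imageD finite_subset subset_UNIV)
  then show False by (simp add: infinite_UNIV_listI)
qed


section \<open>Shifts\<close>

lemma sgn_pow_twice [simp]:
  "sgn_pow (2 * p) v = v" "sgn_pow (2 * p + i) v = sgn_pow i v" "sgn_pow (i + 2 * p) v = sgn_pow i v"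
  by (simp_all add: sgn_pow_def)

lemma shift_simps [simp]:
  "Car (shift p M) x n = Car M x (n + p)"
  "MDiff (shift p M) x n m = sgn_pow p (MDiff M x (n + p) m)"
  "Act (shift p M) x y i j m f = Act M x y (i + p) j m f"
  by (simp_all add: shift_def)

lemma dg_module_shift:
  assumes M: "dg_module C M"
  shows "dg_module C (shift p M)"
proof -
  interpret M: dg_module C M by fact
  show ?thesis
  proof
    fix x n m assume *: "x \<in> Obj C" "m \<in> Car (shift p M) x n"
    have e: "n + 1 + p = n + p + 1" by simp
    show "MDiff (shift p M) x n m \<in> Car (shift p M) x (n + 1)"
      using * by (auto simp: shift_def intro!: M.mem M.d_in)
    show "MDiff (shift p M) x (n + 1) (MDiff (shift p M) x n m) = 0"
      using * by (simp add: shift_def e M.d_sgn M.d_in M.dd)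
  next
    fix x y i j assume *: "x \<in> Obj C" "y \<in> Obj C"
    show "bilinear_map_on (Car (shift p M) y i) (Hom C x y j) (Act (shift p M) x y i j)"
      using M.act_bilinear[OF *] by (simp add: shift_def)
  next
    fix x y m i f j assume *: "x \<in> Obj C" "y \<in> Obj C" "m \<in> Car (shift p M) y i" "f \<in> Hom C x y j"
    then have m: "m \<in> Car M y (i + p)" by (simp add: shift_def)
    have e: "i + j + p = i + p + j" "i + 1 + p = i + p + 1" by simp_all
    show "Act (shift p M) x y i j m f \<in> Car (shift p M) x (i + j)"
      using * m by (auto simp: shift_def intro!: M.act_in)
    show "MDiff (shift p M) x (i + j) (Act (shift p M) x y i j m f) =
        Act (shift p M) x y (i + 1) j (MDiff (shift p M) y i m) f +
        sgn_pow i (Act (shift p M) x y i (j + 1) m (Diff C x y j f))"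
      using * m M.mdiff_act[of x y m "i + p" f j]
      by (simp add: shift_def e M.act_sgn M.d_in sgn_pow_add)
  next
    fix x y z m i g j f k
    assume *: "x \<in> Obj C" "y \<in> Obj C" "z \<in> Obj C" "m \<in> Car (shift p M) z i" "g \<in> Hom C y z j" "f \<in> Hom C x y k"
    have e: "i + j + p = i + p + j" by simp
    show "Act (shift p M) x y (i + j) k (Act (shift p M) y z i j m g) f =
       Act (shift p M) x z i (j + k) m (Comp C x y z j k g f)"
      using * M.act_act[of x y z m "i + p" g j f k] by (simp add: shift_def e)
  qed (auto simp: shift_def M.car_subspace M.act_ident intro!: lin_sgn M.mdiff_linear)
qed

lemma shift_shift [simp]: "shift p (shift q M) = shift (p + q) M"
  by (simp add: shift_def fun_eq_iff add_ac)

lemma shift_0 [simp]: "shift 0 M = M"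
  by (simp add: shift_def)

lemma mor_shift:
  assumes f: "dg_morphism C M N f"
  shows "dg_morphism C (shift p M) (shift p N) (\<lambda>x n. f x (n + p))"
  by (rule dg_morphismI)
    (auto simp: dg_module_shift mor_source[OF f] mor_target[OF f] add_ac
      mor_in[OF f] mor_d[OF f] mor_sgn[OF f] mor_act[OF f]
      dg_module.d_in[OF mor_source[OF f]] intro!: mor_linear[OF f])

lemma mor_unshift:
  assumes f: "dg_morphism C (shift p M) N f"
  shows "dg_morphism C M (shift (- p) N) (\<lambda>x n. f x (n - p))"
  using mor_shift[OF f, of "- p"] by simp

lemma acyclic_shift:
  assumes "acyclic_module C M"
  shows "acyclic_module C (shift p M)"
proof -
  interpret M: dg_module C M using assms by (simp add: acyclic_module_def)
  show ?thesis
    unfolding acyclic_module_def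
  proof (intro conjI ballI allI impI dg_module_shift M.dg_module_axioms)
    fix x n m assume *: "x \<in> Obj C" "m \<in> Car (shift p M) x n" "MDiff (shift p M) x n m = 0"
    then obtain u where u: "u \<in> Car M x (n + p - 1)" "m = MDiff M x (n + p - 1) u"
      using acyclicD[OF assms, of x m "n + p"] by auto
    have e: "n - 1 + p = n + p - 1" by simp
    show "\<exists>u\<in>Car (shift p M) x (n - 1). m = MDiff (shift p M) x (n - 1) u"
      using u * by (intro bexI[of _ "sgn_pow p u"]) (auto simp: e M.d_sgn M.mem)
  qed
qed

lemma quasi_iso_shift:
  assumes f: "quasi_iso C M N f"
  shows "quasi_iso C (shift p M) (shift p N) (\<lambda>x n. f x (n + p))"
proof -
  note fm = quasi_iso_mor[OF f]
  interpret M: dg_module C M using mor_source[OF fm] .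
  interpret N: dg_module C N using mor_target[OF fm] .
  have e: "n - 1 + p = n + p - 1" for n by simp
  show ?thesis
  proof (rule quasi_isoI[OF mor_shift[OF fm]])
    fix x n m u assume *: "x \<in> Obj C" "m \<in> Car (shift p M) x n" "MDiff (shift p M) x n m = 0"
      "u \<in> Car (shift p N) x (n - 1)" "f x (n + p) m = MDiff (shift p N) x (n - 1) u"
    then obtain w where "w \<in> Car M x (n + p - 1)" "m = MDiff M x (n + p - 1) w"
      using quasi_iso_inj[OF f, of x m "n + p" "sgn_pow p u"] by (auto simp: e N.mem N.d_sgn)
    then show "\<exists>u\<in>Car (shift p M) x (n - 1). m = MDiff (shift p M) x (n - 1) u"
      using * by (intro bexI[of _ "sgn_pow p w"]) (auto simp: M.d_sgn M.mem sgn_pow_even e)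
  next
    fix x n v assume *: "x \<in> Obj C" "v \<in> Car (shift p N) x n" "MDiff (shift p N) x n v = 0"
    then obtain m u where "m \<in> Car M x (n + p)" "u \<in> Car N x (n + p - 1)" "MDiff M x (n + p) m = 0"
        "v = f x (n + p) m + MDiff N x (n + p - 1) u"
      using quasi_iso_surj[OF f, of x v "n + p"] by auto
    then show "\<exists>m\<in>Car (shift p M) x n. \<exists>u\<in>Car (shift p N) x (n - 1). MDiff (shift p M) x n m = 0 \<and>
        v = f x (n + p) m + MDiff (shift p N) x (n - 1) u"
      using * by (intro bexI[of _ m] bexI[of _ "sgn_pow p u"]) (auto simp: N.d_sgn N.mem sgn_pow_even e)
  qed
qed

lemma gr_shift:
  assumes f: "graded_map C q M N f"
  shows "graded_map C q (shift p M) (shift p N) (\<lambda>x n. f x (n + p))"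
  by (rule graded_mapI)
    (auto simp: add_ac gr_in[OF f] gr_act[OF f] intro!: gr_linear[OF f])

lemma null_homotopic_shift:
  assumes M: "dg_module C M" and N: "dg_module C N" and f: "null_homotopic C M N f"
  shows "null_homotopic C (shift p M) (shift p N) (\<lambda>x n. f x (n + p))"
proof -
  interpret M: dg_module C M by fact
  interpret N: dg_module C N by fact
  obtain h where h: "graded_map C (-1) M N h" "\<And>x n m. x \<in> Obj C \<Longrightarrow> m \<in> Car M x n \<Longrightarrow>
      f x n m = MDiff N x (n - 1) (h x n m) + h x (n + 1) (MDiff M x n m)"
    using f unfolding null_homotopic_def by metis
  \<comment> \<open>The sign compensates the sign in the differential of the shifted modules, in
    both terms of the homotopy formula.\<close>
  have hs: "graded_map C (-1) (shift p M) (shift p N) (\<lambda>x n m. sgn_pow p (h x (n + p) m))"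
  proof (cases "even p")
    case True
    then show ?thesis using gr_shift[OF h(1), of p] by (simp add: sgn_pow_def)
  next
    case False
    then show ?thesis
      using gr_uminus[OF dg_module_shift[OF N] gr_shift[OF h(1)], of p] by (simp add: sgn_pow_def)
  qed
  show ?thesis
  proof (rule null_homotopicI[OF hs])
    fix x n m assume "x \<in> Obj C" "m \<in> Car (shift p M) x n"
    then have *: "x \<in> Obj C" "m \<in> Car M x (n + p)" by simp_all
    have e: "n - 1 + p = n + p - 1" "n + 1 + p = n + p + 1" by simp_all
    have hin: "h x (n + p) m \<in> Car N x (n + p - 1)" "MDiff M x (n + p) m \<in> Car M x (n + p + 1)"
      using gr_in[OF h(1) *] * by (auto simp: M.d_in)
    have "h x (n + p + 1) (sgn_pow p (MDiff M x (n + p) m)) = sgn_pow p (h x (n + p + 1) (MDiff M x (n + p) m))"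
      using lin_sgn_pow[OF gr_linear[OF h(1)]] * hin by blast
    then show "f x (n + p) m = MDiff (shift p N) x (n - 1) (sgn_pow p (h x (n + p) m)) +
        sgn_pow p (h x (n + 1 + p) (MDiff (shift p M) x n m))"
      using * hin h(2)[OF *] by (simp add: e N.d_sgn sgn_pow_even)
  qed
qed


section \<open>Cones\<close>

abbreviation vfst :: "('b, 'k::field) vec \<Rightarrow> ('b, 'k) vec" where "vfst \<equiv> prj False"
abbreviation vsnd :: "('b, 'k::field) vec \<Rightarrow> ('b, 'k) vec" where "vsnd \<equiv> prj True"

definition vpair :: "('b, 'k::field) vec \<Rightarrow> ('b, 'k) vec \<Rightarrow> ('b, 'k) vec" where
  "vpair u v = push False u + push True v"

text \<open>A concrete model of what \<open>is_cone\<close> describes up to isomorphism. The target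
  sits in the component \<open>False\<close>, the shifted source in the component
  \<open>True\<close>.\<close>

definition cone_module ::
  "('o, 'a, 'b, 'k::field) dgmod \<Rightarrow> ('o, 'a, 'b, 'k) dgmod \<Rightarrow> ('o, 'b, 'k) gmap \<Rightarrow>
   ('o, 'a, 'b, 'k) dgmod" where
  "cone_module M N \<phi> = \<lparr>
     Car = (\<lambda>x n. {w. vfst w \<in> Car N x n \<and> vsnd w \<in> Car M x (n + 1)}),
     MDiff = (\<lambda>x n w. vpair (MDiff N x n (vfst w) + \<phi> x (n + 1) (vsnd w)) (- MDiff M x (n + 1) (vsnd w))),
     Act = (\<lambda>x y i j w f. vpair (Act N x y i j (vfst w) f) (Act M x y (i + 1) j (vsnd w) f))\<rparr>"

lemma cone_module_simps [simp]:
  "Car (cone_module M N \<phi>) x n = {w. vfst w \<in> Car N x n \<and> vsnd w \<in> Car M x (n + 1)}"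
  "MDiff (cone_module M N \<phi>) x n w = vpair (MDiff N x n (vfst w) + \<phi> x (n + 1) (vsnd w)) (- MDiff M x (n + 1) (vsnd w))"
  "Act (cone_module M N \<phi>) x y i j w f = vpair (Act N x y i j (vfst w) f) (Act M x y (i + 1) j (vsnd w) f)"
  by (simp_all add: cone_module_def)

definition cone_incl ::
  "('o, 'a, 'k::field) dgcat \<Rightarrow> ('o, 'a, 'b, 'k) dgmod \<Rightarrow> ('o, 'a, 'b, 'k) dgmod \<Rightarrow>
   ('o, 'b, 'k) gmap \<Rightarrow> ('o, 'a, 'b, 'k) dgmod \<Rightarrow>
   ('o, 'b, 'k) gmap \<Rightarrow> ('o, 'b, 'k) gmap \<Rightarrow> bool" where
  "cone_incl C M N \<phi> X \<alpha> \<beta> \<longleftrightarrow> dg_morphism C N X \<alpha> \<and>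
     (\<forall>x\<in>Obj C. \<forall>n. linear_map_on (Car M x (n + 1)) (\<beta> x n) \<and>
        (\<forall>m\<in>Car M x (n + 1). \<beta> x n m \<in> Car X x n \<and>
           MDiff X x n (\<beta> x n m) = \<alpha> x (n + 1) (\<phi> x (n + 1) m) - \<beta> x (n + 1) (MDiff M x (n + 1) m)) \<and>
        (\<forall>w\<in>Car X x n. \<exists>!(v, m). v \<in> Car N x n \<and> m \<in> Car M x (n + 1) \<and> w = \<alpha> x n v + \<beta> x n m)) \<and>
     (\<forall>x\<in>Obj C. \<forall>y\<in>Obj C. \<forall>i j. \<forall>m\<in>Car M y (i + 1). \<forall>f\<in>Hom C x y j.
        \<beta> x (i + j) (Act M x y (i + 1) j m f) = Act X x y i j (\<beta> y i m) f)"

lemma is_cone_iff: "is_cone C M N \<phi> X \<longleftrightarrow> dg_morphism C M N \<phi> \<and> (\<exists>\<alpha> \<beta>. cone_incl C M N \<phi> X \<alpha> \<beta>)"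
  unfolding is_cone_def cone_incl_def ..

lemma cone_incl_left: "cone_incl C M N \<phi> X \<alpha> \<beta> \<Longrightarrow> dg_morphism C N X \<alpha>"
  by (simp add: cone_incl_def)

lemma cone_inclD:
  assumes "cone_incl C M N \<phi> X \<alpha> \<beta>"
  shows "x \<in> Obj C \<Longrightarrow> linear_map_on (Car M x (n + 1)) (\<beta> x n)"
    and "x \<in> Obj C \<Longrightarrow> m \<in> Car M x (n + 1) \<Longrightarrow> \<beta> x n m \<in> Car X x n"
    and "x \<in> Obj C \<Longrightarrow> m \<in> Car M x (n + 1) \<Longrightarrow>
      MDiff X x n (\<beta> x n m) = \<alpha> x (n + 1) (\<phi> x (n + 1) m) - \<beta> x (n + 1) (MDiff M x (n + 1) m)"
    and "\<lbrakk>x \<in> Obj C; y \<in> Obj C; m \<in> Car M y (i + 1); f \<in> Hom C x y j\<rbrakk> \<Longrightarrow>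
      \<beta> x (i + j) (Act M x y (i + 1) j m f) = Act X x y i j (\<beta> y i m) f"
  using assms by (simp_all add: cone_incl_def)

lemma cone_incl_unique:
  "\<lbrakk>cone_incl C M N \<phi> X \<alpha> \<beta>; x \<in> Obj C; w \<in> Car X x n\<rbrakk> \<Longrightarrow>
    \<exists>!(v, m). v \<in> Car N x n \<and> m \<in> Car M x (n + 1) \<and> w = \<alpha> x n v + \<beta> x n m"
  by (simp add: cone_incl_def)

lemma cone_incl_inj:
  assumes c: "cone_incl C M N \<phi> X \<alpha> \<beta>" and x: "x \<in> Obj C"
    and vm: "v \<in> Car N x n" "m \<in> Car M x (n + 1)" "v' \<in> Car N x n" "m' \<in> Car M x (n + 1)"
    and eq: "\<alpha> x n v + \<beta> x n m = \<alpha> x n v' + \<beta> x n m'"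
  shows "v = v' \<and> m = m'"
proof -
  let ?w = "\<alpha> x n v + \<beta> x n m"
  have "?w \<in> Car X x n"
    using cone_incl_left[OF c] cone_inclD(2)[OF c x vm(2)] mor_in[OF cone_incl_left[OF c] x vm(1)]
      dg_module.mem_add[OF mor_target x] by blast
  from cone_incl_unique[OF c x this] obtain p where
    p: "\<And>q. (case q of (v, m) \<Rightarrow> v \<in> Car N x n \<and> m \<in> Car M x (n + 1) \<and> ?w = \<alpha> x n v + \<beta> x n m) \<Longrightarrow> q = p"
    by (rule ex1E) blast
  from p[of "(v, m)"] p[of "(v', m')"] show ?thesis using vm eq by simp
qed

lemma cone_incl_ex:
  "\<lbrakk>cone_incl C M N \<phi> X \<alpha> \<beta>; x \<in> Obj C; w \<in> Car X x n\<rbrakk> \<Longrightarrow>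
    \<exists>v\<in>Car N x n. \<exists>m\<in>Car M x (n + 1). w = \<alpha> x n v + \<beta> x n m"
  using ex1_implies_ex[OF cone_incl_unique] by (fastforce split: prod.splits)

context infinite_basis
begin

lemma vfst_vpair [simp]: "vfst (vpair u v :: ('b, 'k::field) vec) = u"
  by (simp add: vpair_def bool.prj_push)

lemma vsnd_vpair [simp]: "vsnd (vpair u v :: ('b, 'k::field) vec) = v"
  by (simp add: vpair_def bool.prj_push)

lemma vpair_eq_iff: "(s :: ('b, 'k::field) vec) = t \<longleftrightarrow> vfst s = vfst t \<and> vsnd s = vsnd t"
  using bool.vec_eqI[of s t] by (metis (full_types))

lemma vpair_eq [simp]:
  "vpair u v = (t :: ('b, 'k::field) vec) \<longleftrightarrow> u = vfst t \<and> v = vsnd t"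
  "(t :: ('b, 'k::field) vec) = vpair u v \<longleftrightarrow> vfst t = u \<and> vsnd t = v"
  by (auto simp: vpair_eq_iff[of _ "vpair _ _"] vpair_eq_iff[of "vpair _ _"])

lemma vpair_ops [simp]:
  "vpair u v + vpair u' v' = (vpair (u + u') (v + v') :: ('b, 'k::field) vec)"
  "vpair u v - vpair u' v' = (vpair (u - u') (v - v') :: ('b, 'k::field) vec)"
  "- vpair u v = (vpair (- u) (- v) :: ('b, 'k::field) vec)"
  "kscale c (vpair u v) = (vpair (kscale c u) (kscale c v) :: ('b, 'k::field) vec)"
  "sgn_pow p (vpair u v) = (vpair (sgn_pow p u) (sgn_pow p v) :: ('b, 'k::field) vec)"
  by simp_all

lemma vpair_0_0 [simp]: "vpair 0 0 = (0 :: ('b, 'k::field) vec)"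
  by simp

lemma vpair_vfst_vsnd [simp]: "vpair (vfst t) (vsnd t) = (t :: ('b, 'k::field) vec)"
  by simp

context
  fixes C :: "('o, 'a, 'k::field) dgcat" and M N :: "('o, 'a, 'b, 'k) dgmod" and \<phi>
  assumes mor: "dg_morphism C M N \<phi>"
begin

interpretation M: dg_module C M using mor_source[OF mor] .
interpretation N: dg_module C N using mor_target[OF mor] .

lemma dg_module_cone: "dg_module C (cone_module M N \<phi>)"
proof
  fix x n assume *: "x \<in> Obj C"
  show "kvec.subspace (Car (cone_module M N \<phi>) x n)"
    unfolding kvec.subspace_def by (auto simp: M.mem N.mem *)
  show "linear_map_on (Car (cone_module M N \<phi>) x n) (MDiff (cone_module M N \<phi>) x n)"
    by (rule linear_map_onI)
      (auto simp: M.d_add N.d_add M.d_scale N.d_scale mor_add[OF mor] mor_scale[OF mor] * kvec.scale_right_distrib)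
  fix m assume m: "m \<in> Car (cone_module M N \<phi>) x n"
  then show "MDiff (cone_module M N \<phi>) x n m \<in> Car (cone_module M N \<phi>) x (n + 1)"
    using * by (auto simp: M.mem N.mem M.d_in N.d_in mor_in[OF mor])
  show "MDiff (cone_module M N \<phi>) x (n + 1) (MDiff (cone_module M N \<phi>) x n m) = 0"
    using * m by (auto simp: M.mem N.mem M.d_in N.d_in mor_in[OF mor] N.d_add N.dd M.d_minus M.dd
        mor_minus[OF mor] mor_d[OF mor])
next
  fix x n m assume *: "x \<in> Obj C" "m \<in> Car (cone_module M N \<phi>) x n"
  then show "Act (cone_module M N \<phi>) x x n 0 m (Ident C x) = m"
    by (auto simp: M.act_ident N.act_ident)
next
  fix x y i j assume *: "x \<in> Obj C" "y \<in> Obj C"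
  show "bilinear_map_on (Car (cone_module M N \<phi>) y i) (Hom C x y j) (Act (cone_module M N \<phi>) x y i j)"
    unfolding bilinear_map_on_def
    by (intro conjI ballI linear_map_onI)
      (use * in \<open>auto simp: M.act_add N.act_add M.act_scale N.act_scale
       lin_add[OF M.act_linear_right] lin_add[OF N.act_linear_right]
       lin_scale[OF M.act_linear_right] lin_scale[OF N.act_linear_right]\<close>)
  fix m f assume m: "m \<in> Car (cone_module M N \<phi>) y i" "f \<in> Hom C x y j"
  show "Act (cone_module M N \<phi>) x y i j m f \<in> Car (cone_module M N \<phi>) x (i + j)"
    using * m by (auto intro!: M.act_in N.act_in)
  have e: "i + j + 1 = i + 1 + j" by simp
  have "MDiff M x (i + 1 + j) (Act M x y (i + 1) j (vsnd m) f) = Act M x y (i + 1 + 1) j (MDiff M y (i + 1) (vsnd m)) f -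
      sgn_pow i (Act M x y (i + 1) (j + 1) (vsnd m) (Diff C x y j f))"
    using * m M.mdiff_act[of x y "vsnd m" "i + 1" f j] by simp
  then show "MDiff (cone_module M N \<phi>) x (i + j) (Act (cone_module M N \<phi>) x y i j m f) =
      Act (cone_module M N \<phi>) x y (i + 1) j (MDiff (cone_module M N \<phi>) y i m) f +
      sgn_pow i (Act (cone_module M N \<phi>) x y i (j + 1) m (Diff C x y j f))"
    using * m
    by (simp add: e M.mem N.mem M.d_in N.d_in mor_in[OF mor] M.act_minus N.act_add
      N.mdiff_act mor_act[OF mor])
next
  fix x y z m i g j f k
  assume *: "x \<in> Obj C" "y \<in> Obj C" "z \<in> Obj C" "m \<in> Car (cone_module M N \<phi>) z i"
       "g \<in> Hom C y z j" "f \<in> Hom C x y k"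
  have "Act M x y (i + j + 1) k (Act M y z (i + 1) j (vsnd m) g) f = Act M x z (i + 1) (j + k) (vsnd m) (Comp C x y z j k g f)"
    using * M.act_act[of x y z "vsnd m" "i + 1" g j f k] by (simp add: add_ac)
  then show "Act (cone_module M N \<phi>) x y (i + j) k (Act (cone_module M N \<phi>) y z i j m g) f =
       Act (cone_module M N \<phi>) x z i (j + k) m (Comp C x y z j k g f)"
    using * by (auto simp: N.act_act)
qed

lemma cone_inclusion: "dg_morphism C N (cone_module M N \<phi>) (\<lambda>x n v. vpair v 0)"
  by (rule dg_morphismI; (rule linear_map_onI)?)
   (auto simp: N.dg_module_axioms dg_module_cone M.mem_0 M.d_0 M.act_0 mor_0[OF mor])

lemma cone_projection: "dg_morphism C (cone_module M N \<phi>) (shift 1 M) (\<lambda>x n. vsnd)"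
  by (rule dg_morphismI; (rule linear_map_onI)?)
   (auto simp: M.dg_module_axioms dg_module_cone dg_module_shift)

text \<open>A map out of a cone is a map \<open>a\<close> on the target together with a null
  homotopy of \<open>a\<close> after \<open>\<phi>\<close>. Assumption \<open>d\<close> says that
  \<open>b\<close> is such a homotopy, read as a map of degree 0 on the shift.\<close>

lemma mor_from_cone:
  assumes a: "dg_morphism C N X a" and b: "graded_map C 0 (shift 1 M) X b"
    and d: "\<And>x n m. x \<in> Obj C \<Longrightarrow> m \<in> Car M x (n + 1) \<Longrightarrow>
      MDiff X x n (b x n m) = a x (n + 1) (\<phi> x (n + 1) m) - b x (n + 1) (MDiff M x (n + 1) m)"
  shows "dg_morphism C (cone_module M N \<phi>) X (\<lambda>x n w. a x n (vfst w) + b x n (vsnd w))"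
proof -
  interpret X: dg_module C X using mor_target[OF a] .
  have bi: "b x n m \<in> Car X x n" if "x \<in> Obj C" "m \<in> Car M x (n + 1)" for x n m
    using gr_in[OF b that(1), of m n n] that by simp
  have ba: "b x (i + j) (Act M x y (i + 1) j m f) = Act X x y i j (b y i m) f"
    if "x \<in> Obj C" "y \<in> Obj C" "m \<in> Car M y (i + 1)" "f \<in> Hom C x y j" for x y i j m f
    using gr_act[OF b that(1,2), of m i f j] that by simp
  have bl: "linear_map_on (Car M x (n + 1)) (b x n)" if "x \<in> Obj C" for x n
    using gr_linear[OF b that] by simp
  show ?thesis
    by (rule dg_morphismI; (rule linear_map_onI)?)
      (auto simp: X.dg_module_axioms dg_module_cone mor_add[OF a] mor_scale[OF a] bi ba mor_in[OF a]
        X.mem lin_add[OF bl] lin_scale[OF bl] lin_minus[OF bl] kvec.scale_right_distrib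
        M.d_in N.d_in mor_in[OF mor] mor_d[OF a] X.d_add X.act_add mor_act[OF a] d)
qed

text \<open>Dually, a map into a cone is a map \<open>b\<close> to the shifted source whose
  composite with \<open>\<phi>\<close> is made null homotopic by \<open>a\<close>, up to shift. So
  \<open>a\<close> alone is not closed, and only graded.\<close>

lemma mor_to_cone:
  assumes a: "graded_map C 0 P N a" and b: "dg_morphism C P (shift 1 M) b"
    and d: "\<And>x n p. x \<in> Obj C \<Longrightarrow> p \<in> Car P x n \<Longrightarrow>
      a x (n + 1) (MDiff P x n p) = MDiff N x n (a x n p) + \<phi> x (n + 1) (b x n p)"
  shows "dg_morphism C P (cone_module M N \<phi>) (\<lambda>x n p. vpair (a x n p) (b x n p))"
proof -
  interpret P: dg_module C P using mor_source[OF b] .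
  have bi: "b x n p \<in> Car M x (n + 1)" if "x \<in> Obj C" "p \<in> Car P x n" for x n p
    using mor_in[OF b that] by simp
  have bd: "b x (n + 1) (MDiff P x n p) = - MDiff M x (n + 1) (b x n p)" if "x \<in> Obj C" "p \<in> Car P x n" for x n p
    using mor_d[OF b that] by simp
  have ba: "b x (i + j) (Act P x y i j m f) = Act M x y (i + 1) j (b y i m) f"
    if "x \<in> Obj C" "y \<in> Obj C" "m \<in> Car P y i" "f \<in> Hom C x y j" for x y i j m f
    using mor_act[OF b that] that by simp
  show ?thesis
    by (rule dg_morphismI; (rule linear_map_onI)?)
      (auto simp: P.dg_module_axioms dg_module_cone gr_add[OF a] gr_scale[OF a] bi ba bd
        gr_in[OF a] gr_act[OF a] mor_add[OF b] mor_scale[OF b] d)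
qed

lemma is_cone_cone: "is_cone C M N \<phi> (cone_module M N \<phi>)"
  unfolding is_cone_def
proof (intro conjI exI ballI allI)
  show "dg_morphism C N (cone_module M N \<phi>) (\<lambda>x n v. vpair v 0)" by (rule cone_inclusion)
  fix x n assume "x \<in> Obj C"
  then show "linear_map_on (Car M x (n + 1)) (\<lambda>v. vpair 0 v)"
    by (intro linear_map_onI) auto
  fix w assume "w \<in> Car (cone_module M N \<phi>) x n"
  then show "\<exists>!(v, m). v \<in> Car N x n \<and> m \<in> Car M x (n + 1) \<and> w = vpair v 0 + vpair 0 m"
    by (intro ex1I[of _ "(vfst w, vsnd w)"]) auto
qed (auto simp: mor M.mem_0 N.mem_0 M.d_0 N.d_0 N.act_0)

text \<open>The long exact cohomology sequence of a cone, carried out on elements. It turns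
  statements on quasi-isomorphisms into statements on acyclic modules, to which K-projectivity
  applies.\<close>

lemma acyclic_cone_iff: "acyclic_module C (cone_module M N \<phi>) \<longleftrightarrow> quasi_iso C M N \<phi>"
proof
  assume A: "acyclic_module C (cone_module M N \<phi>)"
  show "quasi_iso C M N \<phi>"
  proof (rule quasi_isoI[OF mor])
    fix x n m u assume *: "x \<in> Obj C" "m \<in> Car M x n" "MDiff M x n m = 0" "u \<in> Car N x (n - 1)" "\<phi> x n m = MDiff N x (n - 1) u"
    \<comment> \<open>The pair is a cycle of the cone in degree \<open>n - 1\<close>, because the
      boundary of \<open>- u\<close> cancels the image of \<open>m\<close>.\<close>
    then obtain w where "w \<in> Car (cone_module M N \<phi>) x (n - 2)" "vpair (- u) m = MDiff (cone_module M N \<phi>) x (n - 2) w"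
      using acyclicD[OF A, of x "vpair (- u) m" "n - 1" "n - 2"] by (auto simp: N.mem N.d_minus)
    then show "\<exists>u\<in>Car M x (n - 1). m = MDiff M x (n - 1) u"
      using * by (intro bexI[of _ "- vsnd w"]) (auto simp: M.d_minus M.mem)
  next
    fix x n v assume *: "x \<in> Obj C" "v \<in> Car N x n" "MDiff N x n v = 0"
    then obtain w where "w \<in> Car (cone_module M N \<phi>) x (n - 1)" "vpair v 0 = MDiff (cone_module M N \<phi>) x (n - 1) w"
      using acyclicD[OF A, of x "vpair v 0" n "n - 1"] by (auto simp: M.mem_0 M.d_0 mor_0[OF mor])
    then show "\<exists>m\<in>Car M x n. \<exists>u\<in>Car N x (n - 1). MDiff M x n m = 0 \<and> v = \<phi> x n m + MDiff N x (n - 1) u"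
      using * by (intro bexI[of _ "vsnd w"] bexI[of _ "vfst w"]) (auto simp: add.commute)
  qed
next
  assume q: "quasi_iso C M N \<phi>"
  show "acyclic_module C (cone_module M N \<phi>)"
    unfolding acyclic_module_def
  proof (intro conjI ballI allI impI dg_module_cone)
    fix x n w assume *: "x \<in> Obj C" "w \<in> Car (cone_module M N \<phi>) x n" "MDiff (cone_module M N \<phi>) x n w = 0"
    define v m where "v = vfst w" and "m = vsnd w"
    have vm: "v \<in> Car N x n" "m \<in> Car M x (n + 1)" "MDiff M x (n + 1) m = 0" "MDiff N x n v + \<phi> x (n + 1) m = 0"
      using * by (auto simp: v_def m_def)
    then have "\<phi> x (n + 1) m = MDiff N x n (- v)" using * by (simp add: N.d_minus add_eq_0_iff)
    then obtain p where p: "p \<in> Car M x n" "m = MDiff M x n p"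
      using quasi_iso_inj[OF q *(1) vm(2,3), of "- v" n] vm * by (auto simp: N.mem)
    have "MDiff N x n (v + \<phi> x n p) = 0" using vm p * mor_d[OF mor, of x p n] by (simp add: N.d_add mor_in[OF mor])
    moreover have "v + \<phi> x n p \<in> Car N x n" using vm p * by (simp add: N.mem mor_in[OF mor])
    \<comment> \<open>The primitive \<open>p\<close> of the source component leaves a cycle in the
      target which need not be exact; \<open>l\<close> lifts its class to the source and corrects
      \<open>p\<close>.\<close>
    ultimately obtain l u where l: "l \<in> Car M x n" "u \<in> Car N x (n - 1)" "MDiff M x n l = 0"
       "v + \<phi> x n p = \<phi> x n l + MDiff N x (n - 1) u"
      using quasi_iso_surj[OF q *(1)] by blast
    show "\<exists>u\<in>Car (cone_module M N \<phi>) x (n - 1). w = MDiff (cone_module M N \<phi>) x (n - 1) u"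
    proof
      show "vpair u (l - p) \<in> Car (cone_module M N \<phi>) x (n - 1)" using l p * by (simp add: M.mem)
      show "w = MDiff (cone_module M N \<phi>) x (n - 1) (vpair u (l - p))"
        using l p * by (auto simp: v_def[symmetric] m_def[symmetric] M.d_diff mor_diff[OF mor] algebra_simps)
    qed
  qed
qed

end

text \<open>Lets \<open>cone_module\<close> stand for any cone, since the classes of modules in
  question are closed under isomorphism.\<close>

lemma is_cone_iso:
  assumes "is_cone C M N \<phi> (X :: ('o, 'a, 'b, 'k::field) dgmod)"
  shows "\<exists>\<psi>. quasi_iso C (cone_module M N \<phi>) X \<psi>"
proof -
  have mor: "dg_morphism C M N \<phi>" using assms by (simp add: is_cone_def)
  obtain \<alpha> \<beta> where c: "cone_incl C M N \<phi> X \<alpha> \<beta>" using assms by (auto simp: is_cone_iff)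
  note a = cone_incl_left[OF c] and b = cone_inclD[OF c]
  have "graded_map C 0 (shift 1 M) X \<beta>"
    by (rule graded_mapI) (auto simp: b add_ac)
  from mor_from_cone[OF mor a this b(3)]
  have m: "dg_morphism C (cone_module M N \<phi>) X (\<lambda>x n w. \<alpha> x n (vfst w) + \<beta> x n (vsnd w))" by blast
  interpret X: dg_module C X using mor_target[OF a] .
  have "quasi_iso C (cone_module M N \<phi>) X (\<lambda>x n w. \<alpha> x n (vfst w) + \<beta> x n (vsnd w))"
  proof (rule quasi_iso_bij[OF m])
    fix x n assume x: "x \<in> Obj C"
    show "bij_betw (\<lambda>w. \<alpha> x n (vfst w) + \<beta> x n (vsnd w)) (Car (cone_module M N \<phi>) x n) (Car X x n)"
    proof (rule bij_betwI')
      fix s t assume st: "s \<in> Car (cone_module M N \<phi>) x n" "t \<in> Car (cone_module M N \<phi>) x n"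
      then show "(\<alpha> x n (vfst s) + \<beta> x n (vsnd s) = \<alpha> x n (vfst t) + \<beta> x n (vsnd t)) = (s = t)"
        using cone_incl_inj[OF c x, of "vfst s" n "vsnd s" "vfst t" "vsnd t"] unfolding vpair_eq_iff[of s t] by auto
    next
      fix s assume "s \<in> Car (cone_module M N \<phi>) x n"
      then show "\<alpha> x n (vfst s) + \<beta> x n (vsnd s) \<in> Car X x n"
        using x by (auto intro!: X.mem b mor_in[OF a])
    next
      fix w assume "w \<in> Car X x n"
      from cone_incl_ex[OF c x this] obtain v m where "v \<in> Car N x n \<and> m \<in> Car M x (n + 1) \<and> w = \<alpha> x n v + \<beta> x n m" by blast
      then show "\<exists>s\<in>Car (cone_module M N \<phi>) x n. w = \<alpha> x n (vfst s) + \<beta> x n (vsnd s)"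
        by (intro bexI[of _ "vpair v m"]) auto
    qed
  qed
  then show ?thesis by blast
qed

end


section \<open>Direct sums\<close>

text \<open>The characterization \<open>is_direct_sum\<close> speaks only of inclusions and unique
  expansions. With projections the notion becomes equational: it is carried along by functors such
  as \<open>tw\<close>, and a map into the sum can be cut off at finitely many summands. The finite
  set \<open>J\<close> depends on the element.\<close>

definition dsum ::
  "('o, 'a, 'k::field) dgcat \<Rightarrow> 'i set \<Rightarrow> ('i \<Rightarrow> ('o, 'a, 'b, 'k) dgmod) \<Rightarrow> ('o, 'a, 'b, 'k) dgmod \<Rightarrow>
   ('i \<Rightarrow> ('o, 'b, 'k) gmap) \<Rightarrow> ('i \<Rightarrow> ('o, 'b, 'k) gmap) \<Rightarrow> bool" where
  "dsum C I X S \<iota> \<pi> \<longleftrightarrow> dg_module C S \<and>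
     (\<forall>i\<in>I. dg_morphism C (X i) S (\<iota> i) \<and> dg_morphism C S (X i) (\<pi> i)) \<and>
     (\<forall>i\<in>I. \<forall>j\<in>I. \<forall>x\<in>Obj C. \<forall>n. \<forall>m\<in>Car (X i) x n. \<pi> j x n (\<iota> i x n m) = (if i = j then m else 0)) \<and>
     (\<forall>x\<in>Obj C. \<forall>n. \<forall>s\<in>Car S x n. \<exists>J. finite J \<and> J \<subseteq> I \<and> (\<forall>i\<in>I - J. \<pi> i x n s = 0) \<and>
        s = (\<Sum>i\<in>J. \<iota> i x n (\<pi> i x n s)))"

lemma dsumD:
  assumes "dsum C I X S \<iota> \<pi>"
  shows "dg_module C S"
    and "i \<in> I \<Longrightarrow> dg_morphism C (X i) S (\<iota> i)"
    and "i \<in> I \<Longrightarrow> dg_morphism C S (X i) (\<pi> i)"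
    and "\<lbrakk>i \<in> I; j \<in> I; x \<in> Obj C; m \<in> Car (X i) x n\<rbrakk> \<Longrightarrow> \<pi> j x n (\<iota> i x n m) = (if i = j then m else 0)"
    and "\<lbrakk>x \<in> Obj C; s \<in> Car S x n\<rbrakk> \<Longrightarrow> \<exists>J. finite J \<and> J \<subseteq> I \<and> (\<forall>i\<in>I - J. \<pi> i x n s = 0) \<and>
        s = (\<Sum>i\<in>J. \<iota> i x n (\<pi> i x n s))"
  using assms by (simp_all add: dsum_def)

lemma dsum_sum_eq:
  assumes "dsum C I X S \<iota> \<pi>" and x: "x \<in> Obj C" "s \<in> Car S x n"
    and J: "finite J" "J \<subseteq> I" "\<And>i. i \<in> I - J \<Longrightarrow> \<pi> i x n s = 0"
  shows "s = (\<Sum>i\<in>J. \<iota> i x n (\<pi> i x n s))"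
proof -
  note d = dsumD[OF assms(1)]
  obtain K where K: "finite K" "K \<subseteq> I" "\<forall>i\<in>I - K. \<pi> i x n s = 0" "s = (\<Sum>i\<in>K. \<iota> i x n (\<pi> i x n s))"
    using d(5)[OF x] by blast
  have "(\<Sum>i\<in>K. \<iota> i x n (\<pi> i x n s)) = (\<Sum>i\<in>K \<union> J. \<iota> i x n (\<pi> i x n s))"
    by (rule sum.mono_neutral_left) (use K J x mor_0[OF d(2)] in auto)
  also have "\<dots> = (\<Sum>i\<in>J. \<iota> i x n (\<pi> i x n s))"
    by (rule sum.mono_neutral_right) (use K J x mor_0[OF d(2)] in auto)
  finally show ?thesis using K(4) by simp
qed

text \<open>The projections are the coordinates in the unique expansion; uniqueness makes them
  linear and compatible with the differential and the action.\<close>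

lemma is_direct_sum_imp_dsum:
  assumes ds: "is_direct_sum C I X S"
  shows "\<exists>\<iota> \<pi>. dsum C I X S \<iota> \<pi>"
proof -
  interpret S: dg_module C S using ds by (simp add: is_direct_sum_def)
  from conjunct2[OF ds[unfolded is_direct_sum_def]] obtain \<iota> where *: "(\<forall>i\<in>I. dg_morphism C (X i) S (\<iota> i)) \<and>
     (\<forall>x\<in>Obj C. \<forall>n. \<forall>s\<in>Car S x n. \<exists>!u. finite {i. u i \<noteq> 0} \<and> {i. u i \<noteq> 0} \<subseteq> I \<and>
        (\<forall>i\<in>I. u i \<in> Car (X i) x n) \<and> s = (\<Sum>i | u i \<noteq> 0. \<iota> i x n (u i)))"
    by (rule exE)
  then have \<iota>: "\<And>i. i \<in> I \<Longrightarrow> dg_morphism C (X i) S (\<iota> i)" by blast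
  define D where "D x n s u \<longleftrightarrow> finite {i. u i \<noteq> 0} \<and> {i. u i \<noteq> 0} \<subseteq> I \<and>
        (\<forall>i\<in>I. u i \<in> Car (X i) x n) \<and> s = (\<Sum>i | u i \<noteq> 0. \<iota> i x n (u i))" for x n s u
  have ex1: "\<exists>!u. D x n s u" if "x \<in> Obj C" "s \<in> Car S x n" for x n s
    using * that by (simp add: D_def)
  have DI: "D x n s u" if "x \<in> Obj C" "finite K" "K \<subseteq> I" "\<And>i. i \<notin> K \<Longrightarrow> u i = 0" "\<And>i. i \<in> K \<Longrightarrow> u i \<in> Car (X i) x n"
     "s = (\<Sum>i\<in>K. \<iota> i x n (u i))" for x n s u K
  proof -
    have sub: "{i. u i \<noteq> 0} \<subseteq> K" using that(4) by blast
    have "(\<Sum>i | u i \<noteq> 0. \<iota> i x n (u i)) = (\<Sum>i\<in>K. \<iota> i x n (u i))"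
      by (rule sum.mono_neutral_left) (use that sub mor_0[OF \<iota> that(1)] in auto)
    moreover have "u i \<in> Car (X i) x n" if "i \<in> I" for i
      using that \<open>\<And>i. i \<notin> K \<Longrightarrow> u i = 0\<close> \<open>\<And>i. i \<in> K \<Longrightarrow> u i \<in> Car (X i) x n\<close> \<open>x \<in> Obj C\<close>
        dg_module.mem_0[OF mor_source[OF \<iota>]] by (cases "i \<in> K") auto
    ultimately show ?thesis unfolding D_def using that sub finite_subset by auto
  qed
  have DE: "\<exists>K. finite K \<and> K \<subseteq> I \<and> (\<forall>i. i \<notin> K \<longrightarrow> u i = 0) \<and> (\<forall>i\<in>I. u i \<in> Car (X i) x n) \<and> s = (\<Sum>i\<in>K. \<iota> i x n (u i))"
    if "D x n s u" for x n s u
    using that unfolding D_def by (intro exI[of _ "{i. u i \<noteq> 0}"]) auto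
  define U where "U x n s = (THE u. D x n s u)" for x n s
  have U: "D x n s (U x n s)" if "x \<in> Obj C" "s \<in> Car S x n" for x n s
    unfolding U_def using ex1[OF that] by (rule theI')
  have DU: "\<exists>K. finite K \<and> K \<subseteq> I \<and> (\<forall>i. i \<notin> K \<longrightarrow> U x n s i = 0) \<and> s = (\<Sum>i\<in>K. \<iota> i x n (U x n s i))"
    if "x \<in> Obj C" "s \<in> Car S x n" for x n s
    using DE[OF U[OF that]] by blast
  have U_eq: "U x n s = u" if "x \<in> Obj C" "s \<in> Car S x n" "D x n s u" for x n s u
    using ex1[OF that(1,2)] U[OF that(1,2)] that(3) by blast
  have Uin: "U x n s i \<in> Car (X i) x n" if "x \<in> Obj C" "s \<in> Car S x n" "i \<in> I" for x n s i
    using U[OF that(1,2)] that(3) by (simp add: D_def)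
  have Xmod: "dg_module C (X i)" if "i \<in> I" for i using mor_source[OF \<iota>[OF that]] .
  have Uadd: "U x n (s + t) i = U x n s i + U x n t i" if "x \<in> Obj C" "s \<in> Car S x n" "t \<in> Car S x n" for x n s t i
  proof -
    note th = that
    obtain K L where K: "finite K" "K \<subseteq> I" "\<forall>i. i \<notin> K \<longrightarrow> U x n s i = 0" "s = (\<Sum>i\<in>K. \<iota> i x n (U x n s i))"
      and L: "finite L" "L \<subseteq> I" "\<forall>i. i \<notin> L \<longrightarrow> U x n t i = 0" "t = (\<Sum>i\<in>L. \<iota> i x n (U x n t i))"
      using DU[OF th(1,2)] DU[OF th(1,3)] by blast
    have s: "s = (\<Sum>i\<in>K \<union> L. \<iota> i x n (U x n s i))"
      by (subst K(4), rule sum.mono_neutral_left) (use K L that mor_0[OF \<iota>] in auto)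
    have t: "t = (\<Sum>i\<in>K \<union> L. \<iota> i x n (U x n t i))"
      by (subst L(4), rule sum.mono_neutral_left) (use K L that mor_0[OF \<iota>] in auto)
    have "s + t = (\<Sum>i\<in>K \<union> L. \<iota> i x n (U x n s i)) + (\<Sum>i\<in>K \<union> L. \<iota> i x n (U x n t i))"
      using s t by simp
    also have "\<dots> = (\<Sum>i\<in>K \<union> L. \<iota> i x n (U x n s i + U x n t i))"
      unfolding sum.distrib[symmetric]
      by (rule sum.cong) (use K L that in \<open>auto intro!: mor_add[OF \<iota>, symmetric] Uin\<close>)
    finally have "D x n (s + t) (\<lambda>i. U x n s i + U x n t i)"
      by (intro DI[of _ "K \<union> L"]) (use that K L in \<open>auto intro!: dg_module.mem_add Xmod Uin\<close>)
    from U_eq[OF that(1) _ this] show ?thesis using that S.mem_add by simp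
  qed
  \<comment> \<open>One argument for scaling, differential and action: coordinates commute with
    every linear \<open>F\<close> that acts on the summands separately, by maps
    \<open>G\<close>.\<close>
  have Umap: "U y l (F s) i = G i (U x n s i)"
    if o: "x \<in> Obj C" "y \<in> Obj C" and s: "s \<in> Car S x n" and i: "i \<in> I" and F: "linear_map_on (Car S x n) F"
      and Fin: "\<And>s. s \<in> Car S x n \<Longrightarrow> F s \<in> Car S y l"
      and G: "\<And>i v. i \<in> I \<Longrightarrow> v \<in> Car (X i) x n \<Longrightarrow> G i v \<in> Car (X i) y l \<and> F (\<iota> i x n v) = \<iota> i y l (G i v)"
      and G0: "\<And>i. i \<in> I \<Longrightarrow> G i 0 = 0" for x y n l s i F G
  proof -
    obtain K where K: "finite K" "K \<subseteq> I" "\<forall>i. i \<notin> K \<longrightarrow> U x n s i = 0" "s = (\<Sum>i\<in>K. \<iota> i x n (U x n s i))"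
      using DU[OF o(1) s] by blast
    have "F s = (\<Sum>i\<in>K. F (\<iota> i x n (U x n s i)))"
      by (subst K(4), rule lin_sum[OF F S.car_subspace[OF o(1)]]) (use K o s in \<open>auto intro!: mor_in[OF \<iota>] Uin\<close>)
    also have "\<dots> = (\<Sum>i\<in>K. \<iota> i y l (if i \<in> K then G i (U x n s i) else 0))"
      by (rule sum.cong) (use K o s G Uin in auto)
    finally have "D y l (F s) (\<lambda>i. if i \<in> K then G i (U x n s i) else 0)"
      by (intro DI[of _ K]) (use o s K G Uin in auto)
    from U_eq[OF o(2) Fin[OF s] this] show ?thesis using K G0[OF i] by (cases "i \<in> K") auto
  qed
  have Uscale: "U x n (kscale c s) i = kscale c (U x n s i)" if "x \<in> Obj C" "s \<in> Car S x n" "i \<in> I" for x n s c i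
    by (rule Umap[OF that(1,1,2,3), where F = "kscale c" and G = "\<lambda>i. kscale c"])
      (use that in \<open>auto simp: linear_map_on_def S.mem_scale kvec.scale_right_distrib mult.commute mor_scale[OF \<iota>] intro: dg_module.mem_scale[OF Xmod]\<close>)
  have Ud: "U x (n + 1) (MDiff S x n s) i = MDiff (X i) x n (U x n s i)" if "x \<in> Obj C" "s \<in> Car S x n" "i \<in> I" for x n s i
    by (rule Umap[OF that(1,1,2,3) S.mdiff_linear[OF that(1)], where G = "\<lambda>i. MDiff (X i) x n"])
      (use that in \<open>auto simp: S.mdiff_closed mor_d[OF \<iota>] dg_module.d_0[OF Xmod] intro: dg_module.mdiff_closed[OF Xmod]\<close>)
  have Uact: "U x (l + j) (Act S x y l j s f) i = Act (X i) x y l j (U y l s i) f"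
    if "x \<in> Obj C" "y \<in> Obj C" "s \<in> Car S y l" "f \<in> Hom C x y j" "i \<in> I" for x y l j s f i
    by (rule Umap[OF that(2,1,3,5) S.act_linear_left[OF that(1,2,4)], where G = "\<lambda>i v. Act (X i) x y l j v f"])
      (use that in \<open>auto simp: S.act_closed mor_act[OF \<iota>] dg_module.act_0[OF Xmod] intro: dg_module.act_closed[OF Xmod]\<close>)
  have "dsum C I X S \<iota> (\<lambda>i x n s. U x n s i)"
    unfolding dsum_def
  proof (intro conjI ballI allI S.dg_module_axioms \<iota>)
    fix i assume "i \<in> I"
    then show "dg_morphism C S (X i) (\<lambda>x n s. U x n s i)"
      by (intro dg_morphismI linear_map_onI) (auto simp: S.dg_module_axioms Xmod Uin Uadd Uscale Ud Uact)
  next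
    fix i j x n m assume *: "i \<in> I" "j \<in> I" "x \<in> Obj C" "m \<in> Car (X i) x n"
    have "D x n (\<iota> i x n m) (\<lambda>k. if k = i then m else 0)"
      by (rule DI[of _ "{i}"]) (use * in auto)
    from U_eq[OF *(3) _ this] show "U x n (\<iota> i x n m) j = (if i = j then m else 0)"
      using * mor_in[OF \<iota>] by auto
  next
    fix x n s assume "x \<in> Obj C" "s \<in> Car S x n"
    from DE[OF U[OF this]] show "\<exists>J. finite J \<and> J \<subseteq> I \<and> (\<forall>i\<in>I - J. U x n s i = 0) \<and> s = (\<Sum>i\<in>J. \<iota> i x n (U x n s i))"
      by blast
  qed
  then show ?thesis by blast
qed

lemma dsum_imp_is_direct_sum:
  assumes ds: "dsum C I X S \<iota> \<pi>"
  shows "is_direct_sum C I X S"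
  unfolding is_direct_sum_def
proof (intro conjI exI ballI allI)
  note d = dsumD[OF ds]
  show "dg_module C S" by (rule d)
  fix i assume "i \<in> I" then show "dg_morphism C (X i) S (\<iota> i)" by (rule d)
next
  note d = dsumD[OF ds]
  interpret S: dg_module C S by (rule d)
  fix x n s assume *: "x \<in> Obj C" "s \<in> Car S x n"
  obtain J where J: "finite J" "J \<subseteq> I" "\<forall>i\<in>I - J. \<pi> i x n s = 0" "s = (\<Sum>i\<in>J. \<iota> i x n (\<pi> i x n s))"
    using d(5)[OF *] by blast
  show "\<exists>!u. finite {i. u i \<noteq> 0} \<and> {i. u i \<noteq> 0} \<subseteq> I \<and>
        (\<forall>i\<in>I. u i \<in> Car (X i) x n) \<and> s = (\<Sum>i | u i \<noteq> 0. \<iota> i x n (u i))"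
  proof (rule ex1I[of _ "\<lambda>i. if i \<in> I then \<pi> i x n s else 0"], intro conjI)
    let ?u = "\<lambda>i. if i \<in> I then \<pi> i x n s else 0"
    have sub: "{i. ?u i \<noteq> 0} \<subseteq> J" using J by auto
    show "finite {i. ?u i \<noteq> 0}" using J sub finite_subset by blast
    show "{i. ?u i \<noteq> 0} \<subseteq> I" by auto
    show "\<forall>i\<in>I. ?u i \<in> Car (X i) x n" using * mor_in[OF d(3)] by auto
    have "s = (\<Sum>i | ?u i \<noteq> 0. \<iota> i x n (\<pi> i x n s))"
      by (rule dsum_sum_eq[OF ds *]) (use J sub finite_subset in \<open>auto split: if_splits\<close>)
    then show "s = (\<Sum>i | ?u i \<noteq> 0. \<iota> i x n (?u i))"
      by (rule trans) (rule sum.cong, auto split: if_splits)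
  next
    fix u assume u: "finite {i. u i \<noteq> 0} \<and> {i. u i \<noteq> 0} \<subseteq> I \<and>
        (\<forall>i\<in>I. u i \<in> Car (X i) x n) \<and> s = (\<Sum>i | u i \<noteq> 0. \<iota> i x n (u i))"
    show "u = (\<lambda>i. if i \<in> I then \<pi> i x n s else 0)"
    proof
      fix j
      show "u j = (if j \<in> I then \<pi> j x n s else 0)"
      proof (cases "j \<in> I")
        case True
        have "\<pi> j x n s = (\<Sum>i | u i \<noteq> 0. \<pi> j x n (\<iota> i x n (u i)))"
          by (subst u[THEN conjunct2, THEN conjunct2, THEN conjunct2], rule mor_sum[OF d(3)[OF True] *(1)])
            (use u * in \<open>auto intro!: mor_in[OF d(2)]\<close>)
        also have "\<dots> = (\<Sum>i | u i \<noteq> 0. if i = j then u i else 0)"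
          by (rule sum.cong) (use u * True in \<open>auto simp: d(4) subset_iff\<close>)
        also have "\<dots> = u j" using u by simp
        finally show ?thesis using True by simp
      qed (use u in auto)
    qed
  qed
qed

text \<open>For a finite set \<open>J\<close> of indices, the idempotent onto the remaining
  summands. That it annihilates a map up to homotopy expresses that the map factors through finitely
  many summands.\<close>

definition dsum_rest where
  "dsum_rest \<iota> \<pi> J x n s = s - (\<Sum>i\<in>J. \<iota> i x n (\<pi> i x n s))"

lemma mor_dsum_rest:
  assumes ds: "dsum C I X S \<iota> \<pi>" and J: "J \<subseteq> I"
  shows "dg_morphism C S S (dsum_rest \<iota> \<pi> J)"
proof -
  note d = dsumD[OF ds]
  have "dg_morphism C S S (\<lambda>x n s. \<Sum>i\<in>J. \<iota> i x n (\<pi> i x n s))"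
    by (rule mor_sum_fun[OF d(1) d(1)]) (use J mor_comp[OF d(3) d(2)] in blast)
  from mor_minus_fun[OF mor_id[OF d(1)] this] show ?thesis
    by (rule mor_cong) (simp add: dsum_rest_def)
qed

text \<open>The projections are orthogonal, so successive removals of summands add up. This combines
  the two finite sets found for the two ends of a cone.\<close>

lemma dsum_rest_dsum_rest:
  assumes ds: "dsum C I X S \<iota> \<pi>" and J: "J \<subseteq> I" "finite J" and K: "K \<subseteq> I" "finite K" and s: "x \<in> Obj C" "s \<in> Car S x n"
  shows "dsum_rest \<iota> \<pi> K x n (dsum_rest \<iota> \<pi> J x n s) = dsum_rest \<iota> \<pi> (J \<union> K) x n s"
proof -
  note d = dsumD[OF ds]
  interpret S: dg_module C S by (rule d)
  have ips: "\<iota> i x n (\<pi> i x n s) \<in> Car S x n" "\<pi> i x n s \<in> Car (X i) x n" if "i \<in> I" for i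
    using that s mor_in[OF d(2)] mor_in[OF d(3)] by auto
  have *: "\<pi> j x n (dsum_rest \<iota> \<pi> J x n s) = (if j \<in> J then 0 else \<pi> j x n s)" if "j \<in> I" for j
  proof -
    have m: "(\<Sum>i\<in>J. \<iota> i x n (\<pi> i x n s)) \<in> Car S x n"
      using J by (auto intro!: S.mem_sum ips s)
    have "\<pi> j x n (\<Sum>i\<in>J. \<iota> i x n (\<pi> i x n s)) = (\<Sum>i\<in>J. \<pi> j x n (\<iota> i x n (\<pi> i x n s)))"
      using J by (intro mor_sum[OF d(3)[OF that] s(1)] ips) auto
    also have "\<dots> = (\<Sum>i\<in>J. if i = j then \<pi> i x n s else 0)"
      by (rule sum.cong) (use J that s in \<open>auto simp: d(4) ips subset_iff\<close>)
    also have "\<dots> = (if j \<in> J then \<pi> j x n s else 0)" using J by simp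
    finally show ?thesis
      unfolding dsum_rest_def using m s by (simp add: mor_diff[OF d(3)[OF that]])
  qed
  have "(\<Sum>i\<in>K. \<iota> i x n (\<pi> i x n (dsum_rest \<iota> \<pi> J x n s))) = (\<Sum>i\<in>K. if i \<in> J then 0 else \<iota> i x n (\<pi> i x n s))"
    by (rule sum.cong) (use K * mor_0[OF d(2) s(1)] in auto)
  also have "\<dots> = (\<Sum>i\<in>K - J. \<iota> i x n (\<pi> i x n s))"
    by (rule sum.mono_neutral_cong_right) (use K in auto)
  finally have "(\<Sum>i\<in>K. \<iota> i x n (\<pi> i x n (dsum_rest \<iota> \<pi> J x n s))) = (\<Sum>i\<in>K - J. \<iota> i x n (\<pi> i x n s))" .
  moreover have "(\<Sum>i\<in>J \<union> K. \<iota> i x n (\<pi> i x n s)) = (\<Sum>i\<in>J. \<iota> i x n (\<pi> i x n s)) + (\<Sum>i\<in>K - J. \<iota> i x n (\<pi> i x n s))"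
    using J K by (subst sum.union_disjoint[symmetric]) (auto intro!: sum.cong)
  ultimately show ?thesis
    unfolding dsum_rest_def[of _ _ K] dsum_rest_def[of _ _ "J \<union> K"] by (simp add: dsum_rest_def)
qed

lemma dsum_shift:
  assumes ds: "dsum C I X S \<iota> \<pi>"
  shows "dsum C I (\<lambda>i. shift p (X i)) (shift p S) (\<lambda>i x n. \<iota> i x (n + p)) (\<lambda>i x n. \<pi> i x (n + p))"
  using dsumD[OF ds] unfolding dsum_def by (auto intro!: dg_module_shift mor_shift)


section \<open>K-projective modules\<close>

text \<open>For such modules homotopy classes of closed maps are the morphisms of the derived
  category, which is what the lifting lemmas below amount to.\<close>

definition kproj :: "('o, 'a, 'k::field) dgcat \<Rightarrow> ('o, 'a, 'b, 'k) dgmod \<Rightarrow> bool" where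
  "kproj C P \<longleftrightarrow> dg_module C P \<and> (\<forall>A f. acyclic_module C A \<longrightarrow> dg_morphism C P A f \<longrightarrow> null_homotopic C P A f)"

lemma kproj_module: "kproj C P \<Longrightarrow> dg_module C P"
  by (simp add: kproj_def)

lemma kprojD: "kproj C P \<Longrightarrow> acyclic_module C A \<Longrightarrow> dg_morphism C P A f \<Longrightarrow> null_homotopic C P A f"
  by (simp add: kproj_def)

lemma kproj_shift:
  assumes P: "kproj C P"
  shows "kproj C (shift p P)"
  unfolding kproj_def
proof (intro conjI allI impI dg_module_shift kproj_module P)
  fix A f assume A: "acyclic_module C A" and f: "dg_morphism C (shift p P) A f"
  have "null_homotopic C P (shift (- p) A) (\<lambda>x n. f x (n - p))"
    by (rule kprojD[OF P acyclic_shift[OF A] mor_unshift[OF f]])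
  from null_homotopic_shift[OF kproj_module[OF P] dg_module_shift[OF mor_target[OF f]] this, of p]
  show "null_homotopic C (shift p P) A f" by simp
qed

text \<open>The two contributions that contain the differential of a morphism of \<open>C\<close>
  cancel, because the degree of \<open>h\<close> is odd.\<close>

lemma mor_homotopy:
  assumes "dg_category C" and M: "dg_module C M" and N: "dg_module C N" and h: "graded_map C (-1) M N h"
  shows "dg_morphism C M N (\<lambda>x n m. MDiff N x (n - 1) (h x n m) + h x (n + 1) (MDiff M x n m))"
proof -
  interpret M: dg_module C M by fact
  interpret N: dg_module C N by fact
  have hin: "h x n m \<in> Car N x k" if "x \<in> Obj C" "m \<in> Car M x n" "k = n - 1" for x n m k
    using gr_in[OF h that(1,2), of k] that(3) by simp
  have h0: "h x n 0 = 0" if "x \<in> Obj C" for x n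
    using lin_zero[OF gr_linear[OF h that] M.car_subspace[OF that]] .
  show ?thesis
  proof (rule dg_morphismI[OF M N])
    fix x n assume x: "x \<in> Obj C"
    show "linear_map_on (Car M x n) (\<lambda>m. MDiff N x (n - 1) (h x n m) + h x (n + 1) (MDiff M x n m))"
      by (rule lin_plus; rule lin_compose[OF gr_linear[OF h x] N.mdiff_linear[OF x]]
          lin_compose[OF M.mdiff_linear[OF x] gr_linear[OF h x]])
        (auto simp: hin M.d_in x)
    fix m assume m: "m \<in> Car M x n"
    show "MDiff N x (n - 1) (h x n m) + h x (n + 1) (MDiff M x n m) \<in> Car N x n"
      using x m by (auto intro!: N.mem_add N.d_in hin M.d_in)
    show "MDiff N x (n + 1 - 1) (h x (n + 1) (MDiff M x n m)) + h x (n + 1 + 1) (MDiff M x (n + 1) (MDiff M x n m)) =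
         MDiff N x n (MDiff N x (n - 1) (h x n m) + h x (n + 1) (MDiff M x n m))"
      using x m by (simp add: M.dd h0 N.d_add N.d_in hin M.d_in N.dd)
  next
    fix x y i j m f assume *: "x \<in> Obj C" "y \<in> Obj C" "m \<in> Car M y i" "f \<in> Hom C x y j"
    have a1: "h x (i + j) (Act M x y i j m f) = Act N x y (i - 1) j (h y i m) f"
      using * by (intro gr_act[OF h]) auto
    have a2: "h x (i + j + 1) (Act M x y (i + 1) j (MDiff M y i m) f) = Act N x y i j (h y (i + 1) (MDiff M y i m)) f"
      using * by (intro gr_act[OF h]) (auto simp: M.d_in)
    show "MDiff N x (i + j - 1) (h x (i + j) (Act M x y i j m f)) + h x (i + j + 1) (MDiff M x (i + j) (Act M x y i j m f)) =
       Act N x y i j (MDiff N y (i - 1) (h y i m) + h y (i + 1) (MDiff M y i m)) f"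
    proof -
      have True: "Diff C x y j f \<in> Hom C x y (j + 1)"
        using * dg_category.diff_closed[OF assms(1)] by blast
      have a3: "h x (i + j + 1) (Act M x y i (j + 1) m (Diff C x y j f)) = Act N x y (i - 1) (j + 1) (h y i m) (Diff C x y j f)"
        using * True by (intro gr_act[OF h]) auto
      have a4: "MDiff N x (i + j - 1) (Act N x y (i - 1) j (h y i m) f) =
           Act N x y i j (MDiff N y (i - 1) (h y i m)) f - sgn_pow i (Act N x y (i - 1) (j + 1) (h y i m) (Diff C x y j f))"
        using N.mdiff_act[of x y "h y i m" "i - 1" f j] * by (simp add: hin add_diff_eq diff_add_eq)
      have in1: "Act M x y (i + 1) j (MDiff M y i m) f \<in> Car M x (i + j + 1)"
        "Act M x y i (j + 1) m (Diff C x y j f) \<in> Car M x (i + j + 1)"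
        using * True by (auto intro!: M.act_in M.d_in)
      have "h x (i + j + 1) (MDiff M x (i + j) (Act M x y i j m f)) =
        Act N x y i j (h y (i + 1) (MDiff M y i m)) f + sgn_pow i (Act N x y (i - 1) (j + 1) (h y i m) (Diff C x y j f))"
        using * in1 by (simp add: M.mdiff_act gr_add[OF h] a2 a3 M.mem lin_sgn_pow[OF gr_linear[OF h]])
      then show ?thesis
        using * by (simp add: a1 a4 N.act_add N.d_in hin M.d_in)
    qed
  qed
qed


lemma sgn_pow_m1 [simp]: "sgn_pow (-1) v = - v"
  by (simp add: sgn_pow_def)

section \<open>Maps out of K-projective modules and quasi-isomorphisms\<close>

locale dg_universe = infinite_basis basis + dg_category C
  for basis :: "'b itself" and C :: "('o, 'a, 'k::field) dgcat"
begin

lemma cone_vfst_graded: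
  assumes "dg_morphism C M N (\<phi> :: ('o, 'b, 'k) gmap)"
  shows "graded_map C 0 (cone_module M N \<phi>) N (\<lambda>x n. vfst)"
  by (rule graded_mapI; (rule linear_map_onI)?) auto

text \<open>Exactness of homotopy classes of maps into \<open>S\<close> for the triangle formed by
  \<open>N\<close>, the cone and \<open>shift 1 M\<close>: a map that vanishes on \<open>N\<close>
  up to homotopy comes from the quotient up to homotopy.\<close>

lemma cone_reduce:
  assumes \<gamma>: "dg_morphism C M N (\<gamma> :: ('o, 'b, 'k) gmap)"
    and f: "dg_morphism C (cone_module M N \<gamma>) S f"
    and null: "null_homotopic C N S (\<lambda>x n v. f x n (vpair v 0))"
  shows "\<exists>g. dg_morphism C (shift 1 M) S g \<and>
    null_homotopic C (cone_module M N \<gamma>) S (\<lambda>x n w. f x n w - g x n (vsnd w))"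
proof -
  let ?R = "cone_module M N \<gamma>"
  interpret M: dg_module C M using mor_source[OF \<gamma>] .
  interpret N: dg_module C N using mor_target[OF \<gamma>] .
  interpret S: dg_module C S using mor_target[OF f] .
  have R: "dg_module C ?R" by (rule dg_module_cone[OF \<gamma>])
  obtain h where h: "graded_map C (-1) N S h" "\<And>x n m. x \<in> Obj C \<Longrightarrow> m \<in> Car N x n \<Longrightarrow>
      f x n (vpair m 0) = MDiff S x (n - 1) (h x n m) + h x (n + 1) (MDiff N x n m)"
    using null unfolding null_homotopic_def by metis
  \<comment> \<open>The null homotopy on \<open>N\<close> is extended by zero. Once its boundary is
    subtracted, the map vanishes on \<open>N\<close> exactly and descends to the quotient.\<close>
  define k where "k x n w = h x n (vfst w)" for x n w
  have k: "graded_map C (-1) ?R S k"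
    using gr_comp[OF cone_vfst_graded[OF \<gamma>] h(1)] by (simp add: k_def[abs_def])
  define f1 where "f1 x n w = f x n w - (MDiff S x (n - 1) (k x n w) + k x (n + 1) (MDiff ?R x n w))" for x n w
  have hom: "dg_morphism C ?R S (\<lambda>x n w. MDiff S x (n - 1) (k x n w) + k x (n + 1) (MDiff ?R x n w))"
    by (rule mor_homotopy[OF dg_category_axioms R S.dg_module_axioms k])
  have f1: "dg_morphism C ?R S f1"
    using mor_minus_fun[OF f hom] unfolding f1_def[abs_def] .
  have null1: "null_homotopic C ?R S (\<lambda>x n w. f x n w - f1 x n w)"
    by (rule null_homotopicI[OF k]) (simp add: f1_def)
  have van: "f1 x n (vpair v 0) = 0" if "x \<in> Obj C" "v \<in> Car N x n" for x n v
    using that by (simp add: f1_def k_def h(2) mor_0[OF \<gamma>])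
  define g where "g x n m = f1 x n (vpair 0 m)" for x n m
  have f1g: "f1 x n w = g x n (vsnd w)" if "x \<in> Obj C" "w \<in> Car ?R x n" for x n w
  proof -
    have "f1 x n (vpair (vfst w) 0 + vpair 0 (vsnd w)) = f1 x n (vpair (vfst w) 0) + f1 x n (vpair 0 (vsnd w))"
      by (rule mor_add[OF f1 that(1)]) (use that in \<open>auto simp: M.mem_0 N.mem_0\<close>)
    then show ?thesis using van that by (simp add: g_def)
  qed
  have g: "dg_morphism C (shift 1 M) S g"
  proof (rule dg_morphismI[OF dg_module_shift[OF M.dg_module_axioms] S.dg_module_axioms])
    fix x n assume x: "x \<in> Obj C"
    show "linear_map_on (Car (shift 1 M) x n) (g x n)"
    proof (rule linear_map_onI)
      fix u v assume "u \<in> Car (shift 1 M) x n" "v \<in> Car (shift 1 M) x n"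
      then show "g x n (u + v) = g x n u + g x n v"
        using mor_add[OF f1 x, of "vpair 0 u" n "vpair 0 v"] x by (simp add: g_def N.mem_0)
    next
      fix c v assume "v \<in> Car (shift 1 M) x n"
      then show "g x n (kscale c v) = kscale c (g x n v)"
        using mor_scale[OF f1 x, of "vpair 0 v" n c] x by (simp add: g_def N.mem_0)
    qed
    fix m assume m: "m \<in> Car (shift 1 M) x n"
    then show "g x n m \<in> Car S x n"
      using mor_in[OF f1 x, of "vpair 0 m" n] x by (simp add: g_def N.mem_0)
    have "f1 x (n + 1) (MDiff ?R x n (vpair 0 m)) = MDiff S x n (f1 x n (vpair 0 m))"
      by (rule mor_d[OF f1 x]) (use m x in \<open>auto simp: N.mem_0\<close>)
    moreover have "MDiff ?R x n (vpair 0 m) \<in> Car ?R x (n + 1)"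
      by (rule dg_module.d_in[OF R x]) (use m x in \<open>auto simp: N.mem_0\<close>)
    ultimately show "g x (n + 1) (MDiff (shift 1 M) x n m) = MDiff S x n (g x n m)"
      using f1g[OF x, of "MDiff ?R x n (vpair 0 m)" "n + 1"] by (simp add: g_def[symmetric])
  next
    fix x y i j m a assume *: "x \<in> Obj C" "y \<in> Obj C" "m \<in> Car (shift 1 M) y i" "a \<in> Hom C x y j"
    then have "f1 x (i + j) (Act ?R x y i j (vpair 0 m) a) = Act S x y i j (f1 y i (vpair 0 m)) a"
      by (intro mor_act[OF f1]) (auto simp: N.mem_0)
    then show "g x (i + j) (Act (shift 1 M) x y i j m a) = Act S x y i j (g y i m) a"
      using * by (simp add: g_def N.act_0)
  qed
  have "null_homotopic C ?R S (\<lambda>x n w. f x n w - g x n (vsnd w))"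
    by (rule null_homotopic_cong[OF null1]) (use f1g in auto)
  with g show ?thesis by blast
qed

lemma kproj_cone:
  assumes \<gamma>: "dg_morphism C M N (\<gamma> :: ('o, 'b, 'k) gmap)"
    and M: "kproj C M" and N: "kproj C N"
  shows "kproj C (cone_module M N \<gamma>)"
  unfolding kproj_def
proof (intro conjI allI impI)
  let ?R = "cone_module M N \<gamma>"
  show R: "dg_module C ?R" by (rule dg_module_cone[OF \<gamma>])
  fix A f assume A: "acyclic_module C A" and f: "dg_morphism C ?R A f"
  have "null_homotopic C N A (\<lambda>x n v. f x n (vpair v 0))"
    by (rule kprojD[OF N A mor_comp[OF cone_inclusion[OF \<gamma>] f]])
  from cone_reduce[OF \<gamma> f this] obtain g where g: "dg_morphism C (shift 1 M) A g"
    "null_homotopic C ?R A (\<lambda>x n w. f x n w - g x n (vsnd w))" by blast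
  have "null_homotopic C ?R A (\<lambda>x n w. g x n (vsnd w))"
    by (rule null_homotopic_pre[OF cone_projection[OF \<gamma>] kprojD[OF kproj_shift[OF M] A g(1)]])
  from null_homotopic_plus[OF mor_target[OF f] R g(2) this]
  show "null_homotopic C ?R A f" by simp
qed

text \<open>The map \<open>f\<close>, composed with the inclusion into the acyclic cone of
  \<open>\<phi>\<close>, is null homotopic. One component of the null homotopy is the lift, the
  other the homotopy between \<open>f\<close> and its lift.\<close>

lemma kproj_lift:
  assumes P: "kproj C P" and \<phi>: "quasi_iso C X Y (\<phi> :: ('o, 'b, 'k) gmap)" and f: "dg_morphism C P Y f"
  shows "\<exists>g. dg_morphism C P X g \<and> null_homotopic C P Y (\<lambda>x n p. f x n p - \<phi> x n (g x n p))"
proof -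
  note \<phi>m = quasi_iso_mor[OF \<phi>]
  interpret P: dg_module C P using kproj_module[OF P] .
  interpret X: dg_module C X using mor_source[OF \<phi>m] .
  interpret Y: dg_module C Y using mor_target[OF \<phi>m] .
  let ?R = "cone_module X Y \<phi>"
  have "null_homotopic C P ?R (\<lambda>x n p. vpair (f x n p) 0)"
    by (rule kprojD[OF P _ mor_comp[OF f cone_inclusion[OF \<phi>m]]]) (simp add: acyclic_cone_iff[OF \<phi>m] \<phi>)
  then obtain h where h: "graded_map C (-1) P ?R h" "\<And>x n m. x \<in> Obj C \<Longrightarrow> m \<in> Car P x n \<Longrightarrow>
      vpair (f x n m) 0 = MDiff ?R x (n - 1) (h x n m) + h x (n + 1) (MDiff P x n m)"
    unfolding null_homotopic_def by metis
  have hin: "vfst (h x n m) \<in> Car Y x (n - 1)" "vsnd (h x n m) \<in> Car X x n" if "x \<in> Obj C" "m \<in> Car P x n" for x n m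
    using gr_in[OF h(1) that] that by simp_all
  have eq: "f x n m = MDiff Y x (n - 1) (vfst (h x n m)) + \<phi> x n (vsnd (h x n m)) + vfst (h x (n + 1) (MDiff P x n m))"
     "MDiff X x n (vsnd (h x n m)) = vsnd (h x (n + 1) (MDiff P x n m))" if "x \<in> Obj C" "m \<in> Car P x n" for x n m
    using h(2)[OF that] by simp_all
  have hact: "h x (i + j) (Act P x y i j m a) = Act ?R x y (i - 1) j (h y i m) a"
    if "x \<in> Obj C" "y \<in> Obj C" "m \<in> Car P y i" "a \<in> Hom C x y j" for x y i j m a
    using gr_act[OF h(1) that] by simp
  have g: "dg_morphism C P X (\<lambda>x n p. vsnd (h x n p))"
    by (rule dg_morphismI[OF P.dg_module_axioms X.dg_module_axioms]; (rule linear_map_onI)?)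
      (auto simp: hin eq hact gr_add[OF h(1)] gr_scale[OF h(1)])
  have k: "graded_map C (-1) P Y (\<lambda>x n p. vfst (h x n p))"
    by (rule graded_mapI; (rule linear_map_onI)?)
      (auto simp: hin hact gr_add[OF h(1)] gr_scale[OF h(1)])
  have "null_homotopic C P Y (\<lambda>x n p. f x n p - \<phi> x n (vsnd (h x n p)))"
    by (rule null_homotopicI[OF k]) (simp add: eq)
  with g show ?thesis by blast
qed

text \<open>Uniqueness of lifts up to homotopy. A null homotopy of the composite with
  \<open>\<phi>\<close> turns \<open>u\<close> into a map to the shifted cone of
  \<open>\<phi>\<close>; this cone is acyclic, and a null homotopy of the new map contains one of
  \<open>u\<close>.\<close>

lemma kproj_cancel:
  assumes P: "kproj C P" and \<phi>: "quasi_iso C X Y (\<phi> :: ('o, 'b, 'k) gmap)" and u: "dg_morphism C P X u"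
    and null: "null_homotopic C P Y (\<lambda>x n p. \<phi> x n (u x n p))"
  shows "null_homotopic C P X u"
proof -
  note \<phi>m = quasi_iso_mor[OF \<phi>]
  interpret P: dg_module C P using kproj_module[OF P] .
  interpret X: dg_module C X using mor_source[OF \<phi>m] .
  interpret Y: dg_module C Y using mor_target[OF \<phi>m] .
  let ?R = "cone_module X Y \<phi>"
  obtain k where k: "graded_map C (-1) P Y k" "\<And>x n m. x \<in> Obj C \<Longrightarrow> m \<in> Car P x n \<Longrightarrow>
      \<phi> x n (u x n m) = MDiff Y x (n - 1) (k x n m) + k x (n + 1) (MDiff P x n m)"
    using null unfolding null_homotopic_def by metis
  have kin: "k x n m \<in> Car Y x (n - 1)" if "x \<in> Obj C" "m \<in> Car P x n" for x n m
    using gr_in[OF k(1) that] by simp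
  have R: "acyclic_module C (shift (-1) ?R)"
    by (rule acyclic_shift) (simp add: acyclic_cone_iff[OF \<phi>m] \<phi>)
  have kact: "k x (i + j) (Act P x y i j m a) = Act Y x y (i - 1) j (k y i m) a"
    if "x \<in> Obj C" "y \<in> Obj C" "m \<in> Car P y i" "a \<in> Hom C x y j" for x y i j m a
    using gr_act[OF k(1) that] by simp
  have "dg_morphism C P (shift (-1) ?R) (\<lambda>x n p. vpair (k x n p) (- u x n p))"
    by (rule dg_morphismI; (rule linear_map_onI)?)
      (auto simp: P.dg_module_axioms dg_module_shift dg_module_cone[OF \<phi>m] kin kact k(2) mor_in[OF u] X.mem
        gr_add[OF k(1)] gr_scale[OF k(1)] mor_add[OF u] mor_scale[OF u]
        X.act_minus mor_act[OF u] mor_d[OF u] mor_minus[OF \<phi>m] X.d_minus)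
  from kprojD[OF P R this] obtain h where h: "graded_map C (-1) P (shift (-1) ?R) h"
    "\<And>x n m. x \<in> Obj C \<Longrightarrow> m \<in> Car P x n \<Longrightarrow> vpair (k x n m) (- u x n m) =
        MDiff (shift (-1) ?R) x (n - 1) (h x n m) + h x (n + 1) (MDiff P x n m)"
    unfolding null_homotopic_def by metis
  have hin: "vsnd (h x n m) \<in> Car X x (n - 1)" if "x \<in> Obj C" "m \<in> Car P x n" for x n m
    using gr_in[OF h(1) that] that by simp
  have hact: "vsnd (h x (i + j) (Act P x y i j m a)) = Act X x y (i - 1) j (vsnd (h y i m)) a"
    if "x \<in> Obj C" "y \<in> Obj C" "m \<in> Car P y i" "a \<in> Hom C x y j" for x y i j m a
    using gr_act[OF h(1) that] by simp
  have g: "graded_map C (-1) P X (\<lambda>x n p. - vsnd (h x n p))"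
    by (rule graded_mapI; (rule linear_map_onI)?)
      (auto simp: hin hact X.mem X.act_minus gr_add[OF h(1)] gr_scale[OF h(1)])
  show ?thesis
  proof (rule null_homotopicI[OF g])
    fix x n m assume *: "x \<in> Obj C" "m \<in> Car P x n"
    have "- u x n m = MDiff X x (n - 1) (vsnd (h x n m)) + vsnd (h x (n + 1) (MDiff P x n m))"
      using h(2)[OF *] by simp
    then have "u x n m = - (MDiff X x (n - 1) (vsnd (h x n m)) + vsnd (h x (n + 1) (MDiff P x n m)))"
      by (metis minus_minus)
    then show "u x n m = MDiff X x (n - 1) (- vsnd (h x n m)) + - vsnd (h x (n + 1) (MDiff P x n m))"
      using * hin by (simp add: X.d_minus)
  qed
qed

text \<open>A square that commutes up to homotopy induces a map of cones, with the homotopy as its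
  off-diagonal entry. The rest is the five lemma, carried out on elements.\<close>

lemma cone_quasi_iso:
  fixes \<gamma> \<phi> :: "('o, 'b, 'k) gmap"
  assumes \<gamma>: "dg_morphism C M N \<gamma>" and \<phi>: "dg_morphism C M' N' \<phi>"
    and a: "quasi_iso C M M' a" and b: "quasi_iso C N N' b"
    and null: "null_homotopic C M N' (\<lambda>x n m. \<phi> x n (a x n m) - b x n (\<gamma> x n m))"
  shows "\<exists>\<theta>. quasi_iso C (cone_module M N \<gamma>) (cone_module M' N' \<phi>) \<theta>"
proof -
  note am = quasi_iso_mor[OF a] and bm = quasi_iso_mor[OF b]
  interpret M: dg_module C M using mor_source[OF \<gamma>] .
  interpret N: dg_module C N using mor_target[OF \<gamma>] .
  interpret M': dg_module C M' using mor_source[OF \<phi>] .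
  interpret N': dg_module C N' using mor_target[OF \<phi>] .
  let ?R = "cone_module M N \<gamma>" and ?R' = "cone_module M' N' \<phi>"
  obtain h where h: "graded_map C (-1) M N' h" "\<And>x n m. x \<in> Obj C \<Longrightarrow> m \<in> Car M x n \<Longrightarrow>
      \<phi> x n (a x n m) - b x n (\<gamma> x n m) = MDiff N' x (n - 1) (h x n m) + h x (n + 1) (MDiff M x n m)"
    using null unfolding null_homotopic_def by metis
  have hin: "h x n m \<in> Car N' x k" if "x \<in> Obj C" "m \<in> Car M x n" "k = n - 1" for x n m k
    using gr_in[OF h(1) that(1,2)] that by simp
  have h0: "h x n 0 = 0" if "x \<in> Obj C" for x n
    using lin_zero[OF gr_linear[OF h(1) that] M.car_subspace[OF that]] .
  have hact: "h x (i + 1 + j) (Act M x y (i + 1) j m f) = Act N' x y i j (h y (i + 1) m) f"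
    if "x \<in> Obj C" "y \<in> Obj C" "m \<in> Car M y (i + 1)" "f \<in> Hom C x y j" for x y i j m f
    using gr_act[OF h(1) that] by simp
  have heq: "\<phi> x n (a x n m) = b x n (\<gamma> x n m) + MDiff N' x (n - 1) (h x n m) + h x (n + 1) (MDiff M x n m)"
    if "x \<in> Obj C" "m \<in> Car M x n" for x n m
    using h(2)[OF that] by (simp add: algebra_simps)
  define \<theta> where "\<theta> x n w = vpair (b x n (vfst w) - h x (n + 1) (vsnd w)) (a x (n + 1) (vsnd w))" for x n w
  have e: "i + j + 1 = i + 1 + j" for i j :: int by simp
  have \<theta>: "dg_morphism C ?R ?R' \<theta>"
    unfolding \<theta>_def
  proof (rule mor_to_cone[OF \<phi>])
    show "graded_map C 0 ?R N' (\<lambda>x n p. b x n (vfst p) - h x (n + 1) (vsnd p))"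
      by (rule graded_mapI; (rule linear_map_onI)?)
        (auto simp: mor_in[OF bm] hin N'.mem mor_add[OF bm] mor_scale[OF bm] gr_add[OF h(1)]
          gr_scale[OF h(1)] kvec.scale_right_diff_distrib mor_act[OF bm] e hact N'.act_diff)
    show "dg_morphism C ?R (shift 1 M') (\<lambda>x n p. a x (n + 1) (vsnd p))"
      using mor_comp[OF cone_projection[OF \<gamma>] mor_shift[OF am]] by simp
    fix x n p assume "x \<in> Obj C" "p \<in> Car ?R x n"
    then show "b x (n + 1) (vfst (MDiff ?R x n p)) - h x (n + 1 + 1) (vsnd (MDiff ?R x n p)) =
         MDiff N' x n (b x n (vfst p) - h x (n + 1) (vsnd p)) + \<phi> x (n + 1) (a x (n + 1) (vsnd p))"
      by (simp add: heq mor_add[OF bm] N.d_in mor_in[OF \<gamma>] gr_minus[OF h(1)] M.d_in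
          N'.d_diff hin mor_in[OF bm] mor_d[OF bm])
  qed
  have "quasi_iso C ?R ?R' \<theta>"
  proof (rule quasi_isoI[OF \<theta>])
    fix x n w u assume *: "x \<in> Obj C" "w \<in> Car ?R x n" "MDiff ?R x n w = 0" "u \<in> Car ?R' x (n - 1)" "\<theta> x n w = MDiff ?R' x (n - 1) u"
    define v m y p where defs: "v = vfst w" "m = vsnd w" "y = vfst u" "p = vsnd u"
    have 1: "v \<in> Car N x n" "m \<in> Car M x (n + 1)" "y \<in> Car N' x (n - 1)" "p \<in> Car M' x n"
      using * by (auto simp: defs)
    have 2: "MDiff M x (n + 1) m = 0" "MDiff N x n v + \<gamma> x (n + 1) m = 0"
      using * by (auto simp: defs)
    have 3: "b x n v - h x (n + 1) m = MDiff N' x (n - 1) y + \<phi> x n p" "a x (n + 1) m = MDiff M' x n (- p)"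
      using * 1 by (auto simp: defs \<theta>_def M'.d_minus)
    obtain m1 where m1: "m1 \<in> Car M x n" "m = MDiff M x n m1"
      using quasi_iso_inj[OF a *(1) 1(2) 2(1) M'.mem_minus[OF *(1) 1(4)] 3(2)] by auto
    have "MDiff M' x n (a x n m1 + p) = 0"
      using 3(2) m1 1 *(1) by (simp add: M'.d_add mor_in[OF am] mor_d[OF am, symmetric] M'.d_minus)
    \<comment> \<open>The primitive \<open>m1\<close> is determined only up to cycles; the cycle
      \<open>m2\<close> is chosen so that \<open>m1 - m2\<close> is mapped to \<open>- p\<close> up
      to a boundary.\<close>
    then obtain m2 p1 where m2: "m2 \<in> Car M x n" "p1 \<in> Car M' x (n - 1)" "MDiff M x n m2 = 0"
        "a x n m1 + p = a x n m2 + MDiff M' x (n - 1) p1"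
      using quasi_iso_surj[OF a *(1), of "a x n m1 + p" n] m1 1 *(1) by (auto simp: M'.mem mor_in[OF am])
    define m3 where "m3 = m1 - m2"
    have m3: "m3 \<in> Car M x n" "MDiff M x n m3 = m" "a x n m3 = MDiff M' x (n - 1) p1 - p"
      using m1 m2 *(1) by (auto simp: m3_def M.mem M.d_diff mor_diff[OF am] algebra_simps)
    have "MDiff N x n (v + \<gamma> x n m3) = 0"
      using 2(2) m3 1 *(1) mor_d[OF \<gamma> *(1) m3(1)] by (simp add: N.d_add mor_in[OF \<gamma>])
    moreover have "b x n (v + \<gamma> x n m3) = MDiff N' x (n - 1) (y + \<phi> x (n - 1) p1 - h x n m3)"
    proof -
      have "b x n v = MDiff N' x (n - 1) y + \<phi> x n p + h x (n + 1) m" using 3(1) by (simp add: algebra_simps)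
      moreover have "b x n (\<gamma> x n m3) = MDiff N' x (n - 1) (\<phi> x (n - 1) p1) - \<phi> x n p - MDiff N' x (n - 1) (h x n m3) - h x (n + 1) m"
        using heq[OF *(1) m3(1)] m3 m2 1 *(1)
        by (simp add: mor_diff[OF \<phi>] M'.d_in mor_d[OF \<phi>] algebra_simps)
      ultimately show ?thesis
        using 1 m3 m2 *(1) by (simp add: mor_add[OF bm] mor_in[OF \<gamma>] N'.d_add N'.d_diff N'.mem hin mor_in[OF \<phi>])
    qed
    ultimately obtain v' where v': "v' \<in> Car N x (n - 1)" "v + \<gamma> x n m3 = MDiff N x (n - 1) v'"
      using quasi_iso_inj[OF b *(1), of "v + \<gamma> x n m3" n "y + \<phi> x (n - 1) p1 - h x n m3" "n - 1"] 1 m3 m2 *(1)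
      by (auto simp: N.mem N'.mem mor_in[OF \<gamma>] mor_in[OF \<phi>] hin)
    show "\<exists>u\<in>Car ?R x (n - 1). w = MDiff ?R x (n - 1) u"
    proof
      show "vpair v' (- m3) \<in> Car ?R x (n - 1)" using v' m3 *(1) by (simp add: M.mem)
      show "w = MDiff ?R x (n - 1) (vpair v' (- m3))"
        using v' m3 *(1) by (simp add: defs[symmetric] v'(2)[symmetric] M.d_minus mor_minus[OF \<gamma>])
    qed
  next
    fix x n u assume *: "x \<in> Obj C" "u \<in> Car ?R' x n" "MDiff ?R' x n u = 0"
    define y p where defs: "y = vfst u" "p = vsnd u"
    have 1: "y \<in> Car N' x n" "p \<in> Car M' x (n + 1)" "MDiff M' x (n + 1) p = 0" "MDiff N' x n y + \<phi> x (n + 1) p = 0"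
      using * by (auto simp: defs)
    obtain m p1 where m: "m \<in> Car M x (n + 1)" "p1 \<in> Car M' x n" "MDiff M x (n + 1) m = 0"
      "p = a x (n + 1) m + MDiff M' x n p1"
      using quasi_iso_surj[OF a *(1) 1(2,3)] by auto
    have "\<phi> x (n + 1) p = b x (n + 1) (\<gamma> x (n + 1) m) + MDiff N' x n (h x (n + 1) m) + MDiff N' x n (\<phi> x n p1)"
      using m heq[OF *(1) m(1)] *(1) by (simp add: mor_add[OF \<phi>] mor_in[OF am] M'.d_in h0 mor_d[OF \<phi>])
    then have bg: "b x (n + 1) (\<gamma> x (n + 1) m) = MDiff N' x n (- (y + h x (n + 1) m + \<phi> x n p1))"
      using 1 m *(1) by (simp add: N'.d_minus N'.d_add N'.d_diff N'.mem hin mor_in[OF \<phi>] algebra_simps eq_neg_iff_add_eq_0)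
    have "MDiff N x (n + 1) (\<gamma> x (n + 1) m) = 0"
      using m *(1) mor_d[OF \<gamma>, of x m "n + 1", symmetric] by (simp add: mor_0[OF \<gamma>])
    then obtain v0 where v0: "v0 \<in> Car N x n" "\<gamma> x (n + 1) m = MDiff N x n v0"
      using quasi_iso_inj[OF b *(1) _ _ _ bg] m 1 *(1) by (auto simp: N'.mem hin mor_in[OF \<phi>] mor_in[OF \<gamma>])
    \<comment> \<open>The pair of \<open>- v0\<close> and \<open>m\<close> is already a cycle of the
      first cone. Its image differs from \<open>u\<close> by \<open>t\<close> in the first
      component, after a correction by the boundary that \<open>p1\<close> gives; it remains to hit
      the class of the cycle \<open>t\<close>.\<close>
    define t where "t = b x n v0 + (y + h x (n + 1) m + \<phi> x n p1)"
    have tin: "t \<in> Car N' x n" using v0 m 1 *(1) by (simp add: t_def N'.mem hin mor_in[OF \<phi>] mor_in[OF bm])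
    have rin: "y + h x (n + 1) m + \<phi> x n p1 \<in> Car N' x n" using m 1 *(1) by (simp add: N'.mem hin mor_in[OF \<phi>])
    have "MDiff N' x n (b x n v0) = MDiff N' x n (- (y + h x (n + 1) m + \<phi> x n p1))"
      using bg v0 *(1) mor_d[OF bm *(1) v0(1)] by simp
    then have "MDiff N' x n t = 0"
      unfolding t_def using v0 rin *(1) by (simp only: N'.d_add N'.d_minus mor_in[OF bm] left_minus)
    then obtain v1 y1 where v1: "v1 \<in> Car N x n" "y1 \<in> Car N' x (n - 1)" "MDiff N x n v1 = 0" "t = b x n v1 + MDiff N' x (n - 1) y1"
      using quasi_iso_surj[OF b *(1) tin] by blast
    show "\<exists>m\<in>Car ?R x n. \<exists>u'\<in>Car ?R' x (n - 1). MDiff ?R x n m = 0 \<and> u = \<theta> x n m + MDiff ?R' x (n - 1) u'"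
    proof (intro bexI conjI)
      show "vpair (v1 - v0) m \<in> Car ?R x n" "vpair y1 (- p1) \<in> Car ?R' x (n - 1)"
        using v1 v0 m *(1) by (auto simp: N.mem M'.mem)
      show "MDiff ?R x n (vpair (v1 - v0) m) = 0"
        using v1 v0 m *(1) by (simp add: N.d_diff)
      have "y = b x n v1 - b x n v0 - h x (n + 1) m + MDiff N' x (n - 1) y1 - \<phi> x n p1"
        using v1(4) unfolding t_def by (simp add: algebra_simps)
      then show "u = \<theta> x n (vpair (v1 - v0) m) + MDiff ?R' x (n - 1) (vpair y1 (- p1))"
        using v1 v0 m *(1)
        by (subst vpair_eq_iff) (simp add: defs[symmetric] \<theta>_def mor_diff[OF bm] mor_minus[OF \<phi>] M'.d_minus algebra_simps)
    qed
  qed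
  then show ?thesis by blast
qed

end


section \<open>Compactness of perfect modules\<close>

text \<open>Compactness expressed by homotopies, which is compactness in the derived category when
  \<open>P\<close> is K-projective. The index sets are subsets of \<open>'b\<close>, as in the rule
  \<open>sum\<close> of \<open>ads\<close>.\<close>

definition cpt :: "('o, 'a, 'k::field) dgcat \<Rightarrow> ('o, 'a, 'b, 'k) dgmod \<Rightarrow> bool" where
  "cpt C P \<longleftrightarrow> (\<forall>(I :: 'b set) X S \<iota> \<pi> f. dsum C I X S \<iota> \<pi> \<longrightarrow> dg_morphism C P S f \<longrightarrow>
     (\<exists>J. finite J \<and> J \<subseteq> I \<and> null_homotopic C P S (\<lambda>x n m. dsum_rest \<iota> \<pi> J x n (f x n m))))"

lemma cptD:
  fixes I :: "'b set"
  assumes "cpt C (P :: ('o, 'a, 'b, 'k::field) dgmod)" "dsum C I X S \<iota> \<pi>" "dg_morphism C P S f"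
  shows "\<exists>J. finite J \<and> J \<subseteq> I \<and> null_homotopic C P S (\<lambda>x n m. dsum_rest \<iota> \<pi> J x n (f x n m))"
  using assms(1)[unfolded cpt_def, rule_format, OF assms(2,3)] .

lemma null_homotopic_unshift:
  assumes "dg_module C M" "dg_module C N" and f: "null_homotopic C (shift p M) (shift p N) (\<lambda>x n. f x (n + p))"
  shows "null_homotopic C M N f"
  using null_homotopic_shift[OF dg_module_shift[OF assms(1)] dg_module_shift[OF assms(2)] f, of "- p"] by simp

lemma cpt_shift:
  assumes P: "cpt C (P :: ('o, 'a, 'b, 'k::field) dgmod)" and m: "dg_module C P"
  shows "cpt C (shift p P)"
  unfolding cpt_def
proof (intro allI impI)
  fix I :: "'b set" and X S \<iota> \<pi> f
  assume ds: "dsum C I X S \<iota> \<pi>" and f: "dg_morphism C (shift p P) S f"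
  from cptD[OF P dsum_shift[OF ds] mor_unshift[OF f]]
  obtain J where J: "finite J" "J \<subseteq> I"
    "null_homotopic C P (shift (- p) S) (\<lambda>x n m. dsum_rest (\<lambda>i x n. \<iota> i x (n + - p)) (\<lambda>i x n. \<pi> i x (n + - p)) J x n (f x (n - p) m))"
    by blast
  have "null_homotopic C (shift (- p) (shift p P)) (shift (- p) S) (\<lambda>x n m. dsum_rest \<iota> \<pi> J x (n + - p) (f x (n + - p) m))"
    using J(3) by (simp add: dsum_rest_def)
  from null_homotopic_unshift[OF dg_module_shift[OF m] dsumD(1)[OF ds] this]
  show "\<exists>J. finite J \<and> J \<subseteq> I \<and> null_homotopic C (shift p P) S (\<lambda>x n m. dsum_rest \<iota> \<pi> J x n (f x n m))"
    using J by blast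
qed

text \<open>Up to homotopy \<open>f\<close> is the composite of \<open>f\<close>, \<open>r\<close>
  and \<open>i\<close>, so the summands that suffice for \<open>f\<close> after \<open>r\<close>
  suffice for \<open>f\<close>.\<close>

lemma cpt_retract:
  assumes P: "cpt C (Q :: ('o, 'a, 'b, 'k::field) dgmod)" and i: "dg_morphism C P Q i" and r: "dg_morphism C Q P r"
    and ri: "null_homotopic C P P (\<lambda>x n m. m - r x n (i x n m))"
  shows "cpt C P"
  unfolding cpt_def
proof (intro allI impI)
  fix I :: "'b set" and X S \<iota> \<pi> f
  assume ds: "dsum C I X S \<iota> \<pi>" and f: "dg_morphism C P S f"
  from cptD[OF P ds mor_comp[OF r f]]
  obtain J where J: "finite J" "J \<subseteq> I" "null_homotopic C Q S (\<lambda>x n m. dsum_rest \<iota> \<pi> J x n (f x n (r x n m)))" by blast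
  note q = mor_dsum_rest[OF ds J(2)] and Pm = mor_source[OF i]
  note qf = mor_comp[OF f q]
  have 1: "null_homotopic C P S (\<lambda>x n m. dsum_rest \<iota> \<pi> J x n (f x n (r x n (i x n m))))"
    by (rule null_homotopic_pre[OF i J(3)])
  have 2: "null_homotopic C P S (\<lambda>x n m. dsum_rest \<iota> \<pi> J x n (f x n (m - r x n (i x n m))))"
    by (rule null_homotopic_post[OF ri qf Pm])
  have "null_homotopic C P S (\<lambda>x n m. dsum_rest \<iota> \<pi> J x n (f x n m))"
    by (rule null_homotopic_cong[OF null_homotopic_plus[OF mor_target[OF f] Pm 1 2]])
      (simp add: mor_diff[OF qf] mor_in[OF r] mor_in[OF i])
  then show "\<exists>J. finite J \<and> J \<subseteq> I \<and> null_homotopic C P S (\<lambda>x n m. dsum_rest \<iota> \<pi> J x n (f x n m))"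
    using J by blast
qed

context dg_universe
begin

text \<open>After removal of finitely many summands the map vanishes on \<open>N\<close> up to
  homotopy, hence comes from \<open>shift 1 M\<close>, where removing finitely many more is
  enough.\<close>

lemma cpt_cone:
  assumes \<gamma>: "dg_morphism C M N (\<gamma> :: ('o, 'b, 'k) gmap)"
    and M: "cpt C M" and N: "cpt C N"
  shows "cpt C (cone_module M N \<gamma>)"
  unfolding cpt_def
proof (intro allI impI)
  let ?R = "cone_module M N \<gamma>"
  fix I :: "'b set" and X S \<iota> \<pi> f
  assume ds: "dsum C I X S \<iota> \<pi>" and f: "dg_morphism C ?R S f"
  have R: "dg_module C ?R" by (rule dg_module_cone[OF \<gamma>])
  note Sm = dsumD(1)[OF ds]
  from cptD[OF N ds mor_comp[OF cone_inclusion[OF \<gamma>] f]]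
  obtain J where J: "finite J" "J \<subseteq> I" "null_homotopic C N S (\<lambda>x n m. dsum_rest \<iota> \<pi> J x n (f x n (vpair m 0)))" by blast
  note qJ = mor_dsum_rest[OF ds J(2)]
  from cone_reduce[OF \<gamma> mor_comp[OF f qJ] J(3)] obtain g where g: "dg_morphism C (shift 1 M) S g"
    "null_homotopic C ?R S (\<lambda>x n w. dsum_rest \<iota> \<pi> J x n (f x n w) - g x n (vsnd w))" by blast
  from cptD[OF cpt_shift[OF M mor_source[OF \<gamma>]] ds g(1)]
  obtain K where K: "finite K" "K \<subseteq> I" "null_homotopic C (shift 1 M) S (\<lambda>x n m. dsum_rest \<iota> \<pi> K x n (g x n m))" by blast
  note qK = mor_dsum_rest[OF ds K(2)]
  have 1: "null_homotopic C ?R S (\<lambda>x n w. dsum_rest \<iota> \<pi> K x n (g x n (vsnd w)))"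
    by (rule null_homotopic_pre[OF cone_projection[OF \<gamma>] K(3)])
  have 2: "null_homotopic C ?R S (\<lambda>x n w. dsum_rest \<iota> \<pi> K x n (dsum_rest \<iota> \<pi> J x n (f x n w) - g x n (vsnd w)))"
    by (rule null_homotopic_post[OF g(2) qK R])
  have "null_homotopic C ?R S (\<lambda>x n m. dsum_rest \<iota> \<pi> (J \<union> K) x n (f x n m))"
  proof (rule null_homotopic_cong[OF null_homotopic_plus[OF Sm R 1 2]])
    fix x n m assume *: "x \<in> Obj C" "m \<in> Car ?R x n"
    have "dsum_rest \<iota> \<pi> K x n (dsum_rest \<iota> \<pi> J x n (f x n m) - g x n (vsnd m)) =
       dsum_rest \<iota> \<pi> K x n (dsum_rest \<iota> \<pi> J x n (f x n m)) - dsum_rest \<iota> \<pi> K x n (g x n (vsnd m))"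
      using * mor_in[OF cone_projection[OF \<gamma>] *]
      by (intro mor_diff[OF qK]) (auto intro!: mor_in[OF qJ] mor_in[OF f] mor_in[OF g(1)] simp del: cone_module_simps)
    then show "dsum_rest \<iota> \<pi> (J \<union> K) x n (f x n m) = dsum_rest \<iota> \<pi> K x n (g x n (vsnd m)) +
        dsum_rest \<iota> \<pi> K x n (dsum_rest \<iota> \<pi> J x n (f x n m) - g x n (vsnd m))"
      using dsum_rest_dsum_rest[OF ds J(2,1) K(2,1) *(1) mor_in[OF f *]] by simp
  qed
  then show "\<exists>J. finite J \<and> J \<subseteq> I \<and> null_homotopic C ?R S (\<lambda>x n m. dsum_rest \<iota> \<pi> J x n (f x n m))"
    using J K by (intro exI[of _ "J \<union> K"]) auto
qed

text \<open>Yoneda lemma: a map out of \<open>M\<close> is determined by the image of the universal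
  element \<open>e\<close>, a cycle of degree 0. A primitive of this image defines a null homotopy,
  and in a direct sum the image involves finitely many summands.\<close>

lemma representable_kproj_cpt:
  assumes a: "a \<in> Obj C" and rep: "is_representable C a (M :: ('o, 'a, 'b, 'k) dgmod)"
  shows "kproj C M" "cpt C M"
proof -
  interpret M: dg_module C M using rep by (simp add: is_representable_def)
  obtain \<epsilon> where \<epsilon>: "\<And>x n. x \<in> Obj C \<Longrightarrow> bij_betw (\<epsilon> x n) (Hom C x a n) (Car M x n)"
      "\<And>x n. x \<in> Obj C \<Longrightarrow> linear_map_on (Hom C x a n) (\<epsilon> x n)"
      "\<And>x n h. x \<in> Obj C \<Longrightarrow> h \<in> Hom C x a n \<Longrightarrow> \<epsilon> x (n + 1) (Diff C x a n h) = MDiff M x n (\<epsilon> x n h)"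
      "\<And>x y i j h f. \<lbrakk>x \<in> Obj C; y \<in> Obj C; h \<in> Hom C y a i; f \<in> Hom C x y j\<rbrakk> \<Longrightarrow>
        \<epsilon> x (i + j) (Comp C x y a i j h f) = Act M x y i j (\<epsilon> y i h) f"
    using rep unfolding is_representable_def by blast
  define e where "e = \<epsilon> a 0 (Ident C a)"
  define c where "c x n = inv_into (Hom C x a n) (\<epsilon> x n)" for x n
  have c: "c x n m \<in> Hom C x a n" "\<epsilon> x n (c x n m) = m" if "x \<in> Obj C" "m \<in> Car M x n" for x n m
    using \<epsilon>(1)[OF that(1), of n] that(2) unfolding c_def bij_betw_def by (auto simp: inv_into_into f_inv_into_f)
  have c_eq: "c x n (\<epsilon> x n h) = h" if "x \<in> Obj C" "h \<in> Hom C x a n" for x n h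
    using \<epsilon>(1)[OF that(1), of n] that(2) unfolding c_def bij_betw_def by simp
  have e: "e \<in> Car M a 0" unfolding e_def using \<epsilon>(1)[OF a, of 0] ident_closed[OF a] by (auto simp: bij_betw_def)
  have ec: "Act M x a 0 n e (c x n m) = m" if "x \<in> Obj C" "m \<in> Car M x n" for x n m
    unfolding e_def using \<epsilon>(4)[OF that(1) a ident_closed[OF a] c(1)[OF that]] c[OF that] a that(1)
    by (simp add: comp_ident_left)
  have de: "MDiff M a 0 e = 0"
    unfolding e_def using \<epsilon>(3)[OF a ident_closed[OF a]] lin_zero[OF \<epsilon>(2)[OF a] hom_subspace[OF a a]]
    by (simp add: diff_ident a)
  have c_lin: "linear_map_on (Car M x n) (c x n)" if "x \<in> Obj C" for x n
  proof (rule linear_map_onI)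
    fix u v assume uv: "u \<in> Car M x n" "v \<in> Car M x n"
    have "\<epsilon> x n (c x n u + c x n v) = u + v"
      using lin_add[OF \<epsilon>(2)[OF that]] c uv that by simp
    then show "c x n (u + v) = c x n u + c x n v"
      using c_eq[OF that kvec.subspace_add[OF hom_subspace[OF that a] c(1)[OF that uv(1)] c(1)[OF that uv(2)]]] by simp
  next
    fix k v assume v: "v \<in> Car M x n"
    have "\<epsilon> x n (kscale k (c x n v)) = kscale k v"
      using lin_scale[OF \<epsilon>(2)[OF that]] c v that by simp
    then show "c x n (kscale k v) = kscale k (c x n v)"
      using c_eq[OF that kvec.subspace_scale[OF hom_subspace[OF that a] c(1)[OF that v]], of k] by simp
  qed
  have c_act: "c x (i + j) (Act M x y i j m f) = Comp C x y a i j (c y i m) f"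
    if "x \<in> Obj C" "y \<in> Obj C" "m \<in> Car M y i" "f \<in> Hom C x y j" for x y i j m f
    using \<epsilon>(4)[OF that(1,2) c(1)[OF that(2,3)] that(4)] c(2)[OF that(2,3)]
      c_eq[OF that(1) comp_closed[OF that(1,2) a c(1)[OF that(2,3)] that(4)]] by simp
  have c_d: "c x (n + 1) (MDiff M x n m) = Diff C x a n (c x n m)" if "x \<in> Obj C" "m \<in> Car M x n" for x n m
    using \<epsilon>(3)[OF that(1) c(1)[OF that]] c[OF that] c_eq[OF that(1) diff_closed[OF that(1) a c(1)[OF that]]] by simp
  show "kproj C M"
    unfolding kproj_def
  proof (intro conjI allI impI M.dg_module_axioms)
    fix A f assume A: "acyclic_module C A" and f: "dg_morphism C M A f"
    interpret A: dg_module C A using mor_target[OF f] .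
    have "MDiff A a 0 (f a 0 e) = 0"
      using mor_d[OF f a e] a by (simp add: de mor_0[OF f])
    from acyclicD[OF A a mor_in[OF f a e] this] obtain u where u: "u \<in> Car A a (-1)" "f a 0 e = MDiff A a (-1) u"
      by auto
    have g: "graded_map C (-1) M A (\<lambda>x n m. Act A x a (-1) n u (c x n m))"
    proof (rule graded_mapI)
      fix x n assume x: "x \<in> Obj C"
      show "linear_map_on (Car M x n) (\<lambda>m. Act A x a (-1) n u (c x n m))"
        by (rule lin_compose[OF c_lin[OF x] A.act_linear_right[OF x a u(1)] c(1)[OF x]])
      fix m assume "m \<in> Car M x n"
      then show "Act A x a (-1) n u (c x n m) \<in> Car A x (n + -1)"
        using x a u c by (auto intro!: A.act_in)
    next
      fix x y i j m b assume *: "x \<in> Obj C" "y \<in> Obj C" "m \<in> Car M y i" "b \<in> Hom C x y j"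
      then have "Act A x a (-1) (i + j) u (Comp C x y a i j (c y i m) b) = Act A x y (-1 + i) j (Act A y a (-1) i u (c y i m)) b"
        by (intro A.act_act[symmetric]) (auto simp: a u c)
      then show "Act A x a (-1) (i + j) u (c x (i + j) (Act M x y i j m b)) = Act A x y (i + -1) j (Act A y a (-1) i u (c y i m)) b"
        using * by (simp add: c_act)
    qed
    show "null_homotopic C M A f"
    proof (rule null_homotopicI[OF g])
      fix x n m assume *: "x \<in> Obj C" "m \<in> Car M x n"
      have "f x n m = Act A x a 0 n (f a 0 e) (c x n m)"
        using mor_act[OF f *(1) a e c(1)[OF *], of n] ec[OF *] by simp
      moreover have "MDiff A x (n - 1) (Act A x a (-1) n u (c x n m)) =
          Act A x a 0 n (MDiff A a (-1) u) (c x n m) - Act A x a (-1) (n + 1) u (Diff C x a n (c x n m))"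
        using A.mdiff_act[OF *(1) a u(1) c(1)[OF *]] by simp
      ultimately show "f x n m = MDiff A x (n - 1) (Act A x a (-1) n u (c x n m)) +
          Act A x a (-1) (n + 1) u (c x (n + 1) (MDiff M x n m))"
        using * u by (simp add: c_d)
    qed
  qed
  show "cpt C M"
    unfolding cpt_def
  proof (intro allI impI)
    fix I :: "'b set" and X S \<iota> \<pi> f
    assume ds: "dsum C I X S \<iota> \<pi>" and f: "dg_morphism C M S f"
    obtain J where J: "finite J" "J \<subseteq> I" "f a 0 e = (\<Sum>i\<in>J. \<iota> i a 0 (\<pi> i a 0 (f a 0 e)))"
      using dsumD(5)[OF ds a mor_in[OF f a e]] by blast
    note q = mor_dsum_rest[OF ds J(2)]
    interpret S: dg_module C S by (rule dsumD(1)[OF ds])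
    have q0: "dsum_rest \<iota> \<pi> J a 0 (f a 0 e) = 0" unfolding dsum_rest_def using J(3) by simp
    have "dsum_rest \<iota> \<pi> J x n (f x n m) = 0" if "x \<in> Obj C" "m \<in> Car M x n" for x n m
      using mor_act[OF mor_comp[OF f q] that(1) a e c(1)[OF that], of n] ec[OF that] q0
        S.act_0[OF that(1) a c(1)[OF that]] by simp
    moreover have "null_homotopic C M S (\<lambda>x n m. 0)"
      by (rule null_homotopicI[OF mor_graded[OF mor_const0[OF M.dg_module_axioms S.dg_module_axioms], THEN gr_comp, of "-1" S "\<lambda>x n m. 0"]])
        (auto simp: S.d_0 S.mem_0 S.act_0 lin_const0 intro!: graded_mapI)
    ultimately have "null_homotopic C M S (\<lambda>x n m. dsum_rest \<iota> \<pi> J x n (f x n m))"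
      using null_homotopic_cong by fastforce
    then show "\<exists>J. finite J \<and> J \<subseteq> I \<and> null_homotopic C M S (\<lambda>x n m. dsum_rest \<iota> \<pi> J x n (f x n m))"
      using J by blast
  qed
qed

end

lemma acyclic_module_module: "acyclic_module C M \<Longrightarrow> dg_module C M"
  by (simp add: acyclic_module_def)

lemma dg_module_is_representable: "is_representable C a M \<Longrightarrow> dg_module C M"
  by (simp add: is_representable_def)

lemma derived_iso_module: "derived_iso C M N \<Longrightarrow> dg_module C M" "derived_iso C M N \<Longrightarrow> dg_module C N"
  by (auto simp: derived_iso_def)

lemma derived_cone_module: "derived_cone C M N X \<Longrightarrow> dg_module C X"
  by (auto simp: derived_cone_def derived_iso_def)

lemma derived_summandE:
  assumes "derived_summand C N M"
  obtains S \<iota> \<pi> where "dg_morphism C N S \<iota>" "dg_morphism C S N \<pi>"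
    "\<And>x n m. x \<in> Obj C \<Longrightarrow> m \<in> Car N x n \<Longrightarrow> \<pi> x n (\<iota> x n m) = m" "derived_iso C M S"
proof -
  obtain Z S where S: "is_direct_sum C UNIV (\<lambda>b::bool. if b then N else Z) S" "derived_iso C S M"
    using assms by (auto simp: derived_summand_def)
  obtain \<iota> \<pi> where ds: "dsum C UNIV (\<lambda>b::bool. if b then N else Z) S \<iota> \<pi>"
    using is_direct_sum_imp_dsum[OF S(1)] by blast
  show ?thesis
    using that[of S "\<iota> True" "\<pi> True"] dsumD(2,3)[OF ds, of True] dsumD(4)[OF ds, of True True] derived_iso_sym[OF S(2)] by simp
qed

lemma derived_summand_module: "derived_summand C N M \<Longrightarrow> dg_module C N"
  by (erule derived_summandE) (rule mor_source)

lemma Perf_module: "M \<in> Perf C \<Longrightarrow> dg_module C M"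
  by (induction rule: Perf.induct)
    (auto simp: acyclic_module_module dg_module_is_representable dg_module_shift
      intro: derived_iso_module derived_cone_module derived_summand_module)

text \<open>Existence of resolutions is assumed here, to separate the compactness arguments from the
  construction; \<open>diagonal_universe\<close> discharges it with semi-free modules made from the
  diagonal bimodule.\<close>

locale enough_kproj = dg_universe basis C
  for basis :: "'b itself" and C :: "('o, 'a, 'k::field) dgcat" +
  assumes resolution: "dg_module C (F :: ('o, 'a, 'b, 'k) dgmod) \<Longrightarrow> \<exists>P \<sigma>. kproj C P \<and> quasi_iso C P F \<sigma>"
begin

lemma quasi_iso_lift:
  assumes P: "kproj C P" and \<sigma>: "quasi_iso C P Y \<sigma>"
    and \<phi>: "quasi_iso C X Y (\<phi> :: ('o, 'b, 'k) gmap)"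
  shows "\<exists>\<tau>. quasi_iso C P X \<tau>"
proof -
  obtain g where g: "dg_morphism C P X g" "null_homotopic C P Y (\<lambda>x n p. \<sigma> x n p - \<phi> x n (g x n p))"
    using kproj_lift[OF P \<phi> quasi_iso_mor[OF \<sigma>]] by blast
  from quasi_iso_homotopic[OF \<sigma> mor_comp[OF g(1) quasi_iso_mor[OF \<phi>]] g(2)] g(1)
  show ?thesis using quasi_iso_cancel_left[OF \<phi>] by blast
qed

lemma resolution_derived_iso:
  assumes P: "kproj C P" and \<sigma>: "quasi_iso C P X \<sigma>" and "derived_iso C X (Y :: ('o, 'a, 'b, 'k) dgmod)"
  shows "\<exists>\<tau>. quasi_iso C P Y \<tau>"
  using assms(3)
proof (induction rule: derived_iso_induct)
  case refl
  then show ?case using \<sigma> by blast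
next
  case (forward X Y \<phi>)
  then show ?case using quasi_iso_comp by blast
next
  case (backward X Y \<phi>)
  then show ?case using quasi_iso_lift[OF P] by blast
qed

text \<open>Both maps lift to the resolutions. The defect of the lifted retraction is null homotopic
  after composition with \<open>\<sigma>\<close>, and \<open>kproj_cancel\<close> removes
  \<open>\<sigma>\<close>.\<close>

lemma kproj_retract:
  assumes P: "kproj C P" and \<sigma>: "quasi_iso C P F (\<sigma> :: ('o, 'b, 'k) gmap)"
    and Q: "kproj C Q" and \<tau>: "quasi_iso C Q G \<tau>"
    and \<iota>: "dg_morphism C F G \<iota>" and \<pi>: "dg_morphism C G F \<pi>"
    and \<pi>\<iota>: "\<And>x n m. x \<in> Obj C \<Longrightarrow> m \<in> Car F x n \<Longrightarrow> \<pi> x n (\<iota> x n m) = m"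
  shows "\<exists>i r. dg_morphism C P Q i \<and> dg_morphism C Q P r \<and> null_homotopic C P P (\<lambda>x n m. m - r x n (i x n m))"
proof -
  note \<sigma>m = quasi_iso_mor[OF \<sigma>] and \<tau>m = quasi_iso_mor[OF \<tau>]
  note Pm = kproj_module[OF P] and Fm = mor_source[OF \<iota>] and Gm = mor_target[OF \<iota>]
  obtain i where i: "dg_morphism C P Q i" "null_homotopic C P G (\<lambda>x n p. \<iota> x n (\<sigma> x n p) - \<tau> x n (i x n p))"
    using kproj_lift[OF P \<tau> mor_comp[OF \<sigma>m \<iota>]] by blast
  obtain r where r: "dg_morphism C Q P r" "null_homotopic C Q F (\<lambda>x n p. \<pi> x n (\<tau> x n p) - \<sigma> x n (r x n p))"
    using kproj_lift[OF Q \<sigma> mor_comp[OF \<tau>m \<pi>]] by blast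
  have 1: "null_homotopic C P F (\<lambda>x n p. \<pi> x n (\<iota> x n (\<sigma> x n p) - \<tau> x n (i x n p)))"
    by (rule null_homotopic_post[OF i(2) \<pi> Pm])
  have 2: "null_homotopic C P F (\<lambda>x n p. \<pi> x n (\<tau> x n (i x n p)) - \<sigma> x n (r x n (i x n p)))"
    by (rule null_homotopic_pre[OF i(1) r(2)])
  have "null_homotopic C P F (\<lambda>x n p. \<sigma> x n (p - r x n (i x n p)))"
    by (rule null_homotopic_cong[OF null_homotopic_plus[OF Fm Pm 1 2]])
      (simp add: mor_diff[OF \<sigma>m] mor_diff[OF \<pi>] mor_in[OF \<sigma>m] mor_in[OF i(1)]
        mor_in[OF r(1)] mor_in[OF \<iota>] mor_in[OF \<tau>m] \<pi>\<iota>)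
  from kproj_cancel[OF P \<sigma> mor_minus_fun[OF mor_id[OF Pm] mor_comp[OF i(1) r(1)]] this]
  show ?thesis using i(1) r(1) by blast
qed

text \<open>Homotopy classes of maps reflect the derived category only for K-projective sources. So
  the induction carries along a compact resolution instead of \<open>F\<close> itself, and an
  isomorphism merely changes the target of the resolution.\<close>

lemma Perf_cpt_resolution:
  assumes "(F :: ('o, 'a, 'b, 'k) dgmod) \<in> Perf C"
  shows "\<exists>P \<sigma>. kproj C P \<and> quasi_iso C P F \<sigma> \<and> cpt C P"
  using assms
proof (induction rule: Perf.induct)
  case (representable a M)
  note r = representable_kproj_cpt[OF representable]
  show ?case using r quasi_iso_id[OF kproj_module[OF r(1)]] by (intro exI conjI)
next
  case (zero M)
  obtain P \<sigma> where P: "kproj C P" "quasi_iso C P M \<sigma>"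
    using resolution[OF acyclic_module_module[OF zero]] by blast
  then have A: "acyclic_module C P" using quasi_iso_acyclic zero by blast
  have null: "null_homotopic C P P (\<lambda>x n m. m)"
    by (rule kprojD[OF P(1) A mor_id[OF kproj_module[OF P(1)]]])
  have "cpt C P"
    unfolding cpt_def
  proof (intro allI impI)
    fix I :: "'b set" and X S \<iota> \<pi> f
    assume ds: "dsum C I X S \<iota> \<pi>" and f: "dg_morphism C P S f"
    show "\<exists>J. finite J \<and> J \<subseteq> I \<and> null_homotopic C P S (\<lambda>x n m. dsum_rest \<iota> \<pi> J x n (f x n m))"
      by (intro exI[of _ "{}"] conjI null_homotopic_post[OF null mor_comp[OF f mor_dsum_rest[OF ds]] kproj_module[OF P(1)]]) auto
  qed
  with P show ?case by (intro exI conjI)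
next
  case (iso M N)
  then obtain P \<sigma> where P: "kproj C P" "quasi_iso C P M \<sigma>" "cpt C P" by (elim exE conjE)
  obtain \<tau> where "quasi_iso C P N \<tau>" using resolution_derived_iso[OF P(1,2) iso(2)] by (rule exE)
  with P show ?case by (intro exI conjI)
next
  case (shift M p)
  then obtain P \<sigma> where P: "kproj C P" "quasi_iso C P M \<sigma>" "cpt C P" by (elim exE conjE)
  show ?case
    using kproj_shift[OF P(1)] quasi_iso_shift[OF P(2)] cpt_shift[OF P(3) kproj_module[OF P(1)]] by (intro exI conjI)
next
  case (cone M N X)
  obtain P \<sigma> \<phi> Y where d: "quasi_iso C P M \<sigma>" "is_cone C P N \<phi> Y" "derived_iso C Y X"
    using cone(3) unfolding derived_cone_def by (elim exE conjE)
  have \<phi>: "dg_morphism C P N \<phi>" using d by (simp add: is_cone_def)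
  \<comment> \<open>The resolution of \<open>M\<close> is moved to the apex \<open>P\<close> of the
    roof, which is where \<open>\<phi>\<close> starts.\<close>
  obtain PM \<tau> where PM: "kproj C PM" "quasi_iso C PM P \<tau>" "cpt C PM"
  proof -
    obtain PM \<tau>' where PM: "kproj C PM" "quasi_iso C PM M \<tau>'" "cpt C PM" using cone.IH(1) by (elim exE conjE)
    obtain \<tau> where "quasi_iso C PM P \<tau>" using quasi_iso_lift[OF PM(1,2) d(1)] by (rule exE)
    with PM that show ?thesis by blast
  qed
  obtain PN \<rho> where PN: "kproj C PN" "quasi_iso C PN N \<rho>" "cpt C PN"
    using cone.IH(2) by (elim exE conjE)
  obtain g where g: "dg_morphism C PM PN g" "null_homotopic C PM N (\<lambda>x n p. \<phi> x n (\<tau> x n p) - \<rho> x n (g x n p))"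
    using kproj_lift[OF PM(1) PN(2) mor_comp[OF quasi_iso_mor[OF PM(2)] \<phi>]] by blast
  obtain \<theta> where \<theta>: "quasi_iso C (cone_module PM PN g) (cone_module P N \<phi>) \<theta>"
    using cone_quasi_iso[OF g(1) \<phi> PM(2) PN(2) g(2)] by (rule exE)
  obtain \<psi> where "quasi_iso C (cone_module P N \<phi>) Y \<psi>" using is_cone_iso[OF d(2)] by (rule exE)
  from derived_iso_trans[OF derived_iso_quasi_iso[OF this] d(3)]
  have "derived_iso C (cone_module P N \<phi>) X" .
  from resolution_derived_iso[OF kproj_cone[OF g(1) PM(1) PN(1)] \<theta> this]
  obtain \<psi>' where "quasi_iso C (cone_module PM PN g) X \<psi>'" by (rule exE)
  then show ?case using kproj_cone[OF g(1) PM(1) PN(1)] cpt_cone[OF g(1) PM(3) PN(3)] by (intro exI conjI)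
next
  case (summand M N)
  obtain S \<iota> \<pi> where S: "dg_morphism C N S \<iota>" "dg_morphism C S N \<pi>"
    "\<And>x n m. x \<in> Obj C \<Longrightarrow> m \<in> Car N x n \<Longrightarrow> \<pi> x n (\<iota> x n m) = m" "derived_iso C M S"
    by (rule derived_summandE[OF summand(2)], rule that) (assumption | simp)+
  obtain Q \<tau> where Q: "kproj C Q" "quasi_iso C Q S \<tau>" "cpt C Q"
  proof -
    obtain Q \<tau>' where Q: "kproj C Q" "quasi_iso C Q M \<tau>'" "cpt C Q" using summand.IH by (elim exE conjE)
    obtain \<tau> where "quasi_iso C Q S \<tau>" using resolution_derived_iso[OF Q(1,2) S(4)] by (rule exE)
    with Q that show ?thesis by blast
  qed
  obtain P \<sigma> where P: "kproj C P" "quasi_iso C P N \<sigma>"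
    using resolution[OF mor_source[OF S(1)]] by blast
  from kproj_retract[OF P Q(1,2) S(1-3)] obtain i r where
    "dg_morphism C P Q i" "dg_morphism C Q P r" "null_homotopic C P P (\<lambda>x n m. m - r x n (i x n m))" by blast
  from cpt_retract[OF Q(3) this] P show ?case by (intro exI conjI)
qed

text \<open>A K-projective module is a retract, up to homotopy, of any of its K-projective
  resolutions, in particular of the compact one.\<close>

lemma kproj_Perf_cpt:
  assumes P: "kproj C (P :: ('o, 'a, 'b, 'k) dgmod)" "P \<in> Perf C"
  shows "cpt C P"
proof -
  obtain Q \<tau> where Q: "kproj C Q" "quasi_iso C Q P \<tau>" "cpt C Q"
    using Perf_cpt_resolution[OF P(2)] by (elim exE conjE)
  note Pm = kproj_module[OF P(1)]
  from kproj_retract[OF P(1) quasi_iso_id[OF Pm] Q(1,2) mor_id[OF Pm] mor_id[OF Pm]]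
  show ?thesis using cpt_retract[OF Q(3)] by blast
qed

end


section \<open>Approximable modules\<close>

text \<open>Equality on the nose is no restriction compared with homotopy, by
  \<open>factors_null\<close>. The middle object is K-projective so that maps out of it can be
  lifted in turn.\<close>

definition factors ::
  "('o, 'a, 'k::field) dgcat \<Rightarrow> ('o, 'a, 'b, 'k) dgmod set \<Rightarrow> ('o, 'a, 'b, 'k) dgmod \<Rightarrow> ('o, 'a, 'b, 'k) dgmod \<Rightarrow>
   ('o, 'b, 'k) gmap \<Rightarrow> bool" where
  "factors C \<G> P X f \<longleftrightarrow> (\<exists>E h e. E \<in> \<G> \<and> kproj C E \<and> dg_morphism C P E h \<and> dg_morphism C E X e \<and>
     (\<forall>x\<in>Obj C. \<forall>n. \<forall>m\<in>Car P x n. f x n m = e x n (h x n m)))"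

definition approximable ::
  "('o, 'a, 'k::field) dgcat \<Rightarrow> ('o, 'a, 'b, 'k) dgmod set \<Rightarrow> ('o, 'a, 'b, 'k) dgmod \<Rightarrow> bool" where
  "approximable C \<G> X \<longleftrightarrow> dg_module C X \<and>
     (\<forall>P f. kproj C P \<longrightarrow> P \<in> Perf C \<longrightarrow> dg_morphism C P X f \<longrightarrow> factors C \<G> P X f)"

text \<open>The last condition is closure under finite direct sums in disguise: the cone of a zero
  map is the sum of the target and the shifted source. Acyclic modules are included because they
  absorb homotopies.\<close>

definition perf_class :: "('o, 'a, 'k::field) dgcat \<Rightarrow> ('o, 'a, 'b, 'k) dgmod set \<Rightarrow> bool" where
  "perf_class C \<G> \<longleftrightarrow> \<G> \<subseteq> Perf C \<and> (\<forall>M. acyclic_module C M \<longrightarrow> M \<in> \<G>) \<and>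
     (\<forall>M N. M \<in> \<G> \<longrightarrow> derived_iso C M N \<longrightarrow> N \<in> \<G>) \<and> (\<forall>M p. M \<in> \<G> \<longrightarrow> shift p M \<in> \<G>) \<and>
     (\<forall>M N. M \<in> \<G> \<longrightarrow> N \<in> \<G> \<longrightarrow> cone_module M N (\<lambda>x n m. 0) \<in> \<G>)"

lemma perf_classD:
  assumes "perf_class C \<G>"
  shows "M \<in> \<G> \<Longrightarrow> M \<in> Perf C" "acyclic_module C M \<Longrightarrow> M \<in> \<G>" "M \<in> \<G> \<Longrightarrow> derived_iso C M N \<Longrightarrow> N \<in> \<G>"
    "M \<in> \<G> \<Longrightarrow> shift p M \<in> \<G>" "M \<in> \<G> \<Longrightarrow> N \<in> \<G> \<Longrightarrow> cone_module M N (\<lambda>x n m. 0) \<in> \<G>"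
  using assms unfolding perf_class_def by blast+

lemma perf_class_module: "perf_class C \<G> \<Longrightarrow> M \<in> \<G> \<Longrightarrow> dg_module C M"
  by (rule Perf_module) (rule perf_classD)

lemma approximable_module: "approximable C \<G> X \<Longrightarrow> dg_module C X"
  by (simp add: approximable_def)

lemma approximableD:
  "\<lbrakk>approximable C \<G> X; kproj C P; P \<in> Perf C; dg_morphism C P X f\<rbrakk> \<Longrightarrow> factors C \<G> P X f"
  by (simp add: approximable_def)

lemma approximableI:
  "\<lbrakk>dg_module C X; \<And>P f. kproj C P \<Longrightarrow> P \<in> Perf C \<Longrightarrow> dg_morphism C P X f \<Longrightarrow> factors C \<G> P X f\<rbrakk>
    \<Longrightarrow> approximable C \<G> X"
  by (simp add: approximable_def)

lemma factorsI:
  assumes "E \<in> \<G>" "kproj C E" "dg_morphism C P E h" "dg_morphism C E X e"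
    "\<And>x n m. x \<in> Obj C \<Longrightarrow> m \<in> Car P x n \<Longrightarrow> f x n m = e x n (h x n m)"
  shows "factors C \<G> P X f"
  unfolding factors_def by (intro exI[of _ E] exI[of _ h] exI[of _ e]) (simp add: assms)

lemma factorsE:
  assumes "factors C \<G> P X f"
  obtains E h e where "E \<in> \<G>" "kproj C E" "dg_morphism C P E h" "dg_morphism C E X e"
    "\<And>x n m. x \<in> Obj C \<Longrightarrow> m \<in> Car P x n \<Longrightarrow> f x n m = e x n (h x n m)"
proof -
  from assms obtain E h e where "E \<in> \<G> \<and> kproj C E \<and> dg_morphism C P E h \<and> dg_morphism C E X e \<and>
     (\<forall>x\<in>Obj C. \<forall>n. \<forall>m\<in>Car P x n. f x n m = e x n (h x n m))"
    unfolding factors_def by (elim exE)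
  then show ?thesis by (intro that[of E h e]) simp_all
qed

lemma factors_cong:
  assumes "factors C \<G> P X f" "\<And>x n m. x \<in> Obj C \<Longrightarrow> m \<in> Car P x n \<Longrightarrow> g x n m = f x n m"
  shows "factors C \<G> P X g"
  by (rule factorsE[OF assms(1)], rule factorsI) (assumption | simp add: assms(2))+

lemma factors_post:
  assumes f: "factors C \<G> P X f" and g: "dg_morphism C X Y g"
  shows "factors C \<G> P Y (\<lambda>x n m. g x n (f x n m))"
proof (rule factorsE[OF f])
  fix E h e assume *: "E \<in> \<G>" "kproj C E" "dg_morphism C P E h" "dg_morphism C E X e"
    "\<And>x n m. x \<in> Obj C \<Longrightarrow> m \<in> Car P x n \<Longrightarrow> f x n m = e x n (h x n m)"
  show ?thesis
    by (rule factorsI[OF *(1-3) mor_comp[OF *(4) g]]) (simp add: *(5))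
qed

lemma factors_shift:
  assumes \<G>: "perf_class C \<G>" and f: "factors C \<G> P X f"
  shows "factors C \<G> (shift p P) (shift p X) (\<lambda>x n. f x (n + p))"
proof (rule factorsE[OF f])
  fix E h e assume *: "E \<in> \<G>" "kproj C E" "dg_morphism C P E h" "dg_morphism C E X e"
    "\<And>x n m. x \<in> Obj C \<Longrightarrow> m \<in> Car P x n \<Longrightarrow> f x n m = e x n (h x n m)"
  show ?thesis
    by (rule factorsI[OF perf_classD(4)[OF \<G> *(1)] kproj_shift[OF *(2)] mor_shift[OF *(3)] mor_shift[OF *(4)]])
      (simp add: *(5))
qed

section \<open>Calculus of factorizations and stability of approximable modules\<close>

context dg_universe
begin

text \<open>The two factorizations are put side by side through the direct sum of the middle
  objects, realized as a cone of a zero map.\<close>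

lemma factors_plus:
  assumes \<G>: "perf_class C \<G>" and f1: "factors C \<G> P (X :: ('o, 'a, 'b, 'k) dgmod) f1" and f2: "factors C \<G> P X f2"
  shows "factors C \<G> P X (\<lambda>x n m. f1 x n m + f2 x n m)"
proof (rule factorsE[OF f1], rule factorsE[OF f2])
  fix E1 h1 e1 E2 h2 e2
  assume 1: "E1 \<in> \<G>" "kproj C E1" "dg_morphism C P E1 h1" "dg_morphism C E1 X e1"
    "\<And>x n m. x \<in> Obj C \<Longrightarrow> m \<in> Car P x n \<Longrightarrow> f1 x n m = e1 x n (h1 x n m)"
  and 2: "E2 \<in> \<G>" "kproj C E2" "dg_morphism C P E2 h2" "dg_morphism C E2 X e2"
    "\<And>x n m. x \<in> Obj C \<Longrightarrow> m \<in> Car P x n \<Longrightarrow> f2 x n m = e2 x n (h2 x n m)"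
  let ?z = "\<lambda>x n m. 0"
  have z: "dg_morphism C (shift (-1) E2) E1 ?z"
    by (rule mor_const0[OF dg_module_shift kproj_module[OF 1(2)]]) (rule kproj_module[OF 2(2)])
  have h: "dg_morphism C P (cone_module (shift (-1) E2) E1 ?z) (\<lambda>x n p. vpair (h1 x n p) (h2 x n p))"
    by (rule mor_to_cone[OF z mor_graded[OF 1(3)]])
      (auto simp: 2(3) mor_d[OF 1(3)])
  have e: "dg_morphism C (cone_module (shift (-1) E2) E1 ?z) X (\<lambda>x n w. e1 x n (vfst w) + e2 x n (vsnd w))"
    by (rule mor_from_cone[OF z 1(4)])
      (auto simp: mor_graded[OF 2(4)] mor_d[OF 2(4)] mor_0[OF 1(4)] mor_minus[OF 2(4)]
        dg_module.d_in[OF mor_source[OF 2(4)]])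
  show ?thesis
    by (rule factorsI[OF perf_classD(5)[OF \<G> perf_classD(4)[OF \<G> 2(1)] 1(1)]
       kproj_cone[OF z kproj_shift[OF 2(2)] 1(2)] h e]) (simp add: 1(5) 2(5))
qed

lemma zero_cone_dsum:
  assumes z: "dg_morphism C M (N :: ('o, 'a, 'b, 'k) dgmod) (\<lambda>x n m. 0)" and ij: "i \<noteq> j" "I = {i, j}"
  shows "dsum C I (\<lambda>k. if k = i then N else shift 1 M) (cone_module M N (\<lambda>x n m. 0))
    (\<lambda>k x n v. if k = i then vpair v 0 else vpair 0 v) (\<lambda>k x n. if k = i then vfst else vsnd)"
proof -
  interpret M: dg_module C M by (rule mor_source[OF z])
  interpret N: dg_module C N by (rule mor_target[OF z])
  let ?S = "cone_module M N (\<lambda>x n m. 0)"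
  note Sm = dg_module_cone[OF z]
  have 1: "dg_morphism C (shift 1 M) ?S (\<lambda>x n v. vpair 0 v)"
    by (rule dg_morphismI; (rule linear_map_onI)?)
      (auto simp: Sm dg_module_shift M.dg_module_axioms N.mem_0 N.d_0 N.act_0)
  have 2: "dg_morphism C ?S N (\<lambda>x n. vfst)"
    by (rule dg_morphismI; (rule linear_map_onI)?) (auto simp: Sm N.dg_module_axioms)
  show ?thesis
    unfolding dsum_def
  proof (intro conjI ballI allI Sm)
    fix k assume "k \<in> I"
    show "dg_morphism C (if k = i then N else shift 1 M) ?S (\<lambda>x n v. if k = i then vpair v 0 else vpair 0 v)"
      using 1 cone_inclusion[OF z] by simp
    show "dg_morphism C ?S (if k = i then N else shift 1 M) (\<lambda>x n. if k = i then vfst else vsnd)"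
      using 2 cone_projection[OF z] by simp
  next
    fix k l x n m assume "k \<in> I" "l \<in> I" "x \<in> Obj C" "m \<in> Car (if k = i then N else shift 1 M) x n"
    then show "(if l = i then vfst else vsnd) (if k = i then vpair m 0 else vpair 0 m) = (if k = l then m else 0)"
      using ij by auto
  next
    fix x n s assume "x \<in> Obj C" "s \<in> Car ?S x n"
    then show "\<exists>J. finite J \<and> J \<subseteq> I \<and> (\<forall>k\<in>I - J. (if k = i then vfst else vsnd) s = 0) \<and>
        s = (\<Sum>k\<in>J. if k = i then vpair ((if k = i then vfst else vsnd) s) 0 else vpair 0 ((if k = i then vfst else vsnd) s))"
      using ij by (intro exI[of _ I]) auto
  qed
qed

lemma cone_id_acyclic:
  assumes "dg_module C (P :: ('o, 'a, 'b, 'k) dgmod)"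
  shows "acyclic_module C (cone_module P P (\<lambda>x n m. m))"
  using acyclic_cone_iff[OF mor_id[OF assms]] quasi_iso_id[OF assms] by blast

text \<open>A null homotopy of \<open>f\<close> is the same as an extension of \<open>f\<close> to
  the cone of the identity of \<open>P\<close>. This cone is acyclic and therefore belongs to the
  class.\<close>

lemma factors_null:
  assumes \<G>: "perf_class C \<G>" and P: "kproj C (P :: ('o, 'a, 'b, 'k) dgmod)" and f: "dg_morphism C P X f"
    and null: "null_homotopic C P X f"
  shows "factors C \<G> P X f"
proof -
  note Pm = kproj_module[OF P] and id = mor_id[OF kproj_module[OF P]]
  obtain h where h: "graded_map C (-1) P X h" "\<And>x n m. x \<in> Obj C \<Longrightarrow> m \<in> Car P x n \<Longrightarrow>
      f x n m = MDiff X x (n - 1) (h x n m) + h x (n + 1) (MDiff P x n m)"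
    using null unfolding null_homotopic_def by metis
  have b: "graded_map C 0 (shift 1 P) X (\<lambda>x n m. h x (n + 1) m)"
  proof (rule graded_mapI)
    fix x y i j m a assume *: "x \<in> Obj C" "y \<in> Obj C" "m \<in> Car (shift 1 P) y i" "a \<in> Hom C x y j"
    then show "h x (i + j + 1) (Act (shift 1 P) x y i j m a) = Act X x y (i + 0) j (h y (i + 1) m) a"
      using gr_act[OF h(1) *(1,2) _ *(4), of m "i + 1" "i + j + 1" i] by simp
  qed (auto intro!: gr_linear[OF h(1)] gr_in[OF h(1)])
  have e: "dg_morphism C (cone_module P P (\<lambda>x n m. m)) X (\<lambda>x n w. f x n (vfst w) + h x (n + 1) (vsnd w))"
    by (rule mor_from_cone[OF id f b]) (simp add: h(2))
  have h0: "h x n 0 = 0" if "x \<in> Obj C" for x n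
    using lin_zero[OF gr_linear[OF h(1) that] dg_module.car_subspace[OF Pm that]] .
  show ?thesis
    by (rule factorsI[OF perf_classD(2)[OF \<G> cone_id_acyclic[OF Pm]] kproj_cone[OF id P P] cone_inclusion[OF id] e])
      (simp add: h0)
qed

lemma factors_homotopic:
  assumes \<G>: "perf_class C \<G>" and P: "kproj C (P :: ('o, 'a, 'b, 'k) dgmod)"
    and f: "dg_morphism C P X f" and g: "dg_morphism C P X g" "factors C \<G> P X g"
    and null: "null_homotopic C P X (\<lambda>x n m. f x n m - g x n m)"
  shows "factors C \<G> P X f"
  by (rule factors_cong[OF factors_plus[OF \<G> factors_null[OF \<G> P mor_minus_fun[OF f g(1)] null] g(2)]]) simp

lemma factors_zero:
  assumes \<G>: "perf_class C \<G>" and P: "kproj C (P :: ('o, 'a, 'b, 'k) dgmod)" and X: "dg_module C X"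
  shows "factors C \<G> P X (\<lambda>x n m. 0)"
proof (rule factors_null[OF \<G> P mor_const0[OF kproj_module[OF P] X]])
  have "null_homotopic C P (cone_module P P (\<lambda>x n m. m)) (\<lambda>x n v. vpair v 0)"
    by (rule kprojD[OF P cone_id_acyclic[OF kproj_module[OF P]] cone_inclusion[OF mor_id[OF kproj_module[OF P]]]])
  from null_homotopic_post[OF this mor_const0[OF dg_module_cone[OF mor_id[OF kproj_module[OF P]]] X] kproj_module[OF P]]
  show "null_homotopic C P X (\<lambda>x n m. 0)" .
qed

lemma factors_sum:
  assumes \<G>: "perf_class C \<G>" and P: "kproj C (P :: ('o, 'a, 'b, 'k) dgmod)" and X: "dg_module C X"
    and f: "\<And>i. i \<in> J \<Longrightarrow> factors C \<G> P X (f i)"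
  shows "factors C \<G> P X (\<lambda>x n m. \<Sum>i\<in>J. f i x n m)"
  using f
proof (induction J rule: infinite_finite_induct)
  case (insert i J)
  have "factors C \<G> P X (\<lambda>x n m. f i x n m + (\<Sum>i\<in>J. f i x n m))"
    by (rule factors_plus[OF \<G>]) (use insert in auto)
  with insert show ?case by simp
qed (auto simp: factors_zero[OF \<G> P X])

lemma approximable_forward:
  assumes \<G>: "perf_class C \<G>" and \<phi>: "quasi_iso C X (Y :: ('o, 'a, 'b, 'k) dgmod) \<phi>" and X: "approximable C \<G> X"
  shows "approximable C \<G> Y"
proof (rule approximableI[OF mor_target[OF quasi_iso_mor[OF \<phi>]]])
  fix P f assume P: "kproj C P" "P \<in> Perf C" and f: "dg_morphism C P Y f"
  note \<phi>m = quasi_iso_mor[OF \<phi>]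
  obtain g where g: "dg_morphism C P X g" "null_homotopic C P Y (\<lambda>x n p. f x n p - \<phi> x n (g x n p))"
    using kproj_lift[OF P(1) \<phi> f] by blast
  show "factors C \<G> P Y f"
    by (rule factors_homotopic[OF \<G> P(1) f mor_comp[OF g(1) \<phi>m] factors_post[OF approximableD[OF X P g(1)] \<phi>m] g(2)])
qed

text \<open>The factorization is found over \<open>Y\<close>, and its second leg is lifted to
  \<open>X\<close>. That the new composite is homotopic to \<open>f\<close> follows from uniqueness
  of lifts.\<close>

lemma approximable_backward:
  assumes \<G>: "perf_class C \<G>" and \<phi>: "quasi_iso C X (Y :: ('o, 'a, 'b, 'k) dgmod) \<phi>" and Y: "approximable C \<G> Y"
  shows "approximable C \<G> X"
proof (rule approximableI[OF mor_source[OF quasi_iso_mor[OF \<phi>]]])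
  fix P f assume P: "kproj C P" "P \<in> Perf C" and f: "dg_morphism C P X f"
  note \<phi>m = quasi_iso_mor[OF \<phi>]
  show "factors C \<G> P X f"
  proof (rule factorsE[OF approximableD[OF Y P mor_comp[OF f \<phi>m]]])
    fix E h e assume *: "E \<in> \<G>" "kproj C E" "dg_morphism C P E h" "dg_morphism C E Y e"
      "\<And>x n m. x \<in> Obj C \<Longrightarrow> m \<in> Car P x n \<Longrightarrow> \<phi> x n (f x n m) = e x n (h x n m)"
    obtain g where g: "dg_morphism C E X g" "null_homotopic C E Y (\<lambda>x n p. e x n p - \<phi> x n (g x n p))"
      using kproj_lift[OF *(2) \<phi> *(4)] by blast
    note gh = mor_comp[OF *(3) g(1)]
    have "null_homotopic C P Y (\<lambda>x n m. \<phi> x n (f x n m - g x n (h x n m)))"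
      by (rule null_homotopic_cong[OF null_homotopic_pre[OF *(3) g(2)]])
        (simp add: mor_diff[OF \<phi>m] mor_in[OF f] mor_in[OF gh] *(5))
    note null = kproj_cancel[OF P(1) \<phi> mor_minus_fun[OF f gh] this]
    have "factors C \<G> P X (\<lambda>x n m. g x n (h x n m))"
      by (rule factorsI[OF *(1,2,3) g(1)]) simp
    from factors_homotopic[OF \<G> P(1) f gh this null] show "factors C \<G> P X f" .
  qed
qed

lemma approximable_derived_iso:
  assumes \<G>: "perf_class C \<G>" and iso: "derived_iso C X (Y :: ('o, 'a, 'b, 'k) dgmod)" and X: "approximable C \<G> X"
  shows "approximable C \<G> Y"
  using iso
proof (induction rule: derived_iso_induct)
  case refl
  show ?case by (rule X)
next
  case (forward X Y \<phi>)
  then show ?case using approximable_forward[OF \<G>] by blast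
next
  case (backward X Y \<phi>)
  then show ?case using approximable_backward[OF \<G>] by blast
qed

lemma approximable_summand:
  assumes \<G>: "perf_class C \<G>" and sm: "derived_summand C X (Y :: ('o, 'a, 'b, 'k) dgmod)" and Y: "approximable C \<G> Y"
  shows "approximable C \<G> X"
proof (rule derived_summandE[OF sm])
  fix S \<iota> \<pi> assume S: "dg_morphism C X S \<iota>" "dg_morphism C S X \<pi>"
    "\<And>x n m. x \<in> Obj C \<Longrightarrow> m \<in> Car X x n \<Longrightarrow> \<pi> x n (\<iota> x n m) = m" "derived_iso C Y S"
  have aS: "approximable C \<G> S" by (rule approximable_derived_iso[OF \<G> S(4) Y])
  show ?thesis
  proof (rule approximableI[OF mor_source[OF S(1)]])
    fix P f assume P: "kproj C P" "P \<in> Perf C" and f: "dg_morphism C P X f"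
    show "factors C \<G> P X f"
      by (rule factors_cong[OF factors_post[OF approximableD[OF aS P mor_comp[OF f S(1)]] S(2)]])
        (simp add: S(3) mor_in[OF f])
  qed
qed

lemma approximable_shift:
  assumes \<G>: "perf_class C \<G>" and X: "approximable C \<G> (X :: ('o, 'a, 'b, 'k) dgmod)"
  shows "approximable C \<G> (shift p X)"
proof (rule approximableI[OF dg_module_shift[OF approximable_module[OF X]]])
  fix P f assume P: "kproj C P" "P \<in> Perf C" and f: "dg_morphism C P (shift p X) f"
  have "dg_morphism C (shift (- p) P) X (\<lambda>x n. f x (n - p))"
    using mor_shift[OF f, of "- p"] by simp
  from factors_shift[OF \<G> approximableD[OF X kproj_shift[OF P(1)] Perf.shift[OF P(2)] this], of p]
  show "factors C \<G> P (shift p X) f" by simp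
qed

text \<open>Up to homotopy \<open>f\<close> is the sum of finitely many components, and these
  factor. Compactness is a hypothesis about this one sum, so that the lemma covers both sums indexed
  by subsets of \<open>'b\<close> and finite sums with indices of any type.\<close>

lemma approximable_dsum:
  assumes \<G>: "perf_class C \<G>" and ds: "dsum C I X (S :: ('o, 'a, 'b, 'k) dgmod) \<iota> \<pi>"
    and X: "\<And>i. i \<in> I \<Longrightarrow> approximable C \<G> (X i)"
    and cpt: "\<And>P f. kproj C P \<Longrightarrow> P \<in> Perf C \<Longrightarrow> dg_morphism C P S f \<Longrightarrow>
      \<exists>J. finite J \<and> J \<subseteq> I \<and> null_homotopic C P S (\<lambda>x n m. dsum_rest \<iota> \<pi> J x n (f x n m))"
  shows "approximable C \<G> S"
proof (rule approximableI[OF dsumD(1)[OF ds]])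
  fix P f assume P: "kproj C P" "P \<in> Perf C" and f: "dg_morphism C P S f"
  note Pm = kproj_module[OF P(1)] and d = dsumD[OF ds]
  obtain J where J: "finite J" "J \<subseteq> I" "null_homotopic C P S (\<lambda>x n m. dsum_rest \<iota> \<pi> J x n (f x n m))"
    using cpt[OF P f] by blast
  have fi: "factors C \<G> P S (\<lambda>x n m. \<iota> i x n (\<pi> i x n (f x n m)))" if "i \<in> J" for i
    using that J by (intro factors_post[OF approximableD[OF X P mor_comp[OF f d(3)]] d(2)]) auto
  have mi: "dg_morphism C P S (\<lambda>x n m. \<iota> i x n (\<pi> i x n (f x n m)))" if "i \<in> J" for i
    using that J by (intro mor_comp[OF mor_comp[OF f d(3)] d(2)]) auto
  have 1: "dg_morphism C P S (\<lambda>x n m. \<Sum>i\<in>J. \<iota> i x n (\<pi> i x n (f x n m)))"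
    by (rule mor_sum_fun[OF Pm d(1) mi])
  have 2: "factors C \<G> P S (\<lambda>x n m. \<Sum>i\<in>J. \<iota> i x n (\<pi> i x n (f x n m)))"
    by (rule factors_sum[OF \<G> P(1) d(1) fi])
  show "factors C \<G> P S f"
    by (rule factors_homotopic[OF \<G> P(1) f 1 2]) (use J(3) in \<open>simp add: dsum_rest_def\<close>)
qed

lemma approximable_finite_dsum:
  assumes \<G>: "perf_class C \<G>" and ds: "dsum C I X (S :: ('o, 'a, 'b, 'k) dgmod) \<iota> \<pi>" and I: "finite I"
    and X: "\<And>i. i \<in> I \<Longrightarrow> approximable C \<G> (X i)"
  shows "approximable C \<G> S"
proof (rule approximable_dsum[OF \<G> ds X])
  fix P f assume P: "kproj C P" and f: "dg_morphism C P S f"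
  interpret S: dg_module C S by (rule dsumD(1)[OF ds])
  have "null_homotopic C P S (\<lambda>x n m. dsum_rest \<iota> \<pi> I x n (f x n m))"
  proof (rule null_homotopicI[of _ _ _ "\<lambda>x n m. 0"])
    show "graded_map C (-1) P S (\<lambda>x n m. 0)"
      by (rule graded_mapI) (auto simp: S.mem_0 S.act_0 lin_const0)
    fix x n m assume *: "x \<in> Obj C" "m \<in> Car P x n"
    show "dsum_rest \<iota> \<pi> I x n (f x n m) = MDiff S x (n - 1) 0 + 0"
      unfolding dsum_rest_def using dsum_sum_eq[OF ds *(1) mor_in[OF f *] I] by (simp add: S.d_0 *)
  qed
  then show "\<exists>J. finite J \<and> J \<subseteq> I \<and> null_homotopic C P S (\<lambda>x n m. dsum_rest \<iota> \<pi> J x n (f x n m))"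
    using I by blast
qed

end

context enough_kproj
begin

lemma approximable_direct_sum:
  assumes \<G>: "perf_class C \<G>" and ds: "is_direct_sum C (I :: 'b set) X (S :: ('o, 'a, 'b, 'k) dgmod)"
    and X: "\<And>i. i \<in> I \<Longrightarrow> approximable C \<G> (X i)"
  shows "approximable C \<G> S"
proof -
  obtain \<iota> \<pi> where d: "dsum C I X S \<iota> \<pi>" using is_direct_sum_imp_dsum[OF ds] by blast
  show ?thesis
    by (rule approximable_dsum[OF \<G> d X]) (auto intro!: cptD[OF _ d] kproj_Perf_cpt)
qed

text \<open>Up to homotopy \<open>f\<close> lifts to a resolution of \<open>X\<close>, which lies in
  the class by closure under isomorphism and is the required K-projective middle object.\<close>

lemma approximable_self:
  assumes \<G>: "perf_class C \<G>" and X: "(X :: ('o, 'a, 'b, 'k) dgmod) \<in> \<G>"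
  shows "approximable C \<G> X"
proof (rule approximableI[OF perf_class_module[OF \<G> X]])
  fix P f assume P: "kproj C P" "P \<in> Perf C" and f: "dg_morphism C P X f"
  obtain E \<rho> where E: "kproj C E" "quasi_iso C E X \<rho>" using resolution[OF perf_class_module[OF \<G> X]] by blast
  have EG: "E \<in> \<G>"
    by (rule perf_classD(3)[OF \<G> X derived_iso_sym[OF derived_iso_quasi_iso[OF E(2)]]])
  obtain g where g: "dg_morphism C P E g" "null_homotopic C P X (\<lambda>x n p. f x n p - \<rho> x n (g x n p))"
    using kproj_lift[OF P(1) E(2) f] by blast
  note \<rho> = quasi_iso_mor[OF E(2)]
  show "factors C \<G> P X f"
    by (rule factors_homotopic[OF \<G> P(1) f mor_comp[OF g(1) \<rho>] factorsI[OF EG E(1) g(1) \<rho>] g(2)]) simp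
qed

lemma approximable_ads:
  assumes \<G>: "perf_class C \<G>" and G: "(G :: ('o, 'a, 'b, 'k) dgmod) \<in> \<G>" and X: "X \<in> ads C {G}"
  shows "approximable C \<G> X"
  using X
proof (induction rule: ads.induct)
  case (base M)
  then show ?case using approximable_self[OF \<G> G] by simp
next
  case (iso M N)
  then show ?case using approximable_derived_iso[OF \<G>] by blast
next
  case (summand M N)
  then show ?case using approximable_summand[OF \<G>] by blast
next
  case (shift M p)
  then show ?case using approximable_shift[OF \<G>] by blast
next
  case (sum I M S)
  then show ?case using approximable_direct_sum[OF \<G>] by blast
qed

text \<open>
  The homotopy fibre \<open>D\<close> of the first component of \<open>f\<close> is again compact, so the induced map
  \<open>D \<rightarrow> N\<close> factors through the second class; the two factorizations are glued in \<open>H\<close>.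
\<close>

lemma approximable_cone:
  assumes \<G>1: "perf_class C \<G>1" and \<G>2: "perf_class C \<G>2"
    and star: "\<And>E G a. E \<in> \<G>1 \<Longrightarrow> G \<in> \<G>2 \<Longrightarrow> dg_morphism C E G a \<Longrightarrow> cone_module E G a \<in> \<G>3"
    and \<phi>: "dg_morphism C M N (\<phi> :: ('o, 'b, 'k) gmap)"
    and M: "approximable C \<G>1 M" and N: "approximable C \<G>2 N"
  shows "approximable C \<G>3 (cone_module M N \<phi>)"
proof (rule approximableI[OF dg_module_cone[OF \<phi>]])
  let ?R = "cone_module M N \<phi>"
  fix P f assume P: "kproj C P" "P \<in> Perf C" and f: "dg_morphism C P ?R f"
  interpret P: dg_module C P by (rule kproj_module[OF P(1)])
  interpret M: dg_module C M by (rule mor_source[OF \<phi>])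
  interpret N: dg_module C N by (rule mor_target[OF \<phi>])
  have fin: "vfst (f x n p) \<in> Car N x n" "vsnd (f x n p) \<in> Car M x (n + 1)" if "x \<in> Obj C" "p \<in> Car P x n" for x n p
    using mor_in[OF f that] by simp_all
  have fd: "vfst (f x (n + 1) (MDiff P x n p)) = MDiff N x n (vfst (f x n p)) + \<phi> x (n + 1) (vsnd (f x n p))"
    if "x \<in> Obj C" "p \<in> Car P x n" for x n p
    using mor_d[OF f that] by simp
  have fN: "graded_map C 0 P N (\<lambda>x n p. vfst (f x n p))"
    using gr_comp[OF mor_graded[OF f] cone_vfst_graded[OF \<phi>]] by simp
  have "dg_morphism C P (shift 1 M) (\<lambda>x n p. vsnd (f x n p))"
    by (rule mor_comp[OF f cone_projection[OF \<phi>]])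
  from mor_shift[OF this, of "-1"] have fM: "dg_morphism C (shift (-1) P) M (\<lambda>x n p. vsnd (f x (n - 1) p))"
    by simp
  show "factors C \<G>3 P ?R f"
  proof (rule factorsE[OF approximableD[OF M kproj_shift[OF P(1)] Perf.shift[OF P(2)] fM]])
    fix E h e assume E: "E \<in> \<G>1" "kproj C E" "dg_morphism C (shift (-1) P) E h" "dg_morphism C E M e"
      "\<And>x n m. x \<in> Obj C \<Longrightarrow> m \<in> Car (shift (-1) P) x n \<Longrightarrow> vsnd (f x (n - 1) m) = e x n (h x n m)"
    have fe: "vsnd (f x n p) = e x (n + 1) (h x (n + 1) p)" if "x \<in> Obj C" "p \<in> Car P x n" for x n p
      using E(5)[OF that(1), of p "n + 1"] that by simp
    interpret E: dg_module C E by (rule kproj_module[OF E(2)])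
    let ?D = "cone_module (shift (-1) P) E h"
    note Dk = kproj_cone[OF E(3) kproj_shift[OF P(1)] E(2)]
    note Dm = dg_module_cone[OF E(3)]
    have DP: "?D \<in> Perf C"
    proof (rule Perf.cone[OF Perf.shift[OF P(2)] perf_classD(1)[OF \<G>1 E(1)]])
      show "derived_cone C (shift (-1) P) E ?D"
        unfolding derived_cone_def
        using quasi_iso_id[OF dg_module_shift[OF P.dg_module_axioms]] is_cone_cone[OF E(3)] derived_iso_refl[OF Dm] by blast
    qed
    note \<phi>e = mor_comp[OF E(4) \<phi>]
    \<comment> \<open>The first component of \<open>f\<close> fails to be closed by
      \<open>\<phi>\<close> of the second one. The latter factors through \<open>E\<close> by
      \<open>fe\<close>, so on \<open>?D\<close> the term with \<open>e\<close> compensates the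
      failure.\<close>
    have g: "dg_morphism C ?D N (\<lambda>x n w. - \<phi> x n (e x n (vfst w)) + vfst (f x n (vsnd w)))"
    proof (rule mor_from_cone[OF E(3) mor_uminus[OF \<phi>e]])
      show "graded_map C 0 (shift 1 (shift (-1) P)) N (\<lambda>x n p. vfst (f x n p))" using fN by simp
      fix x n m assume "x \<in> Obj C" "m \<in> Car (shift (-1) P) x (n + 1)"
      then show "MDiff N x n (vfst (f x n m)) = - \<phi> x (n + 1) (e x (n + 1) (h x (n + 1) m)) -
          vfst (f x (n + 1) (MDiff (shift (-1) P) x (n + 1) m))"
        by (simp add: fd fe mor_minus[OF f] P.d_in)
    qed
    show "factors C \<G>3 P ?R f"
    proof (rule factorsE[OF approximableD[OF N Dk DP g]])
      fix G a b assume G: "G \<in> \<G>2" "kproj C G" "dg_morphism C ?D G a" "dg_morphism C G N b"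
        "\<And>x n m. x \<in> Obj C \<Longrightarrow> m \<in> Car ?D x n \<Longrightarrow> - \<phi> x n (e x n (vfst m)) + vfst (f x n (vsnd m)) = b x n (a x n m)"
      \<comment> \<open>Restricted to \<open>E\<close>, the composite of \<open>b\<close> and
        \<open>a\<close> is minus the composite of \<open>\<phi>\<close> and \<open>e\<close>; hence
        \<open>b\<close> and \<open>- e\<close> define a map from the cone of \<open>?aE\<close> to
        \<open>?R\<close>. On the other part of \<open>?D\<close> the map \<open>a\<close> is not
        closed, and \<open>- h\<close> as a second component makes it a map from \<open>P\<close>
        into this cone. The two signs cancel in the composite.\<close>
      let ?aE = "\<lambda>x n v. a x n (vpair v 0)"
      have aE: "dg_morphism C E G ?aE" by (rule mor_comp[OF cone_inclusion[OF E(3)] G(3)])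
      interpret G: dg_module C G by (rule kproj_module[OF G(2)])
      let ?H = "cone_module E G ?aE"
      have h1: "dg_morphism C P (shift 1 E) (\<lambda>x n p. h x (n + 1) p)"
        using mor_shift[OF E(3), of 1] by simp
      have aP: "graded_map C 0 P G (\<lambda>x n p. a x n (vpair 0 p))"
      proof (rule graded_mapI)
        fix x n assume x: "x \<in> Obj C"
        show "linear_map_on (Car P x n) (\<lambda>p. a x n (vpair 0 p))"
          by (rule lin_compose[OF _ mor_linear[OF G(3) x], of _ "vpair 0"])
            (auto intro!: linear_map_onI simp: E.mem_0 x)
        fix p assume "p \<in> Car P x n"
        then show "a x n (vpair 0 p) \<in> Car G x (n + 0)"
          using mor_in[OF G(3) x, of "vpair 0 p" n] by (simp add: E.mem_0 x)
      next
        fix x y i j m c assume *: "x \<in> Obj C" "y \<in> Obj C" "m \<in> Car P y i" "c \<in> Hom C x y j"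
        have "a x (i + j) (Act ?D x y i j (vpair 0 m) c) = Act G x y i j (a y i (vpair 0 m)) c"
          by (rule mor_act[OF G(3)]) (use * in \<open>auto simp: E.mem_0\<close>)
        then show "a x (i + j) (vpair 0 (Act P x y i j m c)) = Act G x y (i + 0) j (a y i (vpair 0 m)) c"
          using * by (simp add: E.act_0)
      qed
      have hin: "h x (n + 1) p \<in> Car E x (n + 1)" if "x \<in> Obj C" "p \<in> Car P x n" for x n p
        using mor_in[OF h1 that] by simp
      have toH: "dg_morphism C P ?H (\<lambda>x n p. vpair (a x n (vpair 0 p)) (- h x (n + 1) p))"
      proof (rule mor_to_cone[OF aE aP mor_uminus[OF h1]])
        fix x n p assume *: "x \<in> Obj C" "p \<in> Car P x n"
        have "a x (n + 1) (MDiff ?D x n (vpair 0 p)) = MDiff G x n (a x n (vpair 0 p))"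
          by (rule mor_d[OF G(3)]) (use * in \<open>auto simp: E.mem_0\<close>)
        moreover have "MDiff ?D x n (vpair 0 p) = vpair (h x (n + 1) p) 0 + vpair 0 (MDiff P x n p)"
          using * by (simp add: E.d_0)
        moreover have "a x (n + 1) (vpair (h x (n + 1) p) 0 + vpair 0 (MDiff P x n p)) =
            a x (n + 1) (vpair (h x (n + 1) p) 0) + a x (n + 1) (vpair 0 (MDiff P x n p))"
          by (rule mor_add[OF G(3) *(1)]) (use * hin in \<open>auto simp: E.mem_0 P.mem_0 P.d_in\<close>)
        ultimately show "a x (n + 1) (vpair 0 (MDiff P x n p)) =
            MDiff G x n (a x n (vpair 0 p)) + a x (n + 1) (vpair (- h x (n + 1) p) 0)"
          using mor_minus[OF aE *(1) hin[OF *]] by (simp add: eq_diff_eq add.commute)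
      qed
      have fromH: "dg_morphism C ?H ?R (\<lambda>x n w. vpair (b x n (vfst w)) (- e x (n + 1) (vsnd w)))"
      proof (rule mor_to_cone[OF \<phi>])
        show "graded_map C 0 ?H N (\<lambda>x n w. b x n (vfst w))"
          using gr_comp[OF cone_vfst_graded[OF aE] mor_graded[OF G(4)]] by simp
        show "dg_morphism C ?H (shift 1 M) (\<lambda>x n w. - e x (n + 1) (vsnd w))"
          using mor_uminus[OF mor_comp[OF cone_projection[OF aE] mor_shift[OF E(4)]]] by simp
        fix x n w assume *: "x \<in> Obj C" "w \<in> Car ?H x n"
        have "b x (n + 1) (a x (n + 1) (vpair (vsnd w) 0)) = - \<phi> x (n + 1) (e x (n + 1) (vsnd w))"
          using G(5)[OF *(1), of "vpair (vsnd w) 0" "n + 1"] * by (simp add: P.mem_0 mor_0[OF f])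
        then show "b x (n + 1) (vfst (MDiff ?H x n w)) =
            MDiff N x n (b x n (vfst w)) + \<phi> x (n + 1) (- e x (n + 1) (vsnd w))"
          using * by (simp add: mor_add[OF G(4)] G.d_in mor_in[OF aE] mor_d[OF G(4)]
              mor_minus[OF \<phi>] mor_in[OF E(4)])
      qed
      show ?thesis
      proof (rule factorsI[OF star[OF E(1) G(1) aE] kproj_cone[OF aE E(2) G(2)] toH fromH])
        fix x n p assume *: "x \<in> Obj C" "p \<in> Car P x n"
        have "b x n (a x n (vpair 0 p)) = vfst (f x n p)"
          using G(5)[OF *(1), of "vpair 0 p" n] * by (simp add: E.mem_0 mor_0[OF \<phi>e])
        then show "f x n p = vpair (b x n (vfst (vpair (a x n (vpair 0 p)) (- h x (n + 1) p))))
            (- e x (n + 1) (vsnd (vpair (a x n (vpair 0 p)) (- h x (n + 1) p))))"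
          using * by (simp add: fe mor_minus[OF E(4)] hin)
      qed
    qed
  qed
qed

lemma approximable_derived_cone:
  assumes \<G>1: "perf_class C \<G>1" and \<G>2: "perf_class C \<G>2" and \<G>3: "perf_class C \<G>3"
    and star: "\<And>E G a. E \<in> \<G>1 \<Longrightarrow> G \<in> \<G>2 \<Longrightarrow> dg_morphism C E G a \<Longrightarrow> cone_module E G a \<in> \<G>3"
    and dc: "derived_cone C M N (X :: ('o, 'a, 'b, 'k) dgmod)"
    and M: "approximable C \<G>1 M" and N: "approximable C \<G>2 N"
  shows "approximable C \<G>3 X"
proof -
  obtain P \<sigma> \<phi> Y where d: "quasi_iso C P M \<sigma>" "is_cone C P N \<phi> Y" "derived_iso C Y X"
    using dc unfolding derived_cone_def by (elim exE conjE)
  have \<phi>: "dg_morphism C P N \<phi>" using d by (simp add: is_cone_def)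
  obtain \<psi> where "quasi_iso C (cone_module P N \<phi>) Y \<psi>" using is_cone_iso[OF d(2)] by (rule exE)
  from approximable_derived_iso[OF \<G>3 derived_iso_trans[OF derived_iso_quasi_iso[OF this] d(3)]]
  show ?thesis
    using approximable_cone[OF \<G>1 \<G>2 star \<phi> approximable_backward[OF \<G>1 d(1) M] N] by blast
qed

text \<open>A resolution \<open>\<rho>\<close> of \<open>X\<close> factors through some
  \<open>E\<close> in the class. Since \<open>\<rho>\<close> is invertible in the derived category,
  \<open>e\<close> is a split surjection there with section given by \<open>h\<close>. Concretely,
  \<open>e\<close> and the inclusion into the cone of \<open>h\<close> form a quasi-isomorphism from
  \<open>E\<close> to the direct sum \<open>?S\<close> of \<open>X\<close> and this cone.\<close>

lemma perf_approximable_in: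
  assumes \<G>: "perf_class C \<G>" and sm: "\<And>M N. M \<in> \<G> \<Longrightarrow> derived_summand C N M \<Longrightarrow> N \<in> \<G>"
    and X: "(X :: ('o, 'a, 'b, 'k) dgmod) \<in> Perf C" "approximable C \<G> X"
  shows "X \<in> \<G>"
proof -
  obtain P \<rho> where P: "kproj C P" "quasi_iso C P X \<rho>" using resolution[OF Perf_module[OF X(1)]] by blast
  note \<rho> = quasi_iso_mor[OF P(2)]
  have PP: "P \<in> Perf C" by (rule Perf.iso[OF X(1) derived_iso_sym[OF derived_iso_quasi_iso[OF P(2)]]])
  show ?thesis
  proof (rule factorsE[OF approximableD[OF X(2) P(1) PP \<rho>]])
    fix E h e assume E: "E \<in> \<G>" "kproj C E" "dg_morphism C P E h" "dg_morphism C E X e"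
      "\<And>x n m. x \<in> Obj C \<Longrightarrow> m \<in> Car P x n \<Longrightarrow> \<rho> x n m = e x n (h x n m)"
    interpret P: dg_module C P by (rule kproj_module[OF P(1)])
    interpret E: dg_module C E by (rule kproj_module[OF E(2)])
    interpret X: dg_module C X by (rule Perf_module[OF X(1)])
    let ?Z = "cone_module P E h"
    note Zm = dg_module_cone[OF E(3)]
    interpret Z: dg_module C ?Z by (rule Zm)
    let ?z = "\<lambda>x n m. 0"
    let ?S = "cone_module (shift (-1) ?Z) X ?z"
    have z: "dg_morphism C (shift (-1) ?Z) X ?z"
      by (rule mor_const0[OF dg_module_shift[OF Zm] X.dg_module_axioms])
    interpret S: dg_module C ?S by (rule dg_module_cone[OF z])
    have \<theta>: "dg_morphism C E ?S (\<lambda>x n u. vpair (e x n u) (vpair u 0))"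
      by (rule mor_to_cone[OF z mor_graded[OF E(4)]])
        (simp_all add: cone_inclusion[OF E(3)] mor_d[OF E(4)])
    have "quasi_iso C E ?S (\<lambda>x n u. vpair (e x n u) (vpair u 0))"
    proof (rule quasi_isoI[OF \<theta>])
      fix x n u w assume *: "x \<in> Obj C" "u \<in> Car E x n" "MDiff E x n u = 0" "w \<in> Car ?S x (n - 1)"
        "vpair (e x n u) (vpair u 0) = MDiff ?S x (n - 1) w"
      define y v p where "y = vfst w" and "v = vfst (vsnd w)" and "p = vsnd (vsnd w)"
      have 1: "y \<in> Car X x (n - 1)" "v \<in> Car E x (n - 1)" "p \<in> Car P x n"
        using *(4) by (auto simp: y_def v_def p_def)
      have 2: "e x n u = MDiff X x (n - 1) y" "u = MDiff E x (n - 1) v + h x n p" "MDiff P x n p = 0"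
        using *(5) by (auto simp: y_def v_def p_def)
      have "\<rho> x n p = MDiff X x (n - 1) (y - e x (n - 1) v)"
      proof -
        have "e x n u = MDiff X x (n - 1) (e x (n - 1) v) + \<rho> x n p"
          using 1 2(2) *(1) by (simp add: mor_add[OF E(4)] E.d_in mor_in[OF E(3)] mor_d[OF E(4)] E(5))
        then show ?thesis using 1 2(1) *(1) by (simp add: X.d_diff mor_in[OF E(4)] algebra_simps)
      qed
      then obtain q where q: "q \<in> Car P x (n - 1)" "p = MDiff P x (n - 1) q"
        using quasi_iso_inj[OF P(2) *(1) 1(3) 2(3), of "y - e x (n - 1) v" "n - 1"] 1 *(1)
        by (auto simp: X.mem mor_in[OF E(4)])
      then have "u = MDiff E x (n - 1) (v + h x (n - 1) q)"
        using 2(2) 1 *(1) by (simp add: E.d_add mor_in[OF E(3)] mor_d[OF E(3)])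
      then show "\<exists>w\<in>Car E x (n - 1). u = MDiff E x (n - 1) w"
        using q 1 *(1) by (intro bexI[of _ "v + h x (n - 1) q"]) (auto simp: E.mem mor_in[OF E(3)])
    next
      fix x n w assume *: "x \<in> Obj C" "w \<in> Car ?S x n" "MDiff ?S x n w = 0"
      define y v p where "y = vfst w" and "v = vfst (vsnd w)" and "p = vsnd (vsnd w)"
      have w: "w = vpair y (vpair v p)" by (simp add: y_def v_def p_def)
      have 1: "y \<in> Car X x n" "v \<in> Car E x n" "p \<in> Car P x (n + 1)"
        using *(2) by (auto simp: y_def v_def p_def)
      have 2: "MDiff X x n y = 0" "MDiff E x n v + h x (n + 1) p = 0" "MDiff P x (n + 1) p = 0"
        using *(3) by (auto simp: y_def v_def p_def add.commute)
      have hp: "h x (n + 1) p = MDiff E x n (- v)" using 2(2) 1 *(1) by (simp add: E.d_minus add_eq_0_iff)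
      have "\<rho> x (n + 1) p = MDiff X x n (e x n (- v))"
        using 1 *(1) by (simp add: E(5) hp mor_d[OF E(4)] E.mem)
      then obtain q where q: "q \<in> Car P x n" "p = MDiff P x n q"
        using quasi_iso_inj[OF P(2) *(1) 1(3) 2(3), of "e x n (- v)" n] 1 *(1) mor_in[OF E(4) *(1) E.mem_minus[OF *(1) 1(2)]]
        by auto
      \<comment> \<open>The component \<open>p\<close> is exact because its image under
        \<open>\<rho>\<close> is; adding the image of a primitive \<open>q\<close> turns
        \<open>v\<close> into a cycle. Its image in \<open>X\<close> may still differ from
        \<open>y\<close>, and the cycle \<open>r\<close> below, lifted from \<open>X\<close> along
        \<open>\<rho>\<close>, corrects this difference up to a boundary.\<close>
      define v' where "v' = v + h x n q"
      have v': "v' \<in> Car E x n" "MDiff E x n v' = 0"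
        using q 1 2(2) *(1) by (auto simp: v'_def E.mem E.d_add mor_in[OF E(3)] mor_d[OF E(3), symmetric])
      have "MDiff X x n (y - e x n v') = 0"
        using v' 1 2 *(1) by (simp add: X.d_diff mor_in[OF E(4)] mor_d[OF E(4), symmetric] mor_0[OF E(4)])
      then obtain r s where r: "r \<in> Car P x n" "s \<in> Car X x (n - 1)" "MDiff P x n r = 0"
          "y - e x n v' = \<rho> x n r + MDiff X x (n - 1) s"
        using quasi_iso_surj[OF P(2) *(1), of "y - e x n v'" n] v' 1 *(1) by (auto simp: X.mem mor_in[OF E(4)])
      let ?u = "v' + h x n r"
      have u: "?u \<in> Car E x n" "MDiff E x n ?u = 0"
        using v' r *(1) by (auto simp: E.mem E.d_add mor_in[OF E(3)] mor_d[OF E(3), symmetric] mor_0[OF E(3)])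
      have eu: "e x n ?u = e x n v' + \<rho> x n r"
        using v' r *(1) by (simp add: mor_add[OF E(4)] mor_in[OF E(3)] E(5))
      let ?w = "vpair s (vpair 0 (- r - q))"
      have win: "?w \<in> Car ?S x (n - 1)" using r q *(1) by (simp add: E.mem P.mem)
      have "MDiff ?S x (n - 1) ?w = vpair (MDiff X x (n - 1) s) (vpair (h x n (- r - q)) (- MDiff P x n (- r - q)))"
        using *(1) by (simp add: E.d_0)
      also have "h x n (- r - q) = - h x n r - h x n q"
        using r q *(1) by (simp add: mor_diff[OF E(3)] mor_minus[OF E(3)] P.mem)
      also have "MDiff P x n (- r - q) = - p"
        using r q *(1) by (simp add: P.d_diff P.d_minus P.mem)
      finally have dw: "MDiff ?S x (n - 1) ?w = vpair (MDiff X x (n - 1) s) (vpair (- h x n r - h x n q) (- (- p)))" .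
      have "w = vpair (e x n ?u) (vpair ?u 0) + MDiff ?S x (n - 1) ?w"
        unfolding dw eu w using r(4) by (simp add: v'_def algebra_simps)
      with u win show "\<exists>m\<in>Car E x n. \<exists>u\<in>Car ?S x (n - 1). MDiff E x n m = 0 \<and> w = vpair (e x n m) (vpair m 0) + MDiff ?S x (n - 1) u"
        by blast
    qed
    then have iso: "derived_iso C ?S E" by (rule derived_iso_sym[OF derived_iso_quasi_iso])
    have "is_direct_sum C UNIV (\<lambda>b::bool. if b then X else ?Z) ?S"
      using dsum_imp_is_direct_sum[OF zero_cone_dsum[OF z, of True False UNIV]] by (simp add: UNIV_bool insert_commute cong: if_cong)
    then have "derived_summand C X E" unfolding derived_summand_def using iso by blast
    then show "X \<in> \<G>" by (rule sm[OF E(1)])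
  qed
qed

end


section \<open>Classes generated by perfect modules\<close>

definition zero_module :: "('o, 'a, 'b, 'k::field) dgmod" where
  "zero_module = \<lparr>Car = (\<lambda>x n. {0}), MDiff = (\<lambda>x n m. 0), Act = (\<lambda>x y i j m f. 0)\<rparr>"

lemma zero_module_simps [simp]:
  "Car zero_module x n = {0}" "MDiff zero_module x n m = 0" "Act zero_module x y i j m f = 0"
  by (simp_all add: zero_module_def)

lemma acyclic_zero_module: "acyclic_module C zero_module"
proof -
  have "dg_module C zero_module"
    by unfold_locales (auto simp: zero_module_def bilinear_map_on_def linear_map_on_def)
  then show ?thesis by (simp add: acyclic_module_def)
qed

lemma acyclic_derived_iso:
  assumes "acyclic_module C M" "acyclic_module C N"
  shows "derived_iso C M N"
  by (rule derived_iso_quasi_iso[OF acyclic_quasi_iso[OF mor_const0]]) (auto simp: assms acyclic_module_module)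

lemma derived_iso_acyclic:
  assumes "derived_iso C M N" "acyclic_module C M"
  shows "acyclic_module C N"
  using assms by (induction rule: derived_iso_induct) (auto simp: quasi_iso_acyclic)

context dg_universe
begin

lemma derived_cone_cone_module:
  assumes a: "dg_morphism C M (N :: ('o, 'a, 'b, 'k) dgmod) a"
  shows "derived_cone C M N (cone_module M N a)"
  unfolding derived_cone_def
  using quasi_iso_id[OF mor_source[OF a]] is_cone_cone[OF a] derived_iso_refl[OF dg_module_cone[OF a]]
  by (intro exI conjI)

lemma Perf_cone_module:
  assumes "dg_morphism C M (N :: ('o, 'a, 'b, 'k) dgmod) a" "M \<in> Perf C" "N \<in> Perf C"
  shows "cone_module M N a \<in> Perf C"
  by (rule Perf.cone[OF assms(2,3) derived_cone_cone_module[OF assms(1)]])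

text \<open>\<open>T\<close> is the product of the first \<open>k\<close> modules \<open>M i\<close>, with \<open>\<theta>\<close> the map with the components \<open>\<pi> i\<close>.\<close>

definition finite_product where
  "finite_product S M \<pi> (k :: nat) T \<theta> \<longleftrightarrow> T \<in> Perf C \<and> dg_morphism C S T \<theta> \<and>
    (\<forall>x\<in>Obj C. \<forall>n. \<forall>s\<in>Car S x n. \<theta> x n s = 0 \<longrightarrow> (\<forall>i<k. \<pi> i x n s = 0)) \<and>
    (\<forall>x\<in>Obj C. \<forall>n. \<forall>t\<in>Car T x n. \<exists>m. (\<forall>i<k. m i \<in> Car (M i) x n) \<and>
      (\<forall>s\<in>Car S x n. (\<forall>i<k. \<pi> i x n s = m i) \<longrightarrow> \<theta> x n s = t))"

text \<open>\<open>Perf\<close> has no rule for direct sums; iterated cones of zero maps replace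
  them. The map from \<open>S\<close> is built along with them, and the conditional form of
  surjectivity is what can be proved before \<open>S\<close> is known to be a direct sum.\<close>

lemma Perf_finite_product:
  fixes S :: "('o, 'a, 'b, 'k) dgmod"
  assumes S: "dg_module C S" and "\<forall>i<k::nat. M i \<in> Perf C \<and> dg_morphism C S (M i) (\<pi> i)"
  shows "\<exists>T \<theta>. finite_product S M \<pi> k T \<theta>"
  using assms(2)
proof (induction k)
  case 0
  show ?case
    unfolding finite_product_def using Perf.zero[OF acyclic_zero_module, of C] mor_const0[OF S acyclic_module_module[OF acyclic_zero_module]]
    by (intro exI[of _ zero_module] exI[of _ "\<lambda>x n m. 0"]) auto
next
  case (Suc k)
  have "\<forall>i<k. M i \<in> Perf C \<and> dg_morphism C S (M i) (\<pi> i)"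
    using Suc.prems by simp
  note IH = Suc.IH[OF this]
  from IH obtain T \<theta> where "finite_product S M \<pi> k T \<theta>"
    by (elim exE)
  then have T: "T \<in> Perf C" and \<theta>: "dg_morphism C S T \<theta>"
    and inj: "\<And>x n s i. \<lbrakk>x \<in> Obj C; s \<in> Car S x n; \<theta> x n s = 0; i < k\<rbrakk> \<Longrightarrow> \<pi> i x n s = 0"
    and surj: "\<And>x n t. \<lbrakk>x \<in> Obj C; t \<in> Car T x n\<rbrakk> \<Longrightarrow> \<exists>m. (\<forall>i<k. m i \<in> Car (M i) x n) \<and>
      (\<forall>s\<in>Car S x n. (\<forall>i<k. \<pi> i x n s = m i) \<longrightarrow> \<theta> x n s = t)"
    by (simp_all add: finite_product_def)
  have Mk: "M k \<in> Perf C" and pk: "dg_morphism C S (M k) (\<pi> k)" using Suc.prems by auto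
  let ?z = "\<lambda>x n m. 0" and ?T = "cone_module (shift (-1) (M k)) T (\<lambda>x n m. 0)"
  have z: "dg_morphism C (shift (-1) (M k)) T ?z"
    by (rule mor_const0[OF dg_module_shift[OF Perf_module[OF Mk]] Perf_module[OF T]])
  have m: "dg_morphism C S ?T (\<lambda>x n s. vpair (\<theta> x n s) (\<pi> k x n s))"
    by (rule mor_to_cone[OF z mor_graded[OF \<theta>]]) (simp_all add: pk mor_d[OF \<theta>])
  show ?case
    unfolding finite_product_def
  proof (intro exI[of _ ?T] exI[of _ "\<lambda>x n s. vpair (\<theta> x n s) (\<pi> k x n s)"] conjI ballI allI impI m
      Perf_cone_module[OF z Perf.shift[OF Mk] T])
    fix x n s i assume "x \<in> Obj C" "s \<in> Car S x n" "vpair (\<theta> x n s) (\<pi> k x n s) = 0" "i < Suc k"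
    then show "\<pi> i x n s = 0" using inj[of x s n i] by (cases "i = k") auto
  next
    fix x n t assume *: "x \<in> Obj C" "t \<in> Car ?T x n"
    obtain m where m: "\<forall>i<k. m i \<in> Car (M i) x n" "\<And>s. s\<in>Car S x n \<Longrightarrow> \<forall>i<k. \<pi> i x n s = m i \<Longrightarrow> \<theta> x n s = vfst t"
      using surj[OF *(1), of "vfst t" n] * by auto
    show "\<exists>m. (\<forall>i<Suc k. m i \<in> Car (M i) x n) \<and>
      (\<forall>s\<in>Car S x n. (\<forall>i<Suc k. \<pi> i x n s = m i) \<longrightarrow> vpair (\<theta> x n s) (\<pi> k x n s) = t)"
      using m * by (intro exI[of _ "m(k := vsnd t)"]) (auto simp: less_Suc_eq)
  qed
qed

lemma Perf_finite_direct_sum: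
  assumes "\<And>i. i < k \<Longrightarrow> M i \<in> Perf C" and ds: "is_direct_sum C {..<k::nat} M (S :: ('o, 'a, 'b, 'k) dgmod)"
  shows "S \<in> Perf C"
proof -
  obtain \<iota> \<pi> where "dsum C {..<k} M S \<iota> \<pi>" using is_direct_sum_imp_dsum[OF ds] by blast
  note d = dsumD[OF this] and eq = dsum_sum_eq[OF this]
  interpret S: dg_module C S by (rule d(1))
  have "\<exists>T \<theta>. finite_product S M \<pi> k T \<theta>"
    by (rule Perf_finite_product[OF S.dg_module_axioms]) (use assms(1) d(3) in auto)
  then obtain T \<theta> where "finite_product S M \<pi> k T \<theta>"
    by (elim exE)
  then have T: "T \<in> Perf C" and \<theta>: "dg_morphism C S T \<theta>"
    and inj: "\<And>x n s i. \<lbrakk>x \<in> Obj C; s \<in> Car S x n; \<theta> x n s = 0; i < k\<rbrakk> \<Longrightarrow> \<pi> i x n s = 0"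
    and surj: "\<And>x n t. \<lbrakk>x \<in> Obj C; t \<in> Car T x n\<rbrakk> \<Longrightarrow> \<exists>m. (\<forall>i<k. m i \<in> Car (M i) x n) \<and>
      (\<forall>s\<in>Car S x n. (\<forall>i<k. \<pi> i x n s = m i) \<longrightarrow> \<theta> x n s = t)"
    by (simp_all add: finite_product_def)
  have "quasi_iso C S T \<theta>"
  proof (rule quasi_iso_bij[OF \<theta>])
    fix x n assume x: "x \<in> Obj C"
    have 0: "s = 0" if "s \<in> Car S x n" "\<theta> x n s = 0" for s
    proof -
      have "s = (\<Sum>i\<in>{..<k}. \<iota> i x n (\<pi> i x n s))" by (rule eq[OF x that(1)]) auto
      also have "\<dots> = 0"
      proof (rule sum.neutral, intro ballI)
        fix i assume "i \<in> {..<k}"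
        then show "\<iota> i x n (\<pi> i x n s) = 0" using inj[OF x that] mor_0[OF d(2) x, of i] by simp
      qed
      finally show ?thesis .
    qed
    show "bij_betw (\<theta> x n) (Car S x n) (Car T x n)"
      unfolding bij_betw_def
    proof
      show "inj_on (\<theta> x n) (Car S x n)"
        using 0 S.mem_diff[OF x] mor_diff[OF \<theta> x] by (intro inj_onI) (metis eq_iff_diff_eq_0)
      show "\<theta> x n ` Car S x n = Car T x n"
      proof
        show "\<theta> x n ` Car S x n \<subseteq> Car T x n" using mor_in[OF \<theta> x] by blast
        show "Car T x n \<subseteq> \<theta> x n ` Car S x n"
        proof
          fix t assume "t \<in> Car T x n"
          from surj[OF x this] obtain m where m: "\<forall>i<k. m i \<in> Car (M i) x n"
            "\<And>s. s\<in>Car S x n \<Longrightarrow> \<forall>i<k. \<pi> i x n s = m i \<Longrightarrow> \<theta> x n s = t" by blast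
          let ?s = "\<Sum>i<k. \<iota> i x n (m i)"
          have s: "?s \<in> Car S x n" using m x by (intro S.mem_sum) (auto intro!: mor_in[OF d(2)])
          have "\<pi> j x n ?s = m j" if "j < k" for j
          proof -
            have "\<pi> j x n ?s = (\<Sum>i<k. \<pi> j x n (\<iota> i x n (m i)))"
              using m x that by (intro mor_sum[OF d(3)]) (auto intro!: mor_in[OF d(2)])
            also have "\<dots> = (\<Sum>i<k. if i = j then m i else 0)"
              by (rule sum.cong) (use m x that in \<open>auto simp: d(4)\<close>)
            finally show ?thesis using that by simp
          qed
          then have "\<theta> x n ?s = t" using m(2)[OF s] by blast
          then show "t \<in> \<theta> x n ` Car S x n" using s by blast
        qed
      qed
    qed
  qed
  from Perf.iso[OF T derived_iso_sym[OF derived_iso_quasi_iso[OF this]]] show ?thesis .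
qed

lemma generated_subset_Perf:
  assumes "\<A> \<subseteq> (Perf C :: ('o, 'a, 'b, 'k) dgmod set)"
  shows "generated C \<A> \<subseteq> Perf C"
proof
  fix M assume "M \<in> generated C \<A>"
  then show "M \<in> Perf C"
  proof (induction rule: generated.induct)
    case (sum k M S)
    then show ?case using Perf_finite_direct_sum by blast
  qed (use assms in \<open>blast intro: Perf.intros\<close>)+
qed

text \<open>The empty direct sum is a zero module, and every acyclic module is isomorphic to it in
  the derived category.\<close>

lemma acyclic_in_generated:
  assumes "acyclic_module C (M :: ('o, 'a, 'b, 'k) dgmod)"
  shows "M \<in> generated C \<A>"
proof -
  have "is_direct_sum C {..<0::nat} (\<lambda>i. zero_module) (zero_module :: ('o, 'a, 'b, 'k) dgmod)"
    by (rule dsum_imp_is_direct_sum[of _ _ _ _ "\<lambda>i x n m. 0" "\<lambda>i x n m. 0"])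
      (auto simp: dsum_def acyclic_module_module[OF acyclic_zero_module])
  then have "(zero_module :: ('o, 'a, 'b, 'k) dgmod) \<in> generated C \<A>"
    by (rule generated.sum[rotated]) simp
  then show ?thesis by (rule generated.iso[OF _ acyclic_derived_iso[OF acyclic_zero_module assms]])
qed

lemma perf_class_generated:
  assumes \<A>: "\<A> \<subseteq> (Perf C :: ('o, 'a, 'b, 'k) dgmod set)"
  shows "perf_class C (generated C \<A>)"
  unfolding perf_class_def
proof (intro conjI allI impI generated_subset_Perf[OF \<A>])
  fix M N assume M: "M \<in> generated C \<A>" and N: "N \<in> generated C \<A>"
  have mod: "dg_module C M" "dg_module C N"
    using generated_subset_Perf[OF \<A>] M N by (auto intro: Perf_module)
  have "is_direct_sum C {..<2::nat} (\<lambda>k. if k = 0 then N else shift 1 M) (cone_module M N (\<lambda>x n m. 0))"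
    by (rule dsum_imp_is_direct_sum[OF zero_cone_dsum[OF mor_const0[OF mod], where j = 1]]) auto
  then show "cone_module M N (\<lambda>x n m. 0) \<in> generated C \<A>"
    by (rule generated.sum[rotated]) (auto intro: N generated.shift[OF M])
qed (auto intro: acyclic_in_generated generated.iso generated.shift)

lemma perf_class_acyclic: "perf_class C {M :: ('o, 'a, 'b, 'k) dgmod. acyclic_module C M}"
  unfolding perf_class_def
proof (intro conjI allI impI subsetI; clarify?)
  fix M N :: "('o, 'a, 'b, 'k) dgmod" assume "acyclic_module C M" "acyclic_module C N"
  then show "acyclic_module C (cone_module M N (\<lambda>x n m. 0))"
    by (subst acyclic_cone_iff) (auto intro: mor_const0 acyclic_quasi_iso acyclic_module_module)
qed (auto intro: Perf.zero acyclic_shift derived_iso_acyclic)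

lemma star_subset_Perf:
  assumes "\<A> \<subseteq> Perf C" "\<B> \<subseteq> (Perf C :: ('o, 'a, 'b, 'k) dgmod set)"
  shows "star C \<A> \<B> \<subseteq> Perf C"
  using assms unfolding star_def by (auto intro: Perf.cone)

lemma perf_class_generated_in:
  assumes \<A>: "\<A> \<subseteq> (Perf C :: ('o, 'a, 'b, 'k) dgmod set)"
  shows "perf_class C (generated_in C \<A> k)"
proof (induction k)
  case 0
  show ?case using perf_class_acyclic by simp
next
  case (Suc k)
  have "generated_in C \<A> k \<subseteq> Perf C" using perf_classD(1)[OF Suc] by blast
  from star_subset_Perf[OF this generated_subset_Perf[OF \<A>]] show ?case
    using perf_class_generated by simp
qed

lemma cone_module_in_generated_in:
  assumes "dg_morphism C E (G :: ('o, 'a, 'b, 'k) dgmod) a" "E \<in> generated_in C \<A> k" "G \<in> generated C \<A>"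
  shows "cone_module E G a \<in> generated_in C \<A> (Suc k)"
  using derived_cone_cone_module[OF assms(1)] dg_module_cone[OF assms(1)] assms(2,3)
  by (auto simp: star_def intro!: generated.base)

end


section \<open>Bimodules\<close>

lemma lookup_tens: "Poly_Mapping.lookup (tens i j f g) (i', j', a, b) =
  (if i' = i \<and> j' = j then Poly_Mapping.lookup f a * Poly_Mapping.lookup g b else 0)"
proof -
  have "Poly_Mapping.lookup (tens i j f g) (i', j', a, b) = (\<Sum>a'\<in>Poly_Mapping.keys f. \<Sum>b'\<in>Poly_Mapping.keys g.
     if a' = a then if b' = b then if i' = i \<and> j' = j then Poly_Mapping.lookup f a' * Poly_Mapping.lookup g b' else 0 else 0 else 0)"
    unfolding tens_def lookup_sum by (intro sum.cong) (auto simp: lookup_single when_def)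
  also have "\<dots> = (\<Sum>a'\<in>Poly_Mapping.keys f. if a' = a then (\<Sum>b'\<in>Poly_Mapping.keys g.
     if b' = b then if i' = i \<and> j' = j then Poly_Mapping.lookup f a' * Poly_Mapping.lookup g b' else 0 else 0) else 0)"
    by (rule sum.cong) auto
  also have "\<dots> = (if i' = i \<and> j' = j then Poly_Mapping.lookup f a * Poly_Mapping.lookup g b else 0)"
    by (auto simp: in_keys_iff)
  finally show ?thesis .
qed

lemma tens_eqI:
  assumes "\<And>i j a b. Poly_Mapping.lookup s (i, j, a, b) = Poly_Mapping.lookup t (i, j, a, b)"
  shows "s = t"
  by (rule poly_mapping_eqI) (metis assms prod_cases4)

lemma tens_linear_left: "linear_map_on UNIV (\<lambda>f. tens i j f g)"
  by (intro linear_map_onI tens_eqI) (simp_all add: lookup_tens lookup_add distrib_right)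

lemma tens_linear_right: "linear_map_on UNIV (\<lambda>g. tens i j f g)"
  by (intro linear_map_onI tens_eqI) (simp_all add: lookup_tens lookup_add distrib_left)

lemma tens_0 [simp]: "tens i j 0 g = 0" "tens i j f 0 = 0"
  by (simp_all add: tens_def)

lemma tens_sgn: "tens i j (sgn_pow n f) g = sgn_pow n (tens i j f g)"
  using lin_sgn_pow[OF tens_linear_left] by blast

section \<open>Linear extension of bilinear maps to tensors\<close>

lemma lin_combination:
  assumes "linear_map_on V f" "kvec.subspace V" "\<And>i. v i \<in> V"
  shows "f (\<Sum>i\<in>A. kscale (c i) (v i)) = (\<Sum>i\<in>A. kscale (c i) (f (v i)))"
  using lin_sum[OF assms(1,2), of A "\<lambda>i. kscale (c i) (v i)"] lin_scale[OF assms(1,3)]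
    kvec.subspace_scale[OF assms(2,3)] by simp

lemma ex_projection:
  assumes "kvec.subspace (V :: ('b, 'k::field) vec set)"
  shows "\<exists>p. (\<forall>v. p v \<in> V) \<and> linear_map_on UNIV p \<and> (\<forall>v\<in>V. p v = v)"
proof -
  interpret vector_space_pair kscale kscale by (simp add: vector_space_pair_def kvec.vector_space_axioms)
  have "Vector_Spaces.linear kscale kscale (\<lambda>v :: ('b, 'k) vec. v)" by (rule kvec.linear_ident)
  from linear_exists_left_inverse_on[OF this assms] obtain p where
    p: "p ` UNIV \<subseteq> V" "Vector_Spaces.linear kscale kscale p" "\<forall>v\<in>V. p v = v" by auto
  then show ?thesis
    by (intro exI[of _ p] conjI linear_map_onI) (auto simp: linear_add linear_scale)
qed

lemma poly_mapping_expansion: "(\<Sum>a\<in>Poly_Mapping.keys f. kscale (Poly_Mapping.lookup f a) (Poly_Mapping.single a 1)) = f"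
proof (rule poly_mapping_eqI)
  fix b
  have "Poly_Mapping.lookup (\<Sum>a\<in>Poly_Mapping.keys f. kscale (Poly_Mapping.lookup f a) (Poly_Mapping.single a 1)) b =
     (\<Sum>a\<in>Poly_Mapping.keys f. if a = b then Poly_Mapping.lookup f a else 0)"
    unfolding lookup_sum by (rule sum.cong) (auto simp: lookup_single when_def)
  also have "\<dots> = Poly_Mapping.lookup f b" by (auto simp: in_keys_iff)
  finally show "Poly_Mapping.lookup (\<Sum>a\<in>Poly_Mapping.keys f. kscale (Poly_Mapping.lookup f a) (Poly_Mapping.single a 1)) b =
     Poly_Mapping.lookup f b" .
qed

text \<open>
  Linear projections onto the subspaces extend the bilinear maps to the whole spaces, where the
  linear extension is given by values on the basis.
\<close>

lemma tens_lift_tens: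
  fixes \<phi> :: "int \<Rightarrow> int \<Rightarrow> ('a \<Rightarrow>\<^sub>0 'k::field) \<Rightarrow> ('b, 'k) vec \<Rightarrow> ('c \<Rightarrow>\<^sub>0 'k)"
  assumes U: "\<And>i. kvec.subspace (U i)" and V: "\<And>j. kvec.subspace (V j)"
    and bil: "\<And>i j. bilinear_map_on (U i) (V j) (\<phi> i j)" and f: "f \<in> U i" and g: "g \<in> V j"
  shows "tens_lift U V \<phi> (tens i j f g) = \<phi> i j f g"
proof -
  have "\<forall>i. \<exists>p. (\<forall>v. p v \<in> U i) \<and> linear_map_on UNIV p \<and> (\<forall>v\<in>U i. p v = v)" using ex_projection[OF U] by blast
  from choice[OF this] obtain p where p: "\<And>i v. p i v \<in> U i" "\<And>i. linear_map_on UNIV (p i)" "\<And>i v. v \<in> U i \<Longrightarrow> p i v = v" by blast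
  have "\<forall>i. \<exists>p. (\<forall>v. p v \<in> V i) \<and> linear_map_on UNIV p \<and> (\<forall>v\<in>V i. p v = v)" using ex_projection[OF V] by blast
  from choice[OF this] obtain q where q: "\<And>i v. q i v \<in> V i" "\<And>i. linear_map_on UNIV (q i)" "\<And>i v. v \<in> V i \<Longrightarrow> q i v = v" by blast
  have lr: "linear_map_on (V j) (\<phi> i j u)" if "u \<in> U i" for i j u
    using bil[of i j] that by (simp add: bilinear_map_on_def)
  have ll: "linear_map_on (U i) (\<lambda>u. \<phi> i j u v)" if "v \<in> V j" for i j v
    using bil[of i j] that by (simp add: bilinear_map_on_def)
  define b where "b k = (case k of (i, j, a, c) \<Rightarrow> \<phi> i j (p i (Poly_Mapping.single a 1)) (q j (Poly_Mapping.single c 1)))" for k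
  define L where "L t = (\<Sum>k\<in>Poly_Mapping.keys t. kscale (Poly_Mapping.lookup t k) (b k))" for t
  have L_eq: "L t = (\<Sum>k\<in>S. kscale (Poly_Mapping.lookup t k) (b k))" if "finite S" "Poly_Mapping.keys t \<subseteq> S" for t S
    unfolding L_def by (rule sum.mono_neutral_left) (use that in \<open>auto simp: in_keys_iff\<close>)
  have L_add: "L (s + t) = L s + L t" for s t
  proof -
    let ?S = "Poly_Mapping.keys s \<union> Poly_Mapping.keys t"
    have "L (s + t) = (\<Sum>k\<in>?S. kscale (Poly_Mapping.lookup (s + t) k) (b k))" "L s = (\<Sum>k\<in>?S. kscale (Poly_Mapping.lookup s k) (b k))"
      "L t = (\<Sum>k\<in>?S. kscale (Poly_Mapping.lookup t k) (b k))"
      by (rule L_eq; use keys_add[of s t] in auto)+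
    then show ?thesis by (simp add: lookup_add kvec.scale_left_distrib sum.distrib)
  qed
  have L0: "L 0 = 0" by (simp add: L_def)
  have L_tens: "L (tens i j f g) = \<phi> i j f g" if "f \<in> U i" "g \<in> V j" for i j f g
  proof -
    let ?S = "(\<lambda>(a, c). (i, j, a, c)) ` (Poly_Mapping.keys f \<times> Poly_Mapping.keys g)"
    have "Poly_Mapping.keys (tens i j f g) \<subseteq> ?S"
    proof
      fix k assume k: "k \<in> Poly_Mapping.keys (tens i j f g)"
      obtain i' j' a c where "k = (i', j', a, c)" by (cases k) auto
      with k show "k \<in> ?S" by (auto simp: in_keys_iff lookup_tens split: if_splits)
    qed
    then have "L (tens i j f g) = (\<Sum>k\<in>?S. kscale (Poly_Mapping.lookup (tens i j f g) k) (b k))"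
      by (intro L_eq) auto
    also have "\<dots> = (\<Sum>(a, c)\<in>Poly_Mapping.keys f \<times> Poly_Mapping.keys g. kscale (Poly_Mapping.lookup (tens i j f g) (i, j, a, c)) (b (i, j, a, c)))"
      by (subst sum.reindex) (auto simp: inj_on_def case_prod_unfold)
    also have "\<dots> = (\<Sum>a\<in>Poly_Mapping.keys f. \<Sum>c\<in>Poly_Mapping.keys g. kscale (Poly_Mapping.lookup f a)
        (kscale (Poly_Mapping.lookup g c) (\<phi> i j (p i (Poly_Mapping.single a 1)) (q j (Poly_Mapping.single c 1)))))"
      by (simp add: sum.cartesian_product lookup_tens b_def)
    also have "\<dots> = (\<Sum>a\<in>Poly_Mapping.keys f. kscale (Poly_Mapping.lookup f a) (\<phi> i j (p i (Poly_Mapping.single a 1)) g))"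
    proof (rule sum.cong[OF refl])
      fix a
      have "g = (\<Sum>c\<in>Poly_Mapping.keys g. kscale (Poly_Mapping.lookup g c) (q j (Poly_Mapping.single c 1)))"
      proof -
        have "q j (\<Sum>c\<in>Poly_Mapping.keys g. kscale (Poly_Mapping.lookup g c) (Poly_Mapping.single c 1)) =
          (\<Sum>c\<in>Poly_Mapping.keys g. kscale (Poly_Mapping.lookup g c) (q j (Poly_Mapping.single c 1)))"
          by (simp add: lin_sum[OF q(2)] lin_scale[OF q(2)])
        then show ?thesis unfolding poly_mapping_expansion using q(3)[OF that(2)] by simp
      qed
      then have "\<phi> i j (p i (Poly_Mapping.single a 1)) g = \<phi> i j (p i (Poly_Mapping.single a 1))
          (\<Sum>c\<in>Poly_Mapping.keys g. kscale (Poly_Mapping.lookup g c) (q j (Poly_Mapping.single c 1)))" by simp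
      also have "\<dots> = (\<Sum>c\<in>Poly_Mapping.keys g. kscale (Poly_Mapping.lookup g c) (\<phi> i j (p i (Poly_Mapping.single a 1)) (q j (Poly_Mapping.single c 1))))"
        by (rule lin_combination[OF lr[OF p(1)] V q(1)])
      finally show "(\<Sum>c\<in>Poly_Mapping.keys g. kscale (Poly_Mapping.lookup f a)
        (kscale (Poly_Mapping.lookup g c) (\<phi> i j (p i (Poly_Mapping.single a 1)) (q j (Poly_Mapping.single c 1))))) =
        kscale (Poly_Mapping.lookup f a) (\<phi> i j (p i (Poly_Mapping.single a 1)) g)"
        by (simp add: kvec.scale_sum_right)
    qed
    also have "\<dots> = \<phi> i j f g"
    proof -
      have "f = (\<Sum>a\<in>Poly_Mapping.keys f. kscale (Poly_Mapping.lookup f a) (p i (Poly_Mapping.single a 1)))"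
      proof -
        have "p i (\<Sum>a\<in>Poly_Mapping.keys f. kscale (Poly_Mapping.lookup f a) (Poly_Mapping.single a 1)) =
          (\<Sum>a\<in>Poly_Mapping.keys f. kscale (Poly_Mapping.lookup f a) (p i (Poly_Mapping.single a 1)))"
          by (simp add: lin_sum[OF p(2)] lin_scale[OF p(2)])
        then show ?thesis unfolding poly_mapping_expansion using p(3)[OF that(1)] by simp
      qed
      then have "\<phi> i j f g = \<phi> i j (\<Sum>a\<in>Poly_Mapping.keys f. kscale (Poly_Mapping.lookup f a) (p i (Poly_Mapping.single a 1))) g" by simp
      also have "\<dots> = (\<Sum>a\<in>Poly_Mapping.keys f. kscale (Poly_Mapping.lookup f a) (\<phi> i j (p i (Poly_Mapping.single a 1)) g))"
        by (rule lin_combination[OF ll[OF that(2)] U p(1)])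
      finally show ?thesis by simp
    qed
    finally show ?thesis .
  qed
  \<comment> \<open>This is the well-definedness behind the description in \<open>tens_lift\<close>:
    every representation as a sum of pure tensors leads to the value of the single linear map
    \<open>L\<close>.\<close>
  have L_list: "L (\<Sum>(i, j, f, g)\<leftarrow>ts. tens i j f g) = (\<Sum>(i, j, f, g)\<leftarrow>ts. \<phi> i j f g)"
    if "\<forall>(i, j, f, g)\<in>set ts. f \<in> U i \<and> g \<in> V j" for ts
    using that by (induction ts) (auto simp: L0 L_add L_tens)
  show ?thesis
    unfolding tens_lift_def
  proof (rule the_equality)
    show "\<exists>ts. (\<forall>(i, j, f, g)\<in>set ts. f \<in> U i \<and> g \<in> V j) \<and> tens i j f g = (\<Sum>(i, j, f, g)\<leftarrow>ts. tens i j f g) \<and>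
       \<phi> i j f g = (\<Sum>(i, j, f, g)\<leftarrow>ts. \<phi> i j f g)"
      by (rule exI[of _ "[(i, j, f, g)]"]) (simp add: f g)
  next
    fix w assume "\<exists>ts. (\<forall>(i, j, f, g)\<in>set ts. f \<in> U i \<and> g \<in> V j) \<and> tens i j f g = (\<Sum>(i, j, f, g)\<leftarrow>ts. tens i j f g) \<and>
       w = (\<Sum>(i, j, f, g)\<leftarrow>ts. \<phi> i j f g)"
    then obtain ts where ts: "\<forall>(i, j, f, g)\<in>set ts. f \<in> U i \<and> g \<in> V j" "tens i j f g = (\<Sum>(i, j, f, g)\<leftarrow>ts. tens i j f g)"
       "w = (\<Sum>(i, j, f, g)\<leftarrow>ts. \<phi> i j f g)" by blast
    show "w = \<phi> i j f g"
      using L_list[OF ts(1)] L_tens[OF f g] ts(2,3) by simp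
  qed
qed

lemma bilinear_map_on_cong:
  assumes "bilinear_map_on U V f" "kvec.subspace U" "kvec.subspace V" "\<And>u v. u \<in> U \<Longrightarrow> v \<in> V \<Longrightarrow> g u v = f u v"
  shows "bilinear_map_on U V g"
  unfolding bilinear_map_on_def
proof (intro conjI ballI)
  fix u assume u: "u \<in> U"
  then have "linear_map_on V (f u)" using assms(1) by (simp add: bilinear_map_on_def)
  then show "linear_map_on V (g u)" by (rule lin_cong[OF _ assms(3) assms(4)[OF u]])
next
  fix v assume v: "v \<in> V"
  then have "linear_map_on U (\<lambda>u. f u v)" using assms(1) by (simp add: bilinear_map_on_def)
  then show "linear_map_on U (\<lambda>u. g u v)" by (rule lin_cong[OF _ assms(2) assms(4)[OF _ v]])
qed

lemma bilinear_map_on_tens: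
  assumes "linear_map_on U s" "linear_map_on V t"
  shows "bilinear_map_on U V (\<lambda>f g. tens i j (s f) (t g))"
  unfolding bilinear_map_on_def
  using lin_compose[OF assms(1) tens_linear_left] lin_compose[OF assms(2) tens_linear_right] by blast

lemma bilinear_map_on_plus:
  "bilinear_map_on U V f \<Longrightarrow> bilinear_map_on U V g \<Longrightarrow> bilinear_map_on U V (\<lambda>u v. f u v + g u v)"
  by (simp add: bilinear_map_on_def lin_plus)

lemma bilinear_map_on_sgn:
  "bilinear_map_on U V f \<Longrightarrow> bilinear_map_on U V (\<lambda>u v. sgn_pow n (f u v))"
  by (simp add: bilinear_map_on_def lin_sgn)

section \<open>The enveloping category on pure tensors\<close>

lemma opposite_simps [simp]:
  "Obj (opposite C) = Obj C" "Hom (opposite C) x y = Hom C y x" "Diff (opposite C) x y = Diff C y x"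
  "Comp (opposite C) x y z i j g f = sgn_pow (i * j) (Comp C z y x j i f g)" "Ident (opposite C) = Ident C"
  by (simp_all add: opposite_def)

lemma enveloping_Obj [simp]: "Obj (enveloping C) = Obj C \<times> Obj C"
  by (simp add: tensor_def)

lemma enveloping_Ident [simp]: "Ident (enveloping C) (y, x) = tens 0 0 (Ident C y) (Ident C x)"
  by (simp add: tensor_def)

context dg_category
begin

lemma comp_linear_left:
  "\<lbrakk>x \<in> Obj C; y \<in> Obj C; z \<in> Obj C; f \<in> Hom C x y j\<rbrakk> \<Longrightarrow> linear_map_on (Hom C y z i) (\<lambda>g. Comp C x y z i j g f)"
  using comp_bilinear[of x y z i j] by (simp add: bilinear_map_on_def)

lemma comp_linear_right:
  "\<lbrakk>x \<in> Obj C; y \<in> Obj C; z \<in> Obj C; g \<in> Hom C y z i\<rbrakk> \<Longrightarrow> linear_map_on (Hom C x y j) (\<lambda>f. Comp C x y z i j g f)"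
  using comp_bilinear[of x y z i j] by (simp add: bilinear_map_on_def)

lemma enveloping_tens_in:
  assumes "f \<in> Hom C y' y i" "g \<in> Hom C x x' j" "n = i + j"
  shows "tens i j f g \<in> Hom (enveloping C) (y, x) (y', x') n"
  unfolding tensor_def using assms by (auto intro!: kvec.span_base)

lemma enveloping_Diff:
  assumes o: "y \<in> Obj C" "y' \<in> Obj C" "x \<in> Obj C" "x' \<in> Obj C" and fg: "f \<in> Hom C y' y i" "g \<in> Hom C x x' j"
  shows "Diff (enveloping C) (y, x) (y', x') n (tens i j f g) =
    tens (i + 1) j (Diff C y' y i f) g + sgn_pow i (tens i (j + 1) f (Diff C x x' j g))"
proof -
  have "tens_lift (Hom (opposite C) y y') (Hom C x x') (\<lambda>i j f g.
         tens (i + 1) j (Diff (opposite C) y y' i f) g + sgn_pow i (tens i (j + 1) f (Diff C x x' j g))) (tens i j f g) =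
      tens (i + 1) j (Diff (opposite C) y y' i f) g + sgn_pow i (tens i (j + 1) f (Diff C x x' j g))"
    by (rule tens_lift_tens)
      (auto simp: o fg hom_subspace intro!: bilinear_map_on_plus bilinear_map_on_sgn bilinear_map_on_tens diff_linear lin_id)
  then show ?thesis by (simp add: tensor_def)
qed

text \<open>The summand \<open>j * i'\<close> of the exponent is the Koszul sign of the tensor
  product, \<open>i * i'\<close> that of the opposite category.\<close>

lemma enveloping_Comp:
  assumes o: "y \<in> Obj C" "y' \<in> Obj C" "y'' \<in> Obj C" "x \<in> Obj C" "x' \<in> Obj C" "x'' \<in> Obj C"
    and fg: "f \<in> Hom C y'' y' i" "g \<in> Hom C x' x'' j" and fg': "f' \<in> Hom C y' y i'" "g' \<in> Hom C x x' j'"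
  shows "Comp (enveloping C) (y, x) (y', x') (y'', x'') m n (tens i j f g) (tens i' j' f' g') =
    sgn_pow (j * i' + i * i') (tens (i + i') (j + j') (Comp C y'' y' y i' i f' f) (Comp C x x' x'' j j' g g'))"
proof -
  let ?c = "\<lambda>i j f g i' j' f' g'. sgn_pow (j * i') (tens (i + i') (j + j')
             (Comp (opposite C) y y' y'' i i' f f') (Comp C x x' x'' j j' g g'))"
  have inner: "tens_lift (Hom (opposite C) y y') (Hom C x x') (?c i j f g) (tens i' j' f' g') = ?c i j f g i' j' f' g'"
    if "f \<in> Hom C y'' y' i" "g \<in> Hom C x' x'' j" for i j f g
  proof (rule tens_lift_tens)
    fix i' j'
    show "bilinear_map_on (Hom (opposite C) y y' i') (Hom C x x' j') (?c i j f g i' j')"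
      using that o by (auto intro!: bilinear_map_on_sgn bilinear_map_on_tens lin_sgn comp_linear_left comp_linear_right)
  qed (use o fg' in \<open>auto simp: hom_subspace\<close>)
  have "tens_lift (Hom (opposite C) y' y'') (Hom C x' x'')
     (\<lambda>i j f g. tens_lift (Hom (opposite C) y y') (Hom C x x') (?c i j f g) (tens i' j' f' g')) (tens i j f g) =
     tens_lift (Hom (opposite C) y y') (Hom C x x') (?c i j f g) (tens i' j' f' g')"
  proof (rule tens_lift_tens)
    fix i j
    have "bilinear_map_on (Hom C y'' y' i) (Hom C x' x'' j) (\<lambda>f g. ?c i j f g i' j' f' g')"
      using o fg' by (auto intro!: bilinear_map_on_sgn bilinear_map_on_tens lin_sgn comp_linear_left comp_linear_right)
    then show "bilinear_map_on (Hom (opposite C) y' y'' i) (Hom C x' x'' j)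
       (\<lambda>f g. tens_lift (Hom (opposite C) y y') (Hom C x x') (?c i j f g) (tens i' j' f' g'))"
      unfolding opposite_simps(2)
      by (rule bilinear_map_on_cong) (use o inner in \<open>auto simp: hom_subspace\<close>)
  qed (use o fg in \<open>auto simp: hom_subspace\<close>)
  also have "\<dots> = ?c i j f g i' j' f' g'" by (rule inner[OF fg])
  finally show ?thesis by (simp add: tensor_def tens_sgn)
qed

end

section \<open>The left and the right action on a bimodule\<close>

locale bimodule = dg_category C + K: dg_module "enveloping C" K
  for C :: "('o, 'a, 'k::field) dgcat" and K :: "('o, 'a, 'b, 'k) bimod"
begin

lemma lact_in:
  assumes "x \<in> Obj C" "y \<in> Obj C" "z \<in> Obj C" "f \<in> Hom C y z p" "m \<in> Car K (y, x) j" "k = p + j"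
  shows "left_act C K z y x p j f m \<in> Car K (z, x) k"
  unfolding left_act_def
  using assms by (intro K.mem_sgn K.act_in[of "(z, x)" "(y, x)"] enveloping_tens_in) (auto simp: ident_closed)

lemma ract_in:
  assumes "x \<in> Obj C" "x' \<in> Obj C" "y \<in> Obj C" "g \<in> Hom C x' x q" "m \<in> Car K (y, x) j" "k = j + q"
  shows "right_act C K y x x' j q m g \<in> Car K (y, x') k"
  unfolding right_act_def
  using assms by (intro K.act_in[of "(y, x')" "(y, x)"] enveloping_tens_in) (auto simp: ident_closed)

lemma lact_linear:
  assumes "x \<in> Obj C" "y \<in> Obj C" "z \<in> Obj C" "f \<in> Hom C y z p"
  shows "linear_map_on (Car K (y, x) j) (left_act C K z y x p j f)"
  unfolding left_act_def[abs_def]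
  using assms by (intro lin_sgn K.act_linear_left enveloping_tens_in) (auto simp: ident_closed)

lemma lact_linear_left:
  assumes "x \<in> Obj C" "y \<in> Obj C" "z \<in> Obj C" "m \<in> Car K (y, x) j"
  shows "linear_map_on (Hom C y z p) (\<lambda>f. left_act C K z y x p j f m)"
  unfolding left_act_def
proof (rule lin_sgn, rule lin_compose[of _ "\<lambda>f. tens p 0 f (Ident C x)" "Hom (enveloping C) (z, x) (y, x) p"])
  show "linear_map_on (Hom C y z p) (\<lambda>f. tens p 0 f (Ident C x))"
    by (rule lin_subset[OF tens_linear_left]) simp
qed (use assms in \<open>auto intro!: K.act_linear_right enveloping_tens_in simp: ident_closed\<close>)

lemma ract_linear:
  assumes "x \<in> Obj C" "x' \<in> Obj C" "y \<in> Obj C" "g \<in> Hom C x' x q"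
  shows "linear_map_on (Car K (y, x) j) (\<lambda>m. right_act C K y x x' j q m g)"
  unfolding right_act_def
  using assms by (intro K.act_linear_left enveloping_tens_in) (auto simp: ident_closed)

lemma ract_linear_right:
  assumes "x \<in> Obj C" "x' \<in> Obj C" "y \<in> Obj C" "m \<in> Car K (y, x) j"
  shows "linear_map_on (Hom C x' x q) (right_act C K y x x' j q m)"
  unfolding right_act_def[abs_def]
proof (rule lin_compose[of _ "\<lambda>g. tens 0 q (Ident C y) g" "Hom (enveloping C) (y, x') (y, x) q"])
  show "linear_map_on (Hom C x' x q) (\<lambda>g. tens 0 q (Ident C y) g)"
    by (rule lin_subset[OF tens_linear_right]) simp
qed (use assms in \<open>auto intro!: K.act_linear_right enveloping_tens_in simp: ident_closed\<close>)

lemma lact_ident: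
  assumes "x \<in> Obj C" "y \<in> Obj C" "m \<in> Car K (y, x) j"
  shows "left_act C K y y x 0 j (Ident C y) m = m"
  using assms K.act_ident[of "(y, x)" m j] by (simp add: left_act_def)

lemma ract_ident:
  assumes "x \<in> Obj C" "y \<in> Obj C" "m \<in> Car K (y, x) j"
  shows "right_act C K y x x j 0 m (Ident C x) = m"
  using assms K.act_ident[of "(y, x)" m j] by (simp add: right_act_def)

text \<open>The sign built into \<open>left_act\<close> undoes the signs of the opposite category,
  so the left action is associative without signs.\<close>

lemma lact_lact:
  assumes o: "x \<in> Obj C" "y \<in> Obj C" "z \<in> Obj C" "w \<in> Obj C"
    and f: "f \<in> Hom C y z p" "f' \<in> Hom C z w q" and m: "m \<in> Car K (y, x) j"
  shows "left_act C K w z x q (p + j) f' (left_act C K z y x p j f m) =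
    left_act C K w y x (q + p) j (Comp C y z w q p f' f) m"
proof -
  have 1: "tens p 0 f (Ident C x) \<in> Hom (enveloping C) (z, x) (y, x) p"
     "tens q 0 f' (Ident C x) \<in> Hom (enveloping C) (w, x) (z, x) q"
    using o f by (auto intro!: enveloping_tens_in ident_closed)
  have 2: "Comp (enveloping C) (w, x) (z, x) (y, x) p q (tens p 0 f (Ident C x)) (tens q 0 f' (Ident C x)) =
      sgn_pow (p * q) (tens (p + q) 0 (Comp C y z w q p f' f) (Ident C x))"
    using o f by (subst enveloping_Comp) (auto simp: ident_closed comp_ident_left)
  have 3: "tens (p + q) 0 (Comp C y z w q p f' f) (Ident C x) \<in> Hom (enveloping C) (w, x) (y, x) (p + q)"
    using o f comp_closed[of y z w f' q f p] by (auto intro!: enveloping_tens_in ident_closed simp: add.commute)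
  have 4: "Act K (z, x) (y, x) j p m (tens p 0 f (Ident C x)) \<in> Car K (z, x) (j + p)"
    using o m 1 by (intro K.act_closed) auto
  have "Act K (w, x) (z, x) (j + p) q (Act K (z, x) (y, x) j p m (tens p 0 f (Ident C x))) (tens q 0 f' (Ident C x)) =
      sgn_pow (p * q) (Act K (w, x) (y, x) j (p + q) m (tens (p + q) 0 (Comp C y z w q p f' f) (Ident C x)))"
    using o m 1 3 by (subst K.act_act) (auto simp: 2 lin_sgn_pow[OF K.act_linear_right])
  moreover have "Act K (w, x) (z, x) (j + p) q (sgn_pow (p * j) (Act K (z, x) (y, x) j p m (tens p 0 f (Ident C x)))) (tens q 0 f' (Ident C x)) =
      sgn_pow (p * j) (Act K (w, x) (z, x) (j + p) q (Act K (z, x) (y, x) j p m (tens p 0 f (Ident C x))) (tens q 0 f' (Ident C x)))"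
    using o 4 1 by (intro K.act_sgn) auto
  ultimately show ?thesis
    unfolding left_act_def by (simp add: add.commute) (rule sgn_pow_cong, simp add: algebra_simps)
qed

lemma ract_ract:
  assumes o: "x \<in> Obj C" "x' \<in> Obj C" "x'' \<in> Obj C" "y \<in> Obj C"
    and g: "g \<in> Hom C x' x q" "g' \<in> Hom C x'' x' r" and m: "m \<in> Car K (y, x) j"
  shows "right_act C K y x' x'' (j + q) r (right_act C K y x x' j q m g) g' =
    right_act C K y x x'' j (q + r) m (Comp C x'' x' x q r g g')"
proof -
  have 1: "tens 0 q (Ident C y) g \<in> Hom (enveloping C) (y, x') (y, x) q"
     "tens 0 r (Ident C y) g' \<in> Hom (enveloping C) (y, x'') (y, x') r"
    using o g by (auto intro!: enveloping_tens_in ident_closed)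
  have 2: "Comp (enveloping C) (y, x'') (y, x') (y, x) q r (tens 0 q (Ident C y) g) (tens 0 r (Ident C y) g') =
      tens 0 (q + r) (Ident C y) (Comp C x'' x' x q r g g')"
    using o g by (subst enveloping_Comp) (auto simp: ident_closed comp_ident_left)
  show ?thesis
    unfolding right_act_def using o m 1 by (subst K.act_act) (auto simp: 2)
qed

text \<open>Up to one common sign both sides are the action of the pure tensor of \<open>f\<close>
  and \<open>g\<close>, which can be composed in either order in the enveloping category.\<close>

lemma lact_ract:
  assumes o: "x \<in> Obj C" "x' \<in> Obj C" "y \<in> Obj C" "z \<in> Obj C"
    and f: "f \<in> Hom C y z p" and g: "g \<in> Hom C x' x q" and m: "m \<in> Car K (y, x) j"
  shows "right_act C K z x x' (p + j) q (left_act C K z y x p j f m) g =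
    left_act C K z y x' p (j + q) f (right_act C K y x x' j q m g)"
proof -
  have 1: "tens 0 q (Ident C y) g \<in> Hom (enveloping C) (y, x') (y, x) q"
     "tens 0 q (Ident C z) g \<in> Hom (enveloping C) (z, x') (z, x) q"
     "tens p 0 f (Ident C x) \<in> Hom (enveloping C) (z, x) (y, x) p"
     "tens p 0 f (Ident C x') \<in> Hom (enveloping C) (z, x') (y, x') p"
    using o g f by (auto intro!: enveloping_tens_in ident_closed)
  have 2: "Comp (enveloping C) (z, x') (z, x) (y, x) p q (tens p 0 f (Ident C x)) (tens 0 q (Ident C z) g) = tens p q f g"
    using o f g by (subst enveloping_Comp) (auto simp: ident_closed comp_ident_left)
  have 3: "Comp (enveloping C) (z, x') (y, x') (y, x) q p (tens 0 q (Ident C y) g) (tens p 0 f (Ident C x')) = sgn_pow (q * p) (tens p q f g)"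
    using o f g by (subst enveloping_Comp) (auto simp: ident_closed comp_ident_right)
  have 5: "tens p q f g \<in> Hom (enveloping C) (z, x') (y, x) (q + p)"
    using o f g by (auto intro!: enveloping_tens_in)
  have "Act K (z, x) (y, x) j p m (tens p 0 f (Ident C x)) \<in> Car K (z, x) (j + p)"
    using o m 1 by (intro K.act_closed) auto
  then have "right_act C K z x x' (p + j) q (left_act C K z y x p j f m) g = sgn_pow (p * j) (Act K (z, x') (y, x) j (p + q) m (tens p q f g))"
    unfolding left_act_def right_act_def using o m 1 K.act_act[of "(z, x')" "(z, x)" "(y, x)" m j "tens p 0 f (Ident C x)" p "tens 0 q (Ident C z) g" q]
    by (simp add: K.act_sgn 2 add.commute)
  moreover have "Act K (z, x') (y, x') (j + q) p (Act K (y, x') (y, x) j q m (tens 0 q (Ident C y) g)) (tens p 0 f (Ident C x')) =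
     sgn_pow (q * p) (Act K (z, x') (y, x) j (q + p) m (tens p q f g))"
    using o m 1 5 by (subst K.act_act) (auto simp: 3 lin_sgn_pow[OF K.act_linear_right])
  ultimately show ?thesis
    unfolding left_act_def right_act_def by (simp add: add.commute) (rule sgn_pow_cong, simp add: algebra_simps)
qed

lemma d_lact:
  assumes o: "x \<in> Obj C" "y \<in> Obj C" "z \<in> Obj C" and f: "f \<in> Hom C y z p" and m: "m \<in> Car K (y, x) j"
  shows "MDiff K (z, x) (p + j) (left_act C K z y x p j f m) =
    left_act C K z y x (p + 1) j (Diff C y z p f) m + sgn_pow p (left_act C K z y x p (j + 1) f (MDiff K (y, x) j m))"
proof -
  have 1: "tens p 0 f (Ident C x) \<in> Hom (enveloping C) (z, x) (y, x) p"
    using o f by (auto intro!: enveloping_tens_in ident_closed)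
  have 2: "Diff (enveloping C) (z, x) (y, x) p (tens p 0 f (Ident C x)) = tens (p + 1) 0 (Diff C y z p f) (Ident C x)"
    using o f by (subst enveloping_Diff) (auto simp: ident_closed diff_ident)
  have 4: "Act K (z, x) (y, x) j p m (tens p 0 f (Ident C x)) \<in> Car K (z, x) (j + p)"
    using o m 1 by (intro K.act_closed) auto
  have "MDiff K (z, x) (p + j) (left_act C K z y x p j f m) = sgn_pow (p * j) (MDiff K (z, x) (j + p) (Act K (z, x) (y, x) j p m (tens p 0 f (Ident C x))))"
    unfolding left_act_def using 4 o by (simp add: K.d_sgn add.commute)
  also have "\<dots> = sgn_pow (p * j) (Act K (z, x) (y, x) (j + 1) p (MDiff K (y, x) j m) (tens p 0 f (Ident C x)) +
     sgn_pow j (Act K (z, x) (y, x) j (p + 1) m (tens (p + 1) 0 (Diff C y z p f) (Ident C x))))"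
    using o m 1 by (subst K.mdiff_act) (auto simp: 2)
  also have "\<dots> = left_act C K z y x (p + 1) j (Diff C y z p f) m + sgn_pow p (left_act C K z y x p (j + 1) f (MDiff K (y, x) j m))"
  proof -
    have "sgn_pow p (sgn_pow (p * (j + 1)) v) = sgn_pow (p * j) v" "sgn_pow (p * j) (sgn_pow j v) = sgn_pow ((p + 1) * j) v" for v :: "('b, 'k) vec"
      by (auto simp: sgn_pow_def)
    then show ?thesis unfolding left_act_def sgn_pow_add by (simp del: sgn_pow_sgn_pow)
  qed
  finally show ?thesis .
qed

lemma d_ract:
  assumes o: "x \<in> Obj C" "x' \<in> Obj C" "y \<in> Obj C" and g: "g \<in> Hom C x' x q" and m: "m \<in> Car K (y, x) j"
  shows "MDiff K (y, x') (j + q) (right_act C K y x x' j q m g) =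
    right_act C K y x x' (j + 1) q (MDiff K (y, x) j m) g + sgn_pow j (right_act C K y x x' j (q + 1) m (Diff C x' x q g))"
proof -
  have 1: "tens 0 q (Ident C y) g \<in> Hom (enveloping C) (y, x') (y, x) q"
    using o g by (auto intro!: enveloping_tens_in ident_closed)
  have 2: "Diff (enveloping C) (y, x') (y, x) q (tens 0 q (Ident C y) g) = tens 0 (q + 1) (Ident C y) (Diff C x' x q g)"
    using o g by (subst enveloping_Diff) (auto simp: ident_closed diff_ident)
  show ?thesis
    unfolding right_act_def using o m 1 by (subst K.mdiff_act) (auto simp: 2)
qed

end


section \<open>Twisted sums of bimodules\<close>

text \<open>The direct sum of the spaces \<open>A j\<close> over \<open>J\<close>, coded in single
  vectors.\<close>

definition family :: "'j set \<Rightarrow> ('j \<Rightarrow> ('b, 'k::field) vec set) \<Rightarrow> ('b, 'k) vec set" where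
  "family J A = {t. (\<forall>j\<in>J. prj j t \<in> A j) \<and> (\<forall>j. j \<notin> J \<longrightarrow> prj j t = 0)}"

text \<open>The map out of a coded direct sum with the components \<open>\<phi> j\<close>. Summation
  over the support keeps the sum finite, and does so without reference to the index set
  \<open>J\<close>.\<close>

definition extend :: "('j \<Rightarrow> ('b, 'k::field) vec \<Rightarrow> 'v::comm_monoid_add) \<Rightarrow> ('b, 'k) vec \<Rightarrow> 'v" where
  "extend \<phi> t = (\<Sum>j | prj j t \<noteq> 0. \<phi> j (prj j t))"

context coded
begin

context
  fixes J :: "'j set" and A :: "'j \<Rightarrow> ('b, 'k::field) vec set"
  assumes A: "\<And>j. j \<in> J \<Longrightarrow> kvec.subspace (A j)"
begin

lemma family_subspace: "kvec.subspace (family J A)"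
  unfolding kvec.subspace_def family_def
  using A by (auto simp: kvec.subspace_add kvec.subspace_scale kvec.subspace_0)

lemma push_in_family: "j \<in> J \<Longrightarrow> v \<in> A j \<Longrightarrow> push j v \<in> family J A"
  using A by (auto simp: family_def prj_push kvec.subspace_0)

lemma family_induct [consumes 1, case_names zero push add]:
  assumes "t \<in> family J A" and "P 0" and "\<And>j v. j \<in> J \<Longrightarrow> v \<in> A j \<Longrightarrow> P (push j v)"
    and "\<And>s t. s \<in> family J A \<Longrightarrow> t \<in> family J A \<Longrightarrow> P s \<Longrightarrow> P t \<Longrightarrow> P (s + t)"
  shows "P t"
proof -
  have "P (\<Sum>j\<in>S. push j (prj j t)) \<and> (\<Sum>j\<in>S. push j (prj j t)) \<in> family J A" if "S \<subseteq> J" for S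
    using that
  proof (induction S rule: infinite_finite_induct)
    case (insert j S)
    then show ?case
      using assms push_in_family kvec.subspace_add[OF family_subspace] by (auto simp: family_def[of J A])
  qed (use assms(2) kvec.subspace_0[OF family_subspace] in auto)
  moreover have "{j. prj j t \<noteq> 0} \<subseteq> J" using assms(1) by (auto simp: family_def)
  ultimately show ?thesis using sum_push_prj[of t] by metis
qed

lemma extend_eq:
  fixes \<phi> :: "'j \<Rightarrow> ('b, 'k) vec \<Rightarrow> ('c \<Rightarrow>\<^sub>0 'k)"
  assumes \<phi>: "\<And>j. j \<in> J \<Longrightarrow> linear_map_on (A j) (\<phi> j)" and S: "finite S" "{j. prj j t \<noteq> 0} \<subseteq> S" "S \<subseteq> J"
  shows "extend \<phi> t = (\<Sum>j\<in>S. \<phi> j (prj j t))"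
  unfolding extend_def
  by (rule sum.mono_neutral_left) (use S lin_zero[OF \<phi> A] in auto)

lemma extend_push:
  fixes \<phi> :: "'j \<Rightarrow> ('b, 'k) vec \<Rightarrow> ('c \<Rightarrow>\<^sub>0 'k)"
  assumes \<phi>: "\<And>j. j \<in> J \<Longrightarrow> linear_map_on (A j) (\<phi> j)" and "j \<in> J"
  shows "extend \<phi> (push j v) = \<phi> j v"
  by (subst extend_eq[OF \<phi>, of "{j}"]) (use assms in \<open>auto simp: prj_push\<close>)

lemma extend_linear:
  fixes \<phi> :: "'j \<Rightarrow> ('b, 'k) vec \<Rightarrow> ('c \<Rightarrow>\<^sub>0 'k)"
  assumes \<phi>: "\<And>j. j \<in> J \<Longrightarrow> linear_map_on (A j) (\<phi> j)"
  shows "linear_map_on (family J A) (extend \<phi>)"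
proof (rule linear_map_onI)
  fix s t assume st: "s \<in> family J A" "t \<in> family J A"
  let ?S = "{j :: 'j. prj j s \<noteq> 0} \<union> {j. prj j t \<noteq> 0}"
  have S: "finite ?S" "?S \<subseteq> J" using st by (auto simp: family_def)
  have "extend \<phi> (s + t) = (\<Sum>j\<in>?S. \<phi> j (prj j (s + t)))"
    by (rule extend_eq[OF \<phi>]) (use S in auto)
  also have "\<dots> = (\<Sum>j\<in>?S. \<phi> j (prj j s) + \<phi> j (prj j t))"
    by (rule sum.cong) (use S(2) st in \<open>auto intro!: lin_add[OF \<phi>] simp: family_def\<close>)
  also have "\<dots> = extend \<phi> s + extend \<phi> t"
    using S by (simp add: sum.distrib extend_eq[OF \<phi> S(1) _ S(2)])
  finally show "extend \<phi> (s + t) = extend \<phi> s + extend \<phi> t" .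
next
  fix c t assume t: "t \<in> family J A"
  let ?S = "{j :: 'j. prj j t \<noteq> 0}"
  have S: "finite ?S" "?S \<subseteq> J" using t by (auto simp: family_def)
  have "extend \<phi> (kscale c t) = (\<Sum>j\<in>?S. \<phi> j (prj j (kscale c t)))"
    by (rule extend_eq[OF \<phi>]) (use S in auto)
  also have "\<dots> = (\<Sum>j\<in>?S. kscale c (\<phi> j (prj j t)))"
    by (rule sum.cong) (use S(2) t in \<open>auto intro!: lin_scale[OF \<phi>] simp: family_def\<close>)
  also have "\<dots> = kscale c (extend \<phi> t)"
    using S by (simp add: kvec.scale_sum_right extend_eq[OF \<phi> S(1) _ S(2)])
  finally show "extend \<phi> (kscale c t) = kscale c (extend \<phi> t)" .
qed

lemma prj_extend_push:
  assumes \<phi>: "\<And>j. j \<in> J \<Longrightarrow> linear_map_on (A j) (\<phi> j)" and t: "t \<in> family J A"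
  shows "prj j (extend (\<lambda>j m. push j (\<phi> j m :: ('b, 'k) vec)) t) = (if j \<in> J then \<phi> j (prj j t) else 0)"
proof -
  have "j \<in> J" if "prj j t \<noteq> 0" for j using that t by (auto simp: family_def)
  then show ?thesis
    using lin_zero[OF \<phi> A] by (auto simp: extend_def prj_sum prj_push)
qed

end

lemma push_linear: "linear_map_on V (push (j :: 'j) :: ('b, 'k::field) vec \<Rightarrow> _)"
  by (rule linear_map_onI) (simp_all add: push_add push_scale)

end

text \<open>
  For a semi-free module \<open>Q\<close> with generators \<open>j \<in> J\<close> of degree \<open>dg j\<close> at \<open>ob j\<close>, whose boundaries have the coefficients
  \<open>\<delta> j i\<close>, \<open>tw C J ob dg \<delta> K\<close> is \<open>Q \<otimes> K\<close>; the tensor of the generator \<open>j\<close> and \<open>m\<close> is \<open>push j m\<close>.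
\<close>

definition tw_pure where
  "tw_pure C ob dg \<delta> K x n j m = push j (sgn_pow (dg j) (MDiff K (ob j, x) (n - dg j) m)) +
     (\<Sum>i | \<delta> j i \<noteq> 0. push i (left_act C K (ob i) (ob j) x (dg j + 1 - dg i) (n - dg j) (\<delta> j i) m))"

definition tw ::
  "('o, 'a, 'k::field) dgcat \<Rightarrow> 'j set \<Rightarrow> ('j \<Rightarrow> 'o) \<Rightarrow> ('j \<Rightarrow> int) \<Rightarrow> ('j \<Rightarrow> 'j \<Rightarrow> ('a \<Rightarrow>\<^sub>0 'k)) \<Rightarrow>
   ('o, 'a, 'b, 'k) bimod \<Rightarrow> ('o, 'a, 'b, 'k) dgmod" where
  "tw C J ob dg \<delta> K = \<lparr>
     Car = (\<lambda>x n. family J (\<lambda>j. Car K (ob j, x) (n - dg j))),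
     MDiff = (\<lambda>x n. extend (tw_pure C ob dg \<delta> K x n)),
     Act = (\<lambda>x y i q t g. extend (\<lambda>j m. push j (right_act C K (ob j) y x (i - dg j) q m g)) t)\<rparr>"

lemma tw_simps:
  "Car (tw C J ob dg \<delta> K) x n = family J (\<lambda>j. Car K (ob j, x) (n - dg j))"
  "MDiff (tw C J ob dg \<delta> K) x n = extend (tw_pure C ob dg \<delta> K x n)"
  "Act (tw C J ob dg \<delta> K) x y i q t g = extend (\<lambda>j m. push j (right_act C K (ob j) y x (i - dg j) q m g)) t"
  by (simp_all add: tw_def)

text \<open>The Maurer-Cartan equation is kept out of this locale: for the resolution constructed
  below it is derived from the component formula \<open>tw_prj_d\<close>, which has to be available
  before.\<close>

locale pretwisted = coded index basis + dg_category C
  for index :: "'j itself" and basis :: "'b itself" and C :: "('o, 'a, 'k::field) dgcat" +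
  fixes J :: "'j set" and ob :: "'j \<Rightarrow> 'o" and dg :: "'j \<Rightarrow> int" and \<delta> :: "'j \<Rightarrow> 'j \<Rightarrow> ('a \<Rightarrow>\<^sub>0 'k)"
  assumes ob_in: "j \<in> J \<Longrightarrow> ob j \<in> Obj C"
    and \<delta>_in: "i \<in> J \<Longrightarrow> j \<in> J \<Longrightarrow> \<delta> i j \<in> Hom C (ob i) (ob j) (dg i + 1 - dg j)"
    and \<delta>_finite: "i \<in> J \<Longrightarrow> finite {j. \<delta> i j \<noteq> 0}"
    and \<delta>_notin: "i \<in> J \<Longrightarrow> j \<notin> J \<Longrightarrow> \<delta> i j = 0"
begin

abbreviation "T \<equiv> tw C J ob dg \<delta>"

abbreviation "conn K x n i k \<equiv> left_act C K (ob k) (ob i) x (dg i + 1 - dg k) (n - dg i) (\<delta> i k)"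

lemma tw_mem: "t \<in> Car (T K) x n \<Longrightarrow> j \<in> J \<Longrightarrow> prj j t \<in> Car K (ob j, x) (n - dg j)"
  by (simp add: tw_simps(1) family_def)

lemma tw_supp: "t \<in> Car (T K) x n \<Longrightarrow> {j. prj j t \<noteq> 0} \<subseteq> J"
  by (auto simp: tw_simps(1) family_def)

lemma tw_eqI:
  assumes "s \<in> Car (T K) x n" "(t :: ('b, 'k) vec) \<in> Car (T L) y m" "\<And>j. j \<in> J \<Longrightarrow> prj j s = prj j t"
  shows "s = t"
proof (rule vec_eqI)
  fix j :: 'j
  show "prj j s = prj j t" using assms by (cases "j \<in> J") (auto simp: tw_simps(1) family_def)
qed

context
  fixes K :: "('o, 'a, 'b, 'k) bimod"
  assumes K: "dg_module (enveloping C) K"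
begin

interpretation K: bimodule C K
  using K by (simp add: bimodule_def dg_category_axioms)

abbreviation "A x n \<equiv> (\<lambda>j. Car K (ob j, x) (n - dg j))"

lemma tw_car_subspace: "x \<in> Obj C \<Longrightarrow> j \<in> J \<Longrightarrow> kvec.subspace (A x n j)"
  by (rule K.K.car_subspace) (simp add: ob_in)

lemma conn_linear: "\<lbrakk>x \<in> Obj C; i \<in> J; k \<in> J\<rbrakk> \<Longrightarrow> linear_map_on (A x n i) (conn K x n i k)"
  by (rule K.lact_linear) (auto simp: ob_in \<delta>_in)

lemma conn_in: "\<lbrakk>x \<in> Obj C; i \<in> J; k \<in> J; m \<in> A x n i; l = n + 1\<rbrakk> \<Longrightarrow> conn K x n i k m \<in> A x l k"
  by (rule K.lact_in) (auto simp: ob_in \<delta>_in)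

lemma conn_0: "\<lbrakk>x \<in> Obj C; i \<in> J; k \<in> J; m \<in> A x n i; \<delta> i k = 0\<rbrakk> \<Longrightarrow> conn K x n i k m = 0"
  using lin_zero[OF K.lact_linear_left hom_subspace] ob_in by simp

lemma conn_zero: "\<lbrakk>x \<in> Obj C; i \<in> J; k \<in> J\<rbrakk> \<Longrightarrow> conn K x n i k 0 = 0"
  by (rule lin_zero[OF conn_linear tw_car_subspace])

lemma tw_pure_linear:
  assumes "x \<in> Obj C" "j \<in> J"
  shows "linear_map_on (A x n j) (tw_pure C ob dg \<delta> K x n j)"
  unfolding tw_pure_def[abs_def] using assms \<delta>_notin
  by (intro lin_plus lin_sum_fun lin_compose[OF _ push_linear UNIV_I]
      lin_sgn K.K.mdiff_linear conn_linear) (auto simp: ob_in)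

lemma tw_pure_in:
  assumes "x \<in> Obj C" "j \<in> J" "m \<in> A x n j"
  shows "tw_pure C ob dg \<delta> K x n j m \<in> family J (A x (n + 1))"
  unfolding tw_pure_def using assms \<delta>_notin
  by (intro kvec.subspace_add kvec.subspace_sum family_subspace tw_car_subspace push_in_family conn_in K.K.mem_sgn K.K.d_in)
    (auto simp: ob_in)

lemma tw_d_push: "x \<in> Obj C \<Longrightarrow> j \<in> J \<Longrightarrow> MDiff (T K) x n (push j m) = tw_pure C ob dg \<delta> K x n j m"
  unfolding tw_simps by (rule extend_push[OF tw_car_subspace tw_pure_linear])

lemma tw_d_linear: "x \<in> Obj C \<Longrightarrow> linear_map_on (Car (T K) x n) (MDiff (T K) x n)"
  unfolding tw_simps by (rule extend_linear[OF tw_car_subspace tw_pure_linear])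

lemma tw_subspace: "x \<in> Obj C \<Longrightarrow> kvec.subspace (Car (T K) x n)"
  unfolding tw_simps by (rule family_subspace[OF tw_car_subspace])

lemma tw_push_in: "x \<in> Obj C \<Longrightarrow> j \<in> J \<Longrightarrow> m \<in> A x n j \<Longrightarrow> push j m \<in> Car (T K) x n"
  unfolding tw_simps by (rule push_in_family[OF tw_car_subspace])

lemma tw_induct [consumes 2, case_names zero push add]:
  assumes "x \<in> Obj C" "t \<in> Car (T K) x n" and "P 0" and "\<And>j v. j \<in> J \<Longrightarrow> v \<in> A x n j \<Longrightarrow> P (push j v)"
    and "\<And>s t. s \<in> Car (T K) x n \<Longrightarrow> t \<in> Car (T K) x n \<Longrightarrow> P s \<Longrightarrow> P t \<Longrightarrow> P (s + t)"
  shows "P t"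
  by (rule family_induct[of J "A x n"]) (use assms tw_car_subspace in \<open>auto simp: tw_simps(1)\<close>)

lemma tw_d_in:
  assumes x: "x \<in> Obj C" and "t \<in> Car (T K) x n"
  shows "MDiff (T K) x n t \<in> Car (T K) x (n + 1)"
  using assms
proof (induction rule: tw_induct)
  case zero
  then show ?case using lin_zero[OF tw_d_linear tw_subspace] kvec.subspace_0[OF tw_subspace] x by simp
next
  case (push j v)
  then show ?case using tw_pure_in x by (simp add: tw_d_push tw_simps(1))
next
  case (add s t)
  then show ?case using lin_add[OF tw_d_linear] kvec.subspace_add[OF tw_subspace] x by simp
qed

lemma tw_ract_linear:
  assumes "x \<in> Obj C" "y \<in> Obj C" "g \<in> Hom C x y q" "j \<in> J"
  shows "linear_map_on (A y i j) (\<lambda>m. push j (right_act C K (ob j) y x (i - dg j) q m g))"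
  by (rule lin_compose[OF K.ract_linear push_linear[of UNIV]]) (auto simp: assms ob_in)

lemma tw_act_push:
  "\<lbrakk>x \<in> Obj C; y \<in> Obj C; g \<in> Hom C x y q; j \<in> J\<rbrakk> \<Longrightarrow>
    Act (T K) x y i q (push j m) g = push j (right_act C K (ob j) y x (i - dg j) q m g)"
  unfolding tw_simps by (rule extend_push[OF tw_car_subspace tw_ract_linear])

lemma tw_act_linear:
  "\<lbrakk>x \<in> Obj C; y \<in> Obj C; g \<in> Hom C x y q\<rbrakk> \<Longrightarrow> linear_map_on (Car (T K) y i) (\<lambda>t. Act (T K) x y i q t g)"
  unfolding tw_simps by (rule extend_linear[OF tw_car_subspace tw_ract_linear])

lemma tw_prj_act:
  "\<lbrakk>x \<in> Obj C; y \<in> Obj C; g \<in> Hom C x y q; t \<in> Car (T K) y i; j \<in> J\<rbrakk> \<Longrightarrow>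
    prj j (Act (T K) x y i q t g) = right_act C K (ob j) y x (i - dg j) q (prj j t) g"
  unfolding tw_simps by (subst prj_extend_push[OF tw_car_subspace K.ract_linear]) (auto simp: ob_in)

lemma tw_act_in:
  assumes "x \<in> Obj C" "y \<in> Obj C" "g \<in> Hom C x y q" "t \<in> Car (T K) y i"
  shows "Act (T K) x y i q t g \<in> Car (T K) x (i + q)"
  using assms(2,4)
proof (induction rule: tw_induct)
  case zero
  then show ?case using lin_zero[OF tw_act_linear tw_subspace] kvec.subspace_0[OF tw_subspace] assms by simp
next
  case (push j v)
  then show ?case using assms by (auto simp: tw_act_push intro!: tw_push_in K.ract_in ob_in)
next
  case (add s t)
  then show ?case using lin_add[OF tw_act_linear] kvec.subspace_add[OF tw_subspace] assms by simp
qed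

text \<open>The differential in matrix form. The sum may run over any finite set of generators
  containing the support, so that the formulas for several vectors can be compared over one and the
  same set.\<close>

lemma tw_prj_d:
  assumes x: "x \<in> Obj C" and t: "t \<in> Car (T K) x n" and k: "k \<in> J" and S: "finite S" "{i. prj i t \<noteq> 0} \<subseteq> S" "S \<subseteq> J"
  shows "prj k (MDiff (T K) x n t) = sgn_pow (dg k) (MDiff K (ob k, x) (n - dg k) (prj k t)) + (\<Sum>i\<in>S. conn K x n i k (prj i t))"
proof -
  have d0: "MDiff K (ob k, x) (n - dg k) 0 = 0" using K.K.d_0[of "(ob k, x)"] x k by (simp add: ob_in)
  have pure: "prj k (tw_pure C ob dg \<delta> K x n i (prj i t)) =
      (if i = k then sgn_pow (dg k) (MDiff K (ob k, x) (n - dg k) (prj k t)) else 0) + conn K x n i k (prj i t)" if i: "i \<in> J" for i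
  proof -
    have "prj k (\<Sum>l | \<delta> i l \<noteq> 0. push l (conn K x n i l (prj i t))) = (\<Sum>l | \<delta> i l \<noteq> 0. if k = l then conn K x n i k (prj i t) else 0)"
      unfolding prj_sum by (rule sum.cong) (auto simp: prj_push)
    also have "\<dots> = conn K x n i k (prj i t)"
      using \<delta>_finite[OF i] conn_0[OF x i k tw_mem[OF t i]] by (simp add: sum.delta')
    finally show ?thesis by (auto simp: tw_pure_def prj_push)
  qed
  have "prj k (MDiff (T K) x n t) = prj k (\<Sum>i\<in>S. tw_pure C ob dg \<delta> K x n i (prj i t))"
    unfolding tw_simps by (rule arg_cong[OF extend_eq[OF tw_car_subspace[OF x] tw_pure_linear[OF x] S]])
  also have "\<dots> = (\<Sum>i\<in>S. (if i = k then sgn_pow (dg k) (MDiff K (ob k, x) (n - dg k) (prj k t)) else 0) + conn K x n i k (prj i t))"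
    unfolding prj_sum by (rule sum.cong) (use S pure in auto)
  also have "\<dots> = sgn_pow (dg k) (MDiff K (ob k, x) (n - dg k) (prj k t)) + (\<Sum>i\<in>S. conn K x n i k (prj i t))"
    using d0 S by (cases "prj k t = 0") (auto simp: sum.distrib)
  finally show ?thesis .
qed

end

end

text \<open>The equation is the \<open>k\<close>-th coordinate of the square of the differential on
  the generator \<open>j\<close> of \<open>Q\<close>: either the coefficient is differentiated, with
  the sign from passing the generator \<open>k\<close>, or the differential hits an intermediate
  generator \<open>i\<close>.\<close>

locale twisted = pretwisted index basis C J ob dg \<delta>
  for index :: "'j itself" and basis :: "'b itself" and C :: "('o, 'a, 'k::field) dgcat" and J ob dg \<delta> +
  assumes maurer_cartan: "\<lbrakk>j \<in> J; k \<in> J\<rbrakk> \<Longrightarrow>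
     sgn_pow (dg k) (Diff C (ob j) (ob k) (dg j + 1 - dg k) (\<delta> j k)) +
     (\<Sum>i | \<delta> j i \<noteq> 0. Comp C (ob j) (ob i) (ob k) (dg i + 1 - dg k) (dg j + 1 - dg i) (\<delta> i k) (\<delta> j i)) = 0"
begin

context
  fixes K :: "('o, 'a, 'b, 'k) bimod"
  assumes K: "dg_module (enveloping C) K"
begin

interpretation K: bimodule C K
  using K by (simp add: bimodule_def dg_category_axioms)

lemmas tw_ind = tw_induct[OF K, consumes 2, case_names zero push add]

lemma tw_linear_eqI:
  assumes x: "x \<in> Obj C" and F: "linear_map_on (Car (T K) x n) F" and G: "linear_map_on (Car (T K) x n) G" and t: "t \<in> Car (T K) x n"
    and eq: "\<And>j m. j \<in> J \<Longrightarrow> m \<in> Car K (ob j, x) (n - dg j) \<Longrightarrow> F (push j m) = G (push j m)"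
  shows "F t = G t"
  using x t
  by (induction rule: tw_ind)
    (simp_all add: eq lin_zero[OF F tw_subspace[OF K x]] lin_zero[OF G tw_subspace[OF K x]]
      lin_add[OF F] lin_add[OF G])

text \<open>The Maurer-Cartan equation acting on an element of the bimodule from the left.\<close>

lemma conn_conn:
  assumes x: "x \<in> Obj C" and j: "j \<in> J" and k: "k \<in> J" and m: "m \<in> Car K (ob j, x) (n - dg j)" and S: "finite S" "{i. \<delta> j i \<noteq> 0} \<subseteq> S" "S \<subseteq> J"
  shows "(\<Sum>i\<in>S. conn K x (n + 1) i k (conn K x n j i m)) =
    - sgn_pow (dg k) (left_act C K (ob k) (ob j) x (dg j + 1 - dg k + 1) (n - dg j) (Diff C (ob j) (ob k) (dg j + 1 - dg k) (\<delta> j k)) m)"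
proof -
  note o = ob_in[OF j] ob_in[OF k]
  let ?c = "\<lambda>i. Comp C (ob j) (ob i) (ob k) (dg i + 1 - dg k) (dg j + 1 - dg i) (\<delta> i k) (\<delta> j i)"
  let ?l = "\<lambda>f. left_act C K (ob k) (ob j) x (dg j + 1 - dg k + 1) (n - dg j) f m"
  note lin = K.lact_linear_left[OF x o m, of "dg j + 1 - dg k + 1"]
  have c: "?c i \<in> Hom C (ob j) (ob k) (dg j + 1 - dg k + 1)" "conn K x (n + 1) i k (conn K x n j i m) = ?l (?c i)" if "i \<in> {i. \<delta> j i \<noteq> 0}" for i
  proof -
    have i: "i \<in> J" using S that by blast
    have e: "dg i + 1 - dg k + (dg j + 1 - dg i) = dg j + 1 - dg k + 1" "dg j + 1 - dg i + (n - dg j) = n + 1 - dg i" by simp_all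
    show "?c i \<in> Hom C (ob j) (ob k) (dg j + 1 - dg k + 1)"
      using comp_closed[OF o(1) ob_in[OF i] o(2) \<delta>_in[OF i k] \<delta>_in[OF j i]] unfolding e .
    show "conn K x (n + 1) i k (conn K x n j i m) = ?l (?c i)"
      using K.lact_lact[OF x o(1) ob_in[OF i] o(2) \<delta>_in[OF j i] \<delta>_in[OF i k] m] unfolding e .
  qed
  have "conn K x (n + 1) i k (conn K x n j i m) = 0" if "i \<in> S - {i. \<delta> j i \<noteq> 0}" for i
    using that S conn_0[OF K x j _ m, of i] conn_zero[OF K x _ k, of i] by auto
  then have "(\<Sum>i\<in>S. conn K x (n + 1) i k (conn K x n j i m)) = (\<Sum>i | \<delta> j i \<noteq> 0. conn K x (n + 1) i k (conn K x n j i m))"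
    by (intro sum.mono_neutral_right[OF S(1,2)] ballI)
  also have "\<dots> = (\<Sum>i | \<delta> j i \<noteq> 0. ?l (?c i))" by (rule sum.cong[OF refl c(2)])
  also have "\<dots> = ?l (\<Sum>i | \<delta> j i \<noteq> 0. ?c i)"
    by (rule lin_sum[OF lin hom_subspace[OF o] c(1), symmetric])
  also have "(\<Sum>i | \<delta> j i \<noteq> 0. ?c i) = - sgn_pow (dg k) (Diff C (ob j) (ob k) (dg j + 1 - dg k) (\<delta> j k))"
    using maurer_cartan[OF j k] by (simp add: eq_neg_iff_add_eq_0 add.commute)
  also have "?l \<dots> = - sgn_pow (dg k) (?l (Diff C (ob j) (ob k) (dg j + 1 - dg k) (\<delta> j k)))"
    unfolding lin_minus[OF lin sgn_pow_in[OF hom_subspace[OF o] diff_closed[OF o \<delta>_in[OF j k]]]]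
      lin_sgn_pow[OF lin diff_closed[OF o \<delta>_in[OF j k]]] ..
  finally show ?thesis .
qed

text \<open>Two cancellations take place. The connection and the inner differential anticommute up
  to the differential of the coefficient, by \<open>d_lact\<close> and the signs; the term with this
  differential is cancelled by the square of the connection, by \<open>conn_conn\<close>.\<close>

lemma tw_dd_push:
  assumes x: "x \<in> Obj C" and j: "j \<in> J" and m: "m \<in> Car K (ob j, x) (n - dg j)"
  shows "MDiff (T K) x (n + 1) (MDiff (T K) x n (push j m)) = 0"
proof -
  note pin = tw_push_in[OF K x j m] and din = tw_d_in[OF K x tw_push_in[OF K x j m]]
  let ?t = "MDiff (T K) x n (push j m)" and ?dm = "MDiff K (ob j, x) (n - dg j) m"
  have dm: "?dm \<in> Car K (ob j, x) (n + 1 - dg j)"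
    using x j m by (intro K.K.d_in) (auto simp: ob_in)
  note sdm = K.K.mem_sgn[OF _ dm, of "dg j"]
  have supp_push: "{i. prj i (push j m) \<noteq> 0} \<subseteq> {j}" by (auto simp: prj_push)
  have pt: "prj i ?t = (if i = j then sgn_pow (dg j) ?dm else 0) + conn K x n j i m" if i: "i \<in> J" for i
    using tw_prj_d[OF K x pin i _ supp_push] K.K.d_0[of "(ob i, x)"] x i j by (auto simp: prj_push ob_in)
  let ?S = "insert j {i. \<delta> j i \<noteq> 0}"
  have S: "finite ?S" "?S \<subseteq> J" using \<delta>_finite[OF j] \<delta>_notin[OF j] j by auto
  have supp: "{i. prj i ?t \<noteq> 0} \<subseteq> ?S"
  proof
    fix i :: 'j assume i: "i \<in> {i. prj i ?t \<noteq> 0}"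
    then have "i \<in> J" using tw_supp[OF din] by blast
    then show "i \<in> ?S" using i pt[of i] conn_0[OF K x j _ m, of i] by (auto split: if_splits)
  qed
  show ?thesis
  proof (rule tw_eqI[OF tw_d_in[OF K x din] kvec.subspace_0[OF tw_subspace[OF K x]]])
    fix k assume k: "k \<in> J"
    have kx: "(ob k, x) \<in> Obj (enveloping C)" "(ob j, x) \<in> Obj (enveloping C)" using x j k by (auto simp: ob_in)
    let ?p = "dg j + 1 - dg k" and ?dc = "conn K x (n + 1) j k ?dm"
    have c: "conn K x (n + 1) i k (prj i ?t) = (if i = j then sgn_pow (dg j) ?dc else 0) + conn K x (n + 1) i k (conn K x n j i m)" if "i \<in> ?S" for i
    proof -
      have i: "i \<in> J" using S that by blast
      note lin = conn_linear[OF K x i k, of "n + 1"]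
      show ?thesis
        using lin_add[OF lin, of "sgn_pow (dg j) ?dm"] lin_sgn_pow[OF lin, of ?dm] dm sdm kx(2)
          conn_in[OF K x j i m refl] unfolding pt[OF i] by (cases "i = j") simp_all
    qed
    have "(\<Sum>i\<in>?S. conn K x (n + 1) i k (prj i ?t)) = sgn_pow (dg j) ?dc + (\<Sum>i\<in>?S. conn K x (n + 1) i k (conn K x n j i m))"
      using S(1) by (subst sum.cong[OF refl c]) (assumption, simp only: sum.distrib sum.delta insertI1 if_True)
    also have "\<dots> = sgn_pow (dg j) ?dc - sgn_pow (dg k) (left_act C K (ob k) (ob j) x (?p + 1) (n - dg j) (Diff C (ob j) (ob k) ?p (\<delta> j k)) m)"
      using conn_conn[OF x j k m S(1) _ S(2)] by auto
    finally have sum: "(\<Sum>i\<in>?S. conn K x (n + 1) i k (prj i ?t)) = \<dots>" .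
    have e: "?p + (n - dg j) = n + 1 - dg k" "n - dg j + 1 = n + 1 - dg j" by simp_all
    have dconn: "MDiff K (ob k, x) (n + 1 - dg k) (conn K x n j k m) =
        left_act C K (ob k) (ob j) x (?p + 1) (n - dg j) (Diff C (ob j) (ob k) ?p (\<delta> j k)) m + sgn_pow ?p ?dc"
      using K.d_lact[OF x ob_in[OF j] ob_in[OF k] \<delta>_in[OF j k] m] unfolding e .
    have "MDiff K (ob k, x) (n + 1 - dg k) (prj k ?t) = MDiff K (ob k, x) (n + 1 - dg k) (conn K x n j k m)"
      using pt[OF k] sdm conn_in[OF K x j k m refl] kx K.K.dd[OF kx(2) m e(2)[symmetric]] by (auto simp: K.K.d_add K.K.d_sgn dm)
    moreover have "sgn_pow (dg k) (sgn_pow ?p v) = - sgn_pow (dg j) v" for v :: "('b, 'k) vec"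
      by (auto simp: sgn_pow_def)
    ultimately show "prj k (MDiff (T K) x (n + 1) ?t) = prj k 0"
      unfolding tw_prj_d[OF K x din k S(1) supp S(2)] sum by (simp add: sgn_pow_add dconn del: sgn_pow_sgn_pow)
  qed
qed

lemma dg_module_tw: "dg_module C (T K)"
proof
  fix x n assume x: "x \<in> Obj C"
  show "kvec.subspace (Car (T K) x n)" by (rule tw_subspace[OF K x])
  show lin: "linear_map_on (Car (T K) x n) (MDiff (T K) x n)" by (rule tw_d_linear[OF K x])
  fix t assume t: "t \<in> Car (T K) x n"
  show "MDiff (T K) x n t \<in> Car (T K) x (n + 1)" by (rule tw_d_in[OF K x t])
  show "MDiff (T K) x (n + 1) (MDiff (T K) x n t) = 0"
    by (rule tw_linear_eqI[OF x lin_compose[OF lin tw_d_linear[OF K x] tw_d_in[OF K x]] lin_const0 t tw_dd_push[OF x]])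
  show "Act (T K) x x n 0 t (Ident C x) = t"
    by (rule tw_eqI[OF tw_act_in[OF K x x ident_closed[OF x] t] t])
      (simp add: tw_prj_act[OF K x x ident_closed[OF x] t] K.ract_ident[OF x ob_in tw_mem[OF t]])
next
  fix x y i q assume o: "x \<in> Obj C" "y \<in> Obj C"
  show "bilinear_map_on (Car (T K) y i) (Hom C x y q) (Act (T K) x y i q)"
    unfolding bilinear_map_on_def
  proof (intro conjI ballI)
    fix g assume "g \<in> Hom C x y q"
    then show "linear_map_on (Car (T K) y i) (\<lambda>t. Act (T K) x y i q t g)" by (rule tw_act_linear[OF K o])
  next
    fix t assume t: "t \<in> Car (T K) y i"
    then show "linear_map_on (Hom C x y q) (Act (T K) x y i q t)"
      unfolding tw_simps(3)[abs_def] extend_def using o tw_supp[OF t] tw_mem[OF t]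
      by (intro lin_sum_fun lin_compose[OF K.ract_linear_right push_linear UNIV_I]) (auto simp: ob_in)
  qed
next
  fix x y t i g q assume o: "x \<in> Obj C" "y \<in> Obj C" and t: "t \<in> Car (T K) y i" and g: "g \<in> Hom C x y q"
  show tg: "Act (T K) x y i q t g \<in> Car (T K) x (i + q)" by (rule tw_act_in[OF K o g t])
  note dg = diff_closed[OF o g]
  have rhs: "Act (T K) x y (i + 1) q (MDiff (T K) y i t) g + sgn_pow i (Act (T K) x y i (q + 1) t (Diff C x y q g)) \<in> Car (T K) x (i + q + 1)"
    using tw_act_in[OF K o g tw_d_in[OF K o(2) t]] tw_act_in[OF K o dg t]
    by (intro kvec.subspace_add sgn_pow_in tw_subspace[OF K o(1)]) (simp_all add: algebra_simps)
  show "MDiff (T K) x (i + q) (Act (T K) x y i q t g) = Act (T K) x y (i + 1) q (MDiff (T K) y i t) g +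
      sgn_pow i (Act (T K) x y i (q + 1) t (Diff C x y q g))"
  proof (rule tw_eqI[OF tw_d_in[OF K o(1) tg] rhs])
    fix k assume k: "k \<in> J"
    let ?S = "{j :: 'j. prj j t \<noteq> 0}"
    note tk = tw_mem[OF t] and S = tw_supp[OF t]
    have kx: "(ob k, y) \<in> Obj (enveloping C)" using o k by (simp add: ob_in)
    have e: "i + q - dg l = i - dg l + q" "i + 1 - dg l = i - dg l + 1" for l by simp_all
    have supp: "{j. prj j (Act (T K) x y i q t g) \<noteq> 0} \<subseteq> ?S"
    proof
      fix j :: 'j assume j: "j \<in> {j. prj j (Act (T K) x y i q t g) \<noteq> 0}"
      then have "j \<in> J" using tw_supp[OF tg] by blast
      then show "j \<in> ?S" using j lin_zero[OF K.ract_linear[OF o(2,1) ob_in g] tw_car_subspace[OF K o(2)]]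
        by (auto simp: tw_prj_act[OF K o g t])
    qed
    have dk: "MDiff K (ob k, y) (i - dg k) (prj k t) \<in> Car K (ob k, y) (i - dg k + 1)"
      by (rule K.K.d_in[OF kx tk[OF k] refl])
    have ck: "conn K y i l k (prj l t) \<in> Car K (ob k, y) (i - dg k + 1)"
      "conn K x (i + q) l k (right_act C K (ob l) y x (i - dg l) q (prj l t) g) =
        right_act C K (ob k) y x (i - dg k + 1) q (conn K y i l k (prj l t)) g" if "l \<in> ?S" for l
    proof -
      have l: "l \<in> J" using that S by blast
      have e': "dg l + 1 - dg k + (i - dg l) = i - dg k + 1" by simp
      show "conn K y i l k (prj l t) \<in> Car K (ob k, y) (i - dg k + 1)"
        using conn_in[OF K o(2) l k tk[OF l] refl] unfolding e .
      show "conn K x (i + q) l k (right_act C K (ob l) y x (i - dg l) q (prj l t) g) =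
          right_act C K (ob k) y x (i - dg k + 1) q (conn K y i l k (prj l t)) g"
        using K.lact_ract[OF o(2,1) ob_in[OF l] ob_in[OF k] \<delta>_in[OF l k] g tk[OF l]] unfolding e e' by simp
    qed
    have sum_c: "(\<Sum>l\<in>?S. conn K y i l k (prj l t)) \<in> Car K (ob k, y) (i - dg k + 1)"
      by (rule K.K.mem_sum[OF kx ck(1)])
    note rl = K.ract_linear[OF o(2,1) ob_in[OF k] g, of "i - dg k + 1"]
    have rsum: "right_act C K (ob k) y x (i - dg k + 1) q (\<Sum>l\<in>?S. conn K y i l k (prj l t)) g =
        (\<Sum>l\<in>?S. right_act C K (ob k) y x (i - dg k + 1) q (conn K y i l k (prj l t)) g)"
      by (rule lin_sum[OF rl K.K.car_subspace[OF kx] ck(1)])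
    have "prj k (MDiff (T K) x (i + q) (Act (T K) x y i q t g)) =
        sgn_pow (dg k) (MDiff K (ob k, x) (i - dg k + q) (right_act C K (ob k) y x (i - dg k) q (prj k t) g)) +
        (\<Sum>l\<in>?S. conn K x (i + q) l k (prj l (Act (T K) x y i q t g)))"
      unfolding tw_prj_d[OF K o(1) tg k finite_prj supp S] tw_prj_act[OF K o g t k] e ..
    also have "(\<Sum>l\<in>?S. conn K x (i + q) l k (prj l (Act (T K) x y i q t g))) =
        right_act C K (ob k) y x (i - dg k + 1) q (\<Sum>l\<in>?S. conn K y i l k (prj l t)) g"
      unfolding rsum
      by (rule sum.cong[OF refl], subst tw_prj_act[OF K o g t]) (use S ck(2) in auto)
    also have "sgn_pow (dg k) (MDiff K (ob k, x) (i - dg k + q) (right_act C K (ob k) y x (i - dg k) q (prj k t) g)) +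
        right_act C K (ob k) y x (i - dg k + 1) q (\<Sum>l\<in>?S. conn K y i l k (prj l t)) g =
        right_act C K (ob k) y x (i - dg k + 1) q (prj k (MDiff (T K) y i t)) g +
        sgn_pow i (right_act C K (ob k) y x (i - dg k) (q + 1) (prj k t) (Diff C x y q g))"
      unfolding tw_prj_d[OF K o(2) t k finite_prj order_refl S] K.d_ract[OF o(2,1) ob_in[OF k] g tk[OF k]]
        lin_add[OF rl K.K.mem_sgn[OF kx dk] sum_c] lin_sgn_pow[OF rl dk]
      by (simp add: sgn_pow_add)
    finally show "prj k (MDiff (T K) x (i + q) (Act (T K) x y i q t g)) = prj k (Act (T K) x y (i + 1) q (MDiff (T K) y i t) g +
        sgn_pow i (Act (T K) x y i (q + 1) t (Diff C x y q g)))"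
      by (simp add: tw_prj_act[OF K o g tw_d_in[OF K o(2) t] k] tw_prj_act[OF K o dg t k] e)
  qed
next
  fix x y z t i g q f r assume o: "x \<in> Obj C" "y \<in> Obj C" "z \<in> Obj C" and t: "t \<in> Car (T K) z i"
    and g: "g \<in> Hom C y z q" and f: "f \<in> Hom C x y r"
  note gf = comp_closed[OF o g f] and tg = tw_act_in[OF K o(2,3) g t]
  show "Act (T K) x y (i + q) r (Act (T K) y z i q t g) f = Act (T K) x z i (q + r) t (Comp C x y z q r g f)"
  proof (rule tw_eqI[OF tw_act_in[OF K o(1,2) f tg] tw_act_in[OF K o(1,3) gf t]])
    fix j assume j: "j \<in> J"
    have e: "i - dg j + q = i + q - dg j" by simp
    show "prj j (Act (T K) x y (i + q) r (Act (T K) y z i q t g) f) = prj j (Act (T K) x z i (q + r) t (Comp C x y z q r g f))"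
      using K.ract_ract[OF o(3,2,1) ob_in[OF j] g f tw_mem[OF t j], unfolded e]
      by (simp add: tw_prj_act[OF K o(1,2) f tg j] tw_prj_act[OF K o(2,3) g t j] tw_prj_act[OF K o(1,3) gf t j])
  qed
qed

end

end


section \<open>Functoriality of twisted sums\<close>

lemma sgn_pow_sum: "sgn_pow p (sum f S) = (\<Sum>i\<in>S. sgn_pow p (f i))"
  by (simp add: sgn_pow_def sum_negf)

text \<open>
  A map of bimodules of degree \<open>p\<close>, commuting with the right action of the enveloping category, commutes with
  the left action of \<open>C\<close> up to the Koszul sign. Hence it induces a map of the sums with the sign of \<open>tw_map\<close>.
\<close>

definition tw_map where
  "tw_map ob dg p f x n = extend (\<lambda>j m. push j (sgn_pow (p * dg j) (f (ob j, x) (n - dg j) m)))"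

context twisted
begin

abbreviation "C\<^sub>e \<equiv> enveloping C"

abbreviation "tmap \<equiv> tw_map ob dg"

lemma obj_pair: "x \<in> Obj C \<Longrightarrow> j \<in> J \<Longrightarrow> (ob j, x) \<in> Obj C\<^sub>e"
  by (simp add: ob_in)

context
  fixes K L :: "('o, 'a, 'b, 'k) bimod" and p :: int and f
  assumes K: "dg_module C\<^sub>e K" and L: "dg_module C\<^sub>e L" and f: "graded_map C\<^sub>e p K L f"
begin

interpretation K: bimodule C K using K by (simp add: bimodule_def dg_category_axioms)
interpretation L: bimodule C L using L by (simp add: bimodule_def dg_category_axioms)

lemma gr_lact:
  assumes o: "x \<in> Obj C" "y \<in> Obj C" "z \<in> Obj C" and a: "a \<in> Hom C y z q" and m: "m \<in> Car K (y, x) j" and k: "k = q + j" "l = j + p"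
  shows "f (z, x) k (left_act C K z y x q j a m) = sgn_pow (q * p) (left_act C L z y x q l a (f (y, x) j m))"
proof -
  have zx: "(z, x) \<in> Obj C\<^sub>e" "(y, x) \<in> Obj C\<^sub>e" using o by auto
  have t: "tens q 0 a (Ident C x) \<in> Hom C\<^sub>e (z, x) (y, x) q"
    using enveloping_tens_in[OF a ident_closed[OF o(1)]] by simp
  have "f (z, x) k (left_act C K z y x q j a m) = sgn_pow (q * j) (Act L (z, x) (y, x) l q (f (y, x) j m) (tens q 0 a (Ident C x)))"
    unfolding left_act_def k
    using lin_sgn_pow[OF gr_linear[OF f zx(1)] K.K.act_in[OF zx m t refl]] gr_act[OF f zx m t refl refl]
    by (simp add: add.commute)
  moreover have "sgn_pow (q * p) (sgn_pow (q * l) v) = sgn_pow (q * j) v" for v :: "('b, 'k) vec"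
    unfolding sgn_pow_sgn_pow k by (rule sgn_pow_cong) (simp add: algebra_simps)
  ultimately show ?thesis unfolding left_act_def by simp
qed

context
  fixes x assumes x: "x \<in> Obj C"
begin

lemmas jx = obj_pair[OF x]

lemma tw_comp_linear: "j \<in> J \<Longrightarrow> linear_map_on (Car K (ob j, x) (n - dg j)) (\<lambda>m. sgn_pow (p * dg j) (f (ob j, x) (n - dg j) m))"
  by (rule lin_sgn[OF gr_linear[OF f jx]])

lemma prj_tmap:
  assumes "t \<in> Car (T K) x n"
  shows "prj j (tmap p f x n t) = (if j \<in> J then sgn_pow (p * dg j) (f (ob j, x) (n - dg j) (prj j t)) else 0)"
  unfolding tw_map_def
  by (rule prj_extend_push[OF tw_car_subspace[OF K x] tw_comp_linear assms[unfolded tw_simps(1)]])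

lemma tmap_linear: "linear_map_on (Car (T K) x n) (tmap p f x n)"
  unfolding tw_map_def tw_simps(1)
  by (rule extend_linear[OF tw_car_subspace[OF K x] lin_compose[OF tw_comp_linear push_linear[of UNIV]]]) simp_all

lemma tmap_in:
  assumes t: "t \<in> Car (T K) x n" and k: "k = n + p"
  shows "tmap p f x n t \<in> Car (T L) x k"
proof -
  have "f (ob j, x) (n - dg j) (prj j t) \<in> Car L (ob j, x) (k - dg j)" if "j \<in> J" for j
    by (rule gr_in[OF f jx[OF that] tw_mem[OF t that]]) (simp add: k)
  then show ?thesis using jx by (auto simp: tw_simps(1)[of _ _ _ _ _ L] family_def prj_tmap[OF t] L.K.mem)
qed

text \<open>The connection commutes with the induced map up to the sign of \<open>p\<close>, so the
  defect from commuting with the differentials is the defect of \<open>f\<close> itself, component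
  by component. It vanishes for closed maps and for shifts, while for the projection of a cone to
  the target it yields the map of which the cone is taken.\<close>

lemma prj_tmap_d:
  assumes t: "t \<in> Car (T K) x n" and k: "k \<in> J" and l: "l = n + p" "r = n - dg k" "r' = r + 1" "s = l - dg k"
  shows "prj k (MDiff (T L) x l (tmap p f x n t)) = sgn_pow p (prj k (tmap p f x (n + 1) (MDiff (T K) x n t))) +
    sgn_pow (p * dg k + dg k) (MDiff L (ob k, x) s (f (ob k, x) r (prj k t)) - sgn_pow p (f (ob k, x) r' (MDiff K (ob k, x) r (prj k t))))"
proof -
  let ?S = "{i :: 'j. prj i t \<noteq> 0}"
  note S = tw_supp[OF t] and ft = tmap_in[OF t l(1)] and dt = tw_d_in[OF K x t] and kx = jx[OF k] and lin = gr_linear[OF f jx[OF k]]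
  have supp: "{i. prj i (tmap p f x n t) \<noteq> 0} \<subseteq> ?S"
    using lin_zero[OF gr_linear[OF f jx] K.K.car_subspace[OF jx]] by (auto simp: prj_tmap[OF t] split: if_splits)
  have e: "n + 1 - dg k = r'" using l by simp
  have c: "conn K x n i k (prj i t) \<in> Car K (ob k, x) r'"
    "conn L x l i k (prj i (tmap p f x n t)) = sgn_pow p (sgn_pow (p * dg k) (f (ob k, x) r' (conn K x n i k (prj i t))))" if "i \<in> ?S" for i
  proof -
    have i: "i \<in> J" using S that by blast
    show "conn K x n i k (prj i t) \<in> Car K (ob k, x) r'"
      using conn_in[OF K x i k tw_mem[OF t i] refl] unfolding e .
    have fi: "f (ob i, x) (n - dg i) (prj i t) \<in> Car L (ob i, x) (l - dg i)"
      by (rule gr_in[OF f jx[OF i] tw_mem[OF t i]]) (simp add: l)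
    have "f (ob k, x) r' (conn K x n i k (prj i t)) = sgn_pow ((dg i + 1 - dg k) * p) (conn L x l i k (f (ob i, x) (n - dg i) (prj i t)))"
      by (rule gr_lact[OF x ob_in[OF i] ob_in[OF k] \<delta>_in[OF i k] tw_mem[OF t i]]) (simp_all add: l)
    moreover have "sgn_pow p (sgn_pow (p * dg k) (sgn_pow ((dg i + 1 - dg k) * p) v)) = sgn_pow (p * dg i) v" for v :: "('b, 'k) vec"
      unfolding sgn_pow_sgn_pow by (rule sgn_pow_cong) (simp add: algebra_simps)
    ultimately show "conn L x l i k (prj i (tmap p f x n t)) = sgn_pow p (sgn_pow (p * dg k) (f (ob k, x) r' (conn K x n i k (prj i t))))"
      using lin_sgn_pow[OF conn_linear[OF L x i k] fi] i by (simp add: prj_tmap[OF t])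
  qed
  have dk: "MDiff K (ob k, x) r (prj k t) \<in> Car K (ob k, x) r'"
    by (rule K.K.d_in[OF kx _ l(3)]) (use tw_mem[OF t k] l in simp)
  have fk: "f (ob k, x) r (prj k t) \<in> Car L (ob k, x) s"
    by (rule gr_in[OF f kx _]) (use tw_mem[OF t k] l in simp_all)
  have sum_c: "(\<Sum>i\<in>?S. conn K x n i k (prj i t)) \<in> Car K (ob k, x) r'" by (rule K.K.mem_sum[OF kx c(1)])
  have f_sum: "f (ob k, x) r' (\<Sum>i\<in>?S. conn K x n i k (prj i t)) = (\<Sum>i\<in>?S. f (ob k, x) r' (conn K x n i k (prj i t)))"
    by (rule lin_sum[OF lin K.K.car_subspace[OF kx] c(1)])
  have "prj k (tmap p f x (n + 1) (MDiff (T K) x n t)) = sgn_pow (p * dg k) (sgn_pow (dg k) (f (ob k, x) r' (MDiff K (ob k, x) r (prj k t))) +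
      (\<Sum>i\<in>?S. f (ob k, x) r' (conn K x n i k (prj i t))))"
    using k unfolding prj_tmap[OF dt] tw_prj_d[OF K x t k finite_prj order_refl S] l(2)[symmetric] e
      lin_add[OF lin K.K.mem_sgn[OF kx dk] sum_c] lin_sgn_pow[OF lin dk] f_sum by simp
  moreover have "(\<Sum>i\<in>?S. conn L x l i k (prj i (tmap p f x n t))) =
      sgn_pow p (sgn_pow (p * dg k) (\<Sum>i\<in>?S. f (ob k, x) r' (conn K x n i k (prj i t))))"
    unfolding sgn_pow_sum by (rule sum.cong[OF refl c(2)])
  moreover have "MDiff L (ob k, x) s (prj k (tmap p f x n t)) = sgn_pow (p * dg k) (MDiff L (ob k, x) s (f (ob k, x) r (prj k t)))"
    using k L.K.d_sgn[OF kx fk] by (simp add: prj_tmap[OF t] l)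
  ultimately show ?thesis
    unfolding tw_prj_d[OF L x ft k finite_prj supp S] l(4)[symmetric]
    by (simp add: sgn_pow_add sgn_pow_diff algebra_simps)
qed

end

lemma tmap_act:
  assumes o: "x \<in> Obj C" "y \<in> Obj C" and t: "t \<in> Car (T K) y n" and g: "g \<in> Hom C x y q" and k: "k = n + p"
  shows "tmap p f x (n + q) (Act (T K) x y n q t g) = Act (T L) x y k q (tmap p f y n t) g"
proof (rule tw_eqI[OF tmap_in[OF o(1) tw_act_in[OF K o g t] refl] tw_act_in[OF L o g tmap_in[OF o(2) t k]]])
  fix j assume j: "j \<in> J"
  note jy = obj_pair[OF o(2) j] and jx = obj_pair[OF o(1) j]
  have h: "tens 0 q (Ident C (ob j)) g \<in> Hom C\<^sub>e (ob j, x) (ob j, y) q"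
    using enveloping_tens_in[OF ident_closed[OF ob_in[OF j]] g] by simp
  have fj: "f (ob j, y) (n - dg j) (prj j t) \<in> Car L (ob j, y) (k - dg j)"
    by (rule gr_in[OF f jy tw_mem[OF t j]]) (simp add: k)
  have e: "n + q - dg j = n - dg j + q" "k - dg j = n - dg j + p" using k by simp_all
  show "prj j (tmap p f x (n + q) (Act (T K) x y n q t g)) = prj j (Act (T L) x y k q (tmap p f y n t) g)"
    using j gr_act[OF f jx jy tw_mem[OF t j] h refl refl] L.K.act_sgn[OF jx jy fj h]
    by (simp add: prj_tmap[OF o(1) tw_act_in[OF K o g t]] prj_tmap[OF o(2) t] tw_prj_act[OF K o g t j]
        tw_prj_act[OF L o g tmap_in[OF o(2) t k] j] right_act_def e)
qed

end

lemma tw_map_mor: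
  assumes \<phi>: "dg_morphism C\<^sub>e K (L :: ('o, 'a, 'b, 'k) bimod) \<phi>"
  shows "dg_morphism C (T K) (T L) (tmap 0 \<phi>)"
    and "\<And>x n t j. x \<in> Obj C \<Longrightarrow> t \<in> Car (T K) x n \<Longrightarrow>
      prj j (tmap 0 \<phi> x n t) = (if j \<in> J then \<phi> (ob j, x) (n - dg j) (prj j t) else 0)"
proof -
  note K = mor_source[OF \<phi>] and L = mor_target[OF \<phi>] and f = mor_graded[OF \<phi>]
  show "prj j (tmap 0 \<phi> x n t) = (if j \<in> J then \<phi> (ob j, x) (n - dg j) (prj j t) else 0)"
    if "x \<in> Obj C" "t \<in> Car (T K) x n" for x n t j
    using prj_tmap[OF K L f that] by simp
  show "dg_morphism C (T K) (T L) (tmap 0 \<phi>)"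
  proof (rule dg_morphismI[OF dg_module_tw[OF K] dg_module_tw[OF L] tmap_linear[OF K L f] tmap_in[OF K L f] _ tmap_act[OF K L f]])
    fix x n t assume x: "x \<in> Obj C" and t: "t \<in> Car (T K) x n"
    note ft = tmap_in[OF K L f x t, of n, simplified]
    show "tmap 0 \<phi> x (n + 1) (MDiff (T K) x n t) = MDiff (T L) x n (tmap 0 \<phi> x n t)"
    proof (rule tw_eqI[OF tmap_in[OF K L f x tw_d_in[OF K x t] refl] tw_d_in[OF L x ft]])
      fix k assume k: "k \<in> J"
      show "prj k (tmap 0 \<phi> x (n + 1) (MDiff (T K) x n t)) = prj k (MDiff (T L) x n (tmap 0 \<phi> x n t))"
        using prj_tmap_d[OF K L f x t k _ refl refl refl, of n] mor_d[OF \<phi> obj_pair[OF x k] tw_mem[OF t k] refl] by simp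
    qed
  qed simp_all
qed

lemma tw_dsum:
  assumes ds: "dsum C\<^sub>e I K (S :: ('o, 'a, 'b, 'k) bimod) \<iota> \<pi>"
  shows "dsum C I (\<lambda>i. T (K i)) (T S) (\<lambda>i. tmap 0 (\<iota> i)) (\<lambda>i. tmap 0 (\<pi> i))"
proof -
  note d = dsumD[OF ds]
  note \<iota> = tw_map_mor[OF d(2)] and \<pi> = tw_map_mor[OF d(3)]
  interpret S: dg_module C "T S" by (rule dg_module_tw[OF d(1)])
  show ?thesis
    unfolding dsum_def
  proof (intro conjI ballI allI S.dg_module_axioms \<iota>(1) \<pi>(1))
    fix i i' x n t assume *: "i \<in> I" "i' \<in> I" "x \<in> Obj C" "t \<in> Car (T (K i)) x n"
    interpret Ki': dg_module C "T (K i')" by (rule mor_target[OF \<pi>(1)[OF *(2)]])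
    note it = mor_in[OF \<iota>(1)[OF *(1)] *(3,4)]
    note pit = mor_in[OF \<pi>(1)[OF *(2)] *(3) it]
    have z: "(if i = i' then t else 0) \<in> Car (T (K i')) x n" using * Ki'.mem_0 by auto
    show "tmap 0 (\<pi> i') x n (tmap 0 (\<iota> i) x n t) = (if i = i' then t else 0)"
      by (rule tw_eqI[OF pit z])
        (use * it tw_mem[OF *(4)] in \<open>auto simp: \<iota>(2) \<pi>(2) d(4) ob_in\<close>)
  next
    fix x n t assume x: "x \<in> Obj C" and t: "t \<in> Car (T S) x n"
    have "\<forall>j. \<exists>L. j \<in> J \<longrightarrow> finite L \<and> L \<subseteq> I \<and> (\<forall>i\<in>I - L. \<pi> i (ob j, x) (n - dg j) (prj j t) = 0)"
    proof
      fix j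
      show "\<exists>L. j \<in> J \<longrightarrow> finite L \<and> L \<subseteq> I \<and> (\<forall>i\<in>I - L. \<pi> i (ob j, x) (n - dg j) (prj j t) = 0)"
      proof (cases "j \<in> J")
        case True
        then have "(ob j, x) \<in> Obj C\<^sub>e" using x by (simp add: ob_in)
        from d(5)[OF this tw_mem[OF t True]] show ?thesis by blast
      qed simp
    qed
    from choice[OF this] obtain L where
      "\<forall>j. j \<in> J \<longrightarrow> finite (L j) \<and> L j \<subseteq> I \<and> (\<forall>i\<in>I - L j. \<pi> i (ob j, x) (n - dg j) (prj j t) = 0)" ..
    then have L: "\<And>j. j \<in> J \<Longrightarrow> finite (L j)" "\<And>j. j \<in> J \<Longrightarrow> L j \<subseteq> I"
      "\<And>j i. j \<in> J \<Longrightarrow> i \<in> I - L j \<Longrightarrow> \<pi> i (ob j, x) (n - dg j) (prj j t) = 0" by simp_all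
    \<comment> \<open>A finite union: only finitely many components of \<open>t\<close> are nonzero,
      and each of them involves finitely many summands.\<close>
    let ?L = "\<Union>j\<in>{j. prj j t \<noteq> 0}. L j"
    have fin: "finite ?L" using L(1) tw_supp[OF t] by (intro finite_UN_I finite_prj) blast
    have LI: "?L \<subseteq> I" using L(2) tw_supp[OF t] by blast
    have p0: "\<pi> i (ob j, x) (n - dg j) (prj j t) = 0" if "j \<in> J" "i \<in> I - ?L" for i j
    proof (cases "prj j t = 0")
      case True
      then show ?thesis using mor_0[OF d(3)] that x by (auto simp: ob_in)
    next
      case False
      then show ?thesis using L(3)[OF that(1), of i] that by blast
    qed
    have mem: "tmap 0 (\<pi> i) x n t \<in> Car (T (K i)) x n" if "i \<in> I" for i
      by (rule mor_in[OF \<pi>(1)[OF that] x t])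
    have "tmap 0 (\<pi> i) x n t = 0" if "i \<in> I - ?L" for i
    proof (rule vec_eqI)
      fix j :: 'j
      show "prj j (tmap 0 (\<pi> i) x n t) = prj j 0"
        using \<pi>(2)[of i x t n j] p0[of j i] that x t by auto
    qed
    moreover have "t = (\<Sum>i\<in>?L. tmap 0 (\<iota> i) x n (tmap 0 (\<pi> i) x n t))"
    proof (rule tw_eqI[OF t])
      show "(\<Sum>i\<in>?L. tmap 0 (\<iota> i) x n (tmap 0 (\<pi> i) x n t)) \<in> Car (T S) x n"
        using S.mem_sum[OF x, of ?L] LI mem mor_in[OF \<iota>(1) x] by (auto simp: subset_iff)
      fix j assume j: "j \<in> J"
      have "prj j (\<Sum>i\<in>?L. tmap 0 (\<iota> i) x n (tmap 0 (\<pi> i) x n t)) =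
          (\<Sum>i\<in>?L. \<iota> i (ob j, x) (n - dg j) (\<pi> i (ob j, x) (n - dg j) (prj j t)))"
        unfolding prj_sum by (rule sum.cong[OF refl]) (use LI x t j mem in \<open>auto simp: \<iota>(2) \<pi>(2) subset_iff\<close>)
      also have "\<dots> = prj j t"
        by (rule dsum_sum_eq[OF ds, symmetric]) (use x j fin LI p0 tw_mem[OF t] in \<open>auto simp: ob_in\<close>)
      finally show "prj j t = prj j (\<Sum>i\<in>?L. tmap 0 (\<iota> i) x n (tmap 0 (\<pi> i) x n t))" ..
    qed
    ultimately show "\<exists>L. finite L \<and> L \<subseteq> I \<and> (\<forall>i\<in>I - L. tmap 0 (\<pi> i) x n t = 0) \<and>
        t = (\<Sum>i\<in>L. tmap 0 (\<iota> i) x n (tmap 0 (\<pi> i) x n t))"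
      using fin LI by blast
  qed
qed

text \<open>The identity is a map of degree \<open>p\<close> from \<open>shift p K\<close> to
  \<open>K\<close>; the signs that \<open>tw_map\<close> puts on the generators make it a closed
  isomorphism of the twisted sums.\<close>

lemma tw_shift:
  assumes K: "dg_module C\<^sub>e (K :: ('o, 'a, 'b, 'k) bimod)"
  shows "derived_iso C (T (shift p K)) (shift p (T K))"
proof -
  let ?K = "shift p K" and ?f = "\<lambda>z n m. m"
  note sK = dg_module_shift[OF K]
  interpret K: dg_module C\<^sub>e K by (rule K)
  have f: "graded_map C\<^sub>e q M N ?f"
    if "\<And>z n. Car M z n = Car N z (n + q)" "\<And>x y n j. Act M x y n j = Act N x y (n + q) j"
    for q and M N :: "('o, 'a, 'b, 'k) bimod"
    by (rule graded_mapI) (simp_all add: lin_id that)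
  have fp: "graded_map C\<^sub>e p ?K K ?f" and fm: "graded_map C\<^sub>e (- p) K ?K ?f" by (rule f; simp add: fun_eq_iff)+
  note in1 = tmap_in[OF sK K fp] and in2 = tmap_in[OF K sK fm]
  have m: "dg_morphism C (T ?K) (shift p (T K)) (tmap p ?f)"
  proof (rule dg_morphismI[OF dg_module_tw[OF sK] dg_module_shift[OF dg_module_tw[OF K]] tmap_linear[OF sK K fp]])
    fix x n t assume x: "x \<in> Obj C" and t: "t \<in> Car (T ?K) x n"
    show "tmap p ?f x n t \<in> Car (shift p (T K)) x n" using in1[OF x t refl] by simp
    have dt: "tmap p ?f x (n + 1) (MDiff (T ?K) x n t) \<in> Car (T K) x (n + p + 1)"
      by (rule in1[OF x tw_d_in[OF sK x t]]) simp
    have "tmap p ?f x (n + 1) (MDiff (T ?K) x n t) = sgn_pow p (MDiff (T K) x (n + p) (tmap p ?f x n t))"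
    proof (rule tw_eqI[OF dt sgn_pow_in[OF tw_subspace[OF K x] tw_d_in[OF K x in1[OF x t refl]]]])
      fix k assume k: "k \<in> J"
      have e: "n - dg k + p = n + p - dg k" by simp
      show "prj k (tmap p ?f x (n + 1) (MDiff (T ?K) x n t)) = prj k (sgn_pow p (MDiff (T K) x (n + p) (tmap p ?f x n t)))"
        using prj_tmap_d[OF sK K fp x t k refl refl refl refl] by (simp add: e)
    qed
    then show "tmap p ?f x (n + 1) (MDiff (T ?K) x n t) = MDiff (shift p (T K)) x n (tmap p ?f x n t)" by simp
  next
    fix x y i j t g assume "x \<in> Obj C" "y \<in> Obj C" "t \<in> Car (T ?K) y i" "g \<in> Hom C x y j"
    then show "tmap p ?f x (i + j) (Act (T ?K) x y i j t g) = Act (shift p (T K)) x y i j (tmap p ?f y i t) g"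
      unfolding shift_simps by (rule tmap_act[OF sK K fp]) simp
  qed
  have "quasi_iso C (T ?K) (shift p (T K)) (tmap p ?f)"
  proof (rule quasi_iso_bij[OF m])
    fix x n assume x: "x \<in> Obj C"
    show "bij_betw (tmap p ?f x n) (Car (T ?K) x n) (Car (shift p (T K)) x n)"
    proof (rule bij_betw_byWitness[where f' = "tmap (- p) ?f x (n + p)"])
      show "\<forall>t\<in>Car (T ?K) x n. tmap (- p) ?f x (n + p) (tmap p ?f x n t) = t"
      proof
        fix t assume t: "t \<in> Car (T ?K) x n"
        note t1 = in1[OF x t refl]
        show "tmap (- p) ?f x (n + p) (tmap p ?f x n t) = t"
          by (rule tw_eqI[OF in2[OF x t1 refl] t])
            (simp add: prj_tmap[OF K sK fm x t1] prj_tmap[OF sK K fp x t])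
      qed
      show "\<forall>t\<in>Car (shift p (T K)) x n. tmap p ?f x n (tmap (- p) ?f x (n + p) t) = t"
      proof
        fix t assume "t \<in> Car (shift p (T K)) x n"
        then have t: "t \<in> Car (T K) x (n + p)" by simp
        have t1: "tmap (- p) ?f x (n + p) t \<in> Car (T ?K) x n" by (rule in2[OF x t]) simp
        show "tmap p ?f x n (tmap (- p) ?f x (n + p) t) = t"
          by (rule tw_eqI[OF in1[OF x t1 refl] t])
            (simp add: prj_tmap[OF K sK fm x t] prj_tmap[OF sK K fp x t1])
      qed
      show "tmap p ?f x n ` Car (T ?K) x n \<subseteq> Car (shift p (T K)) x n" using in1[OF x] by auto
      show "tmap (- p) ?f x (n + p) ` Car (shift p (T K)) x n \<subseteq> Car (T ?K) x n" using in2[OF x, of _ "n + p" n] by auto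
    qed
  qed
  then show ?thesis by (rule derived_iso_quasi_iso)
qed

end


section \<open>Twisted sums of generated bimodules\<close>

locale filtered_twisted = twisted index basis C J ob dg \<delta> + infinite_basis basis
  for index :: "'j itself" and basis :: "'b itself" and C :: "('o, 'a, 'k::field) dgcat" and J ob dg \<delta> +
  fixes lev :: "'j \<Rightarrow> nat"
  assumes \<delta>_lev: "\<lbrakk>i \<in> J; \<delta> i j \<noteq> 0\<rbrakk> \<Longrightarrow> lev j < lev i"
begin

text \<open>A cycle is reduced to lower levels by subtracting the boundary of primitives of its top components.\<close>

lemma tw_acyclic:
  assumes A: "acyclic_module C\<^sub>e (K :: ('o, 'a, 'b, 'k) bimod)"
  shows "acyclic_module C (T K)"
proof -
  have K: "dg_module C\<^sub>e K" using A by (rule acyclic_module_module)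
  interpret K: bimodule C K using K by (simp add: bimodule_def dg_category_axioms)
  interpret TK: dg_module C "T K" by (rule dg_module_tw[OF K])
  have main: "\<exists>u\<in>Car (T K) x (n - 1). t = MDiff (T K) x (n - 1) u"
    if "x \<in> Obj C" "t \<in> Car (T K) x n" "MDiff (T K) x n t = 0" "\<forall>j. prj j t \<noteq> 0 \<longrightarrow> lev j < N" for x n t N
    using that
  proof (induction N arbitrary: t)
    case 0
    have "prj j t = 0" for j :: 'j using 0(4) by auto
    then have "t = 0" by (rule vec_eqI[of t 0, simplified])
    then show ?case using 0(1) TK.mem_0 TK.d_0 by (intro bexI[of _ 0]) auto
  next
    case (Suc N)
    note x = Suc.prems(1) and t = Suc.prems(2)
    \<comment> \<open>The connection strictly lowers the level, so only the inner differential
      contributes to the components of top level; these are therefore cycles in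
      \<open>K\<close>.\<close>
    have lact0: "conn K x m i k v = 0"
      if "i \<in> J" "k \<in> J" "lev i \<le> lev k" "v \<in> Car K (ob i, x) (m - dg i)" for i k v m
    proof -
      have "\<delta> i k = 0" using \<delta>_lev[OF that(1), of k] that(3) by force
      then show ?thesis using conn_0[OF K x that(1,2,4)] by simp
    qed
    have ex: "\<forall>j. \<exists>u. j \<in> J \<and> lev j = N \<longrightarrow> u \<in> Car K (ob j, x) (n - 1 - dg j) \<and> prj j t = MDiff K (ob j, x) (n - 1 - dg j) u"
    proof
      fix j
      show "\<exists>u. j \<in> J \<and> lev j = N \<longrightarrow> u \<in> Car K (ob j, x) (n - 1 - dg j) \<and> prj j t = MDiff K (ob j, x) (n - 1 - dg j) u"
      proof (cases "j \<in> J \<and> lev j = N")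
      case True
      then have j: "j \<in> J" "lev j = N" by auto
      have "sgn_pow (dg j) (MDiff K (ob j, x) (n - dg j) (prj j t)) = prj j (MDiff (T K) x n t)"
        unfolding tw_prj_d[OF K x t j(1) finite_prj order_refl tw_supp[OF t]]
        using lact0[OF _ j(1) _ tw_mem[OF t]] tw_supp[OF t] Suc.prems(4) j(2)
        by (simp add: sum.neutral less_Suc_eq_le subset_iff)
      then have "MDiff K (ob j, x) (n - dg j) (prj j t) = 0" using Suc.prems(3) by simp
      then show ?thesis
        using acyclicD[OF A, of "(ob j, x)" "prj j t" "n - dg j" "n - 1 - dg j"] tw_mem[OF t j(1)] x j by (auto simp: ob_in)
      qed auto
    qed
    from choice[OF ex] obtain v where
      v': "\<forall>j. j \<in> J \<and> lev j = N \<longrightarrow> v j \<in> Car K (ob j, x) (n - 1 - dg j) \<and> prj j t = MDiff K (ob j, x) (n - 1 - dg j) (v j)" ..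
    have v: "v j \<in> Car K (ob j, x) (n - 1 - dg j)" "prj j t = MDiff K (ob j, x) (n - 1 - dg j) (v j)"
      if "j \<in> J" "lev j = N" for j
      using v' that by simp_all
    define S where "S = {j. prj j t \<noteq> 0 \<and> lev j = N}"
    have S: "finite S" "S \<subseteq> J" using tw_supp[OF t] finite_subset[OF _ finite_prj[of t]] by (auto simp: S_def)
    \<comment> \<open>The sign undoes the one with which the inner differential enters the twisted
      differential.\<close>
    define u where "u = (\<Sum>j\<in>S. push j (sgn_pow (dg j) (v j)))"
    have u: "u \<in> Car (T K) x (n - 1)"
      unfolding u_def
      by (intro TK.mem_sum x tw_push_in[OF K x] K.K.mem_sgn v) (use S x in \<open>auto simp: S_def ob_in\<close>)
    have pu: "prj j u = (if j \<in> S then sgn_pow (dg j) (v j) else 0)" for j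
      using S by (simp add: u_def prj_sum prj_push)
    have supp_u: "{i. prj i u \<noteq> 0} \<subseteq> S" by (auto simp: pu split: if_splits)
    let ?t = "t - MDiff (T K) x (n - 1) u"
    have du: "MDiff (T K) x (n - 1) u \<in> Car (T K) x n" by (rule TK.d_in[OF x u]) simp
    have t': "?t \<in> Car (T K) x n" by (rule TK.mem_diff[OF x t du])
    have dt': "MDiff (T K) x n ?t = 0"
      using x t u du Suc.prems(3) by (simp add: TK.d_diff TK.dd)
    have pd: "prj k (MDiff (T K) x (n - 1) u) = sgn_pow (dg k) (MDiff K (ob k, x) (n - 1 - dg k) (prj k u)) +
        (\<Sum>i\<in>S. conn K x (n - 1) i k (prj i u))" if "k \<in> J" for k
      by (rule tw_prj_d[OF K x u that S(1) supp_u S(2)])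
    have d0: "MDiff K (ob k, x) (n - 1 - dg k) 0 = 0" if "k \<in> J" for k
      using K.K.d_0[of "(ob k, x)"] that x by (simp add: ob_in)
    have sum0: "(\<Sum>i\<in>S. conn K x (n - 1) i k (prj i u)) = 0"
      if "k \<in> J" "N \<le> lev k" for k
    proof (rule sum.neutral, intro ballI)
      fix i assume "i \<in> S"
      then have i: "i \<in> J" "lev i = N" using S by (auto simp: S_def)
      show "conn K x (n - 1) i k (prj i u) = 0"
        by (rule lact0[OF i(1) that(1) _ tw_mem[OF u i(1)]]) (use i that in simp)
    qed
    have "\<forall>j. prj j ?t \<noteq> 0 \<longrightarrow> lev j < N"
    proof (intro allI impI, rule ccontr)
      fix k :: 'j assume k: "prj k ?t \<noteq> 0" "\<not> lev k < N"
      have kJ: "k \<in> J" using k(1) tw_supp[OF t'] by blast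
      have pdk: "prj k (MDiff (T K) x (n - 1) u) = sgn_pow (dg k) (MDiff K (ob k, x) (n - 1 - dg k) (prj k u))"
        using pd[OF kJ] sum0[OF kJ] k(2) by simp
      show False
      proof (cases "prj k t = 0")
        case True
        then have "k \<notin> S" by (simp add: S_def)
        then show False using k(1) True pdk d0[OF kJ] by (simp add: pu)
      next
        case False
        then have lk: "lev k = N" using Suc.prems(4) k(2) by force
        then have "k \<in> S" using False by (simp add: S_def)
        then have "prj k (MDiff (T K) x (n - 1) u) = prj k t"
          using pdk v[OF kJ lk] K.K.d_sgn[of "(ob k, x)" "v k"] kJ x by (simp add: pu ob_in sgn_pow_even)
        then show False using k(1) by simp
      qed
    qed
    from Suc.IH[OF x t' dt' this] obtain w where w: "w \<in> Car (T K) x (n - 1)" "?t = MDiff (T K) x (n - 1) w" by blast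
    then have "t = MDiff (T K) x (n - 1) (w + u)" using x u by (simp add: TK.d_add algebra_simps)
    then show ?case using w u x TK.mem_add by blast
  qed
  show ?thesis
    unfolding acyclic_module_def
  proof (intro conjI ballI allI impI TK.dg_module_axioms)
    fix x n t assume *: "x \<in> Obj C" "t \<in> Car (T K) x n" "MDiff (T K) x n t = 0"
    have "finite (lev ` {j. prj j t \<noteq> 0})" by simp
    then obtain N where "\<forall>l\<in>lev ` {j. prj j t \<noteq> 0}. l < N" using finite_nat_set_iff_bounded by blast
    then show "\<exists>u\<in>Car (T K) x (n - 1). t = MDiff (T K) x (n - 1) u" by (intro main[OF *, of N]) blast
  qed
qed

text \<open>The two cones differ only in the order in which pairs and families are coded, and by
  signs on the shifted part, as the projection from a cone to its unshifted source has degree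
  1.\<close>

lemma tw_cone:
  assumes \<phi>: "dg_morphism C\<^sub>e K (L :: ('o, 'a, 'b, 'k) bimod) \<phi>"
  shows "\<exists>\<psi>. quasi_iso C (T (cone_module K L \<phi>)) (cone_module (T K) (T L) (tmap 0 \<phi>)) \<psi>"
proof -
  let ?N = "cone_module K L \<phi>" and ?M = "cone_module (T K) (T L) (tmap 0 \<phi>)"
  note K = mor_source[OF \<phi>] and L = mor_target[OF \<phi>] and N = dg_module_cone[OF \<phi>] and \<phi>T = tw_map_mor[OF \<phi>]
  note M = dg_module_cone[OF \<phi>T(1)]
  interpret K: dg_module C\<^sub>e K by (rule K)
  interpret L: dg_module C\<^sub>e L by (rule L)
  have f: "graded_map C\<^sub>e 0 ?N L (\<lambda>x n. vfst)" and g: "graded_map C\<^sub>e 1 ?N K (\<lambda>x n. vsnd)"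
    by (rule graded_mapI; (rule linear_map_onI)?; auto)+
  have f': "graded_map C\<^sub>e 0 L ?N (\<lambda>x n v. vpair v 0)" and g': "graded_map C\<^sub>e (-1) K ?N (\<lambda>x n. vpair 0)"
    by (rule graded_mapI; (rule linear_map_onI)?; auto simp: K.mem_0 L.mem_0 K.act_0 L.act_0)+
  note pf = prj_tmap[OF N L f] and pg = prj_tmap[OF N K g] and fin = tmap_in[OF N L f] and gin = tmap_in[OF N K g]
  note pf' = prj_tmap[OF L N f'] and pg' = prj_tmap[OF K N g'] and fin' = tmap_in[OF L N f'] and gin' = tmap_in[OF K N g']
  let ?\<psi> = "\<lambda>x n w. vpair (tmap 0 (\<lambda>x n. vfst) x n w) (tmap 1 (\<lambda>x n. vsnd) x n w)"
  let ?\<chi> = "\<lambda>x n w. tmap 0 (\<lambda>x n v. vpair v 0) x n (vfst w) + tmap (-1) (\<lambda>x n. vpair 0) x (n + 1) (vsnd w)"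
  have \<psi>_in: "?\<psi> x n w \<in> Car ?M x n" if "x \<in> Obj C" "w \<in> Car (T ?N) x n" for x n w
    using fin[OF that, of n] gin[OF that refl] by simp
  have m: "dg_morphism C (T ?N) ?M ?\<psi>"
  proof (rule dg_morphismI[OF dg_module_tw[OF N] M _ \<psi>_in])
    fix x n assume x: "x \<in> Obj C"
    show "linear_map_on (Car (T ?N) x n) (?\<psi> x n)"
      using tmap_linear[OF N L f x, of n] tmap_linear[OF N K g x, of n]
      by (intro linear_map_onI) (simp_all add: linear_map_on_def)
    fix w assume w: "w \<in> Car (T ?N) x n"
    note fw = fin[OF x w, of n, simplified] and gw = gin[OF x w refl] and dw = tw_d_in[OF N x w]
    have "tmap 0 (\<lambda>x n. vfst) x (n + 1) (MDiff (T ?N) x n w) = MDiff (T L) x n (tmap 0 (\<lambda>x n. vfst) x n w) + tmap 0 \<phi> x (n + 1) (tmap 1 (\<lambda>x n. vsnd) x n w)"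
      (is "?l = ?r")
    proof (rule tw_eqI[OF fin[OF x dw refl]])
      show "?r \<in> Car (T L) x (n + 1)"
        by (rule kvec.subspace_add[OF tw_subspace[OF L x] tw_d_in[OF L x fw] mor_in[OF \<phi>T(1) x gw]])
      fix k assume k: "k \<in> J"
      have e: "n + 1 - dg k = n - dg k + 1" by simp
      have "vsnd (prj k w) \<in> Car K (ob k, x) (n - dg k + 1)" using tw_mem[OF w k] by simp
      then show "prj k ?l = prj k ?r"
        using k prj_tmap_d[OF N L f x w k _ refl refl refl, of n] mor_sgn[OF \<phi> obj_pair[OF x k]]
        by (simp add: \<phi>T(2)[OF x gw] pg[OF x w] e)
    qed
    moreover have "tmap 1 (\<lambda>x n. vsnd) x (n + 1) (MDiff (T ?N) x n w) = - MDiff (T K) x (n + 1) (tmap 1 (\<lambda>x n. vsnd) x n w)" (is "?l = ?r")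
    proof (rule tw_eqI[OF gin[OF x dw refl] kvec.subspace_neg[OF tw_subspace[OF K x] tw_d_in[OF K x gw]]])
      fix k assume k: "k \<in> J"
      show "prj k ?l = prj k ?r"
        using prj_tmap_d[OF N K g x w k refl refl refl refl] by (simp add: algebra_simps)
    qed
    ultimately show "?\<psi> x (n + 1) (MDiff (T ?N) x n w) = MDiff ?M x n (?\<psi> x n w)" by simp
  next
    fix x y i j w h assume *: "x \<in> Obj C" "y \<in> Obj C" "w \<in> Car (T ?N) y i" "h \<in> Hom C x y j"
    show "?\<psi> x (i + j) (Act (T ?N) x y i j w h) = Act ?M x y i j (?\<psi> y i w) h"
      using tmap_act[OF N L f *, of i] tmap_act[OF N K g * refl] by simp
  qed
  have "quasi_iso C (T ?N) ?M ?\<psi>"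
  proof (rule quasi_iso_bij[OF m])
    fix x n assume x: "x \<in> Obj C"
    have \<chi>_in: "?\<chi> x n w \<in> Car (T ?N) x n" if "w \<in> Car ?M x n" for w
      using that by (intro kvec.subspace_add tw_subspace[OF N x] fin'[OF x] gin'[OF x]) auto
    show "bij_betw (?\<psi> x n) (Car (T ?N) x n) (Car ?M x n)"
    proof (rule bij_betw_byWitness[where f' = "?\<chi> x n"])
      show "\<forall>w\<in>Car (T ?N) x n. ?\<chi> x n (?\<psi> x n w) = w"
      proof
        fix w assume w: "w \<in> Car (T ?N) x n"
        note fw = fin[OF x w, of n, simplified] and gw = gin[OF x w refl]
        show "?\<chi> x n (?\<psi> x n w) = w"
          by (rule tw_eqI[OF \<chi>_in[OF \<psi>_in[OF x w]] w])
            (simp add: pf'[OF x fw] pg'[OF x gw] pf[OF x w] pg[OF x w] sgn_pow_even)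
      qed
      show "\<forall>w\<in>Car ?M x n. ?\<psi> x n (?\<chi> x n w) = w"
      proof
        fix w assume w: "w \<in> Car ?M x n"
        then have v: "vfst w \<in> Car (T L) x n" "vsnd w \<in> Car (T K) x (n + 1)" by auto
        have "tmap 0 (\<lambda>x n. vfst) x n (?\<chi> x n w) = vfst w"
          by (rule tw_eqI[OF fin[OF x \<chi>_in[OF w]] v(1)])
            (simp_all add: pf[OF x \<chi>_in[OF w]] pf'[OF x v(1)] pg'[OF x v(2)])
        moreover have "tmap 1 (\<lambda>x n. vsnd) x n (?\<chi> x n w) = vsnd w"
          by (rule tw_eqI[OF gin[OF x \<chi>_in[OF w] refl] v(2)])
            (simp add: pg[OF x \<chi>_in[OF w]] pf'[OF x v(1)] pg'[OF x v(2)] sgn_pow_even)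
        ultimately show "?\<psi> x n (?\<chi> x n w) = w" by simp
      qed
      show "?\<psi> x n ` Car (T ?N) x n \<subseteq> Car ?M x n" using \<psi>_in[OF x] by blast
      show "?\<chi> x n ` Car ?M x n \<subseteq> Car (T ?N) x n" using \<chi>_in by blast
    qed
  qed
  then show ?thesis by (rule exI[of _ ?\<psi>])
qed

text \<open>Passing to cones reduces this to the preservation of acyclic bimodules, for which the
  filtration by levels is used.\<close>

lemma tw_quasi_iso:
  assumes \<phi>: "quasi_iso C\<^sub>e K (L :: ('o, 'a, 'b, 'k) bimod) \<phi>"
  shows "quasi_iso C (T K) (T L) (tmap 0 \<phi>)"
proof -
  note m = quasi_iso_mor[OF \<phi>]
  have "acyclic_module C (T (cone_module K L \<phi>))"
    by (rule tw_acyclic) (simp add: acyclic_cone_iff[OF m] \<phi>)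
  then have "acyclic_module C (cone_module (T K) (T L) (tmap 0 \<phi>))"
    using tw_cone[OF m] quasi_iso_acyclic by blast
  then show ?thesis by (simp add: acyclic_cone_iff[OF tw_map_mor(1)[OF m]])
qed

lemma tw_derived_iso:
  assumes "derived_iso C\<^sub>e K (L :: ('o, 'a, 'b, 'k) bimod)"
  shows "derived_iso C (T K) (T L)"
proof -
  have K: "dg_module C (T K)" using dg_module_tw assms derived_iso_module by blast
  show ?thesis
    using assms
  proof (induction rule: derived_iso_induct)
    case refl
    show ?case using K by (rule derived_iso_refl)
  next
    case (forward X Y \<phi>)
    show ?case by (rule derived_iso_trans[OF forward(1) derived_iso_quasi_iso[OF tw_quasi_iso[OF forward(2)]]])
  next
    case (backward X Y \<phi>)
    show ?case by (rule derived_iso_trans[OF backward(1) derived_iso_sym[OF derived_iso_quasi_iso[OF tw_quasi_iso[OF backward(2)]]]])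
  qed
qed

lemma tw_derived_summand:
  assumes "derived_summand C\<^sub>e K (L :: ('o, 'a, 'b, 'k) bimod)"
  shows "derived_summand C (T K) (T L)"
proof -
  obtain Z S where S: "is_direct_sum C\<^sub>e UNIV (\<lambda>b::bool. if b then K else Z) S" "derived_iso C\<^sub>e S L"
    using assms unfolding derived_summand_def by (elim exE conjE)
  obtain \<iota> \<pi> where "dsum C\<^sub>e UNIV (\<lambda>b::bool. if b then K else Z) S \<iota> \<pi>"
    using is_direct_sum_imp_dsum[OF S(1)] by blast
  from dsum_imp_is_direct_sum[OF tw_dsum[OF this]]
  have "is_direct_sum C UNIV (\<lambda>b::bool. if b then T K else T Z) (T S)" by (simp add: if_distrib[of T])
  then show ?thesis
    unfolding derived_summand_def using tw_derived_iso[OF S(2)] by blast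
qed

lemma tw_derived_cone:
  assumes "derived_cone C\<^sub>e K L (X :: ('o, 'a, 'b, 'k) bimod)"
  shows "derived_cone C (T K) (T L) (T X)"
proof -
  obtain P \<sigma> \<phi> Y where d: "quasi_iso C\<^sub>e P K \<sigma>" "is_cone C\<^sub>e P L \<phi> Y" "derived_iso C\<^sub>e Y X"
    using assms unfolding derived_cone_def by (elim exE conjE)
  have \<phi>: "dg_morphism C\<^sub>e P L \<phi>" using d(2) by (simp add: is_cone_def)
  obtain \<chi> where \<chi>: "quasi_iso C\<^sub>e (cone_module P L \<phi>) Y \<chi>" using is_cone_iso[OF d(2)] by (rule exE)
  obtain \<psi> where \<psi>: "quasi_iso C (T (cone_module P L \<phi>)) (cone_module (T P) (T L) (tmap 0 \<phi>)) \<psi>"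
    using tw_cone[OF \<phi>] by (rule exE)
  note tw_derived_iso[OF derived_iso_trans[OF derived_iso_quasi_iso[OF \<chi>] d(3)]]
  from derived_iso_trans[OF derived_iso_sym[OF derived_iso_quasi_iso[OF \<psi>]] this] show ?thesis
    unfolding derived_cone_def using tw_quasi_iso[OF d(1)] is_cone_cone[OF tw_map_mor(1)[OF \<phi>]] by (intro exI conjI)
qed

end

section \<open>Transport of approximability from bimodules to modules\<close>

lemma generated_module: "M \<in> generated C \<A> \<Longrightarrow> dg_module C M"
  by (induction rule: generated.induct)
    (auto intro: derived_iso_module derived_summand_module dg_module_shift simp: is_direct_sum_def)

locale tensor_functor = filtered_twisted index basis C J ob dg \<delta> lev + enough_kproj basis C
  for index :: "'j itself" and basis :: "'b itself" and C :: "('o, 'a, 'k::field) dgcat" and J ob dg \<delta> lev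
begin

text \<open>The functor \<open>T\<close> respects each closure operation in
  \<open>generated\<close>, and approximability is stable under the corresponding operations on
  modules.\<close>

lemma approximable_tw_generated:
  fixes \<A> :: "('o, 'a, 'b, 'k) bimod set"
  assumes \<G>: "perf_class C \<G>" and \<A>: "\<And>K. K \<in> \<A> \<Longrightarrow> dg_module C\<^sub>e K \<Longrightarrow> approximable C \<G> (T K)"
    and K: "K \<in> generated C\<^sub>e \<A>"
  shows "approximable C \<G> (T K)"
  using K
proof (induction rule: generated.induct)
  case (base M)
  then show ?case by (rule \<A>)
next
  case (iso M N)
  show ?case by (rule approximable_derived_iso[OF \<G> tw_derived_iso[OF iso(2)] iso(3)])
next
  case (summand M N)
  show ?case by (rule approximable_summand[OF \<G> tw_derived_summand[OF summand(2)] summand(3)])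
next
  case (shift M p)
  show ?case
    by (rule approximable_derived_iso[OF \<G> derived_iso_sym[OF tw_shift[OF generated_module[OF shift(1)]]] approximable_shift[OF \<G> shift(2)]])
next
  case (sum n M S)
  obtain \<iota> \<pi> where "dsum C\<^sub>e {..<n} M S \<iota> \<pi>" using is_direct_sum_imp_dsum[OF sum(2)] by blast
  from tw_dsum[OF this] show ?case
    by (rule approximable_finite_dsum[OF \<G>]) (use sum(3) in auto)
qed

lemma approximable_tw_generated_in:
  fixes G\<^sub>1\<^sub>2 :: "('o, 'a, 'b, 'k) bimod"
  assumes G: "G \<in> Perf C" and G12: "approximable C (generated C {G}) (T G\<^sub>1\<^sub>2)" and K: "K \<in> generated_in C\<^sub>e {G\<^sub>1\<^sub>2} m"
  shows "approximable C (generated_in C {G} m) (T K)"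
  using K
proof (induction m arbitrary: K)
  case 0
  have "T K \<in> generated_in C {G} 0" using tw_acyclic 0 by simp
  show ?case by (rule approximable_self[OF perf_class_generated_in \<open>T K \<in> generated_in C {G} 0\<close>]) (use G in simp)
next
  case (Suc m)
  have \<A>: "{G} \<subseteq> Perf C" using G by simp
  show ?case
  proof (rule approximable_tw_generated[OF perf_class_generated_in[OF \<A>]])
    show "K \<in> generated C\<^sub>e (star C\<^sub>e (generated_in C\<^sub>e {G\<^sub>1\<^sub>2} m) (generated C\<^sub>e {G\<^sub>1\<^sub>2}))" using Suc.prems by simp
    fix X assume "X \<in> star C\<^sub>e (generated_in C\<^sub>e {G\<^sub>1\<^sub>2} m) (generated C\<^sub>e {G\<^sub>1\<^sub>2})"
    then obtain M N where MN: "M \<in> generated_in C\<^sub>e {G\<^sub>1\<^sub>2} m" "N \<in> generated C\<^sub>e {G\<^sub>1\<^sub>2}" "derived_cone C\<^sub>e M N X"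
      by (auto simp: star_def)
    have N: "approximable C (generated C {G}) (T N)"
      by (rule approximable_tw_generated[OF perf_class_generated[OF \<A>] _ MN(2)]) (use G12 in simp)
    show "approximable C (generated_in C {G} (Suc m)) (T X)"
      by (rule approximable_derived_cone[OF perf_class_generated_in[OF \<A>] perf_class_generated[OF \<A>] perf_class_generated_in[OF \<A>]
            _ tw_derived_cone[OF MN(3)] Suc.IH[OF MN(1)] N]) (rule cone_module_in_generated_in)
  qed
qed

end


section \<open>The diagonal bimodule and tensor products\<close>

text \<open>The maps \<open>\<epsilon>\<close> copy the morphism spaces, which live over
  \<open>'a\<close>, into the universe of modules over \<open>'b\<close>. Besides its role in the
  theorem the diagonal serves as the source of free modules for the resolutions.\<close>

locale diagonal_bimodule = bimodule C D
  for C :: "('o, 'a, 'k::field) dgcat" and D :: "('o, 'a, 'b, 'k) bimod" +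
  fixes \<epsilon> :: "'o \<Rightarrow> 'o \<Rightarrow> int \<Rightarrow> ('a \<Rightarrow>\<^sub>0 'k) \<Rightarrow> ('b, 'k) vec"
  assumes eps_bij: "\<lbrakk>x \<in> Obj C; y \<in> Obj C\<rbrakk> \<Longrightarrow> bij_betw (\<epsilon> y x n) (Hom C x y n) (Car D (y, x) n)"
    and eps_linear: "\<lbrakk>x \<in> Obj C; y \<in> Obj C\<rbrakk> \<Longrightarrow> linear_map_on (Hom C x y n) (\<epsilon> y x n)"
    and eps_d: "\<lbrakk>x \<in> Obj C; y \<in> Obj C; h \<in> Hom C x y n\<rbrakk> \<Longrightarrow> \<epsilon> y x (n + 1) (Diff C x y n h) = MDiff D (y, x) n (\<epsilon> y x n h)"
    and eps_act: "\<lbrakk>x \<in> Obj C; x' \<in> Obj C; y \<in> Obj C; y' \<in> Obj C; h \<in> Hom C x y n; f \<in> Hom C y y' p; g \<in> Hom C x' x q\<rbrakk>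
      \<Longrightarrow> Act D (y', x') (y, x) n (p + q) (\<epsilon> y x n h) (tens p q f g)
          = sgn_pow (p * n) (\<epsilon> y' x' (n + (p + q)) (Comp C x' y y' p (n + q) f (Comp C x' x y n q h g)))"

lemma is_diagonal_imp_diagonal_bimodule:
  assumes "dg_category C" "is_diagonal C D"
  shows "\<exists>\<epsilon>. diagonal_bimodule C D \<epsilon>"
proof -
  from assms(2) obtain \<epsilon> where D: "dg_module (enveloping C) D" and \<epsilon>: "(\<forall>x\<in>Obj C. \<forall>y\<in>Obj C. \<forall>n.
        bij_betw (\<epsilon> y x n) (Hom C x y n) (Car D (y, x) n) \<and> linear_map_on (Hom C x y n) (\<epsilon> y x n) \<and>
        (\<forall>h\<in>Hom C x y n. \<epsilon> y x (n + 1) (Diff C x y n h) = MDiff D (y, x) n (\<epsilon> y x n h)))"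
    "(\<forall>x\<in>Obj C. \<forall>x'\<in>Obj C. \<forall>y\<in>Obj C. \<forall>y'\<in>Obj C. \<forall>n p q.
        \<forall>h\<in>Hom C x y n. \<forall>f\<in>Hom C y y' p. \<forall>g\<in>Hom C x' x q.
        Act D (y', x') (y, x) n (p + q) (\<epsilon> y x n h) (tens p q f g)
          = sgn_pow (p * n) (\<epsilon> y' x' (n + (p + q))
              (Comp C x' y y' p (n + q) f (Comp C x' x y n q h g))))"
    unfolding is_diagonal_def by (elim exE conjE)
  have "diagonal_bimodule C D \<epsilon>"
    using assms(1) D \<epsilon> by (simp add: diagonal_bimodule_def diagonal_bimodule_axioms_def bimodule_def)
  then show ?thesis by (rule exI[of _ \<epsilon>])
qed

context diagonal_bimodule
begin

definition eta where "eta y x n = the_inv_into (Hom C x y n) (\<epsilon> y x n)"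

lemma eps_in: "\<lbrakk>x \<in> Obj C; y \<in> Obj C; h \<in> Hom C x y n\<rbrakk> \<Longrightarrow> \<epsilon> y x n h \<in> Car D (y, x) n"
  using eps_bij[of x y n] by (auto simp: bij_betw_def)

lemma eta_eps: "\<lbrakk>x \<in> Obj C; y \<in> Obj C; h \<in> Hom C x y n\<rbrakk> \<Longrightarrow> eta y x n (\<epsilon> y x n h) = h"
  unfolding eta_def using eps_bij[of x y n] by (simp add: bij_betw_def the_inv_into_f_f)

lemma eps_ex: "\<lbrakk>x \<in> Obj C; y \<in> Obj C; m \<in> Car D (y, x) n\<rbrakk> \<Longrightarrow> \<exists>h\<in>Hom C x y n. m = \<epsilon> y x n h"
  using eps_bij[of x y n] by (auto simp: bij_betw_def)

lemma eta_in: "\<lbrakk>x \<in> Obj C; y \<in> Obj C; m \<in> Car D (y, x) n; k = n\<rbrakk> \<Longrightarrow> eta y x n m \<in> Hom C x y k"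
  using eps_ex[of x y m n] eta_eps[of x y _ n] by auto

lemma eps_eta: "\<lbrakk>x \<in> Obj C; y \<in> Obj C; m \<in> Car D (y, x) n\<rbrakk> \<Longrightarrow> \<epsilon> y x n (eta y x n m) = m"
  using eps_ex[of x y m n] eta_eps[of x y _ n] by auto

lemma eta_linear:
  assumes "x \<in> Obj C" "y \<in> Obj C"
  shows "linear_map_on (Car D (y, x) n) (eta y x n)"
proof (rule linear_map_onI)
  note s = hom_subspace[OF assms, of n]
  fix u v c assume u: "u \<in> Car D (y, x) n"
  then obtain g where g: "g \<in> Hom C x y n" "u = \<epsilon> y x n g" using eps_ex assms by blast
  show "eta y x n (kscale c u) = kscale c (eta y x n u)"
    using g eta_eps[OF assms] lin_scale[OF eps_linear[OF assms] g(1), of c] kvec.subspace_scale[OF s g(1)] by metis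
  assume v: "v \<in> Car D (y, x) n"
  then obtain h where h: "h \<in> Hom C x y n" "v = \<epsilon> y x n h" using eps_ex assms by blast
  show "eta y x n (u + v) = eta y x n u + eta y x n v"
    using g h eta_eps[OF assms] lin_add[OF eps_linear[OF assms] g(1) h(1)] kvec.subspace_add[OF s g(1) h(1)] by metis
qed

lemma lact_eps:
  assumes o: "x \<in> Obj C" "y \<in> Obj C" "z \<in> Obj C" and f: "f \<in> Hom C y z p" and h: "h \<in> Hom C x y n"
  shows "left_act C D z y x p n f (\<epsilon> y x n h) = \<epsilon> z x (p + n) (Comp C x y z p n f h)"
  using eps_act[OF o(1,1,2,3) h f ident_closed[OF o(1)]] comp_ident_right[OF o(1,2) h]
  by (simp add: left_act_def add.commute sgn_pow_even)

lemma ract_eps: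
  assumes o: "x \<in> Obj C" "x' \<in> Obj C" "y \<in> Obj C" and h: "h \<in> Hom C x y n" and g: "g \<in> Hom C x' x q"
  shows "right_act C D y x x' n q (\<epsilon> y x n h) g = \<epsilon> y x' (n + q) (Comp C x' x y n q h g)"
  using eps_act[OF o(1,2,3,3) h ident_closed[OF o(3)] g] comp_ident_left[OF o(2,3) comp_closed[OF o(2,1,3) h g]]
  by (simp add: right_act_def)

lemma eta_lact:
  assumes o: "x \<in> Obj C" "y \<in> Obj C" "z \<in> Obj C" and f: "f \<in> Hom C y z p" and m: "m \<in> Car D (y, x) n" and k: "k = p + n"
  shows "eta z x k (left_act C D z y x p n f m) = Comp C x y z p n f (eta y x n m)"
  using lact_eps[OF o f eta_in[OF o(1,2) m refl]] eta_eps[OF o(1,3) comp_closed[OF o f eta_in[OF o(1,2) m refl]]]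
  by (simp add: eps_eta o m k)

lemma eta_ract:
  assumes o: "x \<in> Obj C" "x' \<in> Obj C" "y \<in> Obj C" and m: "m \<in> Car D (y, x) n" and g: "g \<in> Hom C x' x q" and k: "k = n + q"
  shows "eta y x' k (right_act C D y x x' n q m g) = Comp C x' x y n q (eta y x n m) g"
  using ract_eps[OF o eta_in[OF o(1,3) m refl] g] eta_eps[OF o(2,3) comp_closed[OF o(2,1,3) eta_in[OF o(1,3) m refl] g]]
  by (simp add: eps_eta o m k)

lemma eta_d:
  assumes o: "x \<in> Obj C" "y \<in> Obj C" and m: "m \<in> Car D (y, x) n" and k: "k = n + 1"
  shows "eta y x k (MDiff D (y, x) n m) = Diff C x y n (eta y x n m)"
  using eps_d[OF o eta_in[OF o m refl]] eta_eps[OF o diff_closed[OF o eta_in[OF o m refl]]]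
  by (simp add: eps_eta o m k)

lemma balanced_eta:
  assumes "dg_module C F" "x \<in> Obj C"
  shows "balanced C F D x (\<lambda>y i j u m. Act F x y i j u (eta y x j m))"
proof -
  interpret F: dg_module C F by fact
  show ?thesis
    unfolding balanced_def bilinear_map_on_def
    using assms(2)
    by (auto intro!: F.act_linear_left eta_in lin_compose[OF eta_linear F.act_linear_right] simp: eta_lact F.act_act eta_in)
qed

text \<open>The tensor of \<open>u\<close> and the copy of a morphism is the product of the two. A
  balanced map \<open>\<psi>\<close> is recovered from its values at the identities, as the morphism
  can be moved to the left factor.\<close>

lemma is_tensor_over_diagonal:
  assumes F: "dg_module C (F :: ('o, 'a, 'b, 'k) dgmod)"
  shows "is_tensor_over C F D F"
proof -
  interpret F: dg_module C F by fact
  let ?\<theta> = "\<lambda>x y i j u m. Act F x y i j u (eta y x j m)"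
  have span: "Car F x n = kvec.span {?\<theta> x y i j u m | y i j u m. y \<in> Obj C \<and> i + j = n \<and> u \<in> Car F y i \<and> m \<in> Car D (y, x) j}"
    (is "_ = kvec.span ?X") if x: "x \<in> Obj C" for x n
  proof (rule equalityI)
    show "Car F x n \<subseteq> kvec.span ?X"
    proof
      fix u assume u: "u \<in> Car F x n"
      have "u = ?\<theta> x x n 0 u (\<epsilon> x x 0 (Ident C x))"
        using x u by (simp add: eta_eps ident_closed F.act_ident)
      then have "u \<in> ?X" using x u eps_in[OF x x ident_closed[OF x]] by fastforce
      then show "u \<in> kvec.span ?X" by (rule kvec.span_base)
    qed
    show "kvec.span ?X \<subseteq> Car F x n"
      by (rule kvec.span_minimal[OF _ F.car_subspace[OF x]]) (use x in \<open>auto intro!: F.act_in eta_in\<close>)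
  qed
  have universal: "\<exists>L. linear_map_on (Car F x n) L \<and> (\<forall>y\<in>Obj C. \<forall>i j. i + j = n \<longrightarrow>
      (\<forall>u\<in>Car F y i. \<forall>m\<in>Car D (y, x) j. L (?\<theta> x y i j u m) = \<psi> y i j u m))"
    if x: "x \<in> Obj C" and \<psi>: "balanced C F D x \<psi>" for x n and \<psi> :: "'o \<Rightarrow> int \<Rightarrow> int \<Rightarrow> ('b, 'k) vec \<Rightarrow> ('b, 'k) vec \<Rightarrow> ('b, 'k) vec"
  proof (intro exI conjI ballI allI impI)
    note e = eps_in[OF x x ident_closed[OF x]]
    show "linear_map_on (Car F x n) (\<lambda>u. \<psi> x n 0 u (\<epsilon> x x 0 (Ident C x)))"
      using \<psi> x e by (simp add: balanced_def bilinear_map_on_def)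
    fix y i j u m assume *: "y \<in> Obj C" "i + j = n" "u \<in> Car F y i" "m \<in> Car D (y, x) j"
    have "\<psi> x (i + j) 0 (?\<theta> x y i j u m) (\<epsilon> x x 0 (Ident C x)) =
        \<psi> y i (j + 0) u (left_act C D y x x j 0 (eta y x j m) (\<epsilon> x x 0 (Ident C x)))"
      using \<psi> x * e eta_in[OF x *(1,4) refl] unfolding balanced_def by blast
    also have "\<dots> = \<psi> y i j u m"
      using x * by (simp add: lact_eps eta_in ident_closed comp_ident_right eps_eta)
    finally show "\<psi> x n 0 (?\<theta> x y i j u m) (\<epsilon> x x 0 (Ident C x)) = \<psi> y i j u m" using *(2) by simp
  qed
  show ?thesis
    unfolding is_tensor_over_def
  proof (intro conjI exI[of _ ?\<theta>] F K.dg_module_axioms ballI allI impI)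
    fix x assume x: "x \<in> Obj C"
    show "balanced C F D x (?\<theta> x)" by (rule balanced_eta[OF F x])
    show "Car F x n = kvec.span {?\<theta> x y i j u m | y i j u m. y \<in> Obj C \<and> i + j = n \<and> u \<in> Car F y i \<and> m \<in> Car D (y, x) j}" for n
      by (rule span[OF x])
    show "\<exists>L. linear_map_on (Car F x n) L \<and> (\<forall>y\<in>Obj C. \<forall>i j. i + j = n \<longrightarrow>
        (\<forall>u\<in>Car F y i. \<forall>m\<in>Car D (y, x) j. L (?\<theta> x y i j u m) = \<psi> y i j u m))"
      if "balanced C F D x \<psi>" for n and \<psi> :: "'o \<Rightarrow> int \<Rightarrow> int \<Rightarrow> ('b, 'k) vec \<Rightarrow> ('b, 'k) vec \<Rightarrow> ('b, 'k) vec"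
      by (rule universal[OF x that])
    fix y i j u m assume *: "y \<in> Obj C" "u \<in> Car F y i" "m \<in> Car D (y, x) j"
    show "MDiff F x (i + j) (?\<theta> x y i j u m) = ?\<theta> x y (i + 1) j (MDiff F y i u) m + sgn_pow i (?\<theta> x y i (j + 1) u (MDiff D (y, x) j m))"
      using x * by (simp add: F.mdiff_act eta_in eta_d)
    fix x' q g assume "x' \<in> Obj C" "g \<in> Hom C x' x q"
    then show "Act F x' x (i + j) q (?\<theta> x y i j u m) g = ?\<theta> x' y i (j + q) u (right_act C D y x x' j q m g)"
      using x * by (simp add: F.act_act eta_in eta_ract)
  qed
qed

end

section \<open>Uniqueness of tensor products over the category\<close>

lemma lin_eq_on_span:
  assumes "linear_map_on V f" "linear_map_on V g" "V = kvec.span X" "v \<in> V" "\<And>x. x \<in> X \<Longrightarrow> f x = g x"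
  shows "f v = g v"
proof -
  have V: "kvec.subspace V" using assms(3) by simp
  have "v \<in> V \<and> f v = g v"
    using assms(4)[unfolded assms(3)]
  proof (induction rule: kvec.span_induct)
    case base
    show ?case
      using V assms(1,2)
      by (auto simp: kvec.subspace_def lin_add lin_scale intro: lin_zero[OF assms(1) V, THEN trans]
          lin_zero[OF assms(2) V, symmetric])
  next
    case (step x)
    then show ?case using assms(3,5) kvec.span_base by blast
  qed
  then show ?thesis by simp
qed

locale tensor_product = C: dg_category C + F: dg_module C F + K: bimodule C K + T: dg_module C T
  for C :: "('o, 'a, 'k::field) dgcat" and F :: "('o, 'a, 'b, 'k) dgmod"
    and K :: "('o, 'a, 'b, 'k) bimod" and T :: "('o, 'a, 'b, 'k) dgmod" +
  fixes \<theta> :: "'o \<Rightarrow> 'o \<Rightarrow> int \<Rightarrow> int \<Rightarrow> ('b, 'k) vec \<Rightarrow> ('b, 'k) vec \<Rightarrow> ('b, 'k) vec"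
  assumes theta_balanced: "x \<in> Obj C \<Longrightarrow> balanced C F K x (\<theta> x)"
    and theta_span: "x \<in> Obj C \<Longrightarrow> Car T x n = kvec.span
        {\<theta> x y i j u m | y i j u m. y \<in> Obj C \<and> i + j = n \<and> u \<in> Car F y i \<and> m \<in> Car K (y, x) j}"
    and theta_universal: "\<lbrakk>x \<in> Obj C; balanced C F K x \<psi>\<rbrakk> \<Longrightarrow> \<exists>L. linear_map_on (Car T x n) L \<and>
          (\<forall>y\<in>Obj C. \<forall>i j. i + j = n \<longrightarrow> (\<forall>u\<in>Car F y i. \<forall>m\<in>Car K (y, x) j. L (\<theta> x y i j u m) = \<psi> y i j u m))"
    and theta_d: "\<lbrakk>x \<in> Obj C; y \<in> Obj C; u \<in> Car F y i; m \<in> Car K (y, x) j\<rbrakk> \<Longrightarrow> MDiff T x (i + j) (\<theta> x y i j u m)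
          = \<theta> x y (i + 1) j (MDiff F y i u) m + sgn_pow i (\<theta> x y i (j + 1) u (MDiff K (y, x) j m))"
    and theta_act: "\<lbrakk>x \<in> Obj C; x' \<in> Obj C; y \<in> Obj C; u \<in> Car F y i; m \<in> Car K (y, x) j; g \<in> Hom C x' x q\<rbrakk>
      \<Longrightarrow> Act T x' x (i + j) q (\<theta> x y i j u m) g = \<theta> x' y i (j + q) u (right_act C K y x x' j q m g)"
begin

lemma theta_in: "\<lbrakk>x \<in> Obj C; y \<in> Obj C; u \<in> Car F y i; m \<in> Car K (y, x) j; n = i + j\<rbrakk> \<Longrightarrow> \<theta> x y i j u m \<in> Car T x n"
  unfolding theta_span by (rule kvec.span_base) blast

lemma theta_eqI:
  assumes "x \<in> Obj C" "linear_map_on (Car T x n) f" "linear_map_on (Car T x n) g" "t \<in> Car T x n"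
    and "\<And>y i j u m. \<lbrakk>y \<in> Obj C; i + j = n; u \<in> Car F y i; m \<in> Car K (y, x) j\<rbrakk> \<Longrightarrow> f (\<theta> x y i j u m) = g (\<theta> x y i j u m)"
  shows "f t = g t"
  by (rule lin_eq_on_span[OF assms(2,3) theta_span[OF assms(1)] assms(4)]) (use assms(5) in blast)

text \<open>The universal property yields a linear map for each object and degree separately. Since
  pure tensors span, compatibility with differential and action has to be checked on them
  only.\<close>

lemma ex_tensor_map:
  assumes "tensor_product C F K T' \<theta>'"
  shows "\<exists>\<phi>. dg_morphism C T T' \<phi> \<and> (\<forall>x\<in>Obj C. \<forall>y\<in>Obj C. \<forall>i j. \<forall>u\<in>Car F y i. \<forall>m\<in>Car K (y, x) j.
    \<phi> x (i + j) (\<theta> x y i j u m) = \<theta>' x y i j u m)"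
proof -
  interpret T': tensor_product C F K T' \<theta>' by fact
  define \<phi> where "\<phi> x n = (SOME L. linear_map_on (Car T x n) L \<and>
          (\<forall>y\<in>Obj C. \<forall>i j. i + j = n \<longrightarrow> (\<forall>u\<in>Car F y i. \<forall>m\<in>Car K (y, x) j. L (\<theta> x y i j u m) = \<theta>' x y i j u m)))" for x n
  have "linear_map_on (Car T x n) (\<phi> x n) \<and>
          (\<forall>y\<in>Obj C. \<forall>i j. i + j = n \<longrightarrow> (\<forall>u\<in>Car F y i. \<forall>m\<in>Car K (y, x) j. \<phi> x n (\<theta> x y i j u m) = \<theta>' x y i j u m))"
    if "x \<in> Obj C" for x n
    unfolding \<phi>_def by (rule someI_ex[OF theta_universal[OF that T'.theta_balanced[OF that]]])
  then have lin: "linear_map_on (Car T x n) (\<phi> x n)"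
    and eq: "y \<in> Obj C \<Longrightarrow> n = i + j \<Longrightarrow> u \<in> Car F y i \<Longrightarrow> m \<in> Car K (y, x) j \<Longrightarrow> \<phi> x n (\<theta> x y i j u m) = \<theta>' x y i j u m"
    if "x \<in> Obj C" for x n y i j u m
    using that by auto
  have in': "\<phi> x n t \<in> Car T' x n" if x: "x \<in> Obj C" and t: "t \<in> Car T x n" for x n t
  proof -
    have "Car T x n \<subseteq> {t\<in>Car T x n. \<phi> x n t \<in> Car T' x n}"
      unfolding theta_span[OF x]
    proof (rule kvec.span_minimal, unfold theta_span[OF x, symmetric])
      show "kvec.subspace {t\<in>Car T x n. \<phi> x n t \<in> Car T' x n}"
        using T.car_subspace[OF x, of n] T'.T.car_subspace[OF x, of n] lin_zero[OF lin[OF x], of n]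
        by (auto simp: kvec.subspace_def lin_add[OF lin[OF x]] lin_scale[OF lin[OF x]])
    qed (use x eq T'.theta_in theta_in in auto)
    then show ?thesis using t by blast
  qed
  show ?thesis
  proof (intro exI[of _ \<phi>] conjI dg_morphismI T.dg_module_axioms T'.T.dg_module_axioms lin in'; (intro ballI allI)?)
    fix x n t assume x: "x \<in> Obj C" and t: "t \<in> Car T x n"
    show "\<phi> x (n + 1) (MDiff T x n t) = MDiff T' x n (\<phi> x n t)"
    proof (rule theta_eqI[OF x _ _ t])
      show "linear_map_on (Car T x n) (\<lambda>t. \<phi> x (n + 1) (MDiff T x n t))"
        by (rule lin_compose[OF T.mdiff_linear[OF x] lin[OF x]]) (rule T.mdiff_closed[OF x])
      show "linear_map_on (Car T x n) (\<lambda>t. MDiff T' x n (\<phi> x n t))"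
        by (rule lin_compose[OF lin[OF x] T'.T.mdiff_linear[OF x]]) (rule in'[OF x])
      fix y i j u m assume *: "y \<in> Obj C" "i + j = n" "u \<in> Car F y i" "m \<in> Car K (y, x) j"
      have d: "MDiff F y i u \<in> Car F y (i + 1)" "MDiff K (y, x) j m \<in> Car K (y, x) (j + 1)"
        using x * by (auto intro: F.d_in K.K.d_in)
      show "\<phi> x (n + 1) (MDiff T x n (\<theta> x y i j u m)) = MDiff T' x n (\<phi> x n (\<theta> x y i j u m))"
        using x * d
        by (simp add: theta_d T'.theta_d eq lin_add[OF lin] lin_sgn_pow[OF lin] theta_in T.mem_sgn flip: \<open>i + j = n\<close>)
    qed
  next
    fix x y i j t f assume o: "x \<in> Obj C" "y \<in> Obj C" and t: "t \<in> Car T y i" and f: "f \<in> Hom C x y j"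
    show "\<phi> x (i + j) (Act T x y i j t f) = Act T' x y i j (\<phi> y i t) f"
    proof (rule theta_eqI[OF o(2) _ _ t])
      show "linear_map_on (Car T y i) (\<lambda>t. \<phi> x (i + j) (Act T x y i j t f))"
        by (rule lin_compose[OF T.act_linear_left[OF o f] lin[OF o(1)]]) (rule T.act_in[OF o _ f refl])
      show "linear_map_on (Car T y i) (\<lambda>t. Act T' x y i j (\<phi> y i t) f)"
        by (rule lin_compose[OF lin[OF o(2)] T'.T.act_linear_left[OF o f]]) (rule in'[OF o(2)])
      fix z p q u m assume *: "z \<in> Obj C" "p + q = i" "u \<in> Car F z p" "m \<in> Car K (z, y) q"
      show "\<phi> x (i + j) (Act T x y i j (\<theta> y z p q u m) f) = Act T' x y i j (\<phi> y i (\<theta> y z p q u m)) f"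
        using o * f K.ract_in[OF o(2,1) *(1) f *(4) refl]
        by (simp add: theta_act T'.theta_act eq flip: \<open>p + q = i\<close>)
    qed
  qed (use eq in auto)
qed

lemma ex_tensor_quasi_iso:
  assumes "tensor_product C F K T' \<theta>'"
  shows "\<exists>\<phi>. quasi_iso C T T' \<phi>"
proof -
  interpret T': tensor_product C F K T' \<theta>' by fact
  obtain \<phi> where \<phi>: "dg_morphism C T T' \<phi>" and \<phi>': "\<forall>x\<in>Obj C. \<forall>y\<in>Obj C. \<forall>i j. \<forall>u\<in>Car F y i. \<forall>m\<in>Car K (y, x) j.
    \<phi> x (i + j) (\<theta> x y i j u m) = \<theta>' x y i j u m"
    using ex_tensor_map[OF assms] by (elim exE conjE)
  obtain \<psi> where \<psi>: "dg_morphism C T' T \<psi>" and \<psi>': "\<forall>x\<in>Obj C. \<forall>y\<in>Obj C. \<forall>i j. \<forall>u\<in>Car F y i. \<forall>m\<in>Car K (y, x) j.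
    \<psi> x (i + j) (\<theta>' x y i j u m) = \<theta> x y i j u m"
    using T'.ex_tensor_map[OF tensor_product_axioms] by (elim exE conjE)
  have "quasi_iso C T T' \<phi>"
  proof (rule quasi_iso_bij[OF \<phi>])
    fix x n assume x: "x \<in> Obj C"
    note in1 = mor_in[OF \<phi> x] and in2 = mor_in[OF \<psi> x]
    have "\<psi> x n (\<phi> x n t) = t" if "t \<in> Car T x n" for t
      by (rule theta_eqI[OF x lin_compose[OF mor_linear[OF \<phi> x] mor_linear[OF \<psi> x] in1] lin_id that])
        (use x \<phi>' \<psi>' in auto)
    moreover have "\<phi> x n (\<psi> x n t) = t" if "t \<in> Car T' x n" for t
      by (rule T'.theta_eqI[OF x lin_compose[OF mor_linear[OF \<psi> x] mor_linear[OF \<phi> x] in2] lin_id that])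
        (use x \<phi>' \<psi>' in auto)
    ultimately show "bij_betw (\<phi> x n) (Car T x n) (Car T' x n)"
      by (intro bij_betw_byWitness[where f' = "\<psi> x n"]) (auto intro: in1 in2)
  qed
  then show ?thesis by (rule exI[of _ \<phi>])
qed

end

lemma tensor_product_imp_is_tensor_over:
  assumes "tensor_product C F K T \<theta>"
  shows "is_tensor_over C F K T"
proof -
  interpret tensor_product C F K T \<theta> by fact
  show ?thesis
    unfolding is_tensor_over_def
    by (intro conjI exI[of _ \<theta>] F.dg_module_axioms K.K.dg_module_axioms T.dg_module_axioms ballI allI impI
        theta_balanced theta_span theta_universal theta_d theta_act)
qed

lemma is_tensor_over_imp_tensor_product:
  fixes F T :: "('o, 'a, 'b, 'k::field) dgmod"
  assumes "dg_category C" "is_tensor_over C F K T"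
  shows "\<exists>\<theta>. tensor_product C F K T \<theta>"
proof -
  obtain \<theta> where t: "\<forall>x\<in>Obj C. balanced C F K x (\<theta> x)"
    "\<forall>x\<in>Obj C. \<forall>n. Car T x n = kvec.span
        {\<theta> x y i j u m | y i j u m. y \<in> Obj C \<and> i + j = n \<and> u \<in> Car F y i \<and> m \<in> Car K (y, x) j}"
    "\<forall>x\<in>Obj C. \<forall>\<psi> :: 'o \<Rightarrow> int \<Rightarrow> int \<Rightarrow> ('b, 'k) vec \<Rightarrow> ('b, 'k) vec \<Rightarrow> ('b, 'k) vec.
        balanced C F K x \<psi> \<longrightarrow> (\<forall>n. \<exists>L. linear_map_on (Car T x n) L \<and>
          (\<forall>y\<in>Obj C. \<forall>i j. i + j = n \<longrightarrow> (\<forall>u\<in>Car F y i. \<forall>m\<in>Car K (y, x) j.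
             L (\<theta> x y i j u m) = \<psi> y i j u m)))"
    "\<forall>x\<in>Obj C. \<forall>y\<in>Obj C. \<forall>i j. \<forall>u\<in>Car F y i. \<forall>m\<in>Car K (y, x) j.
        MDiff T x (i + j) (\<theta> x y i j u m)
          = \<theta> x y (i + 1) j (MDiff F y i u) m + sgn_pow i (\<theta> x y i (j + 1) u (MDiff K (y, x) j m))"
    "\<forall>x\<in>Obj C. \<forall>x'\<in>Obj C. \<forall>y\<in>Obj C. \<forall>i j q. \<forall>u\<in>Car F y i. \<forall>m\<in>Car K (y, x) j. \<forall>g\<in>Hom C x' x q.
        Act T x' x (i + j) q (\<theta> x y i j u m) g = \<theta> x' y i (j + q) u (right_act C K y x x' j q m g)"
    and m: "dg_module C F" "dg_module (enveloping C) K" "dg_module C T"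
    using assms(2) unfolding is_tensor_over_def by (elim exE conjE)
  have "tensor_product C F K T \<theta>"
    unfolding tensor_product_def tensor_product_axioms_def bimodule_def
  proof (intro conjI allI impI assms m)
    show "\<exists>L. linear_map_on (Car T x n) L \<and>
          (\<forall>y\<in>Obj C. \<forall>i j. i + j = n \<longrightarrow> (\<forall>u\<in>Car F y i. \<forall>m\<in>Car K (y, x) j. L (\<theta> x y i j u m) = \<psi> y i j u m))"
      if "x \<in> Obj C" "balanced C F K x \<psi>" for x n \<psi>
      using t(3) that by simp
  qed (use t(1,2,4,5) in simp_all)
  then show ?thesis by (rule exI[of _ \<theta>])
qed

lemma is_tensor_over_unique:
  fixes T T' :: "('o, 'a, 'b, 'k::field) dgmod"
  assumes "dg_category C" "is_tensor_over C F K T" "is_tensor_over C F K T'"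
  shows "\<exists>\<phi>. quasi_iso C T T' \<phi>"
  using is_tensor_over_imp_tensor_product[OF assms(1,2)] is_tensor_over_imp_tensor_product[OF assms(1,3)]
    tensor_product.ex_tensor_quasi_iso by (elim exE)


section \<open>Coordinates in semi-free modules\<close>

lemma is_combination_iff: "is_combination C Q B x n m c \<longleftrightarrow>
     finite {r. c r \<noteq> 0} \<and> {r. c r \<noteq> 0} \<subseteq> B \<and> (\<forall>r\<in>B. c r \<in> Hom C x (fst r) (n - fst (snd r))) \<and>
     m = (\<Sum>r | c r \<noteq> 0. Act Q x (fst r) (fst (snd r)) (n - fst (snd r)) (snd (snd r)) (c r))"
proof -
  have "{(y, i, b). c (y, i, b) \<noteq> 0} = {r. c r \<noteq> 0}" by auto
  then show ?thesis unfolding is_combination_def by (simp add: case_prod_beta)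
qed

locale semi_free_basis = dg_category C + Q: dg_module C Q
  for C :: "('o, 'a, 'k::field) dgcat" and Q :: "('o, 'a, 'b, 'k) dgmod" +
  fixes B :: "('o \<times> int \<times> ('b, 'k) vec) set" and level :: "'o \<times> int \<times> ('b, 'k) vec \<Rightarrow> nat"
  assumes basis_in: "r \<in> B \<Longrightarrow> fst r \<in> Obj C \<and> snd (snd r) \<in> Car Q (fst r) (fst (snd r))"
    and basis_ex1: "\<lbrakk>x \<in> Obj C; m \<in> Car Q x n\<rbrakk> \<Longrightarrow> \<exists>!c. is_combination C Q B x n m c"
    and basis_d: "r \<in> B \<Longrightarrow> \<exists>c. is_combination C Q {s\<in>B. level s < level r} (fst r) (fst (snd r) + 1)
      (MDiff Q (fst r) (fst (snd r)) (snd (snd r))) c"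
begin

abbreviation ob :: "'o \<times> int \<times> ('b, 'k) vec \<Rightarrow> 'o" where "ob \<equiv> fst"
abbreviation dg :: "'o \<times> int \<times> ('b, 'k) vec \<Rightarrow> int" where "dg r \<equiv> fst (snd r)"
abbreviation gen :: "'o \<times> int \<times> ('b, 'k) vec \<Rightarrow> ('b, 'k) vec" where "gen r \<equiv> snd (snd r)"

lemma ob_in: "r \<in> B \<Longrightarrow> ob r \<in> Obj C" and gen_in: "r \<in> B \<Longrightarrow> gen r \<in> Car Q (ob r) (dg r)"
  using basis_in by auto

definition co where "co x n u = (THE c. is_combination C Q B x n u c)"

context
  fixes x assumes x: "x \<in> Obj C"
begin

lemma co_combination: "u \<in> Car Q x n \<Longrightarrow> is_combination C Q B x n u (co x n u)"
  using theI'[OF basis_ex1[OF x]] unfolding co_def .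

lemma co_finite: "u \<in> Car Q x n \<Longrightarrow> finite {r. co x n u r \<noteq> 0}"
  and co_supp: "u \<in> Car Q x n \<Longrightarrow> {r. co x n u r \<noteq> 0} \<subseteq> B"
  and co_in: "u \<in> Car Q x n \<Longrightarrow> r \<in> B \<Longrightarrow> k = n - dg r \<Longrightarrow> co x n u r \<in> Hom C x (ob r) k"
  using co_combination unfolding is_combination_iff by blast+

lemma act_gen_0: "r \<in> B \<Longrightarrow> Act Q x (ob r) (dg r) k (gen r) 0 = 0"
  using lin_zero[OF Q.act_linear_right[OF x ob_in gen_in] hom_subspace[OF x ob_in]] by blast

lemma co_unique:
  assumes u: "u \<in> Car Q x n" and S: "finite S" "S \<subseteq> B" and c: "\<And>r. r \<notin> S \<Longrightarrow> c r = 0"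
    and c_in: "\<And>r. r \<in> S \<Longrightarrow> c r \<in> Hom C x (ob r) (n - dg r)"
    and eq: "u = (\<Sum>r\<in>S. Act Q x (ob r) (dg r) (n - dg r) (gen r) (c r))"
  shows "co x n u = c"
proof -
  have supp: "{r. c r \<noteq> 0} \<subseteq> S" using c by blast
  have "is_combination C Q B x n u c"
    unfolding is_combination_iff
  proof (intro conjI ballI)
    show "finite {r. c r \<noteq> 0}" "{r. c r \<noteq> 0} \<subseteq> B" using supp S finite_subset by auto
    show "c r \<in> Hom C x (ob r) (n - dg r)" if "r \<in> B" for r
      using c[of r] c_in[of r] kvec.subspace_0[OF hom_subspace[OF x ob_in[OF that]]] by (cases "r \<in> S") auto
    show "u = (\<Sum>r | c r \<noteq> 0. Act Q x (ob r) (dg r) (n - dg r) (gen r) (c r))"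
      unfolding eq by (rule sum.mono_neutral_right[OF S(1) supp]) (use S(2) act_gen_0 in auto)
  qed
  then show ?thesis using basis_ex1[OF x u] co_combination[OF u] by blast
qed

lemma co_sum_eq:
  assumes u: "u \<in> Car Q x n" and S: "finite S" "{r. co x n u r \<noteq> 0} \<subseteq> S" "S \<subseteq> B"
  shows "(\<Sum>r\<in>S. Act Q x (ob r) (dg r) (n - dg r) (gen r) (co x n u r)) = u"
proof -
  have "u = (\<Sum>r | co x n u r \<noteq> 0. Act Q x (ob r) (dg r) (n - dg r) (gen r) (co x n u r))"
    using co_combination[OF u] unfolding is_combination_iff by blast
  also have "\<dots> = (\<Sum>r\<in>S. Act Q x (ob r) (dg r) (n - dg r) (gen r) (co x n u r))"
    by (rule sum.mono_neutral_left[OF S(1,2)]) (use S(3) act_gen_0 in auto)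
  finally show ?thesis by simp
qed

lemma co_linear: "linear_map_on (Car Q x n) (\<lambda>u. co x n u r)"
proof (rule linear_map_onI)
  fix u v c assume u: "u \<in> Car Q x n"
  note Su = co_finite[OF u] co_supp[OF u]
  have sub: "kvec.subspace (Hom C x (ob r) (n - dg r))" if "r \<in> B" for r by (rule hom_subspace[OF x ob_in[OF that]])
  have "co x n (kscale c u) = (\<lambda>r. kscale c (co x n u r))"
  proof (rule co_unique[OF Q.mem_scale[OF x u] Su])
    have "kscale c u = kscale c (\<Sum>r | co x n u r \<noteq> 0. Act Q x (ob r) (dg r) (n - dg r) (gen r) (co x n u r))"
      using co_sum_eq[OF u Su(1) _ Su(2)] by simp
    then show "kscale c u = (\<Sum>r | co x n u r \<noteq> 0. Act Q x (ob r) (dg r) (n - dg r) (gen r) (kscale c (co x n u r)))"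
      using Su co_in[OF u]
      by (subst sum.cong[OF refl lin_scale[OF Q.act_linear_right[OF x ob_in gen_in]]]) (auto simp: kvec.scale_sum_right)
    show "kscale c (co x n u r) \<in> Hom C x (ob r) (n - dg r)" if "r \<in> {r. co x n u r \<noteq> 0}" for r
      by (rule kvec.subspace_scale[OF sub co_in[OF u _ refl]]) (use that Su in blast)+
  qed simp
  then show "co x n (kscale c u) r = kscale c (co x n u r)" by simp
  assume v: "v \<in> Car Q x n"
  note Sv = co_finite[OF v] co_supp[OF v]
  let ?S = "{r. co x n u r \<noteq> 0} \<union> {r. co x n v r \<noteq> 0}"
  have S: "finite ?S" "?S \<subseteq> B" using Su Sv by auto
  have "co x n (u + v) = (\<lambda>r. co x n u r + co x n v r)"
  proof (rule co_unique[OF Q.mem_add[OF x u v] S])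
    have "u + v = (\<Sum>r\<in>?S. Act Q x (ob r) (dg r) (n - dg r) (gen r) (co x n u r)) +
        (\<Sum>r\<in>?S. Act Q x (ob r) (dg r) (n - dg r) (gen r) (co x n v r))"
      using co_sum_eq[OF u S(1) _ S(2)] co_sum_eq[OF v S(1) _ S(2)] by simp
    then show "u + v = (\<Sum>r\<in>?S. Act Q x (ob r) (dg r) (n - dg r) (gen r) (co x n u r + co x n v r))"
      using S(2) co_in[OF u] co_in[OF v]
      by (subst sum.cong[OF refl lin_add[OF Q.act_linear_right[OF x ob_in gen_in]]]) (auto simp: sum.distrib)
    show "co x n u r + co x n v r \<in> Hom C x (ob r) (n - dg r)" if "r \<in> ?S" for r
      by (rule kvec.subspace_add[OF sub co_in[OF u _ refl] co_in[OF v _ refl]]) (use that S in blast)+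
  qed simp
  then show "co x n (u + v) r = co x n u r + co x n v r" by simp
qed

lemma co_act_gen:
  assumes s: "s \<in> B" and f: "f \<in> Hom C x (ob s) k" and n: "n = dg s + k"
  shows "co x n (Act Q x (ob s) (dg s) k (gen s) f) = (\<lambda>r. if r = s then f else 0)"
  by (rule co_unique[of _ _ "{s}"]) (use assms in \<open>auto intro: Q.act_in x ob_in gen_in\<close>)

lemma co_induct [consumes 1, case_names zero act add]:
  assumes u: "u \<in> Car Q x n" and "P 0"
    and a: "\<And>r f. r \<in> B \<Longrightarrow> f \<in> Hom C x (ob r) (n - dg r) \<Longrightarrow> P (Act Q x (ob r) (dg r) (n - dg r) (gen r) f)"
    and add: "\<And>u v. u \<in> Car Q x n \<Longrightarrow> v \<in> Car Q x n \<Longrightarrow> P u \<Longrightarrow> P v \<Longrightarrow> P (u + v)"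
  shows "P u"
proof -
  note S = co_finite[OF u] co_supp[OF u]
  have "(\<Sum>r\<in>F. Act Q x (ob r) (dg r) (n - dg r) (gen r) (co x n u r)) \<in> Car Q x n \<and>
      P (\<Sum>r\<in>F. Act Q x (ob r) (dg r) (n - dg r) (gen r) (co x n u r))" if "finite F" "F \<subseteq> B" for F
    using that
  proof (induction F rule: finite_induct)
    case empty
    then show ?case using \<open>P 0\<close> Q.mem_0[OF x] by simp
  next
    case (insert r F)
    then have r: "r \<in> B" by simp
    have "Act Q x (ob r) (dg r) (n - dg r) (gen r) (co x n u r) \<in> Car Q x n"
      by (rule Q.act_in[OF x ob_in[OF r] gen_in[OF r] co_in[OF u r refl]]) simp
    then show ?case
      using insert a[OF r co_in[OF u r refl]] add Q.mem_add[OF x] by simp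
  qed
  from this[OF S] show ?thesis using co_sum_eq[OF u S(1) _ S(2)] by simp
qed

lemma linear_eqI:
  assumes F: "linear_map_on (Car Q x n) F" and G: "linear_map_on (Car Q x n) G" and u: "u \<in> Car Q x n"
    and eq: "\<And>r f. r \<in> B \<Longrightarrow> f \<in> Hom C x (ob r) (n - dg r) \<Longrightarrow>
      F (Act Q x (ob r) (dg r) (n - dg r) (gen r) f) = G (Act Q x (ob r) (dg r) (n - dg r) (gen r) f)"
  shows "F u = G u"
  using u
  by (induction rule: co_induct)
    (simp_all add: eq lin_zero[OF F Q.car_subspace[OF x]] lin_zero[OF G Q.car_subspace[OF x]]
      lin_add[OF F] lin_add[OF G])

lemma co_extend_linear:
  fixes \<Phi> :: "_ \<Rightarrow> ('a \<Rightarrow>\<^sub>0 'k) \<Rightarrow> ('c \<Rightarrow>\<^sub>0 'k)"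
  assumes \<Phi>: "\<And>r. r \<in> B \<Longrightarrow> linear_map_on (Hom C x (ob r) (n - dg r)) (\<Phi> r)"
  shows "linear_map_on (Car Q x n) (\<lambda>u. \<Sum>r | co x n u r \<noteq> 0. \<Phi> r (co x n u r))"
    and "\<And>u S. u \<in> Car Q x n \<Longrightarrow> finite S \<Longrightarrow> {r. co x n u r \<noteq> 0} \<subseteq> S \<Longrightarrow> S \<subseteq> B \<Longrightarrow>
      (\<Sum>r | co x n u r \<noteq> 0. \<Phi> r (co x n u r)) = (\<Sum>r\<in>S. \<Phi> r (co x n u r))"
proof -
  have z: "\<Phi> r 0 = 0" if "r \<in> B" for r
    using lin_zero[OF \<Phi>[OF that] hom_subspace[OF x ob_in[OF that]]] .
  show eq: "(\<Sum>r | co x n u r \<noteq> 0. \<Phi> r (co x n u r)) = (\<Sum>r\<in>S. \<Phi> r (co x n u r))"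
    if "u \<in> Car Q x n" "finite S" "{r. co x n u r \<noteq> 0} \<subseteq> S" "S \<subseteq> B" for u S
    by (rule sum.mono_neutral_left) (use that z in auto)
  show "linear_map_on (Car Q x n) (\<lambda>u. \<Sum>r | co x n u r \<noteq> 0. \<Phi> r (co x n u r))"
  proof (rule linear_map_onI)
    fix u v c assume u: "u \<in> Car Q x n"
    note Su = co_finite[OF u] co_supp[OF u]
    have cu: "co x n (kscale c u) = (\<lambda>r. kscale c (co x n u r))" using lin_scale[OF co_linear u] by blast
    have "(\<Sum>r | co x n (kscale c u) r \<noteq> 0. \<Phi> r (co x n (kscale c u) r)) = (\<Sum>r | co x n u r \<noteq> 0. \<Phi> r (co x n (kscale c u) r))"
      by (rule eq[OF Q.mem_scale[OF x u] Su(1) _ Su(2)]) (auto simp: cu)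
    also have "\<dots> = kscale c (\<Sum>r | co x n u r \<noteq> 0. \<Phi> r (co x n u r))"
      unfolding kvec.scale_sum_right cu
      by (rule sum.cong[OF refl]) (use Su(2) lin_scale[OF \<Phi> co_in[OF u _ refl]] in blast)
    finally show "(\<Sum>r | co x n (kscale c u) r \<noteq> 0. \<Phi> r (co x n (kscale c u) r)) = kscale c (\<Sum>r | co x n u r \<noteq> 0. \<Phi> r (co x n u r))" .
    assume v: "v \<in> Car Q x n"
    note Sv = co_finite[OF v] co_supp[OF v]
    let ?S = "{r. co x n u r \<noteq> 0} \<union> {r. co x n v r \<noteq> 0}"
    have S: "finite ?S" "?S \<subseteq> B" using Su Sv by auto
    have cuv: "co x n (u + v) = (\<lambda>r. co x n u r + co x n v r)" using lin_add[OF co_linear u v] by blast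
    have "(\<Sum>r | co x n (u + v) r \<noteq> 0. \<Phi> r (co x n (u + v) r)) = (\<Sum>r\<in>?S. \<Phi> r (co x n (u + v) r))"
      by (rule eq[OF Q.mem_add[OF x u v] S(1) _ S(2)]) (auto simp: cuv)
    also have "\<dots> = (\<Sum>r\<in>?S. \<Phi> r (co x n u r) + \<Phi> r (co x n v r))"
      unfolding cuv by (rule sum.cong[OF refl]) (use S(2) lin_add[OF \<Phi> co_in[OF u _ refl] co_in[OF v _ refl]] in blast)
    also have "\<dots> = (\<Sum>r | co x n u r \<noteq> 0. \<Phi> r (co x n u r)) + (\<Sum>r | co x n v r \<noteq> 0. \<Phi> r (co x n v r))"
      using eq[OF u S(1) _ S(2)] eq[OF v S(1) _ S(2)] by (simp add: sum.distrib)
    finally show "(\<Sum>r | co x n (u + v) r \<noteq> 0. \<Phi> r (co x n (u + v) r)) =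
      (\<Sum>r | co x n u r \<noteq> 0. \<Phi> r (co x n u r)) + (\<Sum>r | co x n v r \<noteq> 0. \<Phi> r (co x n v r))" .
  qed
qed

lemma co_extend_act_gen:
  assumes "\<And>r. r \<in> B \<Longrightarrow> \<Phi> r 0 = (0 :: 'c \<Rightarrow>\<^sub>0 'k)" and s: "s \<in> B" and f: "f \<in> Hom C x (ob s) k" and n: "n = dg s + k"
  shows "(\<Sum>r | co x n (Act Q x (ob s) (dg s) k (gen s) f) r \<noteq> 0. \<Phi> r (co x n (Act Q x (ob s) (dg s) k (gen s) f) r)) = \<Phi> s f"
proof -
  have "{r. (if r = s then f else 0) \<noteq> 0} = (if f = 0 then {} else {s})" by auto
  then show ?thesis unfolding co_act_gen[OF s f n] using assms(1)[OF s] by (cases "f = 0") auto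
qed

end

lemma act_gen_ident: "r \<in> B \<Longrightarrow> Act Q (ob r) (ob r) (dg r) 0 (gen r) (Ident C (ob r)) = gen r"
  by (simp add: Q.act_ident ob_in gen_in)

lemma co_act:
  assumes o: "x \<in> Obj C" "y \<in> Obj C" and u: "u \<in> Car Q y i" and f: "f \<in> Hom C x y q" and r: "r \<in> B" and n: "n = i + q"
  shows "co x n (Act Q x y i q u f) r = Comp C x y (ob r) (i - dg r) q (co y i u r) f"
proof -
  have c0: "Comp C x y (ob s) k q 0 f = 0" if "s \<in> B" for s k
    by (rule lin_zero[OF comp_linear_left[OF o ob_in[OF that] f] hom_subspace[OF o(2) ob_in[OF that]]])
  note S = co_finite[OF o(2) u] co_supp[OF o(2) u]
  have "co x n (Act Q x y i q u f) = (\<lambda>r. if r \<in> {r. co y i u r \<noteq> 0} then Comp C x y (ob r) (i - dg r) q (co y i u r) f else 0)"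
  proof (rule co_unique[OF o(1) _ S])
    show "Act Q x y i q u f \<in> Car Q x n" by (rule Q.act_in[OF o u f n])
    have "Act Q x y i q u f = (\<Sum>r | co y i u r \<noteq> 0. Act Q x y i q (Act Q y (ob r) (dg r) (i - dg r) (gen r) (co y i u r)) f)"
      using S Q.act_in[OF o(2) ob_in gen_in co_in[OF o(2) u _ refl]]
      by (subst co_sum_eq[OF o(2) u S(1) _ S(2), symmetric, OF order_refl], subst Q.act_sum[OF o f]) auto
    also have "\<dots> = (\<Sum>r | co y i u r \<noteq> 0. Act Q x (ob r) (dg r) (n - dg r) (gen r)
        (if r \<in> {r. co y i u r \<noteq> 0} then Comp C x y (ob r) (i - dg r) q (co y i u r) f else 0))"
    proof (rule sum.cong[OF refl])
      fix r assume b: "r \<in> {r. co y i u r \<noteq> 0}"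
      then have r: "r \<in> B" using S by blast
      have e: "dg r + (i - dg r) = i" "i - dg r + q = n - dg r" using n by auto
      show "Act Q x y i q (Act Q y (ob r) (dg r) (i - dg r) (gen r) (co y i u r)) f = Act Q x (ob r) (dg r) (n - dg r) (gen r)
        (if r \<in> {r. co y i u r \<noteq> 0} then Comp C x y (ob r) (i - dg r) q (co y i u r) f else 0)"
        using Q.act_act[OF o ob_in[OF r] gen_in[OF r] co_in[OF o(2) u r refl] f] b by (simp only: e if_True)
    qed
    finally show "Act Q x y i q u f = \<dots>" .
    fix r assume "r \<in> {r. co y i u r \<noteq> 0}"
    then have "r \<in> B" "co y i u r \<noteq> 0" using S by auto
    then show "(if r \<in> {r. co y i u r \<noteq> 0} then Comp C x y (ob r) (i - dg r) q (co y i u r) f else 0) \<in> Hom C x (ob r) (n - dg r)"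
      using comp_closed[OF o ob_in[OF \<open>r \<in> B\<close>] co_in[OF o(2) u \<open>r \<in> B\<close> refl] f] n by (simp add: algebra_simps)
  qed auto
  then show ?thesis using c0[OF r] by simp
qed

definition \<delta> where "\<delta> r = co (ob r) (dg r + 1) (MDiff Q (ob r) (dg r) (gen r))"

lemma d_gen_in: "r \<in> B \<Longrightarrow> MDiff Q (ob r) (dg r) (gen r) \<in> Car Q (ob r) (dg r + 1)"
  by (rule Q.d_in[OF ob_in gen_in]) auto

lemma \<delta>_in: "r \<in> B \<Longrightarrow> s \<in> B \<Longrightarrow> \<delta> r s \<in> Hom C (ob r) (ob s) (dg r + 1 - dg s)"
  unfolding \<delta>_def by (rule co_in[OF ob_in d_gen_in _ refl])

lemma \<delta>_finite: "r \<in> B \<Longrightarrow> finite {s. \<delta> r s \<noteq> 0}"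
  unfolding \<delta>_def by (rule co_finite[OF ob_in d_gen_in])

lemma \<delta>_supp: "r \<in> B \<Longrightarrow> {s. \<delta> r s \<noteq> 0} \<subseteq> B"
  unfolding \<delta>_def by (rule co_supp[OF ob_in d_gen_in])

lemma \<delta>_level:
  assumes r: "r \<in> B" and "\<delta> r s \<noteq> 0"
  shows "level s < level r"
proof -
  let ?B = "{s\<in>B. level s < level r}"
  obtain c where c: "is_combination C Q ?B (ob r) (dg r + 1) (MDiff Q (ob r) (dg r) (gen r)) c"
    using basis_d[OF r] by (rule exE)
  have "\<delta> r = c"
    unfolding \<delta>_def using c[unfolded is_combination_iff]
    by (intro co_unique[OF ob_in[OF r] d_gen_in[OF r], of "{s. c s \<noteq> 0}"]) blast+
  then show ?thesis using c assms(2) unfolding is_combination_iff by blast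
qed

text \<open>The Leibniz rule in coordinates: either the differential hits a generator, which brings
  in \<open>\<delta>\<close>, or it passes the generator \<open>s\<close> with a sign and hits the
  coefficient.\<close>

lemma co_d:
  assumes x: "x \<in> Obj C" and u: "u \<in> Car Q x n" and s: "s \<in> B" and S: "finite S" "{r. co x n u r \<noteq> 0} \<subseteq> S" "S \<subseteq> B"
    and k: "k = n + 1"
  shows "co x k (MDiff Q x n u) s = (\<Sum>r\<in>S. Comp C x (ob r) (ob s) (dg r + 1 - dg s) (n - dg r) (\<delta> r s) (co x n u r)) +
    sgn_pow (dg s) (Diff C x (ob s) (n - dg s) (co x n u s))"
proof -
  let ?c = "\<lambda>r. Comp C x (ob r) (ob s) (dg r + 1 - dg s) (n - dg r) (\<delta> r s)"
  have c_lin: "linear_map_on (Hom C x (ob r) (n - dg r)) (?c r)" if "r \<in> B" for r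
    by (rule comp_linear_right[OF x ob_in[OF that] ob_in[OF s] \<delta>_in[OF that s]])
  have c0: "?c r 0 = 0" if "r \<in> B" for r
    by (rule lin_zero[OF c_lin[OF that] hom_subspace[OF x ob_in[OF that]]])
  let ?L = "\<lambda>u. co x k (MDiff Q x n u) s"
  let ?R = "\<lambda>u. (\<Sum>r | co x n u r \<noteq> 0. ?c r (co x n u r)) + sgn_pow (dg s) (Diff C x (ob s) (n - dg s) (co x n u s))"
  have L: "linear_map_on (Car Q x n) ?L"
    by (rule lin_compose[OF Q.mdiff_linear[OF x] co_linear[OF x] Q.d_in[OF x _ k]])
  have D: "linear_map_on (Hom C x (ob s) (n - dg s)) (Diff C x (ob s) (n - dg s))"
    by (rule diff_linear[OF x ob_in[OF s]])
  have R: "linear_map_on (Car Q x n) ?R"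
    by (intro lin_plus lin_sgn co_extend_linear(1)[OF x c_lin]
        lin_compose[OF co_linear[OF x] D] co_in[OF x _ s refl])
  have "?L u = ?R u"
  proof (rule linear_eqI[OF x L R u])
    fix r f assume act: "r \<in> B" "f \<in> Hom C x (ob r) (n - dg r)"
    let ?i = "n - dg r" and ?u = "Act Q x (ob r) (dg r) (n - dg r) (gen r) f"
    note b = ob_in[OF act(1)] gen_in[OF act(1)]
    have f': "Diff C x (ob r) ?i f \<in> Hom C x (ob r) (?i + 1)" by (rule diff_closed[OF x b(1) act(2)])
    have e: "dg r + (n - dg r) = n" "k - dg r = ?i + 1" "k = dg r + 1 + ?i" "k = dg r + (?i + 1)" using k by auto
    have i1: "Act Q x (ob r) (dg r + 1) ?i (MDiff Q (ob r) (dg r) (gen r)) f \<in> Car Q x k"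
      by (rule Q.act_in[OF x b(1) d_gen_in[OF act(1)] act(2) e(3)])
    have i2: "Act Q x (ob r) (dg r) (?i + 1) (gen r) (Diff C x (ob r) ?i f) \<in> Car Q x k"
      by (rule Q.act_in[OF x b f' e(4)])
    have "MDiff Q x n ?u = Act Q x (ob r) (dg r + 1) ?i (MDiff Q (ob r) (dg r) (gen r)) f +
        sgn_pow (dg r) (Act Q x (ob r) (dg r) (?i + 1) (gen r) (Diff C x (ob r) ?i f))"
      using Q.mdiff_act[OF x b act(2)] unfolding e(1) .
    then have "?L ?u = co x k (Act Q x (ob r) (dg r + 1) ?i (MDiff Q (ob r) (dg r) (gen r)) f) s +
        sgn_pow (dg r) (co x k (Act Q x (ob r) (dg r) (?i + 1) (gen r) (Diff C x (ob r) ?i f)) s)"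
      using lin_add[OF co_linear[OF x] i1 Q.mem_sgn[OF x i2]] lin_sgn_pow[OF co_linear[OF x] i2] by simp
    also have "\<dots> = ?c r f + sgn_pow (dg r) (if s = r then Diff C x (ob r) ?i f else 0)"
      using co_act[OF x b(1) d_gen_in[OF act(1)] act(2) s e(3)] co_act_gen[OF x act(1) f' e(4)] by (simp add: \<delta>_def)
    also have "\<dots> = ?R ?u"
      using co_extend_act_gen[where \<Phi> = ?c, OF x c0 act(1,2) e(1)[symmetric]] co_act_gen[OF x act(1,2) e(1)[symmetric]]
        lin_zero[OF D hom_subspace[OF x ob_in[OF s]]] by simp
    finally show "?L ?u = ?R ?u" .
  qed
  then show ?thesis using co_extend_linear(2)[OF x c_lin u S] by simp
qed

text \<open>This is \<open>co_d\<close> for the boundary of the generator \<open>j\<close>, whose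
  own differential is zero.\<close>

lemma maurer_cartan:
  assumes j: "j \<in> B" and k: "k \<in> B"
  shows "sgn_pow (dg k) (Diff C (ob j) (ob k) (dg j + 1 - dg k) (\<delta> j k)) +
     (\<Sum>i | \<delta> j i \<noteq> 0. Comp C (ob j) (ob i) (ob k) (dg i + 1 - dg k) (dg j + 1 - dg i) (\<delta> i k) (\<delta> j i)) = 0"
proof -
  have "co (ob j) (dg j + 1 + 1) 0 k = 0"
    by (rule lin_zero[OF co_linear[OF ob_in[OF j]] Q.car_subspace[OF ob_in[OF j]]])
  then show ?thesis
    using co_d[OF ob_in[OF j] d_gen_in[OF j] k co_finite[OF ob_in[OF j] d_gen_in[OF j]] order_refl co_supp[OF ob_in[OF j] d_gen_in[OF j]] refl]
    by (simp add: Q.dd[OF ob_in[OF j] gen_in[OF j]] \<delta>_def add.commute)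
qed

text \<open>The graded map of degree \<open>p\<close> with prescribed values \<open>a r\<close> on
  the generators, the underlying graded module being free.\<close>

definition ext where
  "ext N p a x n u = (\<Sum>r | co x n u r \<noteq> 0. Act N x (ob r) (dg r + p) (n - dg r) (a r) (co x n u r))"

lemma
  assumes N: "dg_module C N" and a: "\<And>r. r \<in> B \<Longrightarrow> a r \<in> Car N (ob r) (dg r + p)"
  shows ext_graded: "graded_map C p Q N (ext N p a)"
    and ext_act_gen: "\<And>x r f k n. x \<in> Obj C \<Longrightarrow> r \<in> B \<Longrightarrow> f \<in> Hom C x (ob r) k \<Longrightarrow> n = dg r + k \<Longrightarrow>
      ext N p a x n (Act Q x (ob r) (dg r) k (gen r) f) = Act N x (ob r) (dg r + p) k (a r) f"
proof -
  interpret N: dg_module C N by fact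
  have lin: "linear_map_on (Hom C x (ob r) (n - dg r)) (Act N x (ob r) (dg r + p) (n - dg r) (a r))" if "x \<in> Obj C" "r \<in> B" for x n r
    by (rule N.act_linear_right[OF that(1) ob_in a]) (fact that(2))+
  have a0: "Act N x (ob r) (dg r + p) (n - dg r) (a r) 0 = 0" if "x \<in> Obj C" "r \<in> B" for x n r
    by (rule lin_zero[OF lin[OF that] hom_subspace[OF that(1) ob_in[OF that(2)]]])
  have ext_lin: "linear_map_on (Car Q x n) (ext N p a x n)" if "x \<in> Obj C" for x n
    unfolding ext_def[abs_def] by (rule co_extend_linear(1)[OF that lin[OF that]])
  show gen: "ext N p a x n (Act Q x (ob r) (dg r) k (gen r) f) = Act N x (ob r) (dg r + p) k (a r) f"
    if "x \<in> Obj C" "r \<in> B" "f \<in> Hom C x (ob r) k" "n = dg r + k" for x r f k n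
    unfolding ext_def
    using co_extend_act_gen[where \<Phi> = "\<lambda>r. Act N x (ob r) (dg r + p) (n - dg r) (a r)", OF that(1) a0[OF that(1)] that(2,3,4)] that(4) by simp
  have ext_in: "ext N p a x n u \<in> Car N x (n + p)" if x: "x \<in> Obj C" and u: "u \<in> Car Q x n" for x n u
    unfolding ext_def
    by (rule N.mem_sum[OF x], rule N.act_in[OF x ob_in a co_in[OF x u _ refl]]) (use co_supp[OF x u] in auto)
  show "graded_map C p Q N (ext N p a)"
  proof (rule graded_mapI[OF ext_lin ext_in])
    fix x y i j u f assume o: "x \<in> Obj C" "y \<in> Obj C" and u: "u \<in> Car Q y i" and f: "f \<in> Hom C x y j"
    have L: "linear_map_on (Car Q y i) (\<lambda>u. ext N p a x (i + j) (Act Q x y i j u f))"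
      by (rule lin_compose[OF Q.act_linear_left[OF o f] ext_lin[OF o(1)]]) (rule Q.act_in[OF o _ f refl])
    have R: "linear_map_on (Car Q y i) (\<lambda>u. Act N x y (i + p) j (ext N p a y i u) f)"
      by (rule lin_compose[OF ext_lin[OF o(2)] N.act_linear_left[OF o f] ext_in[OF o(2)]])
    show "ext N p a x (i + j) (Act Q x y i j u f) = Act N x y (i + p) j (ext N p a y i u) f"
    proof (rule linear_eqI[OF o(2) L R u])
      fix r g assume act: "r \<in> B" "g \<in> Hom C y (ob r) (i - dg r)"
      let ?u = "Act Q y (ob r) (dg r) (i - dg r) (gen r) g"
      note b = ob_in[OF act(1)] gen_in[OF act(1)]
      have gf: "Comp C x y (ob r) (i - dg r) j g f \<in> Hom C x (ob r) (i - dg r + j)"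
        by (rule comp_closed[OF o b(1) act(2) f])
      have e: "dg r + (i - dg r) = i" "dg r + p + (i - dg r) = i + p" "i + j = dg r + (i - dg r + j)" by auto
      show "ext N p a x (i + j) (Act Q x y i j ?u f) = Act N x y (i + p) j (ext N p a y i ?u) f"
        using Q.act_act[OF o b act(2) f] N.act_act[OF o b(1) a[OF act(1)] act(2) f]
          gen[OF o(1) act(1) gf e(3)] gen[OF o(2) act(1,2) e(1)[symmetric]]
        unfolding e(1,2) by simp
    qed
  qed
qed

lemma ext_gen:
  assumes N: "dg_module C (N :: ('o, 'a, 'b, 'k) dgmod)" and a: "\<And>r. r \<in> B \<Longrightarrow> a r \<in> Car N (ob r) (dg r + p)" and r: "r \<in> B"
  shows "ext N p a (ob r) (dg r) (gen r) = a r"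
  using ext_act_gen[OF N a ob_in[OF r] r ident_closed[OF ob_in[OF r]], of "dg r"]
    dg_module.act_ident[OF N ob_in[OF r] a[OF r]] by (simp add: act_gen_ident[OF r])

text \<open>Only the generators that occur in \<open>u\<close> are compared. In recursions on the
  level the two maps are known to agree on lower generators alone, and these are the ones that occur
  in a boundary.\<close>

lemma mor_eqI:
  assumes f: "dg_morphism C Q N f" and g: "dg_morphism C Q N g" and x: "x \<in> Obj C" and u: "u \<in> Car Q x n"
    and eq: "\<And>r. co x n u r \<noteq> 0 \<Longrightarrow> f (ob r) (dg r) (gen r) = g (ob r) (dg r) (gen r)"
  shows "f x n u = g x n u"
proof -
  note S = co_finite[OF x u] co_supp[OF x u]
  have act: "Act Q x (ob r) (dg r) (n - dg r) (gen r) (co x n u r) \<in> Car Q x n" if "co x n u r \<noteq> 0" for r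
    by (rule Q.act_in[OF x ob_in gen_in co_in[OF x u _ refl]]) (use S that in auto)
  have h: "h x n u = (\<Sum>r | co x n u r \<noteq> 0. Act N x (ob r) (dg r) (n - dg r) (h (ob r) (dg r) (gen r)) (co x n u r))"
    if h: "dg_morphism C Q N h" for h
  proof -
    have "h x n u = (\<Sum>r | co x n u r \<noteq> 0. h x n (Act Q x (ob r) (dg r) (n - dg r) (gen r) (co x n u r)))"
      by (subst co_sum_eq[OF x u S(1) order_refl S(2), symmetric], rule mor_sum[OF h x]) (use act in blast)
    also have "\<dots> = (\<Sum>r | co x n u r \<noteq> 0. Act N x (ob r) (dg r) (n - dg r) (h (ob r) (dg r) (gen r)) (co x n u r))"
      by (rule sum.cong[OF refl], rule mor_act[OF h x ob_in gen_in co_in[OF x u _ refl]]) (use S in auto)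
    finally show ?thesis .
  qed
  show ?thesis unfolding h[OF f] h[OF g] by (rule sum.cong) (simp_all add: eq)
qed

text \<open>The values of a homotopy on the generators are chosen by recursion on the level.\<close>

lemma kproj: "kproj C Q"
  unfolding kproj_def
proof (intro conjI allI impI Q.dg_module_axioms)
  fix A f assume A: "acyclic_module C A" and f: "dg_morphism C Q A f"
  interpret A: dg_module C A using A by (rule acyclic_module_module)
  have hom: "dg_morphism C Q A (\<lambda>x n u. MDiff A x (n - 1) (ext A (-1) a x n u) + ext A (-1) a x (n + 1) (MDiff Q x n u))"
    if "\<And>r. r \<in> B \<Longrightarrow> a r \<in> Car A (ob r) (dg r + -1)" for a
    by (rule mor_homotopy[OF dg_category_axioms Q.dg_module_axioms A.dg_module_axioms ext_graded[OF A.dg_module_axioms that]])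
  let ?P = "\<lambda>a r v. r \<in> B \<longrightarrow> v \<in> Car A (ob r) (dg r + -1) \<and> f (ob r) (dg r) (gen r) =
      MDiff A (ob r) (dg r - 1) v + ext A (-1) a (ob r) (dg r + 1) (MDiff Q (ob r) (dg r) (gen r))"
  have ext_cong: "ext A (-1) a (ob r) (dg r + 1) (MDiff Q (ob r) (dg r) (gen r)) =
      ext A (-1) a' (ob r) (dg r + 1) (MDiff Q (ob r) (dg r) (gen r))"
    if "r \<in> B" "\<And>s. s \<in> B \<Longrightarrow> level s < level r \<Longrightarrow> a s = a' s" for r a a'
    unfolding ext_def \<delta>_def[symmetric] using that \<delta>_level[OF that(1)] \<delta>_supp[OF that(1)] by (auto intro!: sum.cong)
  have "\<exists>a. \<forall>r. ?P a r (a r)"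
  proof (rule dependent_wf_choice[OF wf_measure[of level]])
    show "?P a r v = ?P a' r v" if "\<And>s. (s, r) \<in> measure level \<Longrightarrow> a s = a' s" for a a' r v
      using ext_cong[of r a a'] that by auto
  next
    fix r a assume IH: "\<And>s. (s, r) \<in> measure level \<Longrightarrow> ?P a s (a s)"
    show "\<exists>v. ?P a r v"
    proof (cases "r \<in> B")
      case r: True
      note b = ob_in[OF r] gen_in[OF r]
      \<comment> \<open>At generators that are not of lower level nothing is known about
        \<open>a\<close>. Replacing it there by 0 makes \<open>ext\<close> applicable and does not
        change the value at the boundary of \<open>r\<close>.\<close>
      define a' where "a' = (\<lambda>s. if s \<in> B \<and> level s < level r then a s else 0)"
      have a': "a' s \<in> Car A (ob s) (dg s + -1)" if "s \<in> B" for s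
        using IH[of s] that A.mem_0[OF ob_in[OF that]] by (auto simp: a'_def)
      define h where "h = ext A (-1) a'"
      define D where "D = (\<lambda>x n u. MDiff A x (n - 1) (h x n u) + h x (n + 1) (MDiff Q x n u))"
      have D: "dg_morphism C Q A D" unfolding D_def h_def by (rule hom[OF a'])
      have hg: "graded_map C (-1) Q A h" unfolding h_def by (rule ext_graded[OF A.dg_module_axioms a'])
      let ?d = "MDiff Q (ob r) (dg r) (gen r)"
      have eq: "D (ob s) (dg s) (gen s) = f (ob s) (dg s) (gen s)" if "s \<in> B" "level s < level r" for s
      proof -
        have "h (ob s) (dg s) (gen s) = a s" unfolding h_def using ext_gen[OF A.dg_module_axioms a' that(1)] that by (simp add: a'_def)
        moreover have "h (ob s) (dg s + 1) (MDiff Q (ob s) (dg s) (gen s)) = ext A (-1) a (ob s) (dg s + 1) (MDiff Q (ob s) (dg s) (gen s))"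
          unfolding h_def by (rule ext_cong[OF that(1)]) (use that in \<open>simp add: a'_def\<close>)
        ultimately show ?thesis using IH[of s] that by (simp add: D_def)
      qed
      \<comment> \<open>The boundary of \<open>r\<close> involves lower generators only, where by
        induction \<open>f\<close> is already the boundary of the homotopy. Hence the obstruction at
        \<open>r\<close> is a cycle, and it has a primitive since \<open>A\<close> is
        acyclic.\<close>
      have "D (ob r) (dg r + 1) ?d = f (ob r) (dg r + 1) ?d"
        by (rule mor_eqI[OF D f b(1) d_gen_in[OF r]], fold \<delta>_def, rule eq) (use \<delta>_supp[OF r] \<delta>_level[OF r] in auto)
      moreover have "D (ob r) (dg r + 1) ?d = MDiff A (ob r) (dg r) (h (ob r) (dg r + 1) ?d)"
        using Q.dd[OF b, of "dg r + 1"] lin_zero[OF gr_linear[OF hg b(1)] Q.car_subspace[OF b(1)]] by (simp add: D_def)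
      moreover have hd: "h (ob r) (dg r + 1) ?d \<in> Car A (ob r) (dg r)"
        by (rule gr_in[OF hg b(1) d_gen_in[OF r]]) simp
      moreover have fb: "f (ob r) (dg r) (gen r) \<in> Car A (ob r) (dg r)" by (rule mor_in[OF f b])
      ultimately have "MDiff A (ob r) (dg r) (f (ob r) (dg r) (gen r) - h (ob r) (dg r + 1) ?d) = 0"
        using mor_d[OF f b, of "dg r + 1"] by (simp add: A.d_diff[OF b(1)])
      from acyclicD[OF A b(1) A.mem_diff[OF b(1) fb hd] this, of "dg r + -1"]
      obtain v where v: "v \<in> Car A (ob r) (dg r + -1)"
        "f (ob r) (dg r) (gen r) - h (ob r) (dg r + 1) ?d = MDiff A (ob r) (dg r - 1) v" by auto
      moreover have "h (ob r) (dg r + 1) ?d = ext A (-1) a (ob r) (dg r + 1) ?d"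
        unfolding h_def by (rule ext_cong[OF r]) (simp add: a'_def)
      ultimately show ?thesis by (intro exI[of _ v]) (simp add: algebra_simps)
    qed simp
  qed
  then obtain a where a: "\<forall>r. ?P a r (a r)" ..
  have ain: "a r \<in> Car A (ob r) (dg r + -1)" if "r \<in> B" for r using a[rule_format, OF that] by (rule conjunct1)
  show "null_homotopic C Q A f"
  proof (rule null_homotopicI[OF ext_graded[OF A.dg_module_axioms ain]])
    fix x n u assume x: "x \<in> Obj C" and u: "u \<in> Car Q x n"
    show "f x n u = MDiff A x (n - 1) (ext A (-1) a x n u) + ext A (-1) a x (n + 1) (MDiff Q x n u)"
    proof (rule mor_eqI[OF f hom[OF ain] x u])
      fix r assume "co x n u r \<noteq> 0"
      then have r: "r \<in> B" using co_supp[OF x u] by blast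
      have e: "ext A (-1) a (ob r) (dg r) (gen r) = a r" by (rule ext_gen[OF A.dg_module_axioms ain r])
      show "f (ob r) (dg r) (gen r) = MDiff A (ob r) (dg r - 1) (ext A (-1) a (ob r) (dg r) (gen r)) +
          ext A (-1) a (ob r) (dg r + 1) (MDiff Q (ob r) (dg r) (gen r))"
        using a[rule_format, OF r, THEN conjunct2, folded e] .
    qed
  qed
qed

end


section \<open>Tensor products of semi-free modules\<close>

locale semi_free_tensor = semi_free_basis C Q B level + infinite_basis basis + coded "TYPE('o \<times> int \<times> ('b, 'k) vec)" basis
  for basis :: "'b itself" and C :: "('o, 'a, 'k::field) dgcat" and Q :: "('o, 'a, 'b, 'k) dgmod" and B level

sublocale semi_free_tensor \<subseteq> tw: filtered_twisted "TYPE('o \<times> int \<times> ('b, 'k) vec)" basis C B ob "\<lambda>r. dg r" \<delta> level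
  by unfold_locales (use \<delta>_supp in \<open>auto simp: ob_in \<delta>_in \<delta>_finite maurer_cartan intro: \<delta>_level\<close>)

context semi_free_tensor
begin

text \<open>The coefficients of \<open>u\<close> with respect to the generators are moved across the
  tensor sign to \<open>m\<close>; the tensor of the generator \<open>r\<close> with an element is
  coded by \<open>push r\<close>.\<close>

definition \<theta> where
  "\<theta> K x y i j u m = (\<Sum>r | co y i u r \<noteq> 0. push r (left_act C K (ob r) y x (i - dg r) j (co y i u r) m))"

context
  fixes K :: "('o, 'a, 'b, 'k) bimod"
  assumes K: "dg_module (enveloping C) K"
begin

interpretation K: bimodule C K using K by (simp add: bimodule_def dg_category_axioms)
interpretation TK: dg_module C "tw.T K" by (rule tw.dg_module_tw[OF K])

lemma lact_summand_linear:
  assumes "x \<in> Obj C" "y \<in> Obj C" "m \<in> Car K (y, x) j" "r \<in> B"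
  shows "linear_map_on (Hom C y (ob r) k) (\<lambda>f. push r (left_act C K (ob r) y x k j f m))"
  by (rule lin_compose[OF K.lact_linear_left push_linear UNIV_I]) (use assms in \<open>simp_all add: ob_in\<close>)

lemma \<theta>_linear:
  assumes "x \<in> Obj C" "y \<in> Obj C" "m \<in> Car K (y, x) j"
  shows "linear_map_on (Car Q y i) (\<lambda>u. \<theta> K x y i j u m)"
  unfolding \<theta>_def by (rule co_extend_linear(1)[OF assms(2) lact_summand_linear[OF assms]])

lemma \<theta>_act_gen:
  assumes x: "x \<in> Obj C" and y: "y \<in> Obj C" and m: "m \<in> Car K (y, x) j" and r: "r \<in> B" and f: "f \<in> Hom C y (ob r) k" and i: "i = dg r + k"
  shows "\<theta> K x y i j (Act Q y (ob r) (dg r) k (gen r) f) m = push r (left_act C K (ob r) y x k j f m)"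
proof -
  have "push s (left_act C K (ob s) y x (i - dg s) j 0 m) = 0" if "s \<in> B" for s
    by (rule lin_zero[OF lact_summand_linear[OF x y m that] hom_subspace[OF y ob_in[OF that]]])
  from co_extend_act_gen[where \<Phi> = "\<lambda>s f. push s (left_act C K (ob s) y x (i - dg s) j f m)", OF y this r f i]
  show ?thesis unfolding \<theta>_def using i by simp
qed

lemma \<theta>_gen:
  assumes "x \<in> Obj C" "r \<in> B" "m \<in> Car K (ob r, x) j"
  shows "\<theta> K x (ob r) (dg r) j (gen r) m = push r m"
  using \<theta>_act_gen[OF assms(1) ob_in[OF assms(2)] assms(3,2) ident_closed[OF ob_in[OF assms(2)]], of "dg r"] assms
  by (simp add: act_gen_ident K.lact_ident ob_in)

lemma \<theta>_in:
  assumes x: "x \<in> Obj C" and y: "y \<in> Obj C" and u: "u \<in> Car Q y i" and m: "m \<in> Car K (y, x) j" and n: "n = i + j"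
  shows "\<theta> K x y i j u m \<in> Car (tw.T K) x n"
  unfolding \<theta>_def
  by (rule TK.mem_sum[OF x], rule tw.tw_push_in[OF K x _ K.lact_in[OF x y ob_in co_in[OF y u _ refl] m]])
    (use co_supp[OF y u] n in auto)

lemma \<theta>_balanced:
  assumes x: "x \<in> Obj C"
  shows "balanced C Q K x (\<theta> K x)"
  unfolding balanced_def bilinear_map_on_def
proof (intro conjI ballI allI)
  fix y i j u assume y: "y \<in> Obj C" and u: "u \<in> Car Q y i"
  show "linear_map_on (Car K (y, x) j) (\<theta> K x y i j u)"
    unfolding \<theta>_def[abs_def]
    by (rule lin_sum_fun, rule lin_compose[OF K.lact_linear[OF x y ob_in co_in[OF y u _ refl]] push_linear UNIV_I])
      (use co_supp[OF y u] in auto)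
next
  fix y i j m assume "y \<in> Obj C" "m \<in> Car K (y, x) j"
  then show "linear_map_on (Car Q y i) (\<lambda>u. \<theta> K x y i j u m)" by (rule \<theta>_linear[OF x])
next
  fix y z i p j u f m assume o: "y \<in> Obj C" "z \<in> Obj C" and u: "u \<in> Car Q z i" and f: "f \<in> Hom C y z p" and m: "m \<in> Car K (y, x) j"
  note fm = K.lact_in[OF x o f m refl]
  show "\<theta> K x y (i + p) j (Act Q y z i p u f) m = \<theta> K x z i (p + j) u (left_act C K z y x p j f m)"
  proof (rule linear_eqI[OF o(2) lin_compose[OF Q.act_linear_left[OF o f] \<theta>_linear[OF x o(1) m] Q.act_in[OF o _ f refl]] \<theta>_linear[OF x o(2) fm] u])
    fix r g assume g: "r \<in> B" "g \<in> Hom C z (ob r) (i - dg r)"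
    note b = ob_in[OF g(1)] gen_in[OF g(1)]
    have e: "dg r + (i - dg r) = i" "i + p = dg r + (i - dg r + p)" by simp_all
    have "Act Q y z i p (Act Q z (ob r) (dg r) (i - dg r) (gen r) g) f =
        Act Q y (ob r) (dg r) (i - dg r + p) (gen r) (Comp C y z (ob r) (i - dg r) p g f)"
      using Q.act_act[OF o b g(2) f] unfolding e(1) .
    then show "\<theta> K x y (i + p) j (Act Q y z i p (Act Q z (ob r) (dg r) (i - dg r) (gen r) g) f) m =
        \<theta> K x z i (p + j) (Act Q z (ob r) (dg r) (i - dg r) (gen r) g) (left_act C K z y x p j f m)"
      using \<theta>_act_gen[OF x o(1) m g(1) comp_closed[OF o b(1) g(2) f] e(2)] \<theta>_act_gen[OF x o(2) fm g e(1)[symmetric]]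
        K.lact_lact[OF x o b(1) f g(2) m] by simp
  qed
qed

text \<open>By linearity and balancedness the axioms only have to be checked on tensors of generators.\<close>

lemma tensor_product: "tensor_product C Q K (tw.T K) (\<theta> K)"
proof (intro tensor_product.intro dg_category_axioms Q.dg_module_axioms K.bimodule_axioms TK.dg_module_axioms
    tensor_product_axioms.intro \<theta>_balanced)
  fix x n assume x: "x \<in> Obj C"
  let ?X = "{\<theta> K x y i j u m | y i j u m. y \<in> Obj C \<and> i + j = n \<and> u \<in> Car Q y i \<and> m \<in> Car K (y, x) j}"
  show "Car (tw.T K) x n = kvec.span ?X"
  proof (rule equalityI)
    show "kvec.span ?X \<subseteq> Car (tw.T K) x n"
      by (rule kvec.span_minimal[OF _ TK.car_subspace[OF x]]) (use \<theta>_in[OF x] in auto)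
    show "Car (tw.T K) x n \<subseteq> kvec.span ?X"
    proof
      fix t assume "t \<in> Car (tw.T K) x n"
      with x show "t \<in> kvec.span ?X"
      proof (induction rule: tw.tw_ind[OF K, consumes 2, case_names zero push add])
        case (push r v)
        have "push r v = \<theta> K x (ob r) (dg r) (n - dg r) (gen r) v" using \<theta>_gen[OF x push] by simp
        then have "push r v \<in> ?X" using push ob_in[OF push(1)] gen_in[OF push(1)] by fastforce
        then show ?case by (rule kvec.span_base)
      qed (auto intro: kvec.span_zero kvec.span_add)
    qed
  qed
next
  fix x n and \<psi> :: "'o \<Rightarrow> int \<Rightarrow> int \<Rightarrow> ('b, 'k) vec \<Rightarrow> ('b, 'k) vec \<Rightarrow> ('b, 'k) vec"
  assume x: "x \<in> Obj C" and \<psi>: "balanced C Q K x \<psi>"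
  let ?L = "extend (\<lambda>r. \<psi> (ob r) (dg r) (n - dg r) (gen r))"
  have lin: "linear_map_on (Car K (ob r, x) (n - dg r)) (\<psi> (ob r) (dg r) (n - dg r) (gen r))" if "r \<in> B" for r
    using \<psi> ob_in[OF that] gen_in[OF that] by (simp add: balanced_def bilinear_map_on_def)
  note sub = tw.tw_car_subspace[OF K x]
  have L: "linear_map_on (Car (tw.T K) x n) ?L"
    unfolding tw_simps by (rule extend_linear[OF sub lin])
  show "\<exists>L. linear_map_on (Car (tw.T K) x n) L \<and> (\<forall>y\<in>Obj C. \<forall>i j. i + j = n \<longrightarrow>
      (\<forall>u\<in>Car Q y i. \<forall>m\<in>Car K (y, x) j. L (\<theta> K x y i j u m) = \<psi> y i j u m))"
  proof (intro exI[of _ ?L] conjI ballI allI impI L)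
    fix y i j u m assume y: "y \<in> Obj C" and n: "i + j = n" and u: "u \<in> Car Q y i" and m: "m \<in> Car K (y, x) j"
    have \<psi>_lin: "linear_map_on (Car Q y i) (\<lambda>u. \<psi> y i j u m)" using \<psi> y m by (simp add: balanced_def bilinear_map_on_def)
    show "?L (\<theta> K x y i j u m) = \<psi> y i j u m"
    proof (rule linear_eqI[OF y lin_compose[OF \<theta>_linear[OF x y m] L \<theta>_in[OF x y _ m n[symmetric]]] \<psi>_lin u])
      fix r f assume f: "r \<in> B" "f \<in> Hom C y (ob r) (i - dg r)"
      have e: "dg r + (i - dg r) = i" "n - dg r = i - dg r + j" using n by auto
      have ep: "?L (push r v) = \<psi> (ob r) (dg r) (n - dg r) (gen r) v" for v
        by (rule extend_push[OF sub lin f(1)])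
      have bal: "\<psi> y (dg r + (i - dg r)) j (Act Q y (ob r) (dg r) (i - dg r) (gen r) f) m =
          \<psi> (ob r) (dg r) (i - dg r + j) (gen r) (left_act C K (ob r) y x (i - dg r) j f m)"
        using \<psi> y ob_in[OF f(1)] gen_in[OF f(1)] f(2) m unfolding balanced_def by blast
      show "?L (\<theta> K x y i j (Act Q y (ob r) (dg r) (i - dg r) (gen r) f) m) = \<psi> y i j (Act Q y (ob r) (dg r) (i - dg r) (gen r) f) m"
        unfolding \<theta>_act_gen[OF x y m f e(1)[symmetric]] ep e(2) by (rule bal[unfolded e(1), symmetric])
    qed
  qed
next
  fix x y i j u m assume x: "x \<in> Obj C" and y: "y \<in> Obj C" and u: "u \<in> Car Q y i" and m: "m \<in> Car K (y, x) j"
  have dm: "MDiff K (y, x) j m \<in> Car K (y, x) (j + 1)" by (rule K.K.d_in[OF _ m refl]) (use x y in simp)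
  have L: "linear_map_on (Car Q y i) (\<lambda>u. MDiff (tw.T K) x (i + j) (\<theta> K x y i j u m))"
    by (rule lin_compose[OF \<theta>_linear[OF x y m] TK.mdiff_linear[OF x] \<theta>_in[OF x y _ m refl]])
  have R: "linear_map_on (Car Q y i) (\<lambda>u. \<theta> K x y (i + 1) j (MDiff Q y i u) m + sgn_pow i (\<theta> K x y i (j + 1) u (MDiff K (y, x) j m)))"
    by (intro lin_plus lin_sgn \<theta>_linear[OF x y dm]
        lin_compose[OF Q.mdiff_linear[OF y] \<theta>_linear[OF x y m] Q.d_in[OF y _ refl]])
  show "MDiff (tw.T K) x (i + j) (\<theta> K x y i j u m) =
      \<theta> K x y (i + 1) j (MDiff Q y i u) m + sgn_pow i (\<theta> K x y i (j + 1) u (MDiff K (y, x) j m))"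
  proof (rule linear_eqI[OF y L R u])
    fix r f assume f: "r \<in> B" "f \<in> Hom C y (ob r) (i - dg r)"
    note b = ob_in[OF f(1)] gen_in[OF f(1)]
    let ?k = "i - dg r" and ?u = "Act Q y (ob r) (dg r) (i - dg r) (gen r) f"
    let ?fm = "left_act C K (ob r) y x ?k j f m"
    have e: "dg r + ?k = i" "i + 1 = dg r + 1 + ?k" "i + 1 = dg r + (?k + 1)" "i + j - dg r = ?k + j" by simp_all
    have df: "Diff C y (ob r) ?k f \<in> Hom C y (ob r) (?k + 1)" by (rule diff_closed[OF y b(1) f(2)])
    have d1: "Act Q y (ob r) (dg r + 1) ?k (MDiff Q (ob r) (dg r) (gen r)) f \<in> Car Q y (i + 1)"
      by (rule Q.act_in[OF y b(1) d_gen_in[OF f(1)] f(2) e(2)])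
    have d2: "Act Q y (ob r) (dg r) (?k + 1) (gen r) (Diff C y (ob r) ?k f) \<in> Car Q y (i + 1)"
      by (rule Q.act_in[OF y b df e(3)])
    have "\<theta> K x y (i + 1) j (MDiff Q y i ?u) m = \<theta> K x y (i + 1) j (Act Q y (ob r) (dg r + 1) ?k (MDiff Q (ob r) (dg r) (gen r)) f) m +
        sgn_pow (dg r) (\<theta> K x y (i + 1) j (Act Q y (ob r) (dg r) (?k + 1) (gen r) (Diff C y (ob r) ?k f)) m)"
      using Q.mdiff_act[OF y b f(2)] lin_add[OF \<theta>_linear[OF x y m] d1 Q.mem_sgn[OF y d2]]
        lin_sgn_pow[OF \<theta>_linear[OF x y m] d2] unfolding e(1) by simp
    also have "\<theta> K x y (i + 1) j (Act Q y (ob r) (dg r + 1) ?k (MDiff Q (ob r) (dg r) (gen r)) f) m =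
        \<theta> K x (ob r) (dg r + 1) (?k + j) (MDiff Q (ob r) (dg r) (gen r)) ?fm"
      using \<theta>_balanced[OF x] y b(1) d_gen_in[OF f(1)] f(2) m unfolding balanced_def e(2) by blast
    also have "\<dots> = (\<Sum>s | \<delta> r s \<noteq> 0. push s (tw.conn K x (i + j) r s ?fm))" unfolding \<theta>_def \<delta>_def e(4) ..
    also have "\<theta> K x y (i + 1) j (Act Q y (ob r) (dg r) (?k + 1) (gen r) (Diff C y (ob r) ?k f)) m =
        push r (left_act C K (ob r) y x (?k + 1) j (Diff C y (ob r) ?k f) m)"
      by (rule \<theta>_act_gen[OF x y m f(1) df e(3)])
    finally show "MDiff (tw.T K) x (i + j) (\<theta> K x y i j ?u m) =
        \<theta> K x y (i + 1) j (MDiff Q y i ?u) m + sgn_pow i (\<theta> K x y i (j + 1) ?u (MDiff K (y, x) j m))"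
      unfolding \<theta>_act_gen[OF x y m f e(1)[symmetric]] \<theta>_act_gen[OF x y dm f e(1)[symmetric]]
        tw.tw_d_push[OF K x f(1)] tw_pure_def e(4) K.d_lact[OF x y b(1) f(2) m]
      by (simp add: sgn_pow_add push_add push_sgn)
  qed
next
  fix x x' y i j q u m g
  assume o: "x \<in> Obj C" "x' \<in> Obj C" and y: "y \<in> Obj C" and u: "u \<in> Car Q y i" and m: "m \<in> Car K (y, x) j" and g: "g \<in> Hom C x' x q"
  note mg = K.ract_in[OF o y g m refl]
  show "Act (tw.T K) x' x (i + j) q (\<theta> K x y i j u m) g = \<theta> K x' y i (j + q) u (right_act C K y x x' j q m g)"
  proof (rule linear_eqI[OF y lin_compose[OF \<theta>_linear[OF o(1) y m] TK.act_linear_left[OF o(2,1) g] \<theta>_in[OF o(1) y _ m refl]]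
        \<theta>_linear[OF o(2) y mg] u])
    fix r f assume f: "r \<in> B" "f \<in> Hom C y (ob r) (i - dg r)"
    have e: "i = dg r + (i - dg r)" "i + j - dg r = i - dg r + j" by simp_all
    show "Act (tw.T K) x' x (i + j) q (\<theta> K x y i j (Act Q y (ob r) (dg r) (i - dg r) (gen r) f) m) g =
        \<theta> K x' y i (j + q) (Act Q y (ob r) (dg r) (i - dg r) (gen r) f) (right_act C K y x x' j q m g)"
      unfolding \<theta>_act_gen[OF o(1) y m f e(1)] \<theta>_act_gen[OF o(2) y mg f e(1)] tw.tw_act_push[OF K o(2,1) g f(1)] e(2)
        K.lact_ract[OF o y ob_in[OF f(1)] f(2) g m] ..
  qed
qed

end

end


section \<open>Semi-free resolutions\<close>

text \<open>
  A generator \<open>(y, i, z, u)\<close> of degree \<open>i\<close> at the object \<open>y\<close> is mapped to \<open>u\<close> and has the boundary \<open>z\<close>,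
  a cycle mapped to the boundary of \<open>u\<close>. All generators of this kind are adjoined, level by level: those
  with \<open>z = 0\<close> make the map to the resolved module surjective in cohomology, and every cycle which
  becomes a boundary is killed by a generator. Objects with zero identity are skipped, so
  that different generators give different elements.
\<close>

locale resolution = large_basis basis C + diagonal_bimodule C D \<epsilon> + F: dg_module C F
  for basis :: "'b itself" and C :: "('o, 'a, 'k::field) dgcat"
    and D :: "('o, 'a, 'b, 'k) bimod" and \<epsilon> and F :: "('o, 'a, 'b, 'k) dgmod"

sublocale resolution \<subseteq> coded "TYPE('o \<times> int \<times> ('b, 'k) vec \<times> ('b, 'k) vec)" basis
proof
  obtain e :: "'o \<times> int \<times> ('b, 'k) vec \<times> ('b, 'k) vec \<Rightarrow> 'b" where "inj e" using ex_inj_vector_data by blast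
  from ex_bij_Times[OF infinite_basis this]
  show "\<exists>e :: ('o \<times> int \<times> ('b, 'k) vec \<times> ('b, 'k) vec) \<times> 'b \<Rightarrow> 'b. bij e" .
qed

context resolution
begin

abbreviation ob :: "'o \<times> int \<times> ('b, 'k) vec \<times> ('b, 'k) vec \<Rightarrow> 'o" where "ob \<equiv> fst"
definition dg :: "'o \<times> int \<times> ('b, 'k) vec \<times> ('b, 'k) vec \<Rightarrow> int" where "dg j = fst (snd j)"
definition bd :: "'o \<times> int \<times> ('b, 'k) vec \<times> ('b, 'k) vec \<Rightarrow> ('b, 'k) vec" where "bd j = fst (snd (snd j))"
definition im :: "'o \<times> int \<times> ('b, 'k) vec \<times> ('b, 'k) vec \<Rightarrow> ('b, 'k) vec" where "im j = snd (snd (snd j))"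

lemma gen_simps [simp]: "dg (y, i, z, u) = i" "bd (y, i, z, u) = z" "im (y, i, z, u) = u"
  by (simp_all add: dg_def bd_def im_def)

text \<open>A boundary is stored as a vector built from elements of the diagonal, and
  \<open>eta\<close> turns its components back into morphisms. The first case secures finite support
  for all \<open>j\<close>, as the set of actual generators is not yet available.\<close>

definition \<delta> where
  "\<delta> j k = (if prj k (bd j) = 0 then 0 else eta (ob k) (ob j) (dg j + 1 - dg k) (prj k (bd j)))"

definition \<phi> where
  "\<phi> x n = extend (\<lambda>j m. Act F x (ob j) (dg j) (n - dg j) (im j) (eta (ob j) x (n - dg j) m))"

text \<open>The equations say that \<open>bd j\<close> is a cycle mapped to the boundary of
  \<open>im j\<close>. The differential appears as \<open>extend\<close> of \<open>tw_pure\<close>,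
  a formula without the set of generators, so the condition can be stated before \<open>J\<close> is
  defined.\<close>

definition admissible where
  "admissible j \<longleftrightarrow> ob j \<in> Obj C \<and> Ident C (ob j) \<noteq> 0 \<and> im j \<in> Car F (ob j) (dg j) \<and>
     (\<forall>k. prj k (bd j) \<noteq> 0 \<longrightarrow> prj k (bd j) \<in> Car D (ob k, ob j) (dg j + 1 - dg k)) \<and>
     extend (tw_pure C ob dg \<delta> D (ob j) (dg j + 1)) (bd j) = 0 \<and>
     \<phi> (ob j) (dg j + 1) (bd j) = MDiff F (ob j) (dg j) (im j)"

primrec J_level where
  "J_level 0 = {}"
| "J_level (Suc n) = {j. admissible j \<and> {k. prj k (bd j) \<noteq> 0} \<subseteq> J_level n}"

definition J where "J = (\<Union>n. J_level n)"

definition lev where "lev j = (LEAST n. j \<in> J_level n)"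

lemma J_level_Suc: "J_level n \<subseteq> J_level (Suc n)"
  by (induction n) auto

lemma J_level_mono: "m \<le> n \<Longrightarrow> J_level m \<subseteq> J_level n"
  using J_level_Suc by (rule lift_Suc_mono_le)

lemma J_ex_Suc: "j \<in> J \<Longrightarrow> \<exists>n. j \<in> J_level (Suc n)"
  using J_level_Suc by (auto simp: J_def)

lemma admissible: "j \<in> J \<Longrightarrow> admissible j"
  using J_ex_Suc by auto

lemma bd_supp: "j \<in> J \<Longrightarrow> {k. prj k (bd j) \<noteq> 0} \<subseteq> J"
  using J_ex_Suc by (fastforce simp: J_def)

lemma bd_lev:
  assumes j: "j \<in> J" and k: "prj k (bd j) \<noteq> 0"
  shows "lev k < lev j"
proof -
  have "j \<in> J_level (lev j)" unfolding lev_def by (rule LeastI_ex) (use j in \<open>auto simp: J_def\<close>)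
  then obtain n where n: "lev j = Suc n" "k \<in> J_level n" using k by (cases "lev j") auto
  then show ?thesis by (auto simp: lev_def[of k] intro: Least_le le_less_trans)
qed

text \<open>A vector has finite support, so its generators appear at a common finite level. Hence
  nothing has to be adjoined after the union over all levels: cycles of the final module already
  serve as boundaries of generators in \<open>J\<close>.\<close>

lemma JI:
  assumes "admissible j" "{k. prj k (bd j) \<noteq> 0} \<subseteq> J"
  shows "j \<in> J"
proof -
  have "\<forall>k\<in>{k. prj k (bd j) \<noteq> 0}. \<exists>n. k \<in> J_level n" using assms(2) by (auto simp: J_def)
  from bchoice[OF this] obtain f where f: "\<forall>k\<in>{k. prj k (bd j) \<noteq> 0}. k \<in> J_level (f k)" ..
  have "finite (f ` {k. prj k (bd j) \<noteq> 0})" by simp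
  then obtain N where "\<forall>n\<in>f ` {k. prj k (bd j) \<noteq> 0}. n \<le> N" using finite_nat_set_iff_bounded_le by blast
  then have "{k. prj k (bd j) \<noteq> 0} \<subseteq> J_level N" using f J_level_mono by blast
  then have "j \<in> J_level (Suc N)" using assms(1) by simp
  then show ?thesis unfolding J_def by blast
qed

lemma ob_in: "j \<in> J \<Longrightarrow> ob j \<in> Obj C" and im_in: "j \<in> J \<Longrightarrow> im j \<in> Car F (ob j) (dg j)"
  and ident_neq_0: "j \<in> J \<Longrightarrow> Ident C (ob j) \<noteq> 0"
  using admissible by (auto simp: admissible_def)

lemma bd_in: "j \<in> J \<Longrightarrow> k \<in> J \<Longrightarrow> prj k (bd j) \<in> Car D (ob k, ob j) (dg j + 1 - dg k)"
  using admissible[of j, unfolded admissible_def] ob_in[of j] ob_in[of k] K.mem_0[of "(ob k, ob j)"]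
  by (cases "prj k (bd j) = 0") (simp, blast)

lemma \<delta>_eta: "j \<in> J \<Longrightarrow> k \<in> J \<Longrightarrow> \<delta> j k = eta (ob k) (ob j) (dg j + 1 - dg k) (prj k (bd j))"
  using lin_zero[OF eta_linear[OF ob_in ob_in] K.car_subspace, of j k] ob_in by (simp add: \<delta>_def)

lemma \<delta>_supp: "{k. \<delta> j k \<noteq> 0} \<subseteq> {k. prj k (bd j) \<noteq> 0}"
  by (auto simp: \<delta>_def)

end

sublocale resolution \<subseteq> pretwisted "TYPE('o \<times> int \<times> ('b, 'k) vec \<times> ('b, 'k) vec)" basis C J ob dg \<delta>
proof unfold_locales
  fix i j assume i: "i \<in> J"
  show "ob i \<in> Obj C" by (rule ob_in[OF i])
  show "finite {j. \<delta> i j \<noteq> 0}" by (rule finite_subset[OF \<delta>_supp finite_prj])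
  show "\<delta> i j = 0" if "j \<notin> J" using that bd_supp[OF i] by (auto simp: \<delta>_def)
  show "\<delta> i j \<in> Hom C (ob i) (ob j) (dg i + 1 - dg j)" if j: "j \<in> J"
    unfolding \<delta>_eta[OF i j] by (rule eta_in[OF ob_in[OF i] ob_in[OF j] bd_in[OF i j] refl])
qed

context resolution
begin

notation T (\<open>T\<close>)

lemma bd_Car: "j \<in> J \<Longrightarrow> bd j \<in> Car (T D) (ob j) (dg j + 1)"
  using bd_in[of j] bd_supp[of j] unfolding tw_simps family_def by blast

lemma d_bd: "j \<in> J \<Longrightarrow> MDiff (T D) (ob j) (dg j + 1) (bd j) = 0"
  using admissible by (simp add: tw_simps admissible_def)

lemma \<phi>_bd: "j \<in> J \<Longrightarrow> \<phi> (ob j) (dg j + 1) (bd j) = MDiff F (ob j) (dg j) (im j)"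
  using admissible by (simp add: admissible_def)

end

text \<open>The Maurer-Cartan equation is the translation, by \<open>eta\<close>, of the fact that
  the vector \<open>bd j\<close> is a cycle, read component by component.\<close>

sublocale resolution \<subseteq> filtered_twisted "TYPE('o \<times> int \<times> ('b, 'k) vec \<times> ('b, 'k) vec)" basis C J ob dg \<delta> lev
proof unfold_locales
  show "lev j < lev i" if "i \<in> J" "\<delta> i j \<noteq> 0" for i j
    using bd_lev[OF that(1)] \<delta>_supp that(2) by blast
next
  fix j k assume j: "j \<in> J" and k: "k \<in> J"
  note D = K.dg_module_axioms
  note o = ob_in[OF j] ob_in[OF k]
  let ?e = "eta (ob k) (ob j) (dg j + 1 + 1 - dg k)"
  have e: "dg j + 1 - dg k + 1 = dg j + 1 + 1 - dg k" by simp
  note lin = eta_linear[OF o, of "dg j + 1 + 1 - dg k"] and sub = K.car_subspace[of "(ob k, ob j)" "dg j + 1 + 1 - dg k"]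
  have d: "MDiff D (ob k, ob j) (dg j + 1 - dg k) (prj k (bd j)) \<in> Car D (ob k, ob j) (dg j + 1 + 1 - dg k)"
    by (rule K.d_in[OF _ bd_in[OF j k]]) (use o in auto)
  have l: "conn D (ob j) (dg j + 1) i k (prj i (bd j)) \<in> Car D (ob k, ob j) (dg j + 1 + 1 - dg k)"
    "?e (conn D (ob j) (dg j + 1) i k (prj i (bd j))) =
      Comp C (ob j) (ob i) (ob k) (dg i + 1 - dg k) (dg j + 1 - dg i) (\<delta> i k) (\<delta> j i)"
    if "i \<in> {i. prj i (bd j) \<noteq> 0}" for i
  proof -
    have i: "i \<in> J" using bd_supp[OF j] that by blast
    show "conn D (ob j) (dg j + 1) i k (prj i (bd j)) \<in> Car D (ob k, ob j) (dg j + 1 + 1 - dg k)"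
      by (rule lact_in[OF o(1) ob_in[OF i] o(2) \<delta>_in[OF i k] bd_in[OF j i]]) simp
    show "?e (conn D (ob j) (dg j + 1) i k (prj i (bd j))) =
      Comp C (ob j) (ob i) (ob k) (dg i + 1 - dg k) (dg j + 1 - dg i) (\<delta> i k) (\<delta> j i)"
      unfolding \<delta>_eta[OF j i] by (rule eta_lact[OF o(1) ob_in[OF i] o(2) \<delta>_in[OF i k] bd_in[OF j i]]) simp
  qed
  have sub: "kvec.subspace (Car D (ob k, ob j) (dg j + 1 + 1 - dg k))" using sub o by simp
  have sum_l: "(\<Sum>i | prj i (bd j) \<noteq> 0. conn D (ob j) (dg j + 1) i k (prj i (bd j)))
      \<in> Car D (ob k, ob j) (dg j + 1 + 1 - dg k)"
    by (rule kvec.subspace_sum[OF sub l(1)])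
  have sum_e: "?e (\<Sum>i | prj i (bd j) \<noteq> 0. conn D (ob j) (dg j + 1) i k (prj i (bd j))) =
      (\<Sum>i | prj i (bd j) \<noteq> 0. ?e (conn D (ob j) (dg j + 1) i k (prj i (bd j))))"
    by (rule lin_sum[OF lin sub l(1)])
  have "0 = ?e (prj k (MDiff (T D) (ob j) (dg j + 1) (bd j)))"
    using lin_zero[OF lin sub] o d_bd[OF j] by simp
  also have "\<dots> = ?e (sgn_pow (dg k) (MDiff D (ob k, ob j) (dg j + 1 - dg k) (prj k (bd j)))) +
      (\<Sum>i | prj i (bd j) \<noteq> 0. ?e (conn D (ob j) (dg j + 1) i k (prj i (bd j))))"
    unfolding tw_prj_d[OF D o(1) bd_Car[OF j] k finite_prj order_refl bd_supp[OF j]] lin_add[OF lin sgn_pow_in[OF sub d] sum_l] sum_e ..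
  also have "\<dots> = sgn_pow (dg k) (Diff C (ob j) (ob k) (dg j + 1 - dg k) (\<delta> j k)) +
      (\<Sum>i | prj i (bd j) \<noteq> 0. Comp C (ob j) (ob i) (ob k) (dg i + 1 - dg k) (dg j + 1 - dg i) (\<delta> i k) (\<delta> j i))"
    using lin_sgn_pow[OF lin d] eta_d[OF o bd_in[OF j k] e[symmetric]] l(2) by (simp add: \<delta>_eta[OF j k])
  also have "(\<Sum>i | prj i (bd j) \<noteq> 0. Comp C (ob j) (ob i) (ob k) (dg i + 1 - dg k) (dg j + 1 - dg i) (\<delta> i k) (\<delta> j i)) =
      (\<Sum>i | \<delta> j i \<noteq> 0. Comp C (ob j) (ob i) (ob k) (dg i + 1 - dg k) (dg j + 1 - dg i) (\<delta> i k) (\<delta> j i))"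
  proof (rule sum.mono_neutral_right[OF finite_prj \<delta>_supp], rule ballI)
    fix i assume "i \<in> {i. prj i (bd j) \<noteq> 0} - {i. \<delta> j i \<noteq> 0}"
    then have i: "i \<in> J" "\<delta> j i = 0" using bd_supp[OF j] by auto
    show "Comp C (ob j) (ob i) (ob k) (dg i + 1 - dg k) (dg j + 1 - dg i) (\<delta> i k) (\<delta> j i) = 0"
      unfolding i(2)
      by (rule lin_zero[OF comp_linear_right[OF o(1) ob_in[OF i(1)] o(2) \<delta>_in[OF i(1) k]] hom_subspace[OF o(1) ob_in[OF i(1)]]])
  qed
  finally show "sgn_pow (dg k) (Diff C (ob j) (ob k) (dg j + 1 - dg k) (\<delta> j k)) +
     (\<Sum>i | \<delta> j i \<noteq> 0. Comp C (ob j) (ob i) (ob k) (dg i + 1 - dg k) (dg j + 1 - dg i) (\<delta> i k) (\<delta> j i)) = 0" by simp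
qed

context resolution
begin

lemma dg_module_TD: "dg_module C (T D)"
  by (rule dg_module_tw[OF K.dg_module_axioms])

interpretation TD: dg_module C "T D" by (rule dg_module_TD)

lemma car_subspace_D: "x \<in> Obj C \<Longrightarrow> j \<in> J \<Longrightarrow> kvec.subspace (Car D (ob j, x) (n - dg j))"
  by (rule K.car_subspace) (simp add: ob_in)

lemma \<phi>_summand_linear:
  assumes "x \<in> Obj C" "j \<in> J"
  shows "linear_map_on (Car D (ob j, x) (n - dg j)) (\<lambda>m. Act F x (ob j) (dg j) (n - dg j) (im j) (eta (ob j) x (n - dg j) m))"
  by (rule lin_compose[OF eta_linear F.act_linear_right]) (use assms in \<open>auto simp: ob_in im_in eta_in\<close>)

lemma \<phi>_linear: "x \<in> Obj C \<Longrightarrow> linear_map_on (Car (T D) x n) (\<phi> x n)"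
  unfolding \<phi>_def tw_simps by (rule extend_linear[OF car_subspace_D \<phi>_summand_linear])

lemma \<phi>_push:
  "x \<in> Obj C \<Longrightarrow> j \<in> J \<Longrightarrow> \<phi> x n (push j m) = Act F x (ob j) (dg j) (n - dg j) (im j) (eta (ob j) x (n - dg j) m)"
  unfolding \<phi>_def by (rule extend_push[OF car_subspace_D \<phi>_summand_linear])

definition gen where "gen j = push j (\<epsilon> (ob j) (ob j) 0 (Ident C (ob j)))"

lemma eps_ident_in: "j \<in> J \<Longrightarrow> \<epsilon> (ob j) (ob j) 0 (Ident C (ob j)) \<in> Car D (ob j, ob j) 0"
  by (simp add: eps_in ob_in ident_closed)

lemma gen_in: "j \<in> J \<Longrightarrow> gen j \<in> Car (T D) (ob j) (dg j)"
  unfolding gen_def by (rule tw_push_in[OF K.dg_module_axioms ob_in]) (simp_all add: eps_ident_in)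

lemma eps_ident_neq_0:
  assumes "j \<in> J"
  shows "\<epsilon> (ob j) (ob j) 0 (Ident C (ob j)) \<noteq> 0"
  using ident_neq_0[OF assms] eta_eps[OF ob_in ob_in ident_closed[OF ob_in], OF assms assms assms]
    lin_zero[OF eta_linear[OF ob_in[OF assms] ob_in[OF assms]] K.car_subspace, of 0] ob_in[OF assms] by auto

lemma gen_act:
  assumes x: "x \<in> Obj C" and j: "j \<in> J" and f: "f \<in> Hom C x (ob j) k"
  shows "Act (T D) x (ob j) (dg j) k (gen j) f = push j (\<epsilon> (ob j) x k f)"
  using ract_eps[OF ob_in[OF j] x ob_in[OF j] ident_closed[OF ob_in[OF j]] f] comp_ident_left[OF x ob_in[OF j] f]
  unfolding gen_def by (simp add: tw_act_push[OF K.dg_module_axioms x ob_in[OF j] f j])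

lemma \<phi>_gen: "j \<in> J \<Longrightarrow> \<phi> (ob j) (dg j) (gen j) = im j"
  unfolding gen_def by (simp add: \<phi>_push ob_in eta_eps ident_closed F.act_ident im_in)

lemma d_gen:
  assumes j: "j \<in> J"
  shows "MDiff (T D) (ob j) (dg j) (gen j) = bd j"
proof -
  note o = ob_in[OF j] and i = ident_closed[OF ob_in[OF j]]
  have "MDiff D (ob j, ob j) 0 (\<epsilon> (ob j) (ob j) 0 (Ident C (ob j))) = \<epsilon> (ob j) (ob j) 1 0"
    using eps_d[OF o o i] diff_ident[OF o] by simp
  also have "\<dots> = 0" by (rule lin_zero[OF eps_linear[OF o o] hom_subspace[OF o o]])
  finally have d0: "MDiff D (ob j, ob j) 0 (\<epsilon> (ob j) (ob j) 0 (Ident C (ob j))) = 0" .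
  have l: "left_act C D (ob k) (ob j) (ob j) (dg j + 1 - dg k) 0 (\<delta> j k) (\<epsilon> (ob j) (ob j) 0 (Ident C (ob j))) = prj k (bd j)"
    if k: "k \<in> J" for k
    using lact_eps[OF o o ob_in[OF k] \<delta>_in[OF j k] i] comp_ident_right[OF o ob_in[OF k] \<delta>_in[OF j k]]
    by (simp add: \<delta>_eta[OF j k] eps_eta[OF o ob_in[OF k] bd_in[OF j k]])
  have "MDiff (T D) (ob j) (dg j) (gen j) = (\<Sum>k | \<delta> j k \<noteq> 0. push k (prj k (bd j)))"
    unfolding gen_def tw_d_push[OF K.dg_module_axioms o j] tw_pure_def
    using d0 l \<delta>_supp[of j] bd_supp[OF j] by (auto intro!: sum.cong)
  also have "\<dots> = (\<Sum>k :: 'o \<times> int \<times> ('b, 'k) vec \<times> ('b, 'k) vec | prj k (bd j) \<noteq> 0. push k (prj k (bd j)))"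
  proof (rule sum.mono_neutral_left[OF finite_prj \<delta>_supp], rule ballI)
    fix k assume "k \<in> {k. prj k (bd j) \<noteq> 0} - {k. \<delta> j k \<noteq> 0}"
    then have k: "k \<in> J" "\<delta> j k = 0" using bd_supp[OF j] by auto
    then have "prj k (bd j) = \<epsilon> (ob k) (ob j) (dg j + 1 - dg k) 0"
      using eps_eta[OF o ob_in[OF k(1)] bd_in[OF j k(1)]] \<delta>_eta[OF j k(1)] by simp
    then show "push k (prj k (bd j)) = 0"
      using lin_zero[OF eps_linear[OF o ob_in[OF k(1)]] hom_subspace[OF o ob_in[OF k(1)]]] by simp
  qed
  also have "\<dots> = bd j" by (rule sum_push_prj)
  finally show ?thesis .
qed

lemma push_gen:
  assumes x: "x \<in> Obj C" and j: "j \<in> J" and m: "m \<in> Car D (ob j, x) k"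
  shows "push j m = Act (T D) x (ob j) (dg j) k (gen j) (eta (ob j) x k m)"
  by (simp add: gen_act[OF x j eta_in[OF x ob_in[OF j] m refl]] eps_eta[OF x ob_in[OF j] m])

lemma \<phi>_in:
  assumes x: "x \<in> Obj C" and t: "t \<in> Car (T D) x n"
  shows "\<phi> x n t \<in> Car F x n"
  using x t
proof (induction rule: tw_ind[OF K.dg_module_axioms, consumes 2, case_names zero push add])
  case zero
  show ?case using lin_zero[OF \<phi>_linear[OF x] TD.car_subspace[OF x]] F.mem_0[OF x] by simp
next
  case (push j m)
  show ?case unfolding \<phi>_push[OF x push(1)]
    by (rule F.act_in[OF x ob_in[OF push(1)] im_in[OF push(1)] eta_in[OF x ob_in[OF push(1)] push(2) refl]]) simp
next
  case (add s t)
  then show ?case using lin_add[OF \<phi>_linear[OF x]] F.mem_add[OF x] by simp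
qed

lemma \<phi>_act:
  assumes o: "x \<in> Obj C" "y \<in> Obj C" and t: "t \<in> Car (T D) y i" and f: "f \<in> Hom C x y q"
  shows "\<phi> x (i + q) (Act (T D) x y i q t f) = Act F x y i q (\<phi> y i t) f"
proof -
  have L: "linear_map_on (Car (T D) y i) (\<lambda>t. \<phi> x (i + q) (Act (T D) x y i q t f))"
    by (rule lin_compose[OF TD.act_linear_left[OF o f] \<phi>_linear[OF o(1)] TD.act_in[OF o _ f refl]])
  have R: "linear_map_on (Car (T D) y i) (\<lambda>t. Act F x y i q (\<phi> y i t) f)"
    by (rule lin_compose[OF \<phi>_linear[OF o(2)] F.act_linear_left[OF o f] \<phi>_in[OF o(2)]])
  show ?thesis
  proof (rule tw_linear_eqI[OF K.dg_module_axioms o(2) L R t])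
    fix j m assume push: "j \<in> J" "m \<in> Car D (ob j, y) (i - dg j)"
    note j = ob_in[OF push(1)]
    have e: "i + q - dg j = i - dg j + q" "dg j + (i - dg j) = i" by auto
    show "\<phi> x (i + q) (Act (T D) x y i q (push j m) f) = Act F x y i q (\<phi> y i (push j m)) f"
      using F.act_act[OF o j im_in[OF push(1)] eta_in[OF o(2) j push(2) refl] f]
      unfolding tw_act_push[OF K.dg_module_axioms o f push(1)] \<phi>_push[OF o(1) push(1)] \<phi>_push[OF o(2) push(1)] e
        eta_ract[OF o(2,1) j push(2) f refl] by simp
  qed
qed

lemma \<phi>_d:
  assumes x: "x \<in> Obj C" and t: "t \<in> Car (T D) x n"
  shows "\<phi> x (n + 1) (MDiff (T D) x n t) = MDiff F x n (\<phi> x n t)"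
proof -
  have L: "linear_map_on (Car (T D) x n) (\<lambda>t. \<phi> x (n + 1) (MDiff (T D) x n t))"
    by (rule lin_compose[OF TD.mdiff_linear[OF x] \<phi>_linear[OF x] TD.d_in[OF x _ refl]])
  have R: "linear_map_on (Car (T D) x n) (\<lambda>t. MDiff F x n (\<phi> x n t))"
    by (rule lin_compose[OF \<phi>_linear[OF x] F.mdiff_linear[OF x] \<phi>_in[OF x]])
  show ?thesis
  proof (rule tw_linear_eqI[OF K.dg_module_axioms x L R t])
    fix j m assume push: "j \<in> J" "m \<in> Car D (ob j, x) (n - dg j)"
    note j = ob_in[OF push(1)]
    define h where "h = eta (ob j) x (n - dg j) m"
    have h: "h \<in> Hom C x (ob j) (n - dg j)" unfolding h_def by (rule eta_in[OF x j push(2) refl])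
    have dh: "Diff C x (ob j) (n - dg j) h \<in> Hom C x (ob j) (n - dg j + 1)" by (rule diff_closed[OF x j h])
    have e: "dg j + (n - dg j) = n" "dg j + 1 + (n - dg j) = n + 1" "dg j + (n - dg j + 1) = n + 1" by auto
    have i1: "Act (T D) x (ob j) (dg j + 1) (n - dg j) (bd j) h \<in> Car (T D) x (n + 1)"
      by (rule TD.act_in[OF x j bd_Car[OF push(1)] h]) simp
    have i2: "Act (T D) x (ob j) (dg j) (n - dg j + 1) (gen j) (Diff C x (ob j) (n - dg j) h) \<in> Car (T D) x (n + 1)"
      by (rule TD.act_in[OF x j gen_in[OF push(1)] dh]) simp
    have "\<phi> x (n + 1) (MDiff (T D) x n (push j m)) = \<phi> x (n + 1) (Act (T D) x (ob j) (dg j + 1) (n - dg j) (bd j) h) +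
        sgn_pow (dg j) (\<phi> x (n + 1) (Act (T D) x (ob j) (dg j) (n - dg j + 1) (gen j) (Diff C x (ob j) (n - dg j) h)))"
      using TD.mdiff_act[OF x j gen_in[OF push(1)] h] lin_add[OF \<phi>_linear[OF x] i1 TD.mem_sgn[OF x i2]]
        lin_sgn_pow[OF \<phi>_linear[OF x] i2]
      unfolding push_gen[OF x push] h_def[symmetric] e(1) d_gen[OF push(1)] by simp
    also have "\<dots> = Act F x (ob j) (dg j + 1) (n - dg j) (MDiff F (ob j) (dg j) (im j)) h +
        sgn_pow (dg j) (Act F x (ob j) (dg j) (n - dg j + 1) (im j) (Diff C x (ob j) (n - dg j) h))"
      using \<phi>_act[OF x j bd_Car[OF push(1)] h] \<phi>_act[OF x j gen_in[OF push(1)] dh]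
      unfolding e \<phi>_bd[OF push(1)] \<phi>_gen[OF push(1)] by simp
    also have "\<dots> = MDiff F x n (Act F x (ob j) (dg j) (n - dg j) (im j) h)"
      using F.mdiff_act[OF x j im_in[OF push(1)] h] unfolding e by simp
    also have "Act F x (ob j) (dg j) (n - dg j) (im j) h = \<phi> x n (push j m)"
      unfolding \<phi>_push[OF x push(1)] h_def ..
    finally show "\<phi> x (n + 1) (MDiff (T D) x n (push j m)) = MDiff F x n (\<phi> x n (push j m))" .
  qed
qed

text \<open>At an object with zero identity every module vanishes, so skipping these objects among
  the generators loses nothing.\<close>

lemma zero_ident: "dg_module C M \<Longrightarrow> x \<in> Obj C \<Longrightarrow> Ident C x = 0 \<Longrightarrow> m \<in> Car M x n \<Longrightarrow> m = 0"
  using dg_module.act_ident[of C M x m n] lin_zero[OF dg_module.act_linear_right[of C M x x m n 0] hom_subspace]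
  by metis

lemma quasi_iso_resolution: "quasi_iso C (T D) F \<phi>"
proof (rule quasi_isoI)
  show "dg_morphism C (T D) F \<phi>"
    by (rule dg_morphismI[OF dg_module_TD F.dg_module_axioms \<phi>_linear \<phi>_in \<phi>_d \<phi>_act])
next
  fix x n t u assume x: "x \<in> Obj C" and t: "t \<in> Car (T D) x n" "MDiff (T D) x n t = 0" and u: "u \<in> Car F x (n - 1)"
    and eq: "\<phi> x n t = MDiff F x (n - 1) u"
  show "\<exists>u\<in>Car (T D) x (n - 1). t = MDiff (T D) x (n - 1) u"
  proof (cases "Ident C x = 0")
    case True
    then have "t = 0" using zero_ident[OF dg_module_TD x] t(1) by blast
    then show ?thesis using TD.mem_0[OF x] TD.d_0[OF x] by (intro bexI[of _ 0]) simp_all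
  next
    case False
    \<comment> \<open>The generator that kills the class of \<open>t\<close>: its boundary is
      \<open>t\<close> and its image is the given primitive \<open>u\<close>.\<close>
    let ?j = "(x, n - 1, t, u)"
    have "?j \<in> J"
    proof (rule JI)
      show "{k. prj k (bd ?j) \<noteq> 0} \<subseteq> J" using tw_supp[OF t(1)] by simp
      show "admissible ?j"
        unfolding admissible_def using x False u eq t tw_supp[OF t(1)] tw_mem[OF t(1)] by (auto simp: tw_simps)
    qed
    from gen_in[OF this] d_gen[OF this] show ?thesis by (intro bexI[of _ "gen ?j"]) simp_all
  qed
next
  fix x n v assume x: "x \<in> Obj C" and v: "v \<in> Car F x n" "MDiff F x n v = 0"
  show "\<exists>m\<in>Car (T D) x n. \<exists>u\<in>Car F x (n - 1). MDiff (T D) x n m = 0 \<and> v = \<phi> x n m + MDiff F x (n - 1) u"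
  proof (cases "Ident C x = 0")
    case True
    then have "v = 0" using zero_ident[OF F.dg_module_axioms x] v(1) by blast
    then show ?thesis
      using TD.mem_0[OF x] TD.d_0[OF x] F.mem_0[OF x] F.d_0[OF x] lin_zero[OF \<phi>_linear[OF x] TD.car_subspace[OF x]]
      by (intro bexI[of _ 0]) simp_all
  next
    case False
    let ?j = "(x, n, 0, v)"
    have "?j \<in> J"
    proof (rule JI)
      show "admissible ?j"
        unfolding admissible_def using x False v TD.d_0[OF x] lin_zero[OF \<phi>_linear[OF x] TD.car_subspace[OF x]]
        by (simp add: tw_simps)
    qed simp
    from gen_in[OF this] d_gen[OF this] \<phi>_gen[OF this] show ?thesis
      using F.mem_0[OF x] F.d_0[OF x] by (intro bexI[of _ "gen ?j"] bexI[of _ 0]) simp_all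
  qed
qed

end


section \<open>The resolution is semi-free\<close>

context resolution
begin

definition basis_elem where "basis_elem j = (ob j, dg j, gen j)"

lemma inj_basis_elem: "inj_on basis_elem J"
proof (rule inj_onI)
  fix i j assume i: "i \<in> J" and j: "j \<in> J" and eq: "basis_elem i = basis_elem j"
  have "prj i (gen i) = prj i (gen j)" using eq by (simp add: basis_elem_def)
  then show "i = j" using eps_ident_neq_0[OF i] by (auto simp: gen_def prj_push split: if_splits)
qed

lemma prj_combination:
  assumes J': "J' \<subseteq> J" and x: "x \<in> Obj C" and supp: "\<And>\<beta>. \<beta> \<notin> basis_elem ` J' \<Longrightarrow> c \<beta> = 0" and fin: "finite {\<beta>. c \<beta> \<noteq> 0}"
    and c: "\<And>j. j \<in> J' \<Longrightarrow> c (basis_elem j) \<in> Hom C x (ob j) (n - dg j)"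
  shows "prj k (\<Sum>\<beta> | c \<beta> \<noteq> 0. Act (T D) x (fst \<beta>) (fst (snd \<beta>)) (n - fst (snd \<beta>)) (snd (snd \<beta>)) (c \<beta>)) =
    (if k \<in> J' then \<epsilon> (ob k) x (n - dg k) (c (basis_elem k)) else 0)"
proof -
  define S where "S = {j\<in>J'. c (basis_elem j) \<noteq> 0}"
  have "\<beta> \<in> basis_elem ` S" if "c \<beta> \<noteq> 0" for \<beta>
    using supp[of \<beta>] that by (cases "\<beta> \<in> basis_elem ` J'") (auto simp: S_def)
  then have eq: "{\<beta>. c \<beta> \<noteq> 0} = basis_elem ` S" by (auto simp: S_def)
  have inj: "inj_on basis_elem S" using inj_basis_elem by (rule inj_on_subset) (use J' in \<open>auto simp: S_def\<close>)
  have S: "finite S" using fin finite_imageD[OF _ inj] eq by simp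
  have "(\<Sum>\<beta> | c \<beta> \<noteq> 0. Act (T D) x (fst \<beta>) (fst (snd \<beta>)) (n - fst (snd \<beta>)) (snd (snd \<beta>)) (c \<beta>)) =
      (\<Sum>j\<in>S. Act (T D) x (ob j) (dg j) (n - dg j) (gen j) (c (basis_elem j)))"
    unfolding eq sum.reindex[OF inj] by (simp add: basis_elem_def)
  also have "\<dots> = (\<Sum>j\<in>S. push j (\<epsilon> (ob j) x (n - dg j) (c (basis_elem j))))"
    by (rule sum.cong[OF refl], rule gen_act[OF x]) (use J' c in \<open>auto simp: S_def\<close>)
  finally have "prj k (\<Sum>\<beta> | c \<beta> \<noteq> 0. Act (T D) x (fst \<beta>) (fst (snd \<beta>)) (n - fst (snd \<beta>)) (snd (snd \<beta>)) (c \<beta>)) =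
      (if k \<in> S then \<epsilon> (ob k) x (n - dg k) (c (basis_elem k)) else 0)"
    using S by (simp add: prj_sum prj_push)
  moreover have "\<epsilon> (ob k) x (n - dg k) 0 = 0" if "k \<in> J'"
    by (rule lin_zero[OF eps_linear hom_subspace]) (use that J' x in \<open>auto simp: ob_in\<close>)
  ultimately show ?thesis by (auto simp: S_def)
qed

text \<open>The component at \<open>j\<close> of a combination is the copy under
  \<open>\<epsilon>\<close> of the coefficient, so coefficients and components determine each other.
  The version for subsets of \<open>J\<close> also expresses boundaries through generators of lower
  level.\<close>

lemma basis_combination_iff:
  assumes J': "J' \<subseteq> J" and x: "x \<in> Obj C" and t: "t \<in> Car (T D) x n" and supp: "\<And>\<beta>. \<beta> \<notin> basis_elem ` J' \<Longrightarrow> c \<beta> = 0"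
  shows "is_combination C (T D) (basis_elem ` J') x n t c \<longleftrightarrow>
    (\<forall>j\<in>J'. c (basis_elem j) = eta (ob j) x (n - dg j) (prj j t)) \<and> {j. prj j t \<noteq> 0} \<subseteq> J'"
proof
  assume "is_combination C (T D) (basis_elem ` J') x n t c"
  then have fin: "finite {\<beta>. c \<beta> \<noteq> 0}" and cin: "\<forall>\<beta>\<in>basis_elem ` J'. c \<beta> \<in> Hom C x (fst \<beta>) (n - fst (snd \<beta>))"
    and sum: "t = (\<Sum>\<beta> | c \<beta> \<noteq> 0. Act (T D) x (fst \<beta>) (fst (snd \<beta>)) (n - fst (snd \<beta>)) (snd (snd \<beta>)) (c \<beta>))"
    unfolding is_combination_iff by blast+
  have c: "c (basis_elem j) \<in> Hom C x (ob j) (n - dg j)" if "j \<in> J'" for j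
    using cin[rule_format, OF imageI[OF that]] by (simp add: basis_elem_def)
  have "prj k t = (if k \<in> J' then \<epsilon> (ob k) x (n - dg k) (c (basis_elem k)) else 0)" for k
    using prj_combination[OF J' x supp fin c] sum by simp
  then show "(\<forall>j\<in>J'. c (basis_elem j) = eta (ob j) x (n - dg j) (prj j t)) \<and> {j. prj j t \<noteq> 0} \<subseteq> J'"
    using eta_eps[OF x ob_in c] J' by (auto split: if_splits)
next
  assume a: "(\<forall>j\<in>J'. c (basis_elem j) = eta (ob j) x (n - dg j) (prj j t)) \<and> {j. prj j t \<noteq> 0} \<subseteq> J'"
  have e0: "eta (ob j) x (n - dg j) 0 = 0" if "j \<in> J'" for j
    by (rule lin_zero[OF eta_linear car_subspace_D]) (use that J' x in \<open>auto simp: ob_in\<close>)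
  have "{\<beta>. c \<beta> \<noteq> 0} \<subseteq> basis_elem ` {j. prj j t \<noteq> 0}"
  proof
    fix \<beta> assume b: "\<beta> \<in> {\<beta>. c \<beta> \<noteq> 0}"
    then obtain j where j: "j \<in> J'" "\<beta> = basis_elem j" using supp by blast
    then show "\<beta> \<in> basis_elem ` {j. prj j t \<noteq> 0}" using b a e0[OF j(1)] by auto
  qed
  from finite_subset[OF this finite_imageI[OF finite_prj]] have fin: "finite {\<beta>. c \<beta> \<noteq> 0}" .
  have c: "c (basis_elem j) \<in> Hom C x (ob j) (n - dg j)" if "j \<in> J'" for j
  proof -
    have j: "j \<in> J" using that J' by blast
    show ?thesis using a that eta_in[OF x ob_in[OF j] tw_mem[OF t j] refl] by simp
  qed
  show "is_combination C (T D) (basis_elem ` J') x n t c"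
    unfolding is_combination_iff
  proof (intro conjI fin)
    show "{\<beta>. c \<beta> \<noteq> 0} \<subseteq> basis_elem ` J'" using supp by blast
    show "\<forall>\<beta>\<in>basis_elem ` J'. c \<beta> \<in> Hom C x (fst \<beta>) (n - fst (snd \<beta>))"
      using c by (auto simp: basis_elem_def)
    show "t = (\<Sum>\<beta> | c \<beta> \<noteq> 0. Act (T D) x (fst \<beta>) (fst (snd \<beta>)) (n - fst (snd \<beta>)) (snd (snd \<beta>)) (c \<beta>))"
    proof (rule vec_eqI)
      fix k :: "'o \<times> int \<times> ('b, 'k) vec \<times> ('b, 'k) vec"
      show "prj k t = prj k (\<Sum>\<beta> | c \<beta> \<noteq> 0. Act (T D) x (fst \<beta>) (fst (snd \<beta>)) (n - fst (snd \<beta>)) (snd (snd \<beta>)) (c \<beta>))"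
        using a eps_eta[OF x ob_in[OF subsetD[OF J']] tw_mem[OF t subsetD[OF J']], of k] prj_combination[OF J' x supp fin c, of k]
        by (cases "k \<in> J'") auto
    qed
  qed
qed

lemma semi_free_TD: "semi_free C (T D)"
proof -
  define inv where "inv = the_inv_into J basis_elem"
  have inv: "inv (basis_elem j) = j" if "j \<in> J" for j
    unfolding inv_def by (rule the_inv_into_f_f[OF inj_basis_elem that])
  define coords where "coords = (\<lambda>J' x n t \<beta>. if \<beta> \<in> basis_elem ` J' then eta (ob (inv \<beta>)) x (n - dg (inv \<beta>)) (prj (inv \<beta>) t) else 0)"
  have coords: "is_combination C (T D) (basis_elem ` J') x n t (coords J' x n t)"
    if "J' \<subseteq> J" "x \<in> Obj C" "t \<in> Car (T D) x n" "{j. prj j t \<noteq> 0} \<subseteq> J'" for J' x n t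
    by (subst basis_combination_iff[OF that(1,2,3)]) (use that inv in \<open>auto simp: coords_def\<close>)
  show ?thesis
    unfolding semi_free_def
  proof (intro conjI dg_module_TD exI[of _ "basis_elem ` J"] exI[of _ "\<lambda>\<beta>. lev (inv \<beta>)"])
    show "\<forall>(y, i, b)\<in>basis_elem ` J. y \<in> Obj C \<and> b \<in> Car (T D) y i"
      using ob_in gen_in by (auto simp: basis_elem_def)
    show "\<forall>x\<in>Obj C. \<forall>n. \<forall>m\<in>Car (T D) x n. \<exists>!c. is_combination C (T D) (basis_elem ` J) x n m c"
    proof (intro ballI allI ex1I)
      fix x n m assume x: "x \<in> Obj C" and m: "m \<in> Car (T D) x n"
      note comb = coords[OF subset_refl x m tw_supp[OF m]]
      show "is_combination C (T D) (basis_elem ` J) x n m (coords J x n m)" by (rule comb)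
      fix c assume c: "is_combination C (T D) (basis_elem ` J) x n m c"
      have z: "d \<beta> = 0" if "is_combination C (T D) (basis_elem ` J) x n m d" "\<beta> \<notin> basis_elem ` J" for d \<beta>
        using that unfolding is_combination_iff by blast
      have eq: "\<forall>j\<in>J. c (basis_elem j) = coords J x n m (basis_elem j)"
        using c comb basis_combination_iff[OF subset_refl x m z[OF c]] basis_combination_iff[OF subset_refl x m z[OF comb]] by simp
      show "c = coords J x n m"
      proof
        fix \<beta>
        show "c \<beta> = coords J x n m \<beta>"
          using eq z[OF c, of \<beta>] z[OF comb, of \<beta>] by (cases "\<beta> \<in> basis_elem ` J") auto
      qed
    qed
    show "\<forall>(y, i, b)\<in>basis_elem ` J. \<exists>c. is_combination C (T D)
        {\<beta>\<in>basis_elem ` J. lev (inv \<beta>) < lev (inv (y, i, b))} y (i + 1) (MDiff (T D) y i b) c"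
    proof
      fix \<beta> assume "\<beta> \<in> basis_elem ` J"
      then obtain j where j: "j \<in> J" "\<beta> = basis_elem j" by blast
      have "{\<beta>\<in>basis_elem ` J. lev (inv \<beta>) < lev (inv (basis_elem j))} = basis_elem ` {k\<in>J. lev k < lev j}"
        using inv j(1) by auto
      moreover have "is_combination C (T D) (basis_elem ` {k\<in>J. lev k < lev j}) (ob j) (dg j + 1) (bd j)
          (coords {k\<in>J. lev k < lev j} (ob j) (dg j + 1) (bd j))"
        by (rule coords[OF _ ob_in[OF j(1)] bd_Car[OF j(1)]]) (use bd_supp[OF j(1)] bd_lev[OF j(1)] in auto)
      ultimately show "case \<beta> of (y, i, b) \<Rightarrow> \<exists>c. is_combination C (T D)
          {\<beta>\<in>basis_elem ` J. lev (inv \<beta>) < lev (inv (y, i, b))} y (i + 1) (MDiff (T D) y i b) c"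
        unfolding j(2) by (auto simp: basis_elem_def d_gen[OF j(1)])
    qed
  qed
qed

end

lemma semi_free_imp_basis:
  assumes "dg_category C" "semi_free C Q"
  shows "\<exists>B level. semi_free_basis C Q B level"
proof -
  from assms(2) obtain B level where Q: "dg_module C Q"
    and b: "\<forall>(y, i, b)\<in>B. y \<in> Obj C \<and> b \<in> Car Q y i" "\<forall>x\<in>Obj C. \<forall>n. \<forall>m\<in>Car Q x n. \<exists>!c. is_combination C Q B x n m c"
      "\<forall>(y, i, b)\<in>B. \<exists>c. is_combination C Q {\<beta>\<in>B. (level \<beta> :: nat) < level (y, i, b)} y (i + 1) (MDiff Q y i b) c"
    unfolding semi_free_def by (elim exE conjE)
  have "semi_free_basis C Q B level"
    unfolding semi_free_basis_def semi_free_basis_axioms_def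
  proof (intro conjI allI impI assms(1) Q)
    fix \<beta> assume "\<beta> \<in> B"
    then show "\<exists>c. is_combination C Q {\<gamma>\<in>B. level \<gamma> < level \<beta>} (fst \<beta>) (fst (snd \<beta>) + 1) (MDiff Q (fst \<beta>) (fst (snd \<beta>)) (snd (snd \<beta>))) c"
      using b(3) by (cases \<beta>) fastforce
  qed (use b(1,2) in auto)
  then show ?thesis by (intro exI)
qed

section \<open>Generation of the diagonal and of the category\<close>

locale diagonal_universe = large_basis basis C + diagonal_bimodule C D \<epsilon>
  for basis :: "'b itself" and C :: "('o, 'a, 'k::field) dgcat"
    and D :: "('o, 'a, 'b, 'k) bimod" and \<epsilon>
begin

lemma ex_semi_free_resolution:
  assumes F: "dg_module C (F :: ('o, 'a, 'b, 'k) dgmod)"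
  shows "\<exists>Q \<sigma>. semi_free C (Q :: ('o, 'a, 'b, 'k) dgmod) \<and> quasi_iso C Q F \<sigma>"
proof -
  interpret F: dg_module C F by fact
  interpret resolution basis C D \<epsilon> F ..
  show ?thesis using semi_free_TD quasi_iso_resolution by (intro exI conjI)
qed

end

sublocale diagonal_universe \<subseteq> enough_kproj basis C
proof unfold_locales
  fix F :: "('o, 'a, 'b, 'k) dgmod" assume "dg_module C F"
  from ex_semi_free_resolution[OF this]
  obtain Q :: "('o, 'a, 'b, 'k) dgmod" and \<sigma> where Q: "semi_free C Q" "quasi_iso C Q F \<sigma>"
    by (elim exE conjE)
  obtain B level where "semi_free_basis C Q B level"
    using semi_free_imp_basis[OF dg_category_axioms Q(1)] by (elim exE)
  from semi_free_basis.kproj[OF this] Q(2) show "\<exists>P \<sigma>. kproj C P \<and> quasi_iso C P F \<sigma>" by (intro exI conjI)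
qed

context diagonal_universe
begin

lemma ex_semi_free_tensor:
  assumes "semi_free C (Q :: ('o, 'a, 'b, 'k) dgmod)"
  shows "\<exists>B level. semi_free_tensor C Q B level"
proof -
  obtain B level where "semi_free_basis C Q B level"
    using semi_free_imp_basis[OF dg_category_axioms assms] by (elim exE)
  moreover obtain e :: "'o \<times> int \<times> ('b, 'k) vec \<times> ('b, 'k) vec \<Rightarrow> 'b" where e: "inj e" using ex_inj_vector_data by blast
  have "inj (\<lambda>(y, i, b). e (y, i, b, 0))" by (auto intro!: injI dest!: injD[OF e])
  note ex_bij_Times[OF infinite_basis this]
  ultimately have "semi_free_tensor C Q B level"
    by (simp add: semi_free_tensor_def infinite_basis_axioms coded_def)
  then show ?thesis by (intro exI)
qed

text \<open>Shows that the choice in \<open>convolution\<close> is made from a nonempty set; only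
  then does the hypothesis about convolutions carry information.\<close>

lemma convolution_ex:
  fixes F :: "('o, 'a, 'b, 'k) dgmod" and K :: "('o, 'a, 'b, 'k) bimod"
  assumes F: "dg_module C F" and K: "dg_module (enveloping C) K"
  shows "\<exists>Q \<sigma>. semi_free C Q \<and> quasi_iso C Q F \<sigma> \<and> is_tensor_over C Q K (convolution C K F)"
  unfolding convolution_def
proof (rule someI_ex)
  obtain Q :: "('o, 'a, 'b, 'k) dgmod" and \<sigma> where Q: "semi_free C Q" "quasi_iso C Q F \<sigma>"
    using ex_semi_free_resolution[OF F] by (elim exE conjE)
  obtain B level where "semi_free_tensor C Q B level"
    using ex_semi_free_tensor[OF Q(1)] by (elim exE)
  then interpret Q: semi_free_tensor basis C Q B level .
  show "\<exists>T Q \<sigma>. semi_free C Q \<and> quasi_iso C Q F \<sigma> \<and> is_tensor_over C Q K T"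
    using Q tensor_product_imp_is_tensor_over[OF Q.tensor_product[OF K]] by (intro exI conjI)
qed

text \<open>The resolution \<open>Q\<close> is the one behind the choice in
  \<open>convolution\<close>. Therefore the convolution and the twisted sum of
  \<open>G\<^sub>1\<^sub>2\<close> are tensor products with the same \<open>Q\<close>, and
  uniqueness of underived tensor products suffices to compare them. The same \<open>Q\<close> is
  tensored with the diagonal, which gives back \<open>Q\<close> and thus \<open>F\<close>.\<close>

lemma Perf_generated_in:
  fixes F G\<^sub>2 :: "('o, 'a, 'b, 'k) dgmod" and G\<^sub>1\<^sub>2 :: "('o, 'a, 'b, 'k) bimod"
  assumes F: "F \<in> Perf C" and G2: "G\<^sub>2 \<in> Perf C" and G12: "dg_module (enveloping C) G\<^sub>1\<^sub>2"
    and conv: "convolution C G\<^sub>1\<^sub>2 F \<in> ads C {G\<^sub>2}" and D: "D \<in> generated_in (enveloping C) {G\<^sub>1\<^sub>2} (Suc k)"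
  shows "F \<in> generated_in C {G\<^sub>2} (Suc k)"
proof -
  have \<A>: "{G\<^sub>2} \<subseteq> Perf C" using G2 by simp
  obtain Q \<sigma> where Q: "semi_free C Q" "quasi_iso C Q F \<sigma>" "is_tensor_over C Q G\<^sub>1\<^sub>2 (convolution C G\<^sub>1\<^sub>2 F)"
    using convolution_ex[OF Perf_module[OF F] G12] by (elim exE conjE)
  obtain B level where "semi_free_tensor C Q B level"
    using ex_semi_free_tensor[OF Q(1)] by (elim exE)
  then interpret Q: semi_free_tensor basis C Q B level .
  interpret Q: tensor_functor "TYPE('o \<times> int \<times> ('b, 'k) vec)" basis C B Q.ob "\<lambda>\<beta>. Q.dg \<beta>" Q.\<delta> level ..
  have tensor: "is_tensor_over C Q K (Q.tw.T K)" if "dg_module (enveloping C) K"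
    for K :: "('o, 'a, 'b, 'k) bimod"
    by (rule tensor_product_imp_is_tensor_over[OF Q.tensor_product[OF that]])
  have unique: "derived_iso C S T" if "is_tensor_over C Q K S" "is_tensor_over C Q K T"
    for S T :: "('o, 'a, 'b, 'k) dgmod" and K :: "('o, 'a, 'b, 'k) bimod"
    using is_tensor_over_unique[OF dg_category_axioms that] derived_iso_quasi_iso by (elim exE)
  have "approximable C (generated C {G\<^sub>2}) (convolution C G\<^sub>1\<^sub>2 F)"
    by (rule approximable_ads[OF perf_class_generated[OF \<A>] generated.base[OF singletonI Perf_module[OF G2]] conv])
  then have "approximable C (generated C {G\<^sub>2}) (Q.tw.T G\<^sub>1\<^sub>2)"
    by (rule approximable_derived_iso[OF perf_class_generated[OF \<A>] unique[OF Q(3) tensor[OF G12]]])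
  then have TD: "approximable C (generated_in C {G\<^sub>2} (Suc k)) (Q.tw.T D)"
    by (rule Q.approximable_tw_generated_in[OF G2 _ D])
  have iso: "derived_iso C (Q.tw.T D) F"
    by (rule derived_iso_trans[OF unique[OF tensor[OF K.dg_module_axioms] is_tensor_over_diagonal[OF Q.Q.dg_module_axioms]]
          derived_iso_quasi_iso[OF Q(2)]])
  have ap: "approximable C (generated_in C {G\<^sub>2} (Suc k)) F"
    by (rule approximable_derived_iso[OF perf_class_generated_in[OF \<A>] iso TD])
  show ?thesis
  proof (rule perf_approximable_in[OF perf_class_generated_in[OF \<A>] _ F ap])
    show "N \<in> generated_in C {G\<^sub>2} (Suc k)" if "M \<in> generated_in C {G\<^sub>2} (Suc k)" "derived_summand C N M" for M N
      using that unfolding generated_in.simps by (rule generated.summand)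
  qed
qed

end

section \<open>From generation times to generated classes and back\<close>

lemma generation_time_eq_enatD:
  assumes "generation_time C \<E> \<G> = enat k"
  shows "\<E> \<subseteq> generated_in C \<G> (Suc k)"
proof -
  let ?K = "{k. \<E> \<subseteq> generated_in C \<G> (k + 1)}"
  have inf: "Inf (enat ` ?K) = enat k" using assms by (simp add: generation_time_def)
  then have "Inf (enat ` ?K) \<noteq> \<infinity>" by simp
  then have ne: "enat ` ?K \<noteq> {}" unfolding Inf_enat_def by (rule contrapos_nn) (rule if_P)
  then have "Inf (enat ` ?K) = (LEAST x. x \<in> enat ` ?K)" unfolding Inf_enat_def by (rule if_not_P)
  then have "Inf (enat ` ?K) \<in> enat ` ?K" using LeastI_ex[of "\<lambda>x. x \<in> enat ` ?K"] ne by (simp add: ex_in_conv)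
  then have "enat k \<in> enat ` ?K" unfolding inf .
  then have "k \<in> ?K" by (rule imageE) simp
  then show ?thesis by simp
qed

text \<open>The index \<open>k\<close> itself is one of the candidates of the infimum, whose classes
  are counted from 1.\<close>

lemma generation_time_le: "\<E> \<subseteq> generated_in C \<G> (Suc k) \<Longrightarrow> generation_time C \<E> \<G> \<le> enat k"
  unfolding generation_time_def by (rule INF_lower) simp

theorem theorem3p6:
  fixes C :: "('o, 'a, 'k::field) dgcat"
    and \<Delta> G\<^sub>1\<^sub>2 :: "('o \<times> 'o, int \<times> int \<times> 'a \<times> 'a, 'b, 'k) dgmod"
    and G\<^sub>2 :: "('o, 'a, 'b, 'k) dgmod"
    and k :: nat
  assumes universe: "\<exists>\<iota> :: ('o \<times> 'a \<times> 'k) list \<Rightarrow> 'b. inj \<iota>"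
    and "dg_category C"
    and "is_diagonal C \<Delta>"
    and "weakly_product_bimodule C G\<^sub>1\<^sub>2"
    and "G\<^sub>2 \<in> Perf C"
    and "\<And>F :: ('o, 'a, 'b, 'k) dgmod. F \<in> Perf C \<Longrightarrow> convolution C G\<^sub>1\<^sub>2 F \<in> ads C {G\<^sub>2}"
    and "generation_time (enveloping C) {\<Delta>} {G\<^sub>1\<^sub>2} = enat k"
  shows "generation_time C (Perf C) {G\<^sub>2} \<le> enat k \<and> Rdim TYPE('b) C \<le> enat k"
proof -
  interpret C: dg_category C by fact
  obtain \<epsilon> where "diagonal_bimodule C \<Delta> \<epsilon>"
    using is_diagonal_imp_diagonal_bimodule[OF assms(2,3)] by (elim exE)
  then interpret diagonal_bimodule C \<Delta> \<epsilon> .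
  interpret diagonal_universe "TYPE('b)" C \<Delta> \<epsilon>
    by unfold_locales (use universe infinite_basisI[OF universe] in simp_all)
  have G12: "dg_module (enveloping C) G\<^sub>1\<^sub>2"
    using assms(4) Perf_module by (auto simp: weakly_product_bimodule_def)
  have "\<Delta> \<in> generated_in (enveloping C) {G\<^sub>1\<^sub>2} (Suc k)"
    using generation_time_eq_enatD[OF assms(7)] by simp
  then have "Perf C \<subseteq> generated_in C {G\<^sub>2} (Suc k)"
    using Perf_generated_in[OF _ assms(5) G12 assms(6)] by blast
  then have gt: "generation_time C (Perf C) {G\<^sub>2} \<le> enat k" by (rule generation_time_le)
  moreover have "Rdim TYPE('b) C \<le> generation_time C (Perf C) {G\<^sub>2}"
    unfolding Rdim_def by (rule INF_lower) (rule assms(5))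
  ultimately show ?thesis by (auto intro: order_trans)
qed

end
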